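(* Let $A:\mathbb{R}^d\to\mathbb{R}^d$ be an expansive dilation, let $V\neq\{0\}$ be an $A$-refinable shift-invariant subspace of $L^2(\mathbb{R}^d)$ with spectral function $\sigma_V$, and let $G\subseteq\mathbb{R}^d$ be an $A^*$-invariant measurable set of positive measure such that $\mathrm{Supp}(\sigma_V)\subseteq G$ (up to a null set). Then the following conditions are equivalent: (1) $\overline{\bigcup_{j\in\mathbb{Z}}\mathcal{D}_A^{j}V}=H^2_G$; (2) if $\mathcal{G}\subseteq V$ generates $V$, in the sense that the linear span of the shifts $\{\phi(\cdot-k):\phi\in\mathcal{G},k\in\mathbb{Z}^d\}$ is dense in $V$, then $\bigcup_{\phi\in\mathcal{G}}\bigcup_{j\in\mathbb{Z}}A^{*j}(\mathrm{Supp}(\widehat{\phi}))=G$ (up to a null set); (3) for any bounded measurable $E\subseteq G$ of positive measure, $$\lim_{j\to\infty}\frac{1}{|A^{*-j}E|}\int_{A^{*-j}E}\sigma_V(\xi)\,d\xi=1;$$ (4) the set $\mathrm{Supp}(\sigma_V)$ is $A^{*-1}$-absorbing in $G$; (5) $\lim_{j\to\infty}\sigma_V(A^{*-j}\xi)>0$ for almost every $\xi\in G$; (6) $\lim_{j\to\infty}\sigma_V(A^{*-j}\xi)=1$ for almost every $\xi\in G$; (7) $\sigma_V$ is $(G,A^* )$-locally nonzero at the origin; (8) the origin is a point of $(G,A^* )$-approximate continuity of $\sigma_V$ if we put $\sigma_V(0)=1$.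
   Context: Conventions: $\widehat f(\xi)=\int_{\mathbb{R}^d}f(x)e^{-2\pi i x\cdot\xi}dx$ for $f\in L^1\cap L^2$, extended to $L^2(\mathbb{R}^d)$; $|E|$ is Lebesgue measure; $\mathrm{Supp}(f)=\{x: f(x)\neq0\}$; $B_r$ is the open ball of radius $r$ centred at the origin. Equalities and inclusions of sets that depend on $L^2$ functions are understood up to null sets; a union of supports over an uncountable family is understood as the essential union (the smallest measurable set, up to null sets, containing each member up to a null set). A linear map $A:\mathbb{R}^d\to\mathbb{R}^d$ is an expansive dilation if $A(\mathbb{Z}^d)\subseteq\mathbb{Z}^d$ and all (complex) eigenvalues of $A$ have modulus strictly greater than $1$; $d_A=|\det A|$; $A^*$ is the adjoint; $\mathcal{D}_Af(x)=d_A^{1/2}f(Ax)$ on $L^2(\mathbb{R}^d)$. A measurable set $G$ is $A^*$-invariant if $A^*G=G$, and $H^2_G=\{f\in L^2(\mathbb{R}^d):\mathrm{Supp}\,\widehat f\subseteq G\}$. A closed subspace $V\subseteq L^2(\mathbb{R}^d)$ is shift-invariant if $f(\cdot-k)\in V$ for all $f\in V$, $k\in\mathbb{Z}^d$. It is $A$-refinable if $V\subseteq\mathcal{D}_AV$. A tight frame generator of $V$ is a (countable) family $\{\phi^\alpha\}_{\alpha\in I}\subseteq V$ with $\sum_{\alpha\in I}\sum_{k\in\mathbb{Z}^d}|\langle f,\phi^\alpha(\cdot-k)\rangle|^2=\|f\|^2$ for all $f\in V$; every shift-invariant subspace has one. The spectral function of $V$ is $\sigma_V(\xi)=\sum_{\alpha\in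 I}|\widehat{\phi^\alpha}(\xi)|^2$; up to null sets it does not depend on the chosen tight frame generator. A measurable set $E$ is $A^{*-1}$-absorbing in $G$ if for almost every $\xi\in G$ there is a positive integer $j_0$ (possibly depending on $\xi$) with $A^{*-j}\xi\in E$ for all $j\ge j_0$. The origin is a point of $(G,A^* )$-density for a measurable set $E\subseteq\mathbb{R}^d$ of positive measure if $\lim_{j\to\infty}|E\cap G\cap A^{*-j}B_r|/|G\cap A^{*-j}B_r|=1$ for all $r>0$. For a measurable $f:\mathbb{R}^d\to\mathbb{C}$, the origin is a point of $(G,A^* )$-approximate continuity of $f$ if there is a measurable $E\subseteq\mathbb{R}^d$ of positive measure such that the origin is a point of $(G,A^* )$-density for $E$ and $\lim_{x\to0,\,x\in E}f(x)=f(0)$. The function $f$ is $(G,A^* )$-locally nonzero at the origin if $\lim_{j\to\infty}|\{x\in G\cap A^{*-j}B_1: f(x)=0\}|/|G\cap A^{*-j}B_1|=0$. *)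

theory Defs
  imports "HOL-Analysis.Analysis"
begin

text \<open>
  Elements of \<open>L\<^sup>2\<close> are represented by functions. Sets of such functions that are given as closures,
  as closed subspaces or by conditions on the Fourier transform are saturated under almost everywhere
  equality, so equality of these sets of representatives is equality of the sets of classes.
\<close>

definition L2 :: "(real^'n \<Rightarrow> complex) set" where
  "L2 = {f \<in> borel_measurable lebesgue. integrable lebesgue (\<lambda>x. (cmod (f x))\<^sup>2)}"

definition L2_inner :: "(real^'n \<Rightarrow> complex) \<Rightarrow> (real^'n \<Rightarrow> complex) \<Rightarrow> complex" where
  "L2_inner f g = (LINT x|lebesgue. f x * cnj (g x))"

definition L2_norm :: "(real^'n \<Rightarrow> complex) \<Rightarrow> real" where
  "L2_norm f = sqrt (LINT x|lebesgue. (cmod (f x))\<^sup>2)"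

text \<open>Membership in \<^const>\<open>L2\<close> is part of convergence because the integral in \<^const>\<open>L2_norm\<close>
  is \<open>0\<close> by convention for functions that are not square integrable.\<close>

definition L2_tendsto :: "(nat \<Rightarrow> real^'n \<Rightarrow> complex) \<Rightarrow> (real^'n \<Rightarrow> complex) \<Rightarrow> bool" where
  "L2_tendsto u f \<longleftrightarrow> (\<forall>n. u n \<in> L2) \<and> f \<in> L2 \<and> (\<lambda>n. L2_norm (\<lambda>x. u n x - f x)) \<longlonglongrightarrow> 0"

definition L2_closure :: "(real^'n \<Rightarrow> complex) set \<Rightarrow> (real^'n \<Rightarrow> complex) set" where
  "L2_closure S = {f. \<exists>u. (\<forall>n. u n \<in> S) \<and> L2_tendsto u f}"

definition closed_L2_subspace :: "(real^'n \<Rightarrow> complex) set \<Rightarrow> bool" where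
  "closed_L2_subspace V \<longleftrightarrow>
     V \<subseteq> L2 \<and> (\<lambda>x. 0) \<in> V \<and>
     (\<forall>f\<in>V. \<forall>g\<in>V. (\<lambda>x. f x + g x) \<in> V) \<and>
     (\<forall>c. \<forall>f\<in>V. (\<lambda>x. c * f x) \<in> V) \<and>
     L2_closure V \<subseteq> V"

definition lin_span :: "(real^'n \<Rightarrow> complex) set \<Rightarrow> (real^'n \<Rightarrow> complex) set" where
  "lin_span S = {(\<lambda>x. \<Sum>g\<in>T. c g * g x) | T c. finite T \<and> T \<subseteq> S}"

definition fourier_L1 :: "(real^'n \<Rightarrow> complex) \<Rightarrow> real^'n \<Rightarrow> complex" where
  "fourier_L1 f \<xi> = (LINT x|lebesgue. f x * exp (- 2 * complex_of_real pi * \<i> * complex_of_real (x \<bullet> \<xi>)))"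

text \<open>The extension by continuity from \<open>L\<^sup>1 \<inter> L\<^sup>2\<close>; it is determined up to a null set.\<close>

definition fourier :: "(real^'n \<Rightarrow> complex) \<Rightarrow> real^'n \<Rightarrow> complex" where
  "fourier f = (SOME g. g \<in> L2 \<and>
     (\<forall>u. (\<forall>n. integrable lebesgue (u n)) \<and> L2_tendsto u f \<longrightarrow>
        L2_tendsto (\<lambda>n. fourier_L1 (u n)) g))"

definition Supp :: "(real^'n \<Rightarrow> 'b::zero) \<Rightarrow> (real^'n) set" where
  "Supp f = {x. f x \<noteq> 0}"

definition ae_subset :: "(real^'n) set \<Rightarrow> (real^'n) set \<Rightarrow> bool" where
  "ae_subset S T \<longleftrightarrow> (AE x in lebesgue. x \<in> S \<longrightarrow> x \<in> T)"

definition is_ess_Union :: "(real^'n) set set \<Rightarrow> (real^'n) set \<Rightarrow> bool" where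
  "is_ess_Union \<S> U \<longleftrightarrow> U \<in> sets lebesgue \<and> (\<forall>S\<in>\<S>. ae_subset S U) \<and>
     (\<forall>W\<in>sets lebesgue. (\<forall>S\<in>\<S>. ae_subset S W) \<longrightarrow> ae_subset U W)"

definition int_lattice :: "(real^'n) set" where
  "int_lattice = {k. \<forall>i. k $ i \<in> \<int>}"

definition expansive_dilation :: "(real^'n \<Rightarrow> real^'n) \<Rightarrow> bool" where
  "expansive_dilation A \<longleftrightarrow> linear A \<and> A ` int_lattice \<subseteq> int_lattice \<and>
     (\<forall>z v. v \<noteq> 0 \<and> (\<chi> i j. complex_of_real (matrix A $ i $ j)) *v v = z *s v \<longrightarrow> cmod z > 1)"

text \<open>Integer powers of a bijection.\<close>

definition int_funpow :: "('a \<Rightarrow> 'a) \<Rightarrow> int \<Rightarrow> 'a \<Rightarrow> 'a" where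
  "int_funpow F j = (if j \<ge> 0 then F ^^ nat j else inv F ^^ nat (- j))"

definition dilation :: "(real^'n \<Rightarrow> real^'n) \<Rightarrow> (real^'n \<Rightarrow> complex) \<Rightarrow> real^'n \<Rightarrow> complex" where
  "dilation A f = (\<lambda>x. complex_of_real (sqrt \<bar>det (matrix A)\<bar>) * f (A x))"

definition shift :: "real^'n \<Rightarrow> (real^'n \<Rightarrow> complex) \<Rightarrow> real^'n \<Rightarrow> complex" where
  "shift k f = (\<lambda>x. f (x - k))"

definition shift_invariant :: "(real^'n \<Rightarrow> complex) set \<Rightarrow> bool" where
  "shift_invariant V \<longleftrightarrow> closed_L2_subspace V \<and> (\<forall>f\<in>V. \<forall>k\<in>int_lattice. shift k f \<in> V)"

definition refinable :: "(real^'n \<Rightarrow> real^'n) \<Rightarrow> (real^'n \<Rightarrow> complex) set \<Rightarrow> bool" where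
  "refinable A V \<longleftrightarrow> V \<subseteq> dilation A ` V"

definition H2 :: "(real^'n) set \<Rightarrow> (real^'n \<Rightarrow> complex) set" where
  "H2 G = {f \<in> L2. ae_subset (Supp (fourier f)) G}"

definition shift_generates ::
    "(real^'n \<Rightarrow> complex) set \<Rightarrow> (real^'n \<Rightarrow> complex) set \<Rightarrow> bool" where
  "shift_generates \<G> V \<longleftrightarrow> V \<subseteq> L2_closure (lin_span {shift k \<phi> | k \<phi>. k \<in> int_lattice \<and> \<phi> \<in> \<G>})"

text \<open>Countable families are indexed by arbitrary, possibly finite or empty, sets of natural numbers.
  The sums are taken in \<^typ>\<open>ennreal\<close>, where they always exist.\<close>

definition tight_frame_generator ::
    "(real^'n \<Rightarrow> complex) set \<Rightarrow> nat set \<Rightarrow> (nat \<Rightarrow> real^'n \<Rightarrow> complex) \<Rightarrow> bool" where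
  "tight_frame_generator V I \<phi> \<longleftrightarrow> (\<forall>\<alpha>\<in>I. \<phi> \<alpha> \<in> V) \<and>
     (\<forall>f\<in>V. (\<Sum>\<^sub>\<infinity>\<alpha>\<in>I. \<Sum>\<^sub>\<infinity>k\<in>int_lattice. ennreal ((cmod (L2_inner f (shift k (\<phi> \<alpha>))))\<^sup>2))
              = ennreal ((L2_norm f)\<^sup>2))"

text \<open>The spectral function is an almost everywhere class, so it is rendered as a relation that holds
  for all representatives \<open>\<sigma>\<close>. The series converges almost everywhere for every tight frame generator,
  so the value \<open>0\<close> that \<^const>\<open>infsum\<close> assigns to divergent series is attained only on a null set.\<close>

definition is_spectral_function ::
    "(real^'n \<Rightarrow> complex) set \<Rightarrow> (real^'n \<Rightarrow> real) \<Rightarrow> bool" where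
  "is_spectral_function V \<sigma> \<longleftrightarrow> (\<exists>I \<phi>. tight_frame_generator V I \<phi> \<and>
     (AE \<xi> in lebesgue. \<sigma> \<xi> = (\<Sum>\<^sub>\<infinity>\<alpha>\<in>I. (cmod (fourier (\<phi> \<alpha>) \<xi>))\<^sup>2)))"

text \<open>In the following notions \<open>B\<close> stands for the adjoint of the dilation.\<close>

definition inv_absorbing ::
    "(real^'n \<Rightarrow> real^'n) \<Rightarrow> (real^'n) set \<Rightarrow> (real^'n) set \<Rightarrow> bool" where
  "inv_absorbing B G E \<longleftrightarrow>
     (AE \<xi> in lebesgue. \<xi> \<in> G \<longrightarrow> (\<exists>j0::nat>0. \<forall>j\<ge>j0. int_funpow B (- int j) \<xi> \<in> E))"

definition density_at_0 ::
    "(real^'n) set \<Rightarrow> (real^'n \<Rightarrow> real^'n) \<Rightarrow> (real^'n) set \<Rightarrow> bool" where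
  "density_at_0 G B E \<longleftrightarrow> (\<forall>r>0.
     (\<lambda>j::nat. measure lebesgue (E \<inter> G \<inter> int_funpow B (- int j) ` ball 0 r)
             / measure lebesgue (G \<inter> int_funpow B (- int j) ` ball 0 r)) \<longlonglongrightarrow> 1)"

definition approx_continuous_at_0 ::
    "(real^'n) set \<Rightarrow> (real^'n \<Rightarrow> real^'n) \<Rightarrow> (real^'n \<Rightarrow> 'b::topological_space) \<Rightarrow> bool" where
  "approx_continuous_at_0 G B f \<longleftrightarrow> (\<exists>E\<in>sets lebesgue. emeasure lebesgue E > 0 \<and>
     density_at_0 G B E \<and> (f \<longlongrightarrow> f 0) (at 0 within E))"

definition locally_nonzero_at_0 ::
    "(real^'n) set \<Rightarrow> (real^'n \<Rightarrow> real^'n) \<Rightarrow> (real^'n \<Rightarrow> 'b::zero) \<Rightarrow> bool" where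
  "locally_nonzero_at_0 G B f \<longleftrightarrow>
     (\<lambda>j::nat. measure lebesgue {x \<in> G \<inter> int_funpow B (- int j) ` ball 0 1. f x = 0}
             / measure lebesgue (G \<inter> int_funpow B (- int j) ` ball 0 1)) \<longlonglongrightarrow> 0"

definition all_equivalent :: "bool list \<Rightarrow> bool" where
  "all_equivalent Ps \<longleftrightarrow> (\<forall>P\<in>set Ps. \<forall>Q\<in>set Ps. P \<longleftrightarrow> Q)"

end

theory Submission
  imports Defs "HOL-Computational_Algebra.Fundamental_Theorem_Algebra"
begin

text \<open>
  Let \<open>B = A\<^sup>*\<close>, \<open>R\<close> its inverse and \<open>Y\<close> the image of \<open>V\<close> under the Fourier transform. For small sets \<open>E\<close>
  the integral of \<open>\<sigma>\<^sub>V\<close> over \<open>E\<close> is the squared norm of the projection of \<open>1\<^sub>E\<close> to \<open>Y\<close>, because on a lattice cell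
  the exponentials of \<open>\<int>\<^sup>d\<close> form an orthonormal basis. Applied to the increasing spaces that correspond to \<open>\<D>\<^sub>A\<^sup>j V\<close>,
  this makes \<open>\<sigma>\<^sub>V (R\<^sup>j \<xi>)\<close> increasing in \<open>j\<close>, with a limit \<open>s\<close> that is related in the same way to the closure \<open>W\<close>
  of their union. Now \<open>W\<close> is invariant under the modulations by \<open>A\<^sup>-\<^sup>j \<int>\<^sup>d\<close> for all \<open>j\<close>, hence under
  multiplication by indicator functions. Therefore the projection of \<open>1\<^sub>E\<close> to \<open>W\<close> is itself an indicator function and \<open>s\<close> takes
  only the values \<open>0\<close> and \<open>1\<close>. Each of the eight conditions says that \<open>s = 1\<close> almost everywhere on \<open>G\<close>.
\<close>

section \<open>The Hilbert space of square integrable functions\<close>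

text \<open>One device recurs: the bounded multipliers of a closed space survive bounded almost
  everywhere limits, so Stone--Weierstrass on the torus turns invariance under integer modulations
  into invariance under periodic indicator functions. It serves three times: for the completeness of
  the exponentials on a cube, hence Parseval and Plancherel; for the surjectivity of the Fourier
  transform, which condition (1) needs because \<open>H2 G\<close> is described by transforms; and
  for \<open>W\<close>. A tight frame generator only speaks about members f of \<open>V\<close>. It
  is tested on the f whose transform is the projection p of \<open>1_E\<close>: then the inner
  products with the shifts of \<phi> are Fourier coefficients of \<open>1_E\<close> times the
  conjugate transform of \<phi>, and Parseval applies if E fits into one lattice cell. A fixed
  radius keeps all sets \<open>R^j E\<close> that small, so that one test set serves at every scale.
  For the 0-1 law let \<open>q = 1_E - p\<close> with p the projection to \<open>W\<close>. As
  \<open>W\<close> contains all \<open>1_F p\<close>, the product of p and the conjugate of q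
  integrates to zero over every bounded F. On E this forces p to be 0 or 1.\<close>

lemma L2_measurable [measurable_dest]: "f \<in> L2 \<Longrightarrow> f \<in> borel_measurable lebesgue"
  by (simp add: L2_def)

lemma L2_integrable: "f \<in> L2 \<Longrightarrow> integrable lebesgue (\<lambda>x. (cmod (f x))\<^sup>2)"
  by (simp add: L2_def)

lemma L2I: "f \<in> borel_measurable lebesgue \<Longrightarrow> integrable lebesgue (\<lambda>x. (cmod (f x))\<^sup>2) \<Longrightarrow> f \<in> L2"
  by (simp add: L2_def)

lemma L2_bound:
  assumes "g \<in> borel_measurable lebesgue" "integrable lebesgue h" "AE x in lebesgue. (cmod (g x))\<^sup>2 \<le> h x"
  shows "g \<in> L2"
proof (rule L2I[OF assms(1)], rule Bochner_Integration.integrable_bound[OF assms(2)])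
  show "(\<lambda>x. (cmod (g x))\<^sup>2) \<in> borel_measurable lebesgue"
    using assms(1) by measurable
  show "AE x in lebesgue. norm ((cmod (g x))\<^sup>2) \<le> norm (h x)"
    using assms(3) by eventually_elim auto
qed

text \<open>Completeness of Lebesgue measure: the exceptional set and all its subsets are
  measurable, so changing a function there is harmless.\<close>

lemma measurable_lebesgue_AE:
  assumes "f \<in> borel_measurable lebesgue" "AE x in lebesgue. f x = g x"
  shows "g \<in> borel_measurable lebesgue"
proof (rule measurableI)
  fix S :: "'b set" assume S: "S \<in> sets borel"
  have f: "f -` S \<in> sets lebesgue"
    using measurable_sets[OF assms(1) S] by simp
  obtain Z where Z: "{x \<in> space lebesgue. \<not> f x = g x} \<subseteq> Z" "Z \<in> null_sets lebesgue"
    using AE_E[OF assms(2)] by (metis (no_types, lifting) null_setsI)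
  have N: "N \<in> sets lebesgue" if "N \<subseteq> {x. f x \<noteq> g x}" for N
    using null_sets_completion_subset[of N Z lborel] that Z by auto
  have "g -` S \<inter> space lebesgue = (f -` S - (f -` S \<inter> {x. f x \<noteq> g x})) \<union> (g -` S \<inter> {x. f x \<noteq> g x})"
    by auto
  also have "\<dots> \<in> sets lebesgue"
    using N[of "f -` S \<inter> {x. f x \<noteq> g x}"] N[of "g -` S \<inter> {x. f x \<noteq> g x}"] f by blast
  finally show "g -` S \<inter> space lebesgue \<in> sets lebesgue" .
qed auto

lemma L2_cong_AE:
  assumes "f \<in> L2" "AE x in lebesgue. f x = g x"
  shows "g \<in> L2"
proof -
  have "g \<in> borel_measurable lebesgue"
    using measurable_lebesgue_AE[OF L2_measurable[OF assms(1)] assms(2)] .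
  then show ?thesis
    by (rule L2_bound[OF _ L2_integrable[OF assms(1)]]) (use assms(2) in auto)
qed

lemma L2_zero [simp]: "(\<lambda>x. 0) \<in> L2"
  by (simp add: L2_def)

lemma L2_mult_bounded:
  assumes "f \<in> L2" "m \<in> borel_measurable lebesgue" "AE x in lebesgue. cmod (m x) \<le> C"
  shows "(\<lambda>x. m x * f x) \<in> L2"
proof (rule L2_bound[where h="\<lambda>x. C\<^sup>2 * (cmod (f x))\<^sup>2"])
  show "(\<lambda>x. m x * f x) \<in> borel_measurable lebesgue"
    using L2_measurable[OF assms(1)] assms(2) by measurable
  show "integrable lebesgue (\<lambda>x. C\<^sup>2 * (cmod (f x))\<^sup>2)"
    using L2_integrable[OF assms(1)] by simp
  show "AE x in lebesgue. (cmod (m x * f x))\<^sup>2 \<le> C\<^sup>2 * (cmod (f x))\<^sup>2"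
    using assms(3) by eventually_elim (simp add: norm_mult power_mult_distrib mult_right_mono power_mono)
qed

lemma L2_cmult: "f \<in> L2 \<Longrightarrow> (\<lambda>x. c * f x) \<in> L2"
  by (rule L2_mult_bounded[where C="cmod c"]) auto

lemma cmod_add_sq_le: "(cmod (a + b))\<^sup>2 \<le> 2 * (cmod a)\<^sup>2 + 2 * (cmod b)\<^sup>2"
proof -
  have "(cmod (a + b))\<^sup>2 \<le> (cmod a + cmod b)\<^sup>2"
    by (simp add: norm_triangle_ineq power_mono)
  also have "\<dots> \<le> 2 * (cmod a)\<^sup>2 + 2 * (cmod b)\<^sup>2"
    using sum_squares_ge_zero[of "cmod a - cmod b" 0] by (simp add: power2_eq_square algebra_simps)
  finally show ?thesis .
qed

lemma L2_add:
  assumes "f \<in> L2" "g \<in> L2"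
  shows "(\<lambda>x. f x + g x) \<in> L2"
proof (rule L2_bound[where h="\<lambda>x. 2 * (cmod (f x))\<^sup>2 + 2 * (cmod (g x))\<^sup>2"])
  show "(\<lambda>x. f x + g x) \<in> borel_measurable lebesgue"
    using L2_measurable[OF assms(1)] L2_measurable[OF assms(2)] by measurable
  show "integrable lebesgue (\<lambda>x. 2 * (cmod (f x))\<^sup>2 + 2 * (cmod (g x))\<^sup>2)"
    by (intro Bochner_Integration.integrable_add integrable_mult_right L2_integrable assms)
qed (simp add: cmod_add_sq_le)

lemma L2_diff: "f \<in> L2 \<Longrightarrow> g \<in> L2 \<Longrightarrow> (\<lambda>x. f x - g x) \<in> L2"
  using L2_add[of f "\<lambda>x. -1 * g x"] L2_cmult[of g "-1"] by simp

lemma L2_sum: "(\<And>i. i \<in> I \<Longrightarrow> f i \<in> L2) \<Longrightarrow> (\<lambda>x. \<Sum>i\<in>I. f i x) \<in> L2"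
  by (induction I rule: infinite_finite_induct) (auto intro: L2_add)

lemma L2_cnj: "f \<in> L2 \<Longrightarrow> (\<lambda>x. cnj (f x)) \<in> L2"
  unfolding L2_def
  by (auto intro: measurable_compose[OF _ borel_measurable_continuous_onI] continuous_intros)

lemma L2_inner_integrable:
  assumes "f \<in> L2" "g \<in> L2"
  shows "integrable lebesgue (\<lambda>x. f x * cnj (g x))"
proof (rule Bochner_Integration.integrable_bound)
  show "integrable lebesgue (\<lambda>x. (cmod (f x))\<^sup>2 + (cmod (g x))\<^sup>2)"
    by (intro Bochner_Integration.integrable_add L2_integrable assms)
  show "(\<lambda>x. f x * cnj (g x)) \<in> borel_measurable lebesgue"
    using assms L2_measurable L2_cnj by (intro borel_measurable_times) auto
  show "AE x in lebesgue. norm (f x * cnj (g x)) \<le> norm ((cmod (f x))\<^sup>2 + (cmod (g x))\<^sup>2)"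
  proof (rule AE_I2)
    fix x
    have "0 \<le> (cmod (f x) - cmod (g x))\<^sup>2" "0 \<le> cmod (f x) * cmod (g x)" by simp_all
    then show "norm (f x * cnj (g x)) \<le> norm ((cmod (f x))\<^sup>2 + (cmod (g x))\<^sup>2)"
      unfolding power2_diff real_norm_def norm_mult complex_mod_cnj by linarith
  qed
qed

lemma L2_norm_nonneg [simp]: "0 \<le> L2_norm f"
  by (simp add: L2_norm_def)

lemma L2_norm_sq: "(L2_norm f)\<^sup>2 = (LINT x|lebesgue. (cmod (f x))\<^sup>2)"
  by (simp add: L2_norm_def)

lemma nn_integral_L2_norm:
  assumes "f \<in> L2"
  shows "(\<integral>\<^sup>+x. ennreal ((cmod (f x))\<^sup>2) \<partial>lebesgue) = ennreal ((L2_norm f)\<^sup>2)"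
  by (simp add: L2_norm_sq nn_integral_eq_integral[OF L2_integrable[OF assms]])

lemma L2_iff_nn_integral:
  "f \<in> L2 \<longleftrightarrow> f \<in> borel_measurable lebesgue \<and> (\<integral>\<^sup>+x. ennreal ((cmod (f x))\<^sup>2) \<partial>lebesgue) < \<infinity>"
  by (auto simp: L2_def integrable_iff_bounded)

lemma L2_inner_self: "L2_inner f f = complex_of_real ((L2_norm f)\<^sup>2)"
  unfolding L2_inner_def L2_norm_sq integral_complex_of_real[symmetric]
  by (simp only: complex_norm_square)

lemma L2_inner_cong:
  assumes "f \<in> L2" "g \<in> L2" "AE x in lebesgue. f x = f' x" "AE x in lebesgue. g x = g' x"
  shows "L2_inner f g = L2_inner f' g'"
  unfolding L2_inner_def
proof (rule integral_cong_AE)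
  have "f' \<in> L2" "g' \<in> L2" using L2_cong_AE assms by blast+
  then show "(\<lambda>x. f' x * cnj (g' x)) \<in> borel_measurable lebesgue"
    by (intro borel_measurable_integrable L2_inner_integrable)
  show "(\<lambda>x. f x * cnj (g x)) \<in> borel_measurable lebesgue"
    by (intro borel_measurable_integrable L2_inner_integrable assms)
  show "AE x in lebesgue. f x * cnj (g x) = f' x * cnj (g' x)"
    using assms(3,4) by eventually_elim simp
qed

lemma L2_norm_cong:
  assumes "f \<in> L2" "AE x in lebesgue. f x = g x"
  shows "L2_norm f = L2_norm g"
  using L2_inner_cong[OF assms(1,1,2,2)] unfolding L2_inner_self of_real_eq_iff
  by (simp add: power2_eq_iff_nonneg)

lemma L2_inner_add_left:
  "f \<in> L2 \<Longrightarrow> g \<in> L2 \<Longrightarrow> h \<in> L2 \<Longrightarrow> L2_inner (\<lambda>x. f x + g x) h = L2_inner f h + L2_inner g h"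
  unfolding L2_inner_def by (simp add: distrib_right L2_inner_integrable)

lemma L2_inner_diff_left:
  "f \<in> L2 \<Longrightarrow> g \<in> L2 \<Longrightarrow> h \<in> L2 \<Longrightarrow> L2_inner (\<lambda>x. f x - g x) h = L2_inner f h - L2_inner g h"
  unfolding L2_inner_def by (simp add: left_diff_distrib L2_inner_integrable)

lemma L2_inner_cmult_left: "L2_inner (\<lambda>x. c * f x) h = c * L2_inner f h"
  unfolding L2_inner_def by (simp add: mult.assoc)

lemma L2_inner_commute: "L2_inner g f = cnj (L2_inner f g)"
proof -
  have "cnj (L2_inner f g) = (LINT x|lebesgue. cnj (f x * cnj (g x)))"
    unfolding L2_inner_def by (rule Bochner_Integration.integral_cnj[symmetric])
  then show ?thesis by (simp add: L2_inner_def mult.commute)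
qed

lemma L2_inner_add_right:
  "f \<in> L2 \<Longrightarrow> g \<in> L2 \<Longrightarrow> h \<in> L2 \<Longrightarrow> L2_inner h (\<lambda>x. f x + g x) = L2_inner h f + L2_inner h g"
  by (subst (1 2 3) L2_inner_commute) (simp add: L2_inner_add_left)

lemma L2_inner_diff_right:
  "f \<in> L2 \<Longrightarrow> g \<in> L2 \<Longrightarrow> h \<in> L2 \<Longrightarrow> L2_inner h (\<lambda>x. f x - g x) = L2_inner h f - L2_inner h g"
  by (subst (1 2 3) L2_inner_commute) (simp add: L2_inner_diff_left)

lemma L2_inner_cmult_right: "L2_inner h (\<lambda>x. c * f x) = cnj c * L2_inner h f"
  by (subst (1 2) L2_inner_commute) (simp add: L2_inner_cmult_left)

lemma L2_inner_sum_left: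
  assumes "\<And>i. i \<in> I \<Longrightarrow> f i \<in> L2" "h \<in> L2"
  shows "L2_inner (\<lambda>x. \<Sum>i\<in>I. f i x) h = (\<Sum>i\<in>I. L2_inner (f i) h)"
  using assms unfolding L2_inner_def by (simp add: sum_distrib_right L2_inner_integrable)

lemma L2_inner_move: "L2_inner (\<lambda>x. m x * f x) g = L2_inner f (\<lambda>x. cnj (m x) * g x)"
  unfolding L2_inner_def by (simp add: mult_ac)

lemma L2_norm_add_sq:
  assumes "f \<in> L2" "g \<in> L2"
  shows "(L2_norm (\<lambda>x. f x + g x))\<^sup>2 = (L2_norm f)\<^sup>2 + 2 * Re (L2_inner f g) + (L2_norm g)\<^sup>2"
proof -
  have "complex_of_real ((L2_norm (\<lambda>x. f x + g x))\<^sup>2)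
      = L2_inner f f + L2_inner f g + (cnj (L2_inner f g) + L2_inner g g)"
    unfolding L2_inner_self[symmetric] L2_inner_commute[of g f, symmetric]
    using assms by (simp add: L2_inner_add_left L2_inner_add_right L2_add)
  then have "Re (complex_of_real ((L2_norm (\<lambda>x. f x + g x))\<^sup>2))
      = Re (L2_inner f f + L2_inner f g + (cnj (L2_inner f g) + L2_inner g g))"
    by (rule arg_cong)
  then show ?thesis
    by (simp add: L2_inner_self del: of_real_power)
qed

lemma L2_norm_cmult: "L2_norm (\<lambda>x. c * f x) = cmod c * L2_norm f"
  by (simp add: L2_norm_def norm_mult power_mult_distrib real_sqrt_mult)

lemma L2_norm_diff_sq:
  assumes "f \<in> L2" "g \<in> L2"
  shows "(L2_norm (\<lambda>x. f x - g x))\<^sup>2 = (L2_norm f)\<^sup>2 - 2 * Re (L2_inner f g) + (L2_norm g)\<^sup>2"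
  using L2_norm_add_sq[OF assms(1) L2_cmult[OF assms(2), of "-1"]]
  unfolding L2_inner_cmult_right L2_norm_cmult by simp

lemma L2_norm_minus_commute: "L2_norm (\<lambda>x. f x - g x) = L2_norm (\<lambda>x. g x - f x)"
  by (simp add: L2_norm_def norm_minus_commute)

lemma L2_norm_zero [simp]: "L2_norm (\<lambda>x. 0) = 0"
  by (simp add: L2_norm_def)

lemma L2_norm_eq_0_iff:
  assumes "f \<in> L2"
  shows "L2_norm f = 0 \<longleftrightarrow> (AE x in lebesgue. f x = 0)"
proof -
  have "L2_norm f = 0 \<longleftrightarrow> (LINT x|lebesgue. (cmod (f x))\<^sup>2) = 0"
    by (simp add: L2_norm_def)
  also have "\<dots> \<longleftrightarrow> (AE x in lebesgue. (cmod (f x))\<^sup>2 = 0)"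
    by (intro integral_nonneg_eq_0_iff_AE L2_integrable assms) auto
  finally show ?thesis by simp
qed

lemma L2_Cauchy_Schwarz:
  assumes "f \<in> L2" "g \<in> L2"
  shows "cmod (L2_inner f g) \<le> L2_norm f * L2_norm g"
proof (cases "L2_norm g = 0")
  case True
  then have "AE x in lebesgue. g x = 0" using L2_norm_eq_0_iff assms by blast
  then have "L2_inner f g = L2_inner f (\<lambda>x. 0)"
    using assms by (intro L2_inner_cong) auto
  then show ?thesis using True by (simp add: L2_inner_def)
next
  case False
  define n where "n = (L2_norm g)\<^sup>2"
  have n: "n > 0" using False by (simp add: n_def)
  define c where "c = L2_inner f g / complex_of_real n"
  have "0 \<le> (L2_norm (\<lambda>x. f x - c * g x))\<^sup>2" by simp
  also have "\<dots> = (L2_norm f)\<^sup>2 - 2 * Re (cnj c * L2_inner f g) + (cmod c)\<^sup>2 * n"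
    using assms by (subst L2_norm_diff_sq)
      (simp_all add: L2_cmult L2_inner_cmult_right L2_norm_cmult power_mult_distrib n_def)
  also have "cnj c * L2_inner f g = complex_of_real ((cmod (L2_inner f g))\<^sup>2 / n)"
    unfolding c_def by (simp add: complex_norm_square mult.commute del: of_real_power)
  also have "(cmod c)\<^sup>2 * n = (cmod (L2_inner f g))\<^sup>2 / n"
    using n by (simp add: c_def norm_divide power_divide power2_eq_square)
  finally have "(cmod (L2_inner f g))\<^sup>2 / n \<le> (L2_norm f)\<^sup>2" by simp
  then have "(cmod (L2_inner f g))\<^sup>2 \<le> (L2_norm f * L2_norm g)\<^sup>2"
    using n by (simp add: n_def power_mult_distrib divide_le_eq)
  then show ?thesis
    by (rule power2_le_imp_le) simp
qed

lemma L2_norm_triangle: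
  assumes "f \<in> L2" "g \<in> L2"
  shows "L2_norm (\<lambda>x. f x + g x) \<le> L2_norm f + L2_norm g"
proof (rule power2_le_imp_le)
  have "Re (L2_inner f g) \<le> L2_norm f * L2_norm g"
    using L2_Cauchy_Schwarz[OF assms] complex_Re_le_cmod[of "L2_inner f g"] by linarith
  then show "(L2_norm (\<lambda>x. f x + g x))\<^sup>2 \<le> (L2_norm f + L2_norm g)\<^sup>2"
    by (simp add: L2_norm_add_sq[OF assms] power2_sum)
qed simp

lemma L2_norm_triangle_diff:
  assumes "f \<in> L2" "g \<in> L2" "h \<in> L2"
  shows "L2_norm (\<lambda>x. f x - h x) \<le> L2_norm (\<lambda>x. f x - g x) + L2_norm (\<lambda>x. g x - h x)"
  using L2_norm_triangle[OF L2_diff[OF assms(1,2)] L2_diff[OF assms(2,3)]] by simp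

lemma L2_norm_abs_diff_le:
  assumes "f \<in> L2" "g \<in> L2"
  shows "\<bar>L2_norm f - L2_norm g\<bar> \<le> L2_norm (\<lambda>x. f x - g x)"
  using L2_norm_triangle_diff[OF assms L2_zero] L2_norm_triangle_diff[OF assms(2,1) L2_zero]
    L2_norm_minus_commute[of f g] by simp

lemma L2_tendstoD: "L2_tendsto u f \<Longrightarrow> f \<in> L2" "L2_tendsto u f \<Longrightarrow> u n \<in> L2"
  "L2_tendsto u f \<Longrightarrow> (\<lambda>n. L2_norm (\<lambda>x. u n x - f x)) \<longlonglongrightarrow> 0"
  by (auto simp: L2_tendsto_def)

lemma L2_tendsto_bound:
  assumes "\<And>n. u n \<in> L2" "f \<in> L2" "\<And>n. L2_norm (\<lambda>x. u n x - f x) \<le> b n" "b \<longlonglongrightarrow> 0"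
  shows "L2_tendsto u f"
  unfolding L2_tendsto_def using assms
  by (auto intro: tendsto_sandwich[OF _ _ tendsto_const assms(4)] always_eventually)

lemma L2_tendsto_const: "f \<in> L2 \<Longrightarrow> L2_tendsto (\<lambda>n. f) f"
  by (simp add: L2_tendsto_def)

lemma L2_tendsto_inner:
  assumes "L2_tendsto u f" "g \<in> L2"
  shows "(\<lambda>n. L2_inner (u n) g) \<longlonglongrightarrow> L2_inner f g"
proof (rule LIM_zero_cancel, rule Lim_null_comparison)
  have "(\<lambda>n. L2_norm (\<lambda>x. u n x - f x) * L2_norm g) \<longlonglongrightarrow> 0 * L2_norm g"
    by (intro tendsto_intros L2_tendstoD assms)
  then show "(\<lambda>n. L2_norm (\<lambda>x. u n x - f x) * L2_norm g) \<longlonglongrightarrow> 0" by simp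
  show "\<forall>\<^sub>F n in sequentially. norm (L2_inner (u n) g - L2_inner f g) \<le> L2_norm (\<lambda>x. u n x - f x) * L2_norm g"
  proof (rule always_eventually, intro allI)
    fix n
    note L = L2_tendstoD[OF assms(1)]
    show "norm (L2_inner (u n) g - L2_inner f g) \<le> L2_norm (\<lambda>x. u n x - f x) * L2_norm g"
      using L2_Cauchy_Schwarz[OF L2_diff[OF L(2,1)] assms(2), of n] L assms(2)
      by (simp add: L2_inner_diff_left)
  qed
qed

lemma L2_tendsto_norm:
  assumes "L2_tendsto u f"
  shows "(\<lambda>n. L2_norm (u n)) \<longlonglongrightarrow> L2_norm f"
proof (rule LIM_zero_cancel, rule Lim_null_comparison)
  note L = L2_tendstoD[OF assms]
  show "\<forall>\<^sub>F n in sequentially. norm (L2_norm (u n) - L2_norm f) \<le> L2_norm (\<lambda>x. u n x - f x)"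
    using L2_norm_abs_diff_le L by (auto intro!: always_eventually)
  show "(\<lambda>n. L2_norm (\<lambda>x. u n x - f x)) \<longlonglongrightarrow> 0" using L by blast
qed

lemma L2_tendsto_unique:
  assumes "L2_tendsto u f" "L2_tendsto u g"
  shows "AE x in lebesgue. f x = g x"
proof -
  note F = L2_tendstoD[OF assms(1)] and G = L2_tendstoD[OF assms(2)]
  have "(\<lambda>n. L2_norm (\<lambda>x. u n x - f x) + L2_norm (\<lambda>x. u n x - g x)) \<longlonglongrightarrow> 0 + 0"
    by (intro tendsto_add F G)
  moreover have "L2_norm (\<lambda>x. f x - g x) \<le> L2_norm (\<lambda>x. u n x - f x) + L2_norm (\<lambda>x. u n x - g x)" for n
    using L2_norm_triangle_diff[OF F(1) F(2) G(1), of n] L2_norm_minus_commute[of f "u n"] by simp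
  ultimately have "L2_norm (\<lambda>x. f x - g x) \<le> 0"
    by (intro LIMSEQ_le_const[where X="\<lambda>n. L2_norm (\<lambda>x. u n x - f x) + L2_norm (\<lambda>x. u n x - g x)"]) auto
  then have "L2_norm (\<lambda>x. f x - g x) = 0"
    by (simp add: order_antisym)
  then have "AE x in lebesgue. f x - g x = 0"
    using L2_norm_eq_0_iff[OF L2_diff[OF F(1) G(1)]] by blast
  then show ?thesis by simp
qed

lemma L2_tendsto_cong:
  assumes "L2_tendsto u f" "\<And>n. AE x in lebesgue. u n x = v n x" "AE x in lebesgue. f x = g x"
  shows "L2_tendsto v g"
proof -
  note L = L2_tendstoD[OF assms(1)]
  have "v n \<in> L2" for n using L2_cong_AE[OF L(2) assms(2)] .
  moreover have "g \<in> L2" using L2_cong_AE[OF L(1) assms(3)] .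
  moreover have "L2_norm (\<lambda>x. v n x - g x) = L2_norm (\<lambda>x. u n x - f x)" for n
    by (rule L2_norm_cong[symmetric]) (use L in \<open>auto intro: L2_diff\<close>, use assms(2)[of n] assms(3) in eventually_elim, simp)
  ultimately show ?thesis using L by (auto simp: L2_tendsto_def)
qed

lemma L2_tendsto_add:
  assumes "L2_tendsto u f" "L2_tendsto v g"
  shows "L2_tendsto (\<lambda>n x. u n x + v n x) (\<lambda>x. f x + g x)"
proof (rule L2_tendsto_bound)
  note F = L2_tendstoD[OF assms(1)] and G = L2_tendstoD[OF assms(2)]
  show "(\<lambda>n. L2_norm (\<lambda>x. u n x - f x) + L2_norm (\<lambda>x. v n x - g x)) \<longlonglongrightarrow> 0"
    using tendsto_add[OF F(3) G(3)] by simp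
  show "(\<lambda>x. u n x + v n x) \<in> L2" "(\<lambda>x. f x + g x) \<in> L2" for n
    using F G by (auto intro: L2_add)
  show "L2_norm (\<lambda>x. (u n x + v n x) - (f x + g x)) \<le> L2_norm (\<lambda>x. u n x - f x) + L2_norm (\<lambda>x. v n x - g x)" for n
    using L2_norm_triangle[OF L2_diff[OF F(2,1)] L2_diff[OF G(2,1)], of n n] by (simp add: algebra_simps)
qed

lemma L2_tendsto_mult_bounded:
  assumes "L2_tendsto u f" "m \<in> borel_measurable lebesgue" "AE x in lebesgue. cmod (m x) \<le> C"
  shows "L2_tendsto (\<lambda>n x. m x * u n x) (\<lambda>x. m x * f x)"
proof (rule L2_tendsto_bound)
  note F = L2_tendstoD[OF assms(1)]
  show "(\<lambda>n. \<bar>C\<bar> * L2_norm (\<lambda>x. u n x - f x)) \<longlonglongrightarrow> 0"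
    using tendsto_mult_left[OF F(3)] by simp
  show "(\<lambda>x. m x * u n x) \<in> L2" "(\<lambda>x. m x * f x) \<in> L2" for n
    using F assms by (auto intro: L2_mult_bounded)
  fix n
  have d: "(\<lambda>x. u n x - f x) \<in> L2" using F by (auto intro: L2_diff)
  have "(L2_norm (\<lambda>x. m x * u n x - m x * f x))\<^sup>2 \<le> C\<^sup>2 * (L2_norm (\<lambda>x. u n x - f x))\<^sup>2"
    unfolding L2_norm_sq integral_mult_right_zero[symmetric]
  proof (rule integral_mono_AE)
    show "integrable lebesgue (\<lambda>x. (cmod (m x * u n x - m x * f x))\<^sup>2)"
      using L2_mult_bounded[OF d assms(2,3)] by (simp add: L2_def algebra_simps)
    show "integrable lebesgue (\<lambda>x. C\<^sup>2 * (cmod (u n x - f x))\<^sup>2)"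
      using d by (simp add: L2_def)
    show "AE x in lebesgue. (cmod (m x * u n x - m x * f x))\<^sup>2 \<le> C\<^sup>2 * (cmod (u n x - f x))\<^sup>2"
      using assms(3)
    proof eventually_elim
      case (elim x)
      have "(cmod (m x * u n x - m x * f x))\<^sup>2 = (cmod (m x))\<^sup>2 * (cmod (u n x - f x))\<^sup>2"
        by (simp add: norm_mult power_mult_distrib flip: right_diff_distrib)
      then show ?case using elim by (simp add: mult_right_mono power_mono)
    qed
  qed
  then have "(L2_norm (\<lambda>x. m x * u n x - m x * f x))\<^sup>2 \<le> (\<bar>C\<bar> * L2_norm (\<lambda>x. u n x - f x))\<^sup>2"
    by (simp add: power_mult_distrib)
  then show "L2_norm (\<lambda>x. m x * u n x - m x * f x) \<le> \<bar>C\<bar> * L2_norm (\<lambda>x. u n x - f x)"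
    by (rule power2_le_imp_le) simp
qed

lemma L2_tendsto_cmult:
  "L2_tendsto u f \<Longrightarrow> L2_tendsto (\<lambda>n x. c * u n x) (\<lambda>x. c * f x)"
  by (rule L2_tendsto_mult_bounded[where C="cmod c"]) auto

lemma L2_tendsto_diff:
  assumes "L2_tendsto u f" "L2_tendsto v g"
  shows "L2_tendsto (\<lambda>n x. u n x - v n x) (\<lambda>x. f x - g x)"
  using L2_tendsto_add[OF assms(1) L2_tendsto_cmult[OF assms(2), of "-1"]] by simp

text \<open>Every later passage from trigonometric polynomials or compact sets to general indicator
  functions goes through this lemma: the pointwise limit is taken in the multiplier, while the
  square integrable factor stays fixed.\<close>

lemma L2_dominated_convergence:
  assumes f: "f \<in> L2" and m: "\<And>n. m n \<in> borel_measurable lebesgue" "l \<in> borel_measurable lebesgue"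
    and bound: "\<And>n. AE x in lebesgue. cmod (m n x) \<le> C"
    and lim: "AE x in lebesgue. (\<lambda>n. m n x) \<longlonglongrightarrow> l x"
  shows "L2_tendsto (\<lambda>n x. m n x * f x) (\<lambda>x. l x * f x)"
proof -
  have all: "AE x in lebesgue. \<forall>n. cmod (m n x) \<le> C"
    using bound by (simp add: AE_all_countable)
  have lb: "AE x in lebesgue. cmod (l x) \<le> C"
    using all lim
  proof eventually_elim
    case (elim x)
    then show ?case by (intro Lim_bounded[OF tendsto_norm[OF elim(2)], of 0]) auto
  qed
  have mL: "(\<lambda>x. m n x * f x) \<in> L2" for n using L2_mult_bounded[OF f m(1) bound] .
  have lL: "(\<lambda>x. l x * f x) \<in> L2" using L2_mult_bounded[OF f m(2) lb] .
  have fm: "f \<in> borel_measurable lebesgue" using L2_measurable[OF f] .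
  have "(\<lambda>n. LINT x|lebesgue. (cmod (m n x * f x - l x * f x))\<^sup>2) \<longlonglongrightarrow> (LINT x|lebesgue. (cmod (l x * f x - l x * f x))\<^sup>2)"
  proof (rule integral_dominated_convergence)
    show "integrable lebesgue (\<lambda>x. (2*C)\<^sup>2 * (cmod (f x))\<^sup>2)"
      using f by (simp add: L2_def)
    show "(\<lambda>x. (cmod (m n x * f x - l x * f x))\<^sup>2) \<in> borel_measurable lebesgue" for n
      using L2_integrable[OF L2_diff[OF mL lL]] by blast
    show "AE x in lebesgue. (\<lambda>n. (cmod (m n x * f x - l x * f x))\<^sup>2) \<longlonglongrightarrow> (cmod (l x * f x - l x * f x))\<^sup>2"
      using lim by eventually_elim (intro tendsto_intros)
    show "AE x in lebesgue. norm ((cmod (m n x * f x - l x * f x))\<^sup>2) \<le> (2*C)\<^sup>2 * (cmod (f x))\<^sup>2" for n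
      using all lb
    proof eventually_elim
      case (elim x)
      have "cmod (m n x * f x - l x * f x) = cmod (m n x - l x) * cmod (f x)"
        by (simp add: norm_mult flip: left_diff_distrib)
      also have "\<dots> \<le> (2 * C) * cmod (f x)"
        proof (rule mult_right_mono)
        show "cmod (m n x - l x) \<le> 2 * C"
          using elim(1)[rule_format, of n] elim(2) norm_triangle_ineq4[of "m n x" "l x"] by linarith
      qed simp
      finally have "(cmod (m n x * f x - l x * f x))\<^sup>2 \<le> ((2 * C) * cmod (f x))\<^sup>2"
        by (intro power_mono) auto
      then show ?case by (simp add: power_mult_distrib)
    qed
  qed simp
  then have "(\<lambda>n. L2_norm (\<lambda>x. m n x * f x - l x * f x)) \<longlonglongrightarrow> sqrt 0"
    unfolding L2_norm_def by (intro tendsto_real_sqrt) simp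
  then show ?thesis using mL lL by (simp add: L2_tendsto_def)
qed

text \<open>Turns a pointwise limit into a member of \<open>L2\<close> with a norm bound. The bound
  is only required eventually, because in its first use it holds from some index of a subsequence
  on.\<close>

lemma L2_Fatou:
  fixes v :: "nat \<Rightarrow> real^'n \<Rightarrow> complex"
  assumes v: "\<And>n. v n \<in> L2" and g: "g \<in> borel_measurable lebesgue"
    and lim: "AE x in lebesgue. (\<lambda>n. v n x) \<longlonglongrightarrow> g x"
    and bound: "\<forall>\<^sub>F n in sequentially. L2_norm (v n) \<le> C" and C: "0 \<le> C"
  shows "g \<in> L2" "L2_norm g \<le> C"
proof -
  have m: "(\<lambda>x. ennreal ((cmod (v n x))\<^sup>2)) \<in> borel_measurable lebesgue" for n
    using L2_measurable[OF v[of n]] by measurable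
  have "(\<integral>\<^sup>+x. ennreal ((cmod (g x))\<^sup>2) \<partial>lebesgue)
      = (\<integral>\<^sup>+x. liminf (\<lambda>n. ennreal ((cmod (v n x))\<^sup>2)) \<partial>lebesgue)"
  proof (rule nn_integral_cong_AE)
    show "AE x in lebesgue. ennreal ((cmod (g x))\<^sup>2) = liminf (\<lambda>n. ennreal ((cmod (v n x))\<^sup>2))"
      using lim
    proof eventually_elim
      case (elim x)
      have "(\<lambda>n. ennreal ((cmod (v n x))\<^sup>2)) \<longlonglongrightarrow> ennreal ((cmod (g x))\<^sup>2)"
        by (intro tendsto_ennrealI tendsto_intros elim)
      then show ?case by (rule lim_imp_Liminf[OF sequentially_bot, symmetric])
    qed
  qed
  also have "\<dots> \<le> liminf (\<lambda>n. \<integral>\<^sup>+x. ennreal ((cmod (v n x))\<^sup>2) \<partial>lebesgue)"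
    by (rule nn_integral_liminf[OF m])
  also have "\<dots> \<le> liminf (\<lambda>n::nat. ennreal (C\<^sup>2))"
    using bound by (intro Liminf_mono) (elim eventually_mono, simp add: nn_integral_L2_norm[OF v] power_mono)
  also have "\<dots> = ennreal (C\<^sup>2)"
    by (simp add: Liminf_const)
  finally have le: "(\<integral>\<^sup>+x. ennreal ((cmod (g x))\<^sup>2) \<partial>lebesgue) \<le> ennreal (C\<^sup>2)" .
  then show gL: "g \<in> L2"
    using g by (simp add: L2_iff_nn_integral order_le_less_trans[OF _ ennreal_less_top])
  from le show "L2_norm g \<le> C"
    unfolding nn_integral_L2_norm[OF gL] using C by (simp add: power2_le_iff_abs_le)
qed

text \<open>Riesz--Fischer. Along a subsequence with geometrically small increments the sums of the
  absolute values of the increments have bounded norm, so the telescoping series converges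
  absolutely almost everywhere.\<close>

theorem L2_complete:
  fixes u :: "nat \<Rightarrow> real^'n \<Rightarrow> complex"
  assumes u: "\<And>n. u n \<in> L2"
    and Cauchy: "\<And>e. 0 < e \<Longrightarrow> \<exists>N. \<forall>m\<ge>N. \<forall>n\<ge>N. L2_norm (\<lambda>x. u m x - u n x) < e"
  obtains f where "L2_tendsto u f"
proof -
  have "\<exists>r. \<forall>k. (\<forall>m\<ge>r k. \<forall>n\<ge>r k. L2_norm (\<lambda>x. u m x - u n x) < (1/2)^k) \<and> r k < r (Suc k)"
  proof (intro dependent_nat_choice)
    show "\<exists>N. \<forall>m\<ge>N. \<forall>n\<ge>N. L2_norm (\<lambda>x. u m x - u n x) < (1/2)^0"
      using Cauchy[of 1] by simp
    fix N k :: nat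
    obtain M where "\<forall>m\<ge>M. \<forall>n\<ge>M. L2_norm (\<lambda>x. u m x - u n x) < (1/2)^Suc k"
      using Cauchy[of "(1/2)^Suc k"] by auto
    then show "\<exists>M. (\<forall>m\<ge>M. \<forall>n\<ge>M. L2_norm (\<lambda>x. u m x - u n x) < (1/2)^Suc k) \<and> N < M"
      by (intro exI[of _ "max M (Suc N)"]) auto
  qed
  then obtain r where r: "\<And>k m n. m \<ge> r k \<Longrightarrow> n \<ge> r k \<Longrightarrow> L2_norm (\<lambda>x. u m x - u n x) < (1/2)^k"
    and "\<And>k. r k < r (Suc k)" by blast
  then have mono: "strict_mono r" by (simp add: strict_mono_Suc_iff)
  define d where "d k x = u (r (Suc k)) x - u (r k) x" for k x
  \<comment> \<open>The sums of absolute values are kept complex valued so that the norm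
    inequalities for \<open>L2\<close> apply to them.\<close>
  define h where "h N x = (\<Sum>k<N. complex_of_real (cmod (d k x)))" for N x
  have d: "d k \<in> L2" "L2_norm (d k) \<le> (1/2)^k" for k
  proof -
    show "d k \<in> L2" unfolding d_def by (intro L2_diff u)
    have "L2_norm (\<lambda>x. u (r (Suc k)) x - u (r k) x) < (1/2)^k"
      by (rule r) (auto intro: strict_mono_leD[OF mono])
    then show "L2_norm (d k) \<le> (1/2)^k" unfolding d_def by simp
  qed
  have dm: "(\<lambda>x. complex_of_real (cmod (d k x))) \<in> L2" for k
    using d(1)[of k] by (auto simp: L2_def)
  have h: "h N \<in> L2 \<and> L2_norm (h N) \<le> (\<Sum>k<N. (1/2)^k)" for N
  proof (induction N)
    case 0
    then show ?case by (simp add: h_def[abs_def])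
  next
    case (Suc N)
    have "h (Suc N) = (\<lambda>x. h N x + complex_of_real (cmod (d N x)))"
      by (auto simp: h_def)
    moreover have "L2_norm (\<lambda>x. complex_of_real (cmod (d N x))) = L2_norm (d N)"
      by (simp add: L2_norm_def)
    ultimately show ?case
      using L2_norm_triangle[of "h N" "\<lambda>x. complex_of_real (cmod (d N x))"] Suc dm[of N] d(2)[of N]
      by (auto intro: L2_add)
  qed
  have h2: "L2_norm (h N) \<le> 2" for N
  proof -
    have "(\<Sum>k<N. (1/2::real)^k) \<le> (\<Sum>k. (1/2)^k)"
      by (intro sum_le_suminf) auto
    also have "\<dots> = 2" using suminf_geometric[of "1/2::real"] by simp
    finally show ?thesis using h[of N] by simp
  qed
  have hm: "(\<lambda>x. ennreal ((cmod (h N x))\<^sup>2)) \<in> borel_measurable lebesgue" for N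
    using L2_measurable[of "h N"] h[of N] by simp
  have hinc: "cmod (h N x) = (\<Sum>k<N. cmod (d k x))" for N x
    unfolding h_def of_real_sum[symmetric] norm_of_real by (simp add: sum_nonneg)
  have "(\<integral>\<^sup>+x. (SUP N. ennreal ((cmod (h N x))\<^sup>2)) \<partial>lebesgue)
      = (SUP N. \<integral>\<^sup>+x. ennreal ((cmod (h N x))\<^sup>2) \<partial>lebesgue)"
    using hm by (intro nn_integral_monotone_convergence_SUP)
      (auto simp: incseq_def le_fun_def hinc intro!: ennreal_leI power_mono sum_mono2 sum_nonneg)
  also have "\<dots> \<le> ennreal (2\<^sup>2)"
  proof (rule SUP_least)
    fix N
    have "(L2_norm (h N))\<^sup>2 \<le> 2\<^sup>2" using h2[of N] by (intro power_mono) auto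
    then show "(\<integral>\<^sup>+x. ennreal ((cmod (h N x))\<^sup>2) \<partial>lebesgue) \<le> ennreal (2\<^sup>2)"
      using h[of N] by (simp only: nn_integral_L2_norm ennreal_leI)
  qed
  finally have "(\<integral>\<^sup>+x. (SUP N. ennreal ((cmod (h N x))\<^sup>2)) \<partial>lebesgue) \<noteq> \<infinity>"
    by (auto simp: top_unique)
  then have "AE x in lebesgue. (SUP N. ennreal ((cmod (h N x))\<^sup>2)) \<noteq> \<infinity>"
    using hm by (intro nn_integral_PInf_AE borel_measurable_SUP) auto
  then have conv: "AE x in lebesgue. convergent (\<lambda>k. u (r k) x)"
  proof eventually_elim
    case (elim x)
    then obtain B where B: "(SUP N. ennreal ((cmod (h N x))\<^sup>2)) = ennreal B" "0 \<le> B"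
      by (cases "(SUP N. ennreal ((cmod (h N x))\<^sup>2))") auto
    have "summable (\<lambda>k. cmod (d k x))"
    proof (rule bounded_imp_summable)
      fix N
      have "ennreal ((cmod (h (Suc N) x))\<^sup>2) \<le> ennreal B"
        unfolding B(1)[symmetric] by (rule SUP_upper) simp
      then have "(cmod (h (Suc N) x))\<^sup>2 \<le> B" using B(2) by simp
      then have "cmod (h (Suc N) x) \<le> sqrt B" by (rule real_le_rsqrt)
      then show "(\<Sum>k\<le>N. cmod (d k x)) \<le> sqrt B"
        unfolding hinc lessThan_Suc_atMost .
    qed simp
    then have "convergent (\<lambda>N. \<Sum>k<N. d k x)"
      using summable_norm_cancel[of "\<lambda>k. d k x"] summable_iff_convergent[of "\<lambda>k. d k x"] by blast
    then have "convergent (\<lambda>N. (\<Sum>k<N. d k x) + u (r 0) x)"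
      by (intro convergent_add convergent_const)
    moreover have "(\<Sum>k<N. d k x) + u (r 0) x = u (r N) x" for N
      using sum_lessThan_telescope[of "\<lambda>k. u (r k) x" N] by (simp add: d_def)
    ultimately show ?case by simp
  qed
  define f where "f x = lim (\<lambda>k. u (r k) x)" for x
  have fm: "f \<in> borel_measurable lebesgue"
    unfolding f_def using L2_measurable[OF u] by (intro borel_measurable_lim_metric)
  have lim: "AE x in lebesgue. (\<lambda>k. u (r k) x) \<longlonglongrightarrow> f x"
    using conv unfolding f_def by eventually_elim (simp add: convergent_LIMSEQ_iff)
  \<comment> \<open>With \<open>m\<close> fixed, Fatou is applied along the subsequence. This gives
    both the membership of \<open>f\<close> in \<open>L2\<close> and the convergence of the whole
    sequence.\<close>
  have key: "(\<lambda>x. f x - u m x) \<in> L2 \<and> L2_norm (\<lambda>x. f x - u m x) \<le> e"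
    if "0 < e" and N: "\<forall>m\<ge>N. \<forall>n\<ge>N. L2_norm (\<lambda>x. u m x - u n x) < e" "m \<ge> N" for e N m
  proof -
    have "AE x in lebesgue. (\<lambda>k. u (r k) x - u m x) \<longlonglongrightarrow> f x - u m x"
      using lim by eventually_elim (intro tendsto_intros)
    moreover have "\<forall>\<^sub>F k in sequentially. L2_norm (\<lambda>x. u (r k) x - u m x) \<le> e"
    proof (rule eventually_sequentiallyI[of N])
      fix k assume "N \<le> k"
      then have "r k \<ge> N" using seq_suble[OF mono, of k] by simp
      then show "L2_norm (\<lambda>x. u (r k) x - u m x) \<le> e" using N by (simp add: less_imp_le)
    qed
    ultimately show ?thesis
      using L2_Fatou[where v="\<lambda>k x. u (r k) x - u m x" and g="\<lambda>x. f x - u m x" and C=e]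
        \<open>0 < e\<close> L2_diff[OF u u] borel_measurable_diff[OF fm L2_measurable[OF u[of m]]] by simp
  qed
  have fL: "f \<in> L2"
  proof -
    obtain N where "\<forall>m\<ge>N. \<forall>n\<ge>N. L2_norm (\<lambda>x. u m x - u n x) < 1"
      using Cauchy[of 1] by auto
    then have "(\<lambda>x. f x - u N x) \<in> L2" using key[of 1 N N] by simp
    from L2_add[OF this u[of N]] show ?thesis by simp
  qed
  have "(\<lambda>n. L2_norm (\<lambda>x. u n x - f x)) \<longlonglongrightarrow> 0"
  proof (rule LIMSEQ_I)
    fix e :: real assume e: "0 < e"
    obtain N where N: "\<forall>m\<ge>N. \<forall>n\<ge>N. L2_norm (\<lambda>x. u m x - u n x) < e/2"
      using Cauchy[of "e/2"] e by auto
    have "norm (L2_norm (\<lambda>x. u n x - f x) - 0) < e" if "n \<ge> N" for n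
      using key[OF _ N that] e L2_norm_minus_commute[of "u n" f] by simp
    then show "\<exists>no. \<forall>n\<ge>no. norm (L2_norm (\<lambda>x. u n x - f x) - 0) < e" by blast
  qed
  then show thesis using that fL u by (auto simp: L2_tendsto_def)
qed

lemma L2_tendsto_Cauchy:
  assumes "L2_tendsto u f" "0 < e"
  shows "\<exists>N. \<forall>m\<ge>N. \<forall>n\<ge>N. L2_norm (\<lambda>x. u m x - u n x) < e"
proof -
  note L = L2_tendstoD[OF assms(1)]
  obtain N where N: "\<forall>n\<ge>N. norm (L2_norm (\<lambda>x. u n x - f x) - 0) < e / 2"
    using LIMSEQ_D[OF L(3), of "e/2"] assms(2) by auto
  have "L2_norm (\<lambda>x. u m x - u n x) < e" if "m \<ge> N" "n \<ge> N" for m n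
    using L2_norm_triangle_diff[OF L(2)[of m] L(1) L(2)[of n]] N[rule_format, OF that(1)]
      N[rule_format, OF that(2)] L2_norm_minus_commute[of "u n" f] by simp
  then show ?thesis by blast
qed

section \<open>Closed subspaces, orthogonal projection and closures\<close>

lemma
  assumes "closed_L2_subspace Y"
  shows closed_subspace_L2: "f \<in> Y \<Longrightarrow> f \<in> L2"
    and closed_subspace_zero: "(\<lambda>x. 0) \<in> Y"
    and closed_subspace_add: "f \<in> Y \<Longrightarrow> g \<in> Y \<Longrightarrow> (\<lambda>x. f x + g x) \<in> Y"
    and closed_subspace_cmult: "f \<in> Y \<Longrightarrow> (\<lambda>x. c * f x) \<in> Y"
    and closed_subspace_limit: "L2_tendsto u f \<Longrightarrow> (\<And>n. u n \<in> Y) \<Longrightarrow> f \<in> Y"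
  using assms unfolding closed_L2_subspace_def L2_closure_def by blast+

lemma closed_subspace_sum:
  assumes "closed_L2_subspace Y" "\<And>i. i \<in> I \<Longrightarrow> f i \<in> Y"
  shows "(\<lambda>x. \<Sum>i\<in>I. f i x) \<in> Y"
  using assms(2)
  by (induction I rule: infinite_finite_induct)
    (auto intro: closed_subspace_add[OF assms(1)] closed_subspace_zero[OF assms(1)])

lemma closed_subspace_cong:
  assumes "closed_L2_subspace Y" "f \<in> Y" "AE x in lebesgue. f x = g x"
  shows "g \<in> Y"
proof (rule closed_subspace_limit[OF assms(1)])
  show "L2_tendsto (\<lambda>n. f) g"
    using L2_tendsto_cong[OF L2_tendsto_const[OF closed_subspace_L2[OF assms(1,2)]]] assms(3) by auto
qed (rule assms)

text \<open>The midpoint of two members of a minimising sequence lies in \<open>Y\<close> again, so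
  the parallelogram law makes the sequence Cauchy. Orthogonality then follows by varying the
  minimiser.\<close>

theorem L2_projection:
  fixes Y :: "(real^'n \<Rightarrow> complex) set"
  assumes Y: "closed_L2_subspace Y" and g: "g \<in> L2"
  shows "\<exists>p\<in>Y. \<forall>y\<in>Y. L2_inner (\<lambda>x. g x - p x) y = 0"
proof -
  define D where "D = Inf ((\<lambda>y. (L2_norm (\<lambda>x. g x - y x))\<^sup>2) ` Y)"
  have bdd: "bdd_below ((\<lambda>y. (L2_norm (\<lambda>x. g x - y x))\<^sup>2) ` Y)"
    by (rule bdd_belowI[of _ 0]) auto
  have D: "D \<le> (L2_norm (\<lambda>x. g x - y x))\<^sup>2" if "y \<in> Y" for y
    unfolding D_def by (rule cInf_lower[OF imageI[OF that] bdd])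
  have ne: "(\<lambda>y. (L2_norm (\<lambda>x. g x - y x))\<^sup>2) ` Y \<noteq> {}"
    using closed_subspace_zero[OF Y] by blast
  have "\<exists>y\<in>Y. (L2_norm (\<lambda>x. g x - y x))\<^sup>2 < D + 1 / real (Suc n)" for n
    using cInf_lessD[OF ne, of "D + 1 / real (Suc n)"] unfolding D_def[symmetric] by auto
  then obtain y where y: "\<And>n. y n \<in> Y" "\<And>n. (L2_norm (\<lambda>x. g x - y n x))\<^sup>2 < D + 1 / real (Suc n)"
    by metis
  have yL: "y n \<in> L2" for n using y(1) closed_subspace_L2[OF Y] by blast
  have par: "(L2_norm (\<lambda>x. y m x - y n x))\<^sup>2 \<le> 2 / real (Suc m) + 2 / real (Suc n)" for m n
  proof -
    define a b where "a x = g x - y m x" and "b x = g x - y n x" for x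
    have ab: "a \<in> L2" "b \<in> L2" unfolding a_def b_def by (intro L2_diff g yL)+
    have "(\<lambda>x. (1/2) * (y m x + y n x)) \<in> Y"
      by (intro closed_subspace_cmult closed_subspace_add Y y)
    from D[OF this] have "D \<le> (L2_norm (\<lambda>x. (1/2) * (a x + b x)))\<^sup>2"
      by (simp add: a_def b_def field_simps)
    also have "\<dots> = (L2_norm (\<lambda>x. a x + b x))\<^sup>2 / 4"
      by (simp only: L2_norm_cmult power_mult_distrib) (simp add: power2_eq_square)
    finally have "4 * D \<le> (L2_norm (\<lambda>x. a x + b x))\<^sup>2" by simp
    moreover have "(L2_norm (\<lambda>x. a x + b x))\<^sup>2 + (L2_norm (\<lambda>x. a x - b x))\<^sup>2
        = 2 * (L2_norm a)\<^sup>2 + 2 * (L2_norm b)\<^sup>2"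
      by (simp add: L2_norm_add_sq L2_norm_diff_sq ab)
    moreover have "L2_norm (\<lambda>x. a x - b x) = L2_norm (\<lambda>x. y m x - y n x)"
      using L2_norm_minus_commute[of "y m" "y n"] by (simp add: a_def b_def)
    ultimately show ?thesis
      using y(2)[of m] y(2)[of n] unfolding a_def[symmetric] b_def[symmetric]
      by (simp add: divide_inverse)
  qed
  obtain p where p: "L2_tendsto y p"
  proof (rule L2_complete[OF yL])
    fix e :: real assume e: "0 < e"
    obtain N where N: "4 / e\<^sup>2 < real N" using reals_Archimedean2 by blast
    have "L2_norm (\<lambda>x. y m x - y n x) < e" if "m \<ge> N" "n \<ge> N" for m n
    proof (rule power2_less_imp_less)
      have "0 < 4 / e\<^sup>2" using e by simp
      then have N0: "0 < real N" using N by linarith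
      have "2 / real (Suc m) \<le> 2 / real N" "2 / real (Suc n) \<le> 2 / real N"
        using that N0 by (auto intro!: divide_left_mono)
      moreover have "4 / real N < e\<^sup>2" using N N0 e by (simp add: field_simps)
      ultimately show "(L2_norm (\<lambda>x. y m x - y n x))\<^sup>2 < e\<^sup>2" using par[of m n] by simp
    qed (use e in simp)
    then show "\<exists>N. \<forall>m\<ge>N. \<forall>n\<ge>N. L2_norm (\<lambda>x. y m x - y n x) < e" by blast
  qed
  have pY: "p \<in> Y" using closed_subspace_limit[OF Y p y(1)] .
  have pL: "p \<in> L2" using pY closed_subspace_L2[OF Y] by blast
  have "(L2_norm (\<lambda>x. g x - p x))\<^sup>2 \<le> D"
  proof (rule LIMSEQ_le)
    show "(\<lambda>n. (L2_norm (\<lambda>x. g x - y n x))\<^sup>2) \<longlonglongrightarrow> (L2_norm (\<lambda>x. g x - p x))\<^sup>2"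
      by (intro tendsto_power L2_tendsto_norm L2_tendsto_diff L2_tendsto_const g p)
    have "(\<lambda>n. D + 1 / real (Suc n)) \<longlonglongrightarrow> D + 0"
      by (intro tendsto_add tendsto_const LIMSEQ_Suc[OF lim_1_over_n])
    then show "(\<lambda>n. D + 1 / real (Suc n)) \<longlonglongrightarrow> D" by simp
    show "\<exists>N. \<forall>n\<ge>N. (L2_norm (\<lambda>x. g x - y n x))\<^sup>2 \<le> D + 1 / real (Suc n)"
      using y(2) less_imp_le by blast
  qed
  have "L2_inner (\<lambda>x. g x - p x) z = 0" if z: "z \<in> Y" for z
  proof (cases "L2_norm z = 0")
    case True
    then show ?thesis
      using L2_Cauchy_Schwarz[OF L2_diff[OF g pL] closed_subspace_L2[OF Y z]] by simp
  next
    case False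
    define q where "q x = g x - p x" for x
    have qL: "q \<in> L2" unfolding q_def by (intro L2_diff g pL)
    define n where "n = (L2_norm z)\<^sup>2"
    have n: "n > 0" using False by (simp add: n_def)
    \<comment> \<open>Moving from \<open>p\<close> by \<open>c z\<close> would lower the squared
      distance by the squared modulus of the inner product divided by \<open>n\<close>; minimality
      of \<open>p\<close> excludes this unless the inner product is zero.\<close>
    define c where "c = L2_inner q z / complex_of_real n"
    have "(\<lambda>x. p x + c * z x) \<in> Y"
      by (intro closed_subspace_add closed_subspace_cmult Y pY z)
    from D[OF this] have "D \<le> (L2_norm (\<lambda>x. q x - c * z x))\<^sup>2"
      unfolding q_def by (simp add: algebra_simps)
    then have "(L2_norm q)\<^sup>2 \<le> (L2_norm (\<lambda>x. q x - c * z x))\<^sup>2"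
      using \<open>(L2_norm (\<lambda>x. g x - p x))\<^sup>2 \<le> D\<close> unfolding q_def by linarith
    also have "\<dots> = (L2_norm q)\<^sup>2 - 2 * Re (cnj c * L2_inner q z) + (cmod c)\<^sup>2 * n"
      using qL closed_subspace_L2[OF Y z] by (subst L2_norm_diff_sq)
        (simp_all add: L2_cmult L2_inner_cmult_right L2_norm_cmult power_mult_distrib n_def)
    also have "cnj c * L2_inner q z = complex_of_real ((cmod (L2_inner q z))\<^sup>2 / n)"
      unfolding c_def by (simp add: complex_norm_square mult.commute del: of_real_power)
    also have "(cmod c)\<^sup>2 * n = (cmod (L2_inner q z))\<^sup>2 / n"
      using n by (simp add: c_def norm_divide power_divide power2_eq_square)
    finally have "(cmod (L2_inner q z))\<^sup>2 / n \<le> 0" by simp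
    then have "L2_inner q z = 0"
      using n by (simp add: divide_le_0_iff)
    then show ?thesis unfolding q_def .
  qed
  then show ?thesis using pY by blast
qed

lemma L2_closure_mono: "S \<subseteq> T \<Longrightarrow> L2_closure S \<subseteq> L2_closure T"
  unfolding L2_closure_def by blast

lemma L2_closure_L2: "f \<in> L2_closure S \<Longrightarrow> f \<in> L2"
  unfolding L2_closure_def by (auto dest: L2_tendstoD)

lemma L2_closure_incl:
  assumes "S \<subseteq> L2"
  shows "S \<subseteq> L2_closure S"
proof
  fix f assume "f \<in> S"
  then show "f \<in> L2_closure S"
    unfolding L2_closure_def using L2_tendsto_const[of f] assms by (intro CollectI exI[of _ "\<lambda>n. f"]) auto
qed

lemma L2_closureI:
  assumes "S \<subseteq> L2" "f \<in> L2" "\<And>e. 0 < e \<Longrightarrow> \<exists>s\<in>S. L2_norm (\<lambda>x. s x - f x) < e"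
  shows "f \<in> L2_closure S"
proof -
  have "\<exists>s\<in>S. L2_norm (\<lambda>x. s x - f x) < 1 / real (Suc n)" for n
    by (rule assms(3)) simp
  then obtain s where s: "\<And>n. s n \<in> S" "\<And>n. L2_norm (\<lambda>x. s n x - f x) < 1 / real (Suc n)"
    by metis
  have "L2_tendsto s f"
    by (rule L2_tendsto_bound[OF _ assms(2) less_imp_le[OF s(2)] LIMSEQ_Suc[OF lim_1_over_n]])
      (use s assms(1) in auto)
  then show ?thesis unfolding L2_closure_def using s(1) by (intro CollectI exI[of _ s]) simp
qed

lemma L2_closure_approx:
  assumes "f \<in> L2_closure S" "0 < e"
  shows "\<exists>s\<in>S. s \<in> L2 \<and> L2_norm (\<lambda>x. s x - f x) < e"
proof -
  obtain u where u: "\<And>n. u n \<in> S" "L2_tendsto u f"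
    using assms(1) unfolding L2_closure_def by blast
  from LIMSEQ_D[OF L2_tendstoD(3)[OF u(2)] assms(2)]
  obtain n where "norm (L2_norm (\<lambda>x. u n x - f x) - 0) < e" by blast
  then show ?thesis using u L2_tendstoD by (intro bexI[of _ "u n"]) auto
qed

lemma closed_subspace_closure:
  assumes S: "S \<subseteq> L2" "(\<lambda>x. 0) \<in> S" "\<And>f g. f \<in> S \<Longrightarrow> g \<in> S \<Longrightarrow> (\<lambda>x. f x + g x) \<in> S"
    "\<And>c f. f \<in> S \<Longrightarrow> (\<lambda>x. c * f x) \<in> S"
  shows "closed_L2_subspace (L2_closure S)"
  unfolding closed_L2_subspace_def
proof (intro conjI ballI allI subsetI)
  show "(\<lambda>x. 0) \<in> L2_closure S" using L2_closure_incl S by blast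
next
  fix f g assume "f \<in> L2_closure S" "g \<in> L2_closure S"
  then obtain u v where "\<forall>n. u n \<in> S" "L2_tendsto u f" "\<forall>n. v n \<in> S" "L2_tendsto v g"
    unfolding L2_closure_def by auto
  then show "(\<lambda>x. f x + g x) \<in> L2_closure S"
    unfolding L2_closure_def
    by (intro CollectI exI[of _ "\<lambda>n x. u n x + v n x"]) (simp add: S(3) L2_tendsto_add)
next
  fix c f assume "f \<in> L2_closure S"
  then obtain u where "\<forall>n. u n \<in> S" "L2_tendsto u f"
    unfolding L2_closure_def by auto
  then show "(\<lambda>x. c * f x) \<in> L2_closure S"
    unfolding L2_closure_def
    by (intro CollectI exI[of _ "\<lambda>n x. c * u n x"]) (simp add: S(4) L2_tendsto_cmult)
next
  fix f assume f: "f \<in> L2_closure (L2_closure S)"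
  show "f \<in> L2_closure S"
  proof (rule L2_closureI[OF S(1) L2_closure_L2[OF f]])
    fix e :: real assume e: "0 < e"
    obtain g where g: "g \<in> L2_closure S" "g \<in> L2" "L2_norm (\<lambda>x. g x - f x) < e/2"
      using L2_closure_approx[OF f, of "e/2"] e by auto
    obtain s where s: "s \<in> S" "s \<in> L2" "L2_norm (\<lambda>x. s x - g x) < e/2"
      using L2_closure_approx[OF g(1), of "e/2"] e by auto
    have "L2_norm (\<lambda>x. s x - f x) < e"
      using L2_norm_triangle_diff[OF s(2) g(2) L2_closure_L2[OF f]] s(3) g(3) by simp
    then show "\<exists>s\<in>S. L2_norm (\<lambda>x. s x - f x) < e" using s by blast
  qed
qed (use L2_closure_L2 in blast)

section \<open>Linear changes of variables\<close>

text \<open>\<open>d\<close> is the factor by which \<open>T\<close> multiplies volumes, so that the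
  integral of f is \<open>d\<close> times the integral of f composed with \<open>T\<close>. It is
  encoded as an equation of measures in order to cover nonnegative, real and complex integrals and
  null sets at once.\<close>

definition rescales :: "(real^'n \<Rightarrow> real^'n) \<Rightarrow> real \<Rightarrow> bool" where
  "rescales T d \<longleftrightarrow> T \<in> lebesgue \<rightarrow>\<^sub>M lebesgue \<and> 0 < d \<and>
     lebesgue = density (distr lebesgue lebesgue T) (\<lambda>_. ennreal d)"

lemma rescales_measurable: "rescales T d \<Longrightarrow> T \<in> lebesgue \<rightarrow>\<^sub>M lebesgue"
  and rescales_pos: "rescales T d \<Longrightarrow> 0 < d"
  by (auto simp: rescales_def)

lemma rescales_compose:
  "rescales T d \<Longrightarrow> f \<in> measurable lebesgue M \<Longrightarrow> (\<lambda>x. f (T x)) \<in> measurable lebesgue M"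
  by (rule measurable_compose[OF rescales_measurable])

lemma rescales_nn_integral:
  assumes T: "rescales T d" and f: "f \<in> borel_measurable lebesgue"
  shows "(\<integral>\<^sup>+x. f x \<partial>lebesgue) = ennreal d * (\<integral>\<^sup>+x. f (T x) \<partial>lebesgue)"
proof -
  note Tm = rescales_measurable[OF T]
  have "(\<integral>\<^sup>+x. f x \<partial>lebesgue) = (\<integral>\<^sup>+x. f x \<partial>density (distr lebesgue lebesgue T) (\<lambda>_. ennreal d))"
    using T by (simp add: rescales_def)
  also have "\<dots> = (\<integral>\<^sup>+x. ennreal d * f x \<partial>distr lebesgue lebesgue T)"
    using f by (intro nn_integral_density) auto
  also have "\<dots> = (\<integral>\<^sup>+x. ennreal d * f (T x) \<partial>lebesgue)"
    using f Tm by (intro nn_integral_distr) auto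
  also have "\<dots> = ennreal d * (\<integral>\<^sup>+x. f (T x) \<partial>lebesgue)"
    using rescales_compose[OF T f] by (intro nn_integral_cmult)
  finally show ?thesis .
qed

lemma rescales_integral:
  fixes f :: "real^'n \<Rightarrow> 'b::{banach, second_countable_topology}"
  assumes T: "rescales T d" and f: "f \<in> borel_measurable lebesgue"
  shows "(LINT x|lebesgue. f x) = d *\<^sub>R (LINT x|lebesgue. f (T x))"
proof -
  note Tm = rescales_measurable[OF T] and d = rescales_pos[OF T]
  have "(LINT x|lebesgue. f x) = (LINT x|density (distr lebesgue lebesgue T) (\<lambda>_. ennreal d). f x)"
    using T by (simp add: rescales_def)
  also have "\<dots> = (LINT x|distr lebesgue lebesgue T. d *\<^sub>R f x)"
    using f d by (intro integral_density) auto
  also have "\<dots> = (LINT x|lebesgue. d *\<^sub>R f (T x))"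
    using f Tm by (intro integral_distr) auto
  finally show ?thesis by simp
qed

lemma rescales_integrable:
  fixes f :: "real^'n \<Rightarrow> 'b::{banach, second_countable_topology}"
  assumes T: "rescales T d" and f: "f \<in> borel_measurable lebesgue"
  shows "integrable lebesgue (\<lambda>x. f (T x)) \<longleftrightarrow> integrable lebesgue f"
proof -
  note d = rescales_pos[OF T]
  have "(\<integral>\<^sup>+x. ennreal (norm (f x)) \<partial>lebesgue) = ennreal d * (\<integral>\<^sup>+x. ennreal (norm (f (T x))) \<partial>lebesgue)"
    using f by (intro rescales_nn_integral[OF T]) auto
  then show ?thesis
    using rescales_compose[OF T f] f d by (auto simp: integrable_iff_bounded ennreal_mult_less_top)
qed

text \<open>Since \<open>d\<close> is positive, the preimage of a null set has measure zero.\<close>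

lemma rescales_AE:
  assumes T: "rescales T d" and P: "AE x in lebesgue. P x"
  shows "AE x in lebesgue. P (T x)"
proof -
  obtain N where N: "{x. \<not> P x} \<subseteq> N" "N \<in> null_sets lebesgue"
    by (rule AE_E[OF P]) (auto simp: null_sets_def intro: that simp del: emeasure_completion)
  have Nm: "N \<in> sets lebesgue" using N by auto
  have "(\<integral>\<^sup>+x. indicator N x \<partial>lebesgue) = ennreal d * (\<integral>\<^sup>+x. indicator N (T x) \<partial>lebesgue)"
    using Nm by (intro rescales_nn_integral[OF T]) auto
  then have "(\<integral>\<^sup>+x. indicator N (T x) \<partial>lebesgue) = (0::ennreal)"
    using N Nm rescales_pos[OF T] by (auto simp: null_setsD1)
  then have "AE x in lebesgue. indicator N (T x) = (0::ennreal)"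
    using rescales_compose[OF T, of "indicator N :: _ \<Rightarrow> ennreal" borel] Nm
    by (subst (asm) nn_integral_0_iff_AE) auto
  then show ?thesis
  proof eventually_elim
    case (elim x)
    then show ?case using N by (auto simp: indicator_def split: if_splits)
  qed
qed

lemma rescales_L2:
  assumes T: "rescales T d" and f: "f \<in> L2"
  shows "(\<lambda>x. f (T x)) \<in> L2"
    and rescales_L2_norm: "(L2_norm f)\<^sup>2 = d * (L2_norm (\<lambda>x. f (T x)))\<^sup>2"
proof -
  note fm = L2_measurable[OF f]
  show "(\<lambda>x. f (T x)) \<in> L2"
    using rescales_compose[OF T fm] rescales_integrable[OF T, of "\<lambda>x. (cmod (f x))\<^sup>2"] fm L2_integrable[OF f]
    by (intro L2I) auto
  show "(L2_norm f)\<^sup>2 = d * (L2_norm (\<lambda>x. f (T x)))\<^sup>2"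
    unfolding L2_norm_sq using fm by (subst rescales_integral[OF T]) auto
qed

lemma rescales_L2_inner:
  assumes T: "rescales T d" and f: "f \<in> L2" and g: "g \<in> L2"
  shows "L2_inner f g = complex_of_real d * L2_inner (\<lambda>x. f (T x)) (\<lambda>x. g (T x))"
  unfolding L2_inner_def
  using rescales_integral[OF T borel_measurable_integrable[OF L2_inner_integrable[OF f g]]]
  by (simp add: scaleR_conv_of_real)

lemma rescales_translation: "rescales (\<lambda>x. x + a) 1"
proof -
  have eq: "(\<lambda>x::real^'a. a + (\<Sum>j\<in>Basis. (1 * (x \<bullet> j)) *\<^sub>R j)) = (\<lambda>x. x + a)"
    by (simp add: euclidean_representation add.commute)
  have "lebesgue = density (distr lebesgue lebesgue (\<lambda>x. x + a)) (\<lambda>_. \<Prod>j\<in>(Basis::(real^'a) set). \<bar>1::real\<bar>)"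
    using lebesgue_affine_euclidean[of "\<lambda>_. 1" a] unfolding eq by simp
  moreover have "(\<lambda>x. x + a) \<in> lebesgue \<rightarrow>\<^sub>M lebesgue"
    using lebesgue_affine_measurable[of "\<lambda>_. 1" a] unfolding eq by simp
  ultimately show ?thesis by (simp add: rescales_def)
qed

lemma lborel_nn_integral_translation:
  fixes f :: "real^'n \<Rightarrow> ennreal"
  assumes "f \<in> borel_measurable borel"
  shows "(\<integral>\<^sup>+x. f (x + a) \<partial>lborel) = (\<integral>\<^sup>+x. f x \<partial>lborel)"
proof -
  have "(\<integral>\<^sup>+x. f x \<partial>lborel) = (\<integral>\<^sup>+x. f x \<partial>distr lborel borel ((+) a))"
    by (simp add: lborel_distr_plus)
  also have "\<dots> = (\<integral>\<^sup>+x. f (a + x) \<partial>lborel)"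
    using assms by (intro nn_integral_distr) auto
  finally show ?thesis by (simp add: add.commute)
qed

text \<open>The change of variables formula of the library computes the constant as a determinant, but only
  for well-ordered index types. The value plays no role here, so it is obtained from the uniqueness of
  translation invariant measures.\<close>

lemma lborel_linear:
  fixes L :: "real^'n \<Rightarrow> real^'n"
  assumes L: "linear L" "linear M" "\<And>x. L (M x) = x" "\<And>x. M (L x) = x"
  obtains d where "0 < d" "lborel = density (distr lborel borel L) (\<lambda>_. ennreal d)"
proof -
  have Lm[measurable]: "L \<in> borel_measurable borel" "M \<in> borel_measurable borel"
    using L linear_continuous_on borel_measurable_continuous_onI linear_conv_bounded_linear by blast+
  define m where "m B = (\<integral>\<^sup>+y. indicator B (L y) \<partial>lborel)" for B :: "(real^'n) set"
  define Q :: "(real^'n) set" where "Q = cbox 0 1"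
  define k where "k = (\<integral>\<^sup>+y. indicator Q (- L y) \<partial>lborel)"
  have [measurable]: "Q \<in> sets borel" by (simp add: Q_def)
  have Q: "emeasure lborel Q = 1"
    unfolding Q_def by (subst emeasure_lborel_cbox_eq)
      (auto simp: Basis_vec_def inner_axis' cart_eq_inner_axis[symmetric] axis_def inner_vec_def if_distrib[of "\<lambda>t. _ * t"] sum.delta intro!: prod.neutral)
  \<comment> \<open>The double integral of \<open>1_Q(x) 1_B(x + L y)\<close> is evaluated in both
    orders. In each order a translation of \<open>y\<close> by \<open>M x\<close> removes
    \<open>x\<close> from the inner integral, which leaves \<open>m B\<close> on one side and the
    constant \<open>k\<close> on the other.\<close>
  have key: "m B = emeasure lborel B * k" if [measurable]: "B \<in> sets borel" for B
  proof -
    have "emeasure lborel Q * m B = (\<integral>\<^sup>+x. indicator Q x * m B \<partial>lborel)"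
      by (simp add: nn_integral_multc)
    also have "\<dots> = (\<integral>\<^sup>+x. (\<integral>\<^sup>+y. indicator Q x * indicator B (x + L y) \<partial>lborel) \<partial>lborel)"
    proof (rule nn_integral_cong)
      fix x :: "real^'n"
      have "m B = (\<integral>\<^sup>+y. indicator B (L (y + M x)) \<partial>lborel)"
        unfolding m_def by (rule lborel_nn_integral_translation[symmetric]) measurable
      also have "\<dots> = (\<integral>\<^sup>+y. indicator B (x + L y) \<partial>lborel)"
        using L by (simp add: linear_add add.commute)
      finally show "indicator Q x * m B = (\<integral>\<^sup>+y. indicator Q x * indicator B (x + L y) \<partial>lborel)"
        by (simp add: nn_integral_cmult)
    qed
    also have "\<dots> = (\<integral>\<^sup>+y. (\<integral>\<^sup>+x. indicator Q x * indicator B (x + L y) \<partial>lborel) \<partial>lborel)"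
      by (rule lborel_pair.Fubini') measurable
    also have "\<dots> = (\<integral>\<^sup>+y. (\<integral>\<^sup>+x. indicator Q (x - L y) * indicator B x \<partial>lborel) \<partial>lborel)"
    proof (rule nn_integral_cong)
      fix y :: "real^'n"
      show "(\<integral>\<^sup>+x. indicator Q x * indicator B (x + L y) \<partial>lborel)
          = (\<integral>\<^sup>+x. indicator Q (x - L y) * indicator B x \<partial>lborel)"
        using lborel_nn_integral_translation[of "\<lambda>x. indicator Q (x - L y) * indicator B x" "L y"] by simp
    qed
    also have "\<dots> = (\<integral>\<^sup>+x. (\<integral>\<^sup>+y. indicator Q (x - L y) * indicator B x \<partial>lborel) \<partial>lborel)"
      by (rule lborel_pair.Fubini') measurable
    also have "\<dots> = (\<integral>\<^sup>+x. k * indicator B x \<partial>lborel)"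
    proof (rule nn_integral_cong)
      fix x :: "real^'n"
      have "(\<integral>\<^sup>+y. indicator Q (x - L y) \<partial>lborel) = (\<integral>\<^sup>+y. indicator Q (x - L (y + M x)) \<partial>lborel)"
        by (rule lborel_nn_integral_translation[symmetric]) measurable
      also have "\<dots> = k"
        using L by (simp add: linear_add k_def)
      finally show "(\<integral>\<^sup>+y. indicator Q (x - L y) * indicator B x \<partial>lborel) = k * indicator B x"
        by (simp add: nn_integral_multc)
    qed
    also have "\<dots> = k * emeasure lborel B"
      by (simp add: nn_integral_cmult)
    finally show ?thesis by (simp add: Q mult.commute)
  qed
  have "m UNIV = \<infinity>" by (simp add: m_def)
  then have k0: "k \<noteq> 0" using key[of UNIV] by auto
  have kfin: "k \<noteq> \<infinity>"
  proof -
    have "bounded_linear M" using L(2) by (simp add: linear_conv_bounded_linear)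
    then have "continuous_on Q (\<lambda>x. M (- x))"
      by (rule bounded_linear.continuous_on) (intro continuous_intros)
    then have comp: "compact ((\<lambda>x. M (- x)) ` Q)"
      by (rule compact_continuous_image) (simp add: Q_def)
    then have "emeasure lborel ((\<lambda>x. M (- x)) ` Q) < \<infinity>"
      by (intro emeasure_bounded_finite compact_imp_bounded)
    moreover have "k \<le> (\<integral>\<^sup>+y. indicator ((\<lambda>x. M (- x)) ` Q) y \<partial>lborel)"
      unfolding k_def
    proof (rule nn_integral_mono)
      fix y :: "real^'n"
      have "- L y \<in> Q \<Longrightarrow> y \<in> (\<lambda>x. M (- x)) ` Q"
        using L(4)[of y] by (intro image_eqI[of _ _ "- L y"]) auto
      then show "indicator Q (- L y) \<le> (indicator ((\<lambda>x. M (- x)) ` Q) y :: ennreal)"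
        by (auto simp: indicator_def)
    qed
    moreover have "(\<lambda>x. M (- x)) ` Q \<in> sets borel"
      using comp by (intro borel_closed compact_imp_closed)
    ultimately show ?thesis by auto
  qed
  obtain c where c: "k = ennreal c" "0 < c"
    using k0 kfin by (cases k) (auto simp: order_less_le)
  have "lborel = density (distr lborel borel L) (\<lambda>_. ennreal (1 / c))"
  proof (rule measure_eqI)
    fix B :: "(real^'n) set" assume "B \<in> sets lborel"
    then have B[measurable]: "B \<in> sets borel" by simp
    have "emeasure (density (distr lborel borel L) (\<lambda>_. ennreal (1 / c))) B = ennreal (1/c) * emeasure (distr lborel borel L) B"
      by (simp add: emeasure_density nn_integral_cmult)
    also have "emeasure (distr lborel borel L) B = m B"
      unfolding m_def using nn_integral_distr[of L lborel borel "indicator B"] by simp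
    also have "ennreal (1/c) * m B = emeasure lborel B * (ennreal (1/c) * ennreal c)"
      by (simp add: key[OF B] c mult_ac)
    also have "ennreal (1/c) * ennreal c = 1"
      using c by (simp add: ennreal_mult[symmetric])
    finally show "emeasure lborel B = emeasure (density (distr lborel borel L) (\<lambda>_. ennreal (1 / c))) B" by simp
  qed simp
  then show thesis using that[of "1/c"] c by simp
qed

text \<open>The Borel identity passes to the completion because a Borel set is null exactly when its
  preimage under \<open>L\<close> is null; under this condition completion commutes with
  \<open>distr\<close> and \<open>density\<close>.\<close>

theorem rescales_linear:
  fixes L :: "real^'n \<Rightarrow> real^'n"
  assumes L: "linear L" "linear M" "\<And>x. L (M x) = x" "\<And>x. M (L x) = x"
  obtains d where "rescales L d"
proof -
  obtain d where d: "0 < d" "lborel = density (distr lborel borel L) (\<lambda>_. ennreal d)"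
    using lborel_linear[OF L] .
  have L_borel[measurable]: "L \<in> borel \<rightarrow>\<^sub>M borel"
    using L linear_continuous_on borel_measurable_continuous_onI linear_conv_bounded_linear by blast
  { fix A :: "(real^'n) set" assume A: "A \<in> sets borel"
    then have "emeasure lborel A = 0 \<longleftrightarrow> emeasure (density (distr lborel borel L) (\<lambda>_. ennreal d)) A = 0"
      by (subst d(2)[symmetric]) (rule refl)
    also have "\<dots> \<longleftrightarrow> emeasure (distr lborel borel L) A = 0"
      using A d(1) by (simp add: emeasure_density nn_integral_cmult)
    also have "\<dots> \<longleftrightarrow> emeasure (distr lebesgue lborel L) A = 0"
      using A by (simp add: distr_completion cong: distr_cong)
    finally have "emeasure lborel A = 0 \<longleftrightarrow> emeasure (distr lebesgue lborel L) A = 0" . }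
  then have eq: "null_sets lborel = null_sets (distr lebesgue lborel L)"
    by (auto simp: null_sets_def)
  have Lm: "L \<in> lebesgue \<rightarrow>\<^sub>M lebesgue"
    by (simp add: completion.measurable_completion2 eq measurable_completion)
  have "lebesgue = completion (density (distr lborel borel L) (\<lambda>_. ennreal d))"
    by (subst d(2)) simp
  also have "\<dots> = density (completion (distr lebesgue lborel L)) (\<lambda>_. ennreal d)"
    using d(1) by (auto intro!: always_eventually completion_density_eq simp: distr_completion cong: distr_cong)
  also have "\<dots> = density (distr lebesgue lebesgue L) (\<lambda>_. ennreal d)"
    by (subst completion.completion_distr_eq) (auto simp: eq measurable_completion)
  finally show thesis using that Lm d by (auto simp: rescales_def)
qed

lemma rescales_funpow:
  assumes "rescales T d"
  shows "rescales (T ^^ n) (d ^ n)"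
proof (induction n)
  case 0
  have "distr lebesgue lebesgue (\<lambda>x::real^'a. x) = lebesgue" by (rule distr_id)
  then show ?case by (simp add: rescales_def density_1 id_def)
next
  case (Suc n)
  have m: "T ^^ Suc n \<in> lebesgue \<rightarrow>\<^sub>M lebesgue"
    using measurable_comp[OF rescales_measurable[OF Suc] rescales_measurable[OF assms]] by simp
  moreover have "lebesgue = density (distr lebesgue lebesgue (T ^^ Suc n)) (\<lambda>_. ennreal (d ^ Suc n))"
  proof (rule measure_eqI)
    fix B :: "(real^'a) set" assume B: "B \<in> sets lebesgue"
    have "emeasure lebesgue B = (\<integral>\<^sup>+x. indicator B x \<partial>lebesgue)" using B by simp
    also have "\<dots> = ennreal d * (\<integral>\<^sup>+x. indicator B (T x) \<partial>lebesgue)"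
      using B by (intro rescales_nn_integral[OF assms]) auto
    also have "\<dots> = ennreal d * (ennreal (d^n) * (\<integral>\<^sup>+x. indicator B (T ((T ^^ n) x)) \<partial>lebesgue))"
      using B by (subst rescales_nn_integral[OF Suc]) (auto intro: rescales_compose[OF assms])
    also have "\<dots> = (\<integral>\<^sup>+x. ennreal (d^Suc n) * indicator B ((T ^^ Suc n) x) \<partial>lebesgue)"
      using B rescales_pos[OF assms] measurable_compose[OF m, of "indicator B :: _ \<Rightarrow> ennreal" borel]
      by (simp add: nn_integral_cmult ennreal_mult mult.assoc)
    also have "\<dots> = (\<integral>\<^sup>+x. ennreal (d^Suc n) * indicator B x \<partial>distr lebesgue lebesgue (T ^^ Suc n))"
      using B by (subst nn_integral_distr[OF m]) auto
    also have "\<dots> = emeasure (density (distr lebesgue lebesgue (T ^^ Suc n)) (\<lambda>_. ennreal (d ^ Suc n))) B"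
      using B by (simp add: emeasure_density)
    finally show "emeasure lebesgue B = emeasure (density (distr lebesgue lebesgue (T ^^ Suc n)) (\<lambda>_. ennreal (d ^ Suc n))) B" .
  qed simp
  ultimately show ?case using zero_less_power[OF rescales_pos[OF assms], of "Suc n"] unfolding rescales_def by blast
qed

section \<open>Spaces invariant under integer modulations\<close>

definition wave :: "real^'n \<Rightarrow> real^'n \<Rightarrow> complex" where
  "wave k x = cis (2 * pi * (k \<bullet> x))"

lemma wave_commute: "wave k x = wave x k"
  by (simp add: wave_def inner_commute)

lemma norm_wave [simp]: "cmod (wave k x) = 1"
  by (simp add: wave_def)

lemma wave_add_left: "wave (k + l) x = wave k x * wave l x"
  by (simp add: wave_def cis_mult inner_add_left distrib_left)

lemma wave_add_right: "wave k (x + y) = wave k x * wave k y"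
  by (simp add: wave_def cis_mult inner_add_right distrib_left)

lemma wave_minus_left: "wave (- k) x = cnj (wave k x)"
  by (simp add: wave_def cis_cnj)

lemma wave_minus_right: "wave k (- x) = cnj (wave k x)"
  by (simp add: wave_def cis_cnj)

lemma wave_zero [simp]: "wave 0 x = 1" "wave k 0 = 1"
  by (simp_all add: wave_def)

lemma continuous_wave: "continuous_on S (wave k)"
  unfolding wave_def[abs_def] by (intro continuous_intros)

lemma wave_measurable [measurable]: "wave k \<in> borel_measurable lebesgue"
  by (intro measurable_completion) (auto intro!: borel_measurable_continuous_onI continuous_wave)

lemma int_lattice_minus: "- k \<in> int_lattice \<longleftrightarrow> k \<in> int_lattice"
proof -
  have "- k \<in> int_lattice" if "k \<in> int_lattice" for k :: "real^'n" using that by (simp add: int_lattice_def)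
  from this[of k] this[of "-k"] show ?thesis by auto
qed

lemma int_lattice_diff: "k \<in> int_lattice \<Longrightarrow> l \<in> int_lattice \<Longrightarrow> k - l \<in> int_lattice"
  by (simp add: int_lattice_def)

lemma int_lattice_zero [simp]: "0 \<in> int_lattice"
  by (simp add: int_lattice_def)

lemma int_lattice_axis: "axis i 1 \<in> int_lattice"
  by (simp add: int_lattice_def axis_def)

lemma wave_int_lattice:
  assumes "k \<in> int_lattice" "l \<in> int_lattice"
  shows "wave k l = 1"
proof -
  have "k \<bullet> l \<in> \<int>"
    using assms unfolding inner_vec_def int_lattice_def inner_real_def by (intro Ints_sum Ints_mult) auto
  then obtain n where "k \<bullet> l = real_of_int n" by (auto elim: Ints_cases)
  then show ?thesis by (simp add: wave_def)
qed

lemma countable_int_lattice: "countable (int_lattice :: (real^'n) set)"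
proof -
  have "int_lattice \<subseteq> range (\<lambda>f::'n \<Rightarrow> int. \<chi> i. real_of_int (f i))"
  proof
    fix k :: "real^'n" assume "k \<in> int_lattice"
    then have "k = (\<chi> i. real_of_int \<lfloor>k $ i\<rfloor>)"
      by (simp add: int_lattice_def vec_eq_iff)
    then show "k \<in> range (\<lambda>f::'n \<Rightarrow> int. \<chi> i. real_of_int (f i))"
      by (rule image_eqI[where x="\<lambda>i. \<lfloor>k $ i\<rfloor>"]) simp
  qed
  then show ?thesis by (rule countable_subset) simp
qed

lemma int_lattice_norm_ge_1:
  assumes "k \<in> int_lattice" "k \<noteq> 0"
  shows "1 \<le> norm k"
proof -
  obtain i where i: "k $ i \<noteq> 0" using assms(2) by (auto simp: vec_eq_iff)
  obtain n where n: "k $ i = real_of_int n" using assms(1) by (auto simp: int_lattice_def elim: Ints_cases)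
  have "1 \<le> \<bar>k $ i\<bar>" using i n by auto
  also have "\<dots> \<le> norm k" by (rule component_le_norm_cart)
  finally show ?thesis .
qed

text \<open>Boundedness is part of the notion so that multipliers form an algebra of operators on
  \<open>L2\<close> and sums and products need no integrability checks.\<close>

definition multiplier :: "(real^'n \<Rightarrow> complex) set \<Rightarrow> (real^'n \<Rightarrow> complex) \<Rightarrow> bool" where
  "multiplier Y m \<longleftrightarrow> m \<in> borel_measurable lebesgue \<and> (\<exists>C. \<forall>x. cmod (m x) \<le> C) \<and>
     (\<forall>u\<in>Y. (\<lambda>x. m x * u x) \<in> Y)"

lemma multiplier_bounded:
  assumes "multiplier Y m"
  obtains C where "\<And>x. cmod (m x) \<le> C"
  using assms unfolding multiplier_def by blast

lemma multiplierD: "multiplier Y m \<Longrightarrow> u \<in> Y \<Longrightarrow> (\<lambda>x. m x * u x) \<in> Y"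
  by (simp add: multiplier_def)

lemma multiplier_const: "closed_L2_subspace Y \<Longrightarrow> multiplier Y (\<lambda>x. c)"
  by (auto simp: multiplier_def closed_subspace_cmult)

lemma multiplier_add:
  assumes "closed_L2_subspace Y" "multiplier Y m" "multiplier Y n"
  shows "multiplier Y (\<lambda>x. m x + n x)"
proof -
  obtain C D where "\<And>x. cmod (m x) \<le> C" "\<And>x. cmod (n x) \<le> D"
    using multiplier_bounded assms by metis
  then have "cmod (m x + n x) \<le> C + D" for x by (intro norm_triangle_mono) auto
  then show ?thesis
    using assms by (auto simp: multiplier_def distrib_right closed_subspace_add)
qed

lemma multiplier_mult:
  assumes "multiplier Y m" "multiplier Y n"
  shows "multiplier Y (\<lambda>x. m x * n x)"
proof -
  obtain C D where "\<And>x. cmod (m x) \<le> C" "\<And>x. cmod (n x) \<le> D"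
    using multiplier_bounded assms by metis
  then have "cmod (m x * n x) \<le> C * D" for x
    unfolding norm_mult by (intro mult_mono) (auto intro: order.trans[OF norm_ge_zero])
  then show ?thesis
    using assms by (auto simp: multiplier_def mult.assoc)
qed

lemma multiplier_sum:
  assumes "closed_L2_subspace Y" "\<And>i. i \<in> I \<Longrightarrow> multiplier Y (m i)"
  shows "multiplier Y (\<lambda>x. \<Sum>i\<in>I. m i x)"
  using assms(2)
  by (induction I rule: infinite_finite_induct) (simp_all add: multiplier_const multiplier_add assms(1))

lemma multiplier_limit:
  assumes Y: "closed_L2_subspace Y" and m: "\<And>n. multiplier Y (m n)"
    and bound: "\<And>n. AE x in lebesgue. cmod (m n x) \<le> C"
    and l: "l \<in> borel_measurable lebesgue" "\<And>x. cmod (l x) \<le> D"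
    and lim: "AE x in lebesgue. (\<lambda>n. m n x) \<longlonglongrightarrow> l x"
  shows "multiplier Y l"
  unfolding multiplier_def
proof (intro conjI ballI)
  fix u assume u: "u \<in> Y"
  have "L2_tendsto (\<lambda>n x. m n x * u x) (\<lambda>x. l x * u x)"
    using m by (intro L2_dominated_convergence[OF closed_subspace_L2[OF Y u] _ l(1) bound lim])
      (auto simp: multiplier_def)
  then show "(\<lambda>x. l x * u x) \<in> Y"
    by (rule closed_subspace_limit[OF Y]) (rule multiplierD[OF m u])
qed (use l in auto)

text \<open>Embeds the quotient of the space by \<open>int_lattice\<close> into a complex vector
  space: the fibres are the cosets of the lattice. Periodic sets thereby become preimages of sets to
  which compactness arguments apply.\<close>

definition torus_map :: "real^'n \<Rightarrow> complex^'n" where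
  "torus_map x = (\<chi> i. cis (2 * pi * x $ i))"

lemma continuous_torus_map: "continuous_on S torus_map"
  unfolding torus_map_def[abs_def] by (intro continuous_intros continuous_on_vec_lambda)

lemma norm_torus_map: "norm (torus_map x :: complex^'n) \<le> real CARD('n)"
proof -
  have "norm (torus_map x) \<le> (\<Sum>i\<in>UNIV. norm (torus_map x $ i))"
    unfolding norm_vec_def by (rule L2_set_le_sum) simp
  then show ?thesis by (simp add: torus_map_def)
qed

lemma torus_map_eq_iff: "torus_map x = torus_map y \<longleftrightarrow> x - y \<in> int_lattice"
proof -
  have "cis (2 * pi * a) = cis (2 * pi * b) \<longleftrightarrow> a - b \<in> \<int>" for a b :: real
  proof -
    have "cis (2 * pi * a) = cis (2 * pi * b) \<longleftrightarrow> (\<exists>n::int. 2 * pi * a = 2 * pi * b + 2 * pi * real_of_int n)"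
      using sin_cos_eq_iff[of "2 * pi * a" "2 * pi * b"] by (auto simp: complex_eq_iff)
    also have "\<dots> \<longleftrightarrow> (\<exists>n::int. a = b + real_of_int n)"
      by (simp flip: distrib_left)
    also have "\<dots> \<longleftrightarrow> a - b \<in> \<int>"
      by (auto simp: Ints_def algebra_simps)
    finally show ?thesis .
  qed
  then show ?thesis by (simp add: torus_map_def vec_eq_iff int_lattice_def)
qed

lemma complex_vec_expansion:
  fixes z :: "complex^'n"
  shows "z = (\<Sum>i\<in>UNIV. Re (z $ i) *\<^sub>R axis i 1 + Im (z $ i) *\<^sub>R axis i \<i>)"
proof -
  have "(\<Sum>i\<in>UNIV. Re (z $ i) *\<^sub>R axis i 1 + Im (z $ i) *\<^sub>R axis i \<i>) $ j = z $ j" for j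
  proof -
    have "(\<Sum>i\<in>UNIV. Re (z $ i) *\<^sub>R axis i 1 + Im (z $ i) *\<^sub>R axis i \<i>) $ j
        = (\<Sum>i\<in>UNIV. if i = j then z $ j else 0)"
      unfolding sum_component by (intro sum.cong) (auto simp: axis_def complex_eq_iff)
    then show ?thesis by simp
  qed
  then show ?thesis by (simp add: vec_eq_iff)
qed

lemma multiplier_torus_polynomial:
  assumes Y: "closed_L2_subspace Y" and inv: "\<And>k u. k \<in> int_lattice \<Longrightarrow> u \<in> Y \<Longrightarrow> (\<lambda>x. wave k x * u x) \<in> Y"
    and p: "real_polynomial_function p"
  shows "multiplier Y (\<lambda>x. complex_of_real (p (torus_map x)))"
  using p
proof induction
  case (linear f)
  have w: "multiplier Y (wave k)" if "k \<in> int_lattice" for k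
    unfolding multiplier_def using inv[OF that] by (auto intro: exI[of _ 1])
  \<comment> \<open>A real linear functional of the image point combines cosines and sines of single
    coordinates, and these are combinations of the exponentials with frequencies plus and minus
    \<open>axis i 1\<close>.\<close>
  have eq: "complex_of_real (f (torus_map x)) = (\<Sum>i\<in>UNIV.
      complex_of_real (f (axis i 1)) * ((1/2) * (wave (axis i 1) x + wave (- axis i 1) x)) +
      complex_of_real (f (axis i \<i>)) * ((- \<i> / 2) * (wave (axis i 1) x + (-1) * wave (- axis i 1) x)))" for x
  proof -
    interpret bounded_linear f by fact
    have "f (torus_map x) = (\<Sum>i\<in>UNIV. Re (torus_map x $ i) * f (axis i 1) + Im (torus_map x $ i) * f (axis i \<i>))"
      by (subst complex_vec_expansion) (simp add: sum add scaleR)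
    then show ?thesis
      unfolding wave_minus_left
      by (simp add: torus_map_def wave_def inner_axis' complex_eq_iff sum.distrib sum_distrib_left
        mult.commute)
  qed
  show ?case unfolding eq
    by (intro multiplier_sum multiplier_add multiplier_mult multiplier_const w Y)
      (auto simp: int_lattice_axis int_lattice_minus)
qed (simp_all add: multiplier_const multiplier_add multiplier_mult Y)

text \<open>The indicator function of \<open>K\<close> is the limit of continuous functions, which Stone--Weierstrass approximates on
  the image of \<^const>\<open>torus_map\<close> by polynomials, that is, by trigonometric polynomials in the original variable.\<close>

lemma multiplier_torus_compact:
  fixes Y :: "(real^'n \<Rightarrow> complex) set"
  assumes Y: "closed_L2_subspace Y" and inv: "\<And>k u. k \<in> int_lattice \<Longrightarrow> u \<in> Y \<Longrightarrow> (\<lambda>x. wave k x * u x) \<in> Y"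
    and K: "compact K"
  shows "multiplier Y (indicator (torus_map -` K))"
proof (cases "K = {}")
  case True
  then show ?thesis using multiplier_const[OF Y, of 0] by (simp add: indicator_def[abs_def])
next
  case False
  define f where "f n z = max 0 (1 - real n * infdist z K)" for n and z :: "complex^'n"
  \<comment> \<open>The approximation takes place on a ball that contains the whole image; its
    compactness is immediate.\<close>
  define T where "T = cball (0::complex^'n) (real CARD('n))"
  have T: "torus_map x \<in> T" for x by (simp add: T_def norm_torus_map)
  have "\<exists>g. real_polynomial_function g \<and> (\<forall>z\<in>T. \<bar>f n z - g z\<bar> < 1 / real (Suc n))" for n
  proof -
    have "continuous_on T (f n)" unfolding f_def by (intro continuous_intros)
    then show ?thesis
      using Stone_Weierstrass_real_polynomial_function[of T "f n" "1 / real (Suc n)"]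
      by (metis T_def compact_cball zero_less_divide_1_iff of_nat_0_less_iff zero_less_Suc)
  qed
  then obtain g where g: "\<And>n. real_polynomial_function (g n)"
    "\<And>n z. z \<in> T \<Longrightarrow> \<bar>f n z - g n z\<bar> < 1 / real (Suc n)" by metis
  have lim_f: "(\<lambda>n. f n z) \<longlonglongrightarrow> indicator K z" for z
  proof (cases "z \<in> K")
    case True
    then show ?thesis by (simp add: f_def)
  next
    case False
    then have d: "infdist z K > 0"
      using in_closed_iff_infdist_zero[OF compact_imp_closed[OF K] \<open>K \<noteq> {}\<close>, of z] infdist_nonneg[of z K] by linarith
    obtain N where N: "1 / infdist z K < real N" using reals_Archimedean2 by blast
    have "f n z = 0" if "n \<ge> N" for n
    proof -
      have "1 / infdist z K < real n" using N that by (meson less_le_trans of_nat_mono)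
      then have "1 < real n * infdist z K" using d by (simp add: divide_less_eq)
      then show ?thesis by (simp add: f_def)
    qed
    then have "\<forall>\<^sub>F n in sequentially. f n z = 0" by (rule eventually_sequentiallyI)
    then show ?thesis using False by (simp add: tendsto_eventually)
  qed
  have lim: "(\<lambda>n. g n (torus_map x)) \<longlonglongrightarrow> indicator K (torus_map x)" for x
  proof -
    have "(\<lambda>n. f n (torus_map x) - g n (torus_map x)) \<longlonglongrightarrow> 0"
    proof (rule Lim_null_comparison[OF _ LIMSEQ_Suc[OF lim_1_over_n]])
      show "\<forall>\<^sub>F n in sequentially. norm (f n (torus_map x) - g n (torus_map x)) \<le> 1 / real (Suc n)"
        using g(2)[OF T] by (auto intro!: always_eventually less_imp_le)
    qed
    from tendsto_diff[OF lim_f[of "torus_map x"] this] show ?thesis by simp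
  qed
  show ?thesis
  proof (rule multiplier_limit[OF Y multiplier_torus_polynomial[OF Y inv g(1)]])
    \<comment> \<open>The bound 2 is 1 for \<open>f n\<close> plus an approximation error below
      1.\<close>
    show "AE x in lebesgue. cmod (complex_of_real (g n (torus_map x))) \<le> 2" for n
    proof (rule AE_I2)
      fix x :: "real^'n"
      have "\<bar>f n (torus_map x)\<bar> \<le> 1" by (simp add: f_def infdist_nonneg)
      moreover have "\<bar>f n (torus_map x) - g n (torus_map x)\<bar> < 1 / real (Suc n)" by (rule g(2)[OF T])
      moreover have "1 / real (Suc n) \<le> 1" by simp
      ultimately show "cmod (complex_of_real (g n (torus_map x))) \<le> 2"
        unfolding norm_of_real by linarith
    qed
    have "closed (torus_map -` K)"
      using compact_imp_closed[OF K] by (intro closed_vimage[OF _ continuous_torus_map])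
    then show "indicator (torus_map -` K) \<in> borel_measurable lebesgue"
      by (intro borel_measurable_indicator) auto
    show "cmod (indicator (torus_map -` K) x) \<le> 1" for x :: "real^'n"
      by (simp add: indicator_def)
    show "AE x in lebesgue. (\<lambda>n. complex_of_real (g n (torus_map x))) \<longlonglongrightarrow> indicator (torus_map -` K) x"
    proof (rule AE_I2)
      fix x :: "real^'n"
      have "complex_of_real (indicator K (torus_map x)) = indicator (torus_map -` K) x"
        by (simp add: indicator_def)
      then show "(\<lambda>n. complex_of_real (g n (torus_map x))) \<longlonglongrightarrow> indicator (torus_map -` K) x"
        using tendsto_of_real[OF lim[of x], where 'a=complex] by simp
    qed
  qed
qed

definition periodic_hull :: "(real^'n) set \<Rightarrow> (real^'n) set" where
  "periodic_hull F = {x. \<exists>k\<in>int_lattice. x - k \<in> F}"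

text \<open>For compact \<open>F\<close> the image is compact, which brings the periodic hull into
  the form that \<open>multiplier_torus_compact\<close> requires.\<close>

lemma torus_map_vimage_image: "torus_map -` (torus_map ` F) = periodic_hull F"
proof -
  have "x \<in> torus_map -` (torus_map ` F) \<longleftrightarrow> x \<in> periodic_hull F" for x
  proof
    assume "x \<in> torus_map -` (torus_map ` F)"
    then obtain y where "y \<in> F" "torus_map x = torus_map y" by auto
    then have "x - y \<in> int_lattice" "x - (x - y) \<in> F" by (simp_all add: torus_map_eq_iff)
    then show "x \<in> periodic_hull F" unfolding periodic_hull_def by blast
  next
    assume "x \<in> periodic_hull F"
    then obtain k where "k \<in> int_lattice" "x - k \<in> F" by (auto simp: periodic_hull_def)
    then have "torus_map x = torus_map (x - k)" by (simp add: torus_map_eq_iff)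
    then show "x \<in> torus_map -` (torus_map ` F)" using \<open>x - k \<in> F\<close> by auto
  qed
  then show ?thesis by (intro set_eqI)
qed

lemma periodic_hull_UN:
  fixes F :: "(real^'n) set"
  shows "periodic_hull F = (\<Union>k\<in>int_lattice. (\<lambda>x. x + k) ` F)"
proof -
  have "x \<in> (\<lambda>x. x + k) ` F \<longleftrightarrow> x - k \<in> F" for x k :: "real^'n"
    by (auto intro: image_eqI[of _ _ "x - k"])
  then show ?thesis by (intro set_eqI) (simp add: periodic_hull_def)
qed

lemma rescales_emeasure_image:
  assumes T: "rescales T d" and T': "rescales T' e" and inv: "\<And>x. T (T' x) = x" "\<And>x. T' (T x) = x"
    and S: "S \<in> sets lebesgue"
  shows "T ` S \<in> sets lebesgue" "emeasure lebesgue (T ` S) = ennreal d * emeasure lebesgue S"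
proof -
  have "T ` S = T' -` S \<inter> space lebesgue"
  proof (intro set_eqI iffI)
    fix x assume "x \<in> T' -` S \<inter> space lebesgue"
    then show "x \<in> T ` S" by (intro image_eqI[of _ _ "T' x"]) (simp_all add: inv)
  qed (auto simp: inv)
  also have "\<dots> \<in> sets lebesgue"
    by (rule measurable_sets[OF rescales_measurable[OF T'] S])
  finally show m: "T ` S \<in> sets lebesgue" .
  have "T x \<in> T ` S \<longleftrightarrow> x \<in> S" for x
    using inv(2) by (metis imageE imageI)
  then have eq: "indicator (T ` S) (T x) = (indicator S x :: ennreal)" for x
    by (simp add: indicator_def)
  show "emeasure lebesgue (T ` S) = ennreal d * emeasure lebesgue S"
    using rescales_nn_integral[OF T, of "indicator (T ` S)"] m S by (simp add: eq)
qed

lemma translation_sets_lebesgue: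
  fixes a :: "real^'n"
  assumes "S \<in> sets lebesgue"
  shows "(\<lambda>x. x + a) ` S \<in> sets lebesgue" "emeasure lebesgue ((\<lambda>x. x + a) ` S) = emeasure lebesgue S"
  using rescales_emeasure_image[OF rescales_translation[of a] rescales_translation[of "-a"] _ _ assms] by auto

lemma periodic_hull_sets: "F \<in> sets lebesgue \<Longrightarrow> periodic_hull F \<in> sets lebesgue"
  unfolding periodic_hull_UN
  by (intro sets.countable_UN' countable_int_lattice) (auto intro: translation_sets_lebesgue)

lemma periodic_hull_null:
  assumes "F \<in> null_sets lebesgue"
  shows "periodic_hull F \<in> null_sets lebesgue"
  unfolding periodic_hull_UN
proof (intro null_sets_UN' countable_int_lattice null_setsI)
  fix k :: "real^'a"
  show "(\<lambda>x. x + k) ` F \<in> sets lebesgue" "emeasure lebesgue ((\<lambda>x. x + k) ` F) = 0"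
    using translation_sets_lebesgue[of F k] assms by (auto simp: null_sets_def simp del: emeasure_completion)
qed

text \<open>Inner regularity reduces the measurable case to the compact one: up to a null set
  \<open>F\<close> is an increasing union of compact sets, and hulls commute with unions and keep
  null sets null because the lattice is countable.\<close>

theorem multiplier_periodic_hull:
  fixes Y :: "(real^'n \<Rightarrow> complex) set"
  assumes Y: "closed_L2_subspace Y" and inv: "\<And>k u. k \<in> int_lattice \<Longrightarrow> u \<in> Y \<Longrightarrow> (\<lambda>x. wave k x * u x) \<in> Y"
    and F: "F \<in> sets lebesgue"
  shows "multiplier Y (indicator (periodic_hull F))"
proof -
  obtain C N where CN: "fsigma C" "N \<in> null_sets lebesgue" "C \<union> N = F"
    using lebesgue_set_almost_fsigma[OF F] by metis
  obtain K :: "nat \<Rightarrow> (real^'n) set" where K: "range K \<subseteq> Collect compact" "C = \<Union>(K ` UNIV)"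
    using CN(1) fsigma_Union_compact by metis
  define D where "D n = (\<Union>i\<le>n. K i)" for n
  have D: "compact (D n)" for n
    using K(1) unfolding D_def by (intro compact_UN) auto
  have "compact (torus_map ` D n)" for n
    by (intro compact_continuous_image continuous_torus_map D)
  then have m: "multiplier Y (indicator (periodic_hull (D n)))" for n
    using multiplier_torus_compact[OF Y inv] by (simp add: torus_map_vimage_image[symmetric])
  have "AE x in lebesgue. x \<notin> periodic_hull N"
    using periodic_hull_null[OF CN(2)] by (rule AE_not_in)
  then have lim: "AE x in lebesgue. (\<lambda>n. indicator (periodic_hull (D n)) x :: complex) \<longlonglongrightarrow> indicator (periodic_hull F) x"
  proof eventually_elim
    case (elim x)
    show ?case
    proof (cases "x \<in> periodic_hull F")
      case True
      then obtain k where k: "k \<in> int_lattice" "x - k \<in> F" by (auto simp: periodic_hull_def)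
      then have "x - k \<in> C" using elim CN(3) by (auto simp: periodic_hull_def)
      then obtain N where N: "x - k \<in> K N" using K(2) by auto
      have "x \<in> periodic_hull (D n)" if "n \<ge> N" for n
        using N k that by (auto simp: periodic_hull_def D_def)
      then have "\<forall>\<^sub>F n in sequentially. indicator (periodic_hull (D n)) x = (1::complex)"
        by (intro eventually_sequentiallyI[of N]) simp
      then show ?thesis using True by (simp add: tendsto_eventually)
    next
      case False
      have "D n \<subseteq> F" for n using K(2) CN(3) by (auto simp: D_def)
      then have "x \<notin> periodic_hull (D n)" for n using False by (auto simp: periodic_hull_def)
      then show ?thesis using False by simp
    qed
  qed
  show ?thesis
    by (rule multiplier_limit[OF Y m _ _ _ lim, where C=1 and D=1])
      (use periodic_hull_sets[OF F] in \<open>auto simp: indicator_def\<close>)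
qed

lemma indicator_L2:
  assumes "F \<in> sets lebesgue" "emeasure lebesgue F < \<infinity>"
  shows "(indicator F :: real^'n \<Rightarrow> complex) \<in> L2"
proof -
  have "(\<lambda>x. ennreal ((cmod (indicator F x))\<^sup>2)) = (indicator F :: real^'n \<Rightarrow> ennreal)"
    by (auto simp: indicator_def)
  then show ?thesis
    using assms by (simp add: L2_iff_nn_integral del: emeasure_completion)
qed

lemma L2_norm_indicator:
  assumes "F \<in> sets lebesgue"
  shows "(L2_norm (indicator F))\<^sup>2 = measure lebesgue F"
proof -
  have "(\<lambda>x. (cmod (indicator F x))\<^sup>2) = (indicator F :: real^'a \<Rightarrow> real)"
    by (auto simp: indicator_def)
  then show ?thesis using assms by (simp add: L2_norm_sq)
qed

text \<open>The test set is the part of \<open>S\<close> where the real part of \<open>c * u\<close>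
  is positive; the four choices of \<open>c\<close> at the end bound the real and imaginary parts
  from above and below.\<close>

lemma integral_zero_test:
  fixes u :: "real^'n \<Rightarrow> complex"
  assumes u: "integrable lebesgue u" and S: "S \<in> sets lebesgue"
    and zero: "\<And>F. F \<in> sets lebesgue \<Longrightarrow> F \<subseteq> S \<Longrightarrow> (LINT x|lebesgue. indicator F x * u x) = 0"
  shows "AE x in lebesgue. x \<in> S \<longrightarrow> u x = 0"
proof -
  have um: "u \<in> borel_measurable lebesgue" by (rule borel_measurable_integrable[OF u])
  have neg: "AE x in lebesgue. x \<in> S \<longrightarrow> Re (c * u x) \<le> 0" for c
  proof -
    define F where "F = {x \<in> space lebesgue. 0 < Re (c * u x)} \<inter> S"
    have F: "F \<in> sets lebesgue" "F \<subseteq> S"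
    proof -
      have "(\<lambda>x. Re (c * u x)) \<in> borel_measurable lebesgue"
        using um by measurable
      then show "F \<in> sets lebesgue"
        unfolding F_def using S by (intro sets.Int borel_measurable_less borel_measurable_const)
    qed (simp add: F_def)
    have "integrable lebesgue (\<lambda>x. indicator F x *\<^sub>R u x)"
      by (rule integrable_mult_indicator[OF F(1) u])
    moreover have "(\<lambda>x. indicator F x *\<^sub>R u x) = (\<lambda>x. indicator F x * u x)"
      by (simp add: fun_eq_iff indicator_def)
    ultimately have int: "integrable lebesgue (\<lambda>x. indicator F x * u x)" by simp
    have eq: "Re (c * (indicator F x * u x)) = (if x \<in> F then Re (c * u x) else 0)" for x
      by (simp add: indicator_def)
    have "(LINT x|lebesgue. Re (c * (indicator F x * u x))) = Re (c * (LINT x|lebesgue. indicator F x * u x))"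
      using integral_Re[OF integrable_mult_right[OF int, of c]] by (simp only: integral_mult_right_zero)
    also have "\<dots> = 0" using zero[OF F] by simp
    finally have z: "(LINT x|lebesgue. Re (c * (indicator F x * u x))) = 0" .
    have "AE x in lebesgue. 0 \<le> Re (c * (indicator F x * u x))"
      unfolding eq by (simp add: F_def)
    then have "AE x in lebesgue. Re (c * (indicator F x * u x)) = 0"
      using z integral_nonneg_eq_0_iff_AE[OF integrable_Re[OF integrable_mult_right[OF int, of c]]] by blast
    then show ?thesis
    proof eventually_elim
      case (elim x)
      then show ?case unfolding eq by (auto simp: F_def split: if_splits)
    qed
  qed
  show ?thesis
    using neg[of 1] neg[of "-1"] neg[of \<i>] neg[of "-\<i>"]
    by eventually_elim (auto simp: complex_eq_iff)
qed

lemma L2_zero_test: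
  fixes u :: "real^'n \<Rightarrow> complex"
  assumes u: "u \<in> L2" and S: "S \<in> sets lebesgue" "emeasure lebesgue S < \<infinity>"
    and zero: "\<And>F. F \<in> sets lebesgue \<Longrightarrow> F \<subseteq> S \<Longrightarrow> L2_inner u (indicator F) = 0"
  shows "AE x in lebesgue. x \<in> S \<longrightarrow> u x = 0"
proof -
  have "AE x in lebesgue. x \<in> S \<longrightarrow> u x * cnj (indicator S x) = 0"
  proof (rule integral_zero_test[OF L2_inner_integrable[OF u indicator_L2[OF S]] S(1)])
    fix F assume F: "F \<in> sets lebesgue" "F \<subseteq> S"
    have "(\<lambda>x. indicator F x * (u x * cnj (indicator S x))) = (\<lambda>x. u x * cnj (indicator F x))"
      using F(2) by (auto simp: fun_eq_iff indicator_def)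
    then show "(LINT x|lebesgue. indicator F x * (u x * cnj (indicator S x))) = 0"
      using zero[OF F] by (simp add: L2_inner_def)
  qed
  then show ?thesis by eventually_elim simp
qed

section \<open>The Plancherel theorem\<close>

text \<open>Half open, so that its lattice translates tile the space without overlap.\<close>

definition unit_cube :: "(real^'n) set" where
  "unit_cube = {x. \<forall>i. 0 \<le> x $ i \<and> x $ i < 1}"

lemma unit_cube_sets [measurable]: "unit_cube \<in> sets borel"
proof -
  have "unit_cube = (\<Inter>i\<in>UNIV. {x::real^'a. 0 \<le> x $ i} \<inter> {x. x $ i < 1})"
    by (auto simp: unit_cube_def)
  also have "\<dots> \<in> sets borel"
    by (intro sets.countable_INT'' sets.Int borel_closed borel_open)
      (auto intro!: closed_Collect_le open_Collect_less continuous_intros)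
  finally show ?thesis .
qed

lemma unit_cube_lebesgue [simp]: "unit_cube \<in> sets lebesgue"
  using unit_cube_sets by simp

lemma emeasure_unit_cube: "emeasure lebesgue (unit_cube :: (real^'n) set) = 1"
proof -
  have 1: "(\<Prod>b\<in>Basis. ((1::real^'n) - 0) \<bullet> b) = 1"
    by (rule prod.neutral) (auto simp: Basis_vec_def inner_axis)
  have le: "\<forall>b\<in>Basis. (0::real^'n) \<bullet> b \<le> 1 \<bullet> b"
    by (auto simp: Basis_vec_def inner_axis)
  have "box (0::real^'n) 1 \<subseteq> unit_cube" "unit_cube \<subseteq> cbox (0::real^'n) 1"
    by (auto simp: unit_cube_def mem_box_cart less_imp_le)
  then have "emeasure lborel (box (0::real^'n) 1) \<le> emeasure lborel (unit_cube :: (real^'n) set)"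
    "emeasure lborel (unit_cube :: (real^'n) set) \<le> emeasure lborel (cbox (0::real^'n) 1)"
    by (auto intro!: emeasure_mono)
  moreover have "emeasure lborel (box (0::real^'n) 1) = 1" "emeasure lborel (cbox (0::real^'n) 1) = 1"
    using 1 le by (simp_all add: emeasure_lborel_box_eq emeasure_lborel_cbox_eq)
  ultimately show ?thesis by simp
qed

lemma unit_cube_representative:
  obtains k where "k \<in> int_lattice" "x - k \<in> unit_cube"
proof
  show "(\<chi> i. real_of_int \<lfloor>x $ i\<rfloor>) \<in> int_lattice" by (simp add: int_lattice_def)
  have "0 \<le> x $ i - real_of_int \<lfloor>x $ i\<rfloor>" "x $ i - real_of_int \<lfloor>x $ i\<rfloor> < 1" for i
    using floor_correct[of "x $ i"] by linarith+
  then show "x - (\<chi> i. real_of_int \<lfloor>x $ i\<rfloor>) \<in> unit_cube"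
    by (simp add: unit_cube_def)
qed

lemma unit_cube_unique:
  assumes "k \<in> int_lattice" "l \<in> int_lattice" "x - k \<in> unit_cube" "x - l \<in> unit_cube"
  shows "k = l"
proof -
  have "k $ i = l $ i" for i
  proof -
    have "k $ i \<in> \<int>" "l $ i \<in> \<int>" using assms by (auto simp: int_lattice_def)
    then obtain a b where ab: "k $ i = real_of_int a" "l $ i = real_of_int b" by (auto elim!: Ints_cases)
    have "0 \<le> x $ i - k $ i" "x $ i - k $ i < 1" "0 \<le> x $ i - l $ i" "x $ i - l $ i < 1"
      using assms(3,4) by (auto simp: unit_cube_def)
    then have "\<bar>real_of_int (a - b)\<bar> < 1" unfolding ab by simp
    then have "a = b" by linarith
    then show ?thesis unfolding ab by simp
  qed
  then show ?thesis by (simp add: vec_eq_iff)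
qed

text \<open>Turns sums over the lattice into series over the naturals, for which
  \<open>suminf\<close> and \<open>sums\<close> and their interchange with integrals are at
  hand.\<close>

definition lattice_enum :: "nat \<Rightarrow> real^'n" where
  "lattice_enum = from_nat_into int_lattice"

lemma bij_lattice_enum: "bij_betw (lattice_enum :: nat \<Rightarrow> real^'n) UNIV int_lattice"
proof -
  have "inj (\<lambda>n::nat. axis (undefined::'n) (real n))"
    by (auto simp: inj_on_def axis_eq_axis)
  moreover have "range (\<lambda>n::nat. axis (undefined::'n) (real n)) \<subseteq> int_lattice"
    by (auto simp: int_lattice_def axis_def)
  ultimately have "infinite (int_lattice :: (real^'n) set)"
    using infinite_super range_inj_infinite by blast
  then show ?thesis
    unfolding lattice_enum_def by (intro bij_betw_from_nat_into countable_int_lattice)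
qed

lemma lattice_enum_mem [simp]: "(lattice_enum n :: real^'n) \<in> int_lattice"
  using bij_betwE[OF bij_lattice_enum[where 'n='n]] by simp

lemma lattice_enum_eq_iff [simp]: "(lattice_enum m :: real^'n) = lattice_enum n \<longleftrightarrow> m = n"
  using bij_betw_imp_inj_on[OF bij_lattice_enum[where 'n='n]] by (simp add: inj_eq)

lemma lattice_enum_obtain:
  fixes k :: "real^'n"
  assumes "k \<in> int_lattice"
  obtains n where "k = lattice_enum n"
proof -
  have "k \<in> range lattice_enum"
    using bij_betw_imp_surj_on[OF bij_lattice_enum[where 'n='n]] assms by simp
  then show thesis by (elim imageE) (rule that)
qed

lemma suminf_indicator_unique:
  assumes "P m" "\<And>n. P n \<Longrightarrow> n = m"
  shows "(\<Sum>n. if P n then c else 0) = (c::ennreal)"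
proof -
  have "(\<Sum>n. if P n then c else 0) = (\<Sum>n\<in>{m}. if P n then c else 0)"
    by (rule suminf_finite) (auto dest: assms(2))
  then show ?thesis using assms(1) by simp
qed

text \<open>Each coset of the lattice meets a translate of the half-open cube in exactly one point,
  so one term of the series survives.\<close>

lemma lattice_translates_partition:
  fixes x t :: "real^'n"
  shows "(\<Sum>n. if x + lattice_enum n - t \<in> unit_cube then c else 0) = (c::ennreal)"
proof -
  obtain k :: "real^'n" where k: "k \<in> int_lattice" "(x - t) - k \<in> unit_cube" using unit_cube_representative by blast
  obtain m where m: "- k = lattice_enum m" using lattice_enum_obtain[of "-k"] k int_lattice_minus by blast
  show ?thesis
  proof (rule suminf_indicator_unique[of _ m])
    show "x + lattice_enum m - t \<in> unit_cube" using k m by (simp add: algebra_simps flip: m)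
    fix n assume "x + lattice_enum n - t \<in> unit_cube"
    then have "(x - t) - (- lattice_enum n) \<in> unit_cube" by (simp add: algebra_simps)
    then have "- lattice_enum n = k"
      using unit_cube_unique[of "- lattice_enum n" k "x - t"] k by (simp add: int_lattice_minus)
    then have "lattice_enum n = (lattice_enum m :: real^'n)" unfolding m[symmetric] by auto
    then show "n = m" by simp
  qed
qed

lemma nn_integral_tiling:
  fixes f :: "real^'n \<Rightarrow> ennreal"
  assumes f: "f \<in> borel_measurable lebesgue"
  shows "(\<integral>\<^sup>+x. f x \<partial>lebesgue) = (\<integral>\<^sup>+x. indicator unit_cube x * (\<Sum>n. f (x + lattice_enum n)) \<partial>lebesgue)"
proof -
  have m: "(\<lambda>x. if x - k \<in> unit_cube then f x else 0) \<in> borel_measurable lebesgue" for k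
  proof -
    have "{x. x - k \<in> unit_cube} \<in> sets lebesgue"
      using measurable_sets[OF rescales_measurable[OF rescales_translation[of "-k"]] unit_cube_lebesgue]
      by (simp add: vimage_def)
    then show ?thesis using f by (intro measurable_If) auto
  qed
  have m2: "(\<lambda>x. indicator unit_cube x * f (x + k)) \<in> borel_measurable lebesgue" for k
    using rescales_compose[OF rescales_translation f, of k]
    by (intro borel_measurable_times_ennreal borel_measurable_indicator unit_cube_lebesgue)
  have "(\<integral>\<^sup>+x. f x \<partial>lebesgue)
      = (\<integral>\<^sup>+x. (\<Sum>n. if x - lattice_enum n \<in> unit_cube then f x else 0) \<partial>lebesgue)"
  proof (rule nn_integral_cong)
    fix x :: "real^'n"
    obtain k where k: "k \<in> int_lattice" "x - k \<in> unit_cube" using unit_cube_representative by blast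
    obtain m where m: "k = lattice_enum m" by (rule lattice_enum_obtain[OF k(1)])
    have "n = m" if "x - lattice_enum n \<in> unit_cube" for n
    proof -
      have "lattice_enum n = k"
        by (rule unit_cube_unique[OF lattice_enum_mem k(1) that k(2)])
      then show ?thesis unfolding m by simp
    qed
    then have "(\<Sum>n. if x - lattice_enum n \<in> unit_cube then f x else 0) = f x"
      using k(2) unfolding m
      by (intro suminf_indicator_unique[where P="\<lambda>n. x - lattice_enum n \<in> unit_cube" and m=m])
    then show "f x = (\<Sum>n. if x - lattice_enum n \<in> unit_cube then f x else 0)" by (rule sym)
  qed
  also have "\<dots> = (\<Sum>n. \<integral>\<^sup>+x. (if x - lattice_enum n \<in> unit_cube then f x else 0) \<partial>lebesgue)"
    by (rule nn_integral_suminf) (rule m)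
  also have "\<dots> = (\<Sum>n. \<integral>\<^sup>+x. indicator unit_cube x * f (x + lattice_enum n) \<partial>lebesgue)"
  proof (rule suminf_cong)
    fix n
    have "(\<integral>\<^sup>+x. (if x - lattice_enum n \<in> unit_cube then f x else 0) \<partial>lebesgue)
       = ennreal 1 * (\<integral>\<^sup>+x. (if (x + lattice_enum n) - lattice_enum n \<in> unit_cube then f (x + lattice_enum n) else 0) \<partial>lebesgue)"
      by (rule rescales_nn_integral[OF rescales_translation m])
    also have "\<dots> = (\<integral>\<^sup>+x. indicator unit_cube x * f (x + lattice_enum n) \<partial>lebesgue)"
      by (auto intro!: nn_integral_cong simp: indicator_def)
    finally show "(\<integral>\<^sup>+x. (if x - lattice_enum n \<in> unit_cube then f x else 0) \<partial>lebesgue) = \<dots>" .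
  qed
  also have "\<dots> = (\<integral>\<^sup>+x. (\<Sum>n. indicator unit_cube x * f (x + lattice_enum n)) \<partial>lebesgue)"
    by (rule nn_integral_suminf[symmetric]) (rule m2)
  finally show ?thesis by simp
qed

text \<open>Restrict \<open>h\<close> to the translated cube and fold the restriction back by
  \<open>nn_integral_tiling\<close>; its lattice sum is again \<open>h\<close>.\<close>

lemma nn_integral_unit_cube_translate:
  fixes h :: "real^'n \<Rightarrow> ennreal"
  assumes h: "h \<in> borel_measurable lebesgue" and per: "\<And>x k. k \<in> int_lattice \<Longrightarrow> h (x + k) = h x"
  shows "(\<integral>\<^sup>+x. indicator unit_cube x * h (x + t) \<partial>lebesgue) = (\<integral>\<^sup>+x. indicator unit_cube x * h x \<partial>lebesgue)"
proof -
  define g where "g x = (if x - t \<in> unit_cube then h x else 0)" for x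
  have "{x. x - t \<in> unit_cube} \<in> sets lebesgue"
    using measurable_sets[OF rescales_measurable[OF rescales_translation[of "-t"]] unit_cube_lebesgue]
    by (simp add: vimage_def)
  then have g: "g \<in> borel_measurable lebesgue" unfolding g_def using h by (intro measurable_If) auto
  have "(\<integral>\<^sup>+x. indicator unit_cube x * h (x + t) \<partial>lebesgue) = (\<integral>\<^sup>+x. g (x + t) \<partial>lebesgue)"
    by (auto intro!: nn_integral_cong simp: g_def indicator_def)
  also have "\<dots> = (\<integral>\<^sup>+x. g x \<partial>lebesgue)"
    using rescales_nn_integral[OF rescales_translation g, of t] by simp
  also have "\<dots> = (\<integral>\<^sup>+x. indicator unit_cube x * (\<Sum>n. g (x + lattice_enum n)) \<partial>lebesgue)"
    by (rule nn_integral_tiling[OF g])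
  also have "\<dots> = (\<integral>\<^sup>+x. indicator unit_cube x * h x \<partial>lebesgue)"
  proof (rule nn_integral_cong)
    fix x :: "real^'n"
    have "(\<Sum>n. g (x + lattice_enum n)) = h x"
      using lattice_translates_partition[of x t "h x"] by (simp add: g_def per cong: if_cong)
    then show "indicator unit_cube x * (\<Sum>n. g (x + lattice_enum n)) = indicator unit_cube x * h x"
      by simp
  qed
  finally show ?thesis .
qed

lemma wave_integrable_unit_cube: "integrable lebesgue (\<lambda>x. indicator unit_cube x * wave k x)"
proof (rule Bochner_Integration.integrable_bound)
  show "integrable lebesgue (indicator unit_cube :: real^'a \<Rightarrow> real)"
    by (intro integrable_real_indicator) (simp_all add: emeasure_unit_cube del: emeasure_completion)
  show "(\<lambda>x. indicator unit_cube x * wave k x) \<in> borel_measurable lebesgue"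
    by (intro borel_measurable_times borel_measurable_indicator unit_cube_lebesgue wave_measurable)
qed (simp add: norm_mult indicator_def)

lemma integral_indicator_complex:
  assumes "F \<in> sets lebesgue"
  shows "(LINT x|lebesgue. indicator F x) = complex_of_real (measure lebesgue F)"
proof -
  have "(LINT x|lebesgue. indicator F x) = (LINT x|lebesgue. complex_of_real (indicator F x))"
    by (rule Bochner_Integration.integral_cong) (simp_all add: indicator_def)
  also have "\<dots> = complex_of_real (LINT x|lebesgue. indicator F x)"
    by (rule integral_complex_of_real)
  finally show ?thesis using assms by simp
qed

lemma integral_unit_cube_wave:
  assumes k: "k \<in> int_lattice"
  shows "(LINT x|lebesgue. indicator unit_cube x * wave k x) = (if k = 0 then 1 else 0)"
proof (cases "k = 0")
  case True
  have "(LINT x|lebesgue. indicator (unit_cube :: (real^'a) set) x) = complex_of_real (measure lebesgue (unit_cube :: (real^'a) set))"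
    by (rule integral_indicator_complex) simp
  also have "\<dots> = 1"
    using emeasure_unit_cube[where 'n='a] by (simp add: measure_def)
  finally have "(LINT x|lebesgue. indicator (unit_cube :: (real^'a) set) x) = (1::complex)" .
  then show ?thesis using True by simp
next
  case False
  then obtain i where i: "k $ i \<noteq> 0" by (auto simp: vec_eq_iff)
  \<comment> \<open>A translation by half a period of \<open>wave k\<close>: it changes the sign of
    the exponential but not the integral over a cube.\<close>
  define t :: "real^'a" where "t = axis i (1 / (2 * k $ i))"
  have "k \<bullet> t = 1 / 2" using i by (simp add: t_def inner_axis)
  then have "2 * pi * (k \<bullet> t) = pi" by simp
  then have "wave k t = -1" unfolding wave_def by (simp only: cis_pi)
  then have wt: "wave k (x + t) = - wave k x" for x by (simp add: wave_add_right)
  have "Re (c * (LINT x|lebesgue. indicator unit_cube x * wave k x)) = 0" if c: "cmod c = 1" for c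
  proof -
    \<comment> \<open>Adding 1 makes the integrand nonnegative, as the translation lemma is stated
      in \<open>ennreal\<close>. Translation by \<open>t\<close> turns \<open>h 1\<close> into
      \<open>h (-1)\<close>, so the quantity in question equals its negative; \<open>c = 1\<close>
      and \<open>c = -\<i>\<close> give real and imaginary part.\<close>
    define h where "h s x = 1 + s * Re (c * wave k x)" for s :: real and x
    have bound: "\<bar>Re (c * wave k x)\<bar> \<le> 1" for x
      using abs_Re_le_cmod[of "c * wave k x"] c by (simp add: norm_mult)
    have h0: "0 \<le> h 1 x" "0 \<le> h (-1) x" for x using bound[of x] by (auto simp: h_def)
    have hm: "h s \<in> borel_measurable lebesgue" for s
    proof -
      have "(\<lambda>x. Re (c * wave k x)) \<in> borel_measurable lebesgue"
        using wave_measurable[of k] by measurable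
      then show ?thesis unfolding h_def by measurable
    qed
    have int: "integrable lebesgue (\<lambda>x. indicator unit_cube x * h s x)"
      and val: "(LINT x|lebesgue. indicator unit_cube x * h s x)
        = 1 + s * Re (c * (LINT x|lebesgue. indicator unit_cube x * wave k x))" for s
    proof -
      have eq: "indicator unit_cube x * h s x = indicator unit_cube x + s * Re (c * (indicator unit_cube x * wave k x))" for x
        by (simp add: h_def indicator_def)
      have i1: "integrable lebesgue (indicator unit_cube :: real^'a \<Rightarrow> real)"
        by (intro integrable_real_indicator) (simp_all add: emeasure_unit_cube del: emeasure_completion)
      have i2: "integrable lebesgue (\<lambda>x. Re (c * (indicator unit_cube x * wave k x)))"
        by (intro integrable_Re integrable_mult_right wave_integrable_unit_cube)
      show "integrable lebesgue (\<lambda>x. indicator unit_cube x * h s x)"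
        unfolding eq using i1 i2 by (intro Bochner_Integration.integrable_add integrable_mult_right)
      have "(LINT x|lebesgue. indicator unit_cube x * h s x) = measure lebesgue (unit_cube :: (real^'a) set)
         + s * (LINT x|lebesgue. Re (c * (indicator unit_cube x * wave k x)))"
        unfolding eq using i1 i2 by (subst Bochner_Integration.integral_add) auto
      also have "(LINT x|lebesgue. Re (c * (indicator unit_cube x * wave k x)))
         = Re (LINT x|lebesgue. c * (indicator unit_cube x * wave k x))"
        by (intro integral_Re integrable_mult_right wave_integrable_unit_cube)
      also have "\<dots> = Re (c * (LINT x|lebesgue. indicator unit_cube x * wave k x))"
        by simp
      also have "measure lebesgue (unit_cube :: (real^'a) set) = 1"
        using emeasure_unit_cube[where 'n='a] by (simp add: measure_def)
      finally show "(LINT x|lebesgue. indicator unit_cube x * h s x)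
        = 1 + s * Re (c * (LINT x|lebesgue. indicator unit_cube x * wave k x))" .
    qed
    have "(\<integral>\<^sup>+x. indicator unit_cube x * ennreal (h 1 (x + t)) \<partial>lebesgue)
        = (\<integral>\<^sup>+x. indicator unit_cube x * ennreal (h 1 x) \<partial>lebesgue)"
    proof (rule nn_integral_unit_cube_translate)
      show "(\<lambda>x. ennreal (h 1 x)) \<in> borel_measurable lebesgue" using hm by measurable
      show "ennreal (h 1 (x + l)) = ennreal (h 1 x)" if "l \<in> int_lattice" for x l
        using wave_int_lattice[OF k that] by (simp add: h_def wave_add_right)
    qed
    moreover have "h 1 (x + t) = h (-1) x" for x by (simp add: h_def wt)
    ultimately have "(\<integral>\<^sup>+x. ennreal (indicator unit_cube x * h (-1) x) \<partial>lebesgue)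
        = (\<integral>\<^sup>+x. ennreal (indicator unit_cube x * h 1 x) \<partial>lebesgue)"
      by (simp add: ennreal_mult' ennreal_indicator)
    then have "ennreal (LINT x|lebesgue. indicator unit_cube x * h (-1) x)
        = ennreal (LINT x|lebesgue. indicator unit_cube x * h 1 x)"
      using nn_integral_eq_integral[OF int[of 1]] nn_integral_eq_integral[OF int[of "-1"]] h0 by simp
    moreover have "0 \<le> (LINT x|lebesgue. indicator unit_cube x * h (-1) x)"
      "0 \<le> (LINT x|lebesgue. indicator unit_cube x * h 1 x)"
      using h0 by (intro Bochner_Integration.integral_nonneg; simp)+
    ultimately show ?thesis unfolding val by simp
  qed
  from this[of 1] this[of "-\<i>"] have "(LINT x|lebesgue. indicator unit_cube x * wave k x) = 0"
    unfolding complex_eq_iff by simp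
  then show ?thesis using False by simp
qed

lemma fourier_L1_wave: "fourier_L1 f \<xi> = (LINT x|lebesgue. f x * cnj (wave \<xi> x))"
proof -
  have "exp (- 2 * complex_of_real pi * \<i> * complex_of_real (x \<bullet> \<xi>)) = cnj (wave \<xi> x)" for x
  proof -
    have "- 2 * complex_of_real pi * \<i> * complex_of_real (x \<bullet> \<xi>) = \<i> * complex_of_real (- (2 * pi * (\<xi> \<bullet> x)))"
      by (simp add: inner_commute)
    then have "exp (- 2 * complex_of_real pi * \<i> * complex_of_real (x \<bullet> \<xi>)) = cis (- (2 * pi * (\<xi> \<bullet> x)))"
      unfolding cis_conv_exp by (rule arg_cong)
    then show ?thesis by (simp only: wave_def cis_cnj)
  qed
  then show ?thesis by (simp add: fourier_L1_def)
qed

lemma wave_cnj_measurable: "(\<lambda>x. cnj (wave k x)) \<in> borel_measurable lebesgue"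
  using wave_measurable[of "-k"] by (simp add: wave_minus_left[abs_def])

lemma closed_subspace_orthogonal:
  fixes E :: "'k \<Rightarrow> real^'n \<Rightarrow> complex"
  assumes E: "\<And>k. k \<in> K \<Longrightarrow> E k \<in> L2"
  shows "closed_L2_subspace {u \<in> L2. \<forall>k\<in>K. L2_inner u (E k) = 0}"
  unfolding closed_L2_subspace_def
proof (intro conjI ballI allI subsetI)
  show "(\<lambda>x. 0) \<in> {u \<in> L2. \<forall>k\<in>K. L2_inner u (E k) = 0}"
    by (simp add: L2_inner_def)
next
  fix f g assume "f \<in> {u \<in> L2. \<forall>k\<in>K. L2_inner u (E k) = 0}" "g \<in> {u \<in> L2. \<forall>k\<in>K. L2_inner u (E k) = 0}"
  then show "(\<lambda>x. f x + g x) \<in> {u \<in> L2. \<forall>k\<in>K. L2_inner u (E k) = 0}"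
    using E by (simp add: L2_add L2_inner_add_left)
next
  fix c f assume "f \<in> {u \<in> L2. \<forall>k\<in>K. L2_inner u (E k) = 0}"
  then show "(\<lambda>x. c * f x) \<in> {u \<in> L2. \<forall>k\<in>K. L2_inner u (E k) = 0}"
    by (simp add: L2_cmult L2_inner_cmult_left)
next
  fix f assume "f \<in> L2_closure {u \<in> L2. \<forall>k\<in>K. L2_inner u (E k) = 0}"
  then obtain u where u: "\<And>n. u n \<in> {u \<in> L2. \<forall>k\<in>K. L2_inner u (E k) = 0}" "L2_tendsto u f"
    unfolding L2_closure_def by auto
  have "L2_inner f (E k) = 0" if "k \<in> K" for k
  proof -
    have "(\<lambda>n. L2_inner (u n) (E k)) \<longlonglongrightarrow> L2_inner f (E k)"
      by (rule L2_tendsto_inner[OF u(2) E[OF that]])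
    moreover have "L2_inner (u n) (E k) = 0" for n using u(1)[of n] that by simp
    ultimately show ?thesis by (simp add: LIMSEQ_const_iff)
  qed
  then show "f \<in> {u \<in> L2. \<forall>k\<in>K. L2_inner u (E k) = 0}"
    using L2_tendstoD(1)[OF u(2)] by simp
qed simp

definition cube_wave :: "real^'n \<Rightarrow> real^'n \<Rightarrow> complex" where
  "cube_wave k x = indicator unit_cube x * wave k x"

lemma cube_wave_L2: "cube_wave k \<in> L2"
proof -
  have "(indicator unit_cube :: real^'a \<Rightarrow> complex) \<in> L2"
    by (rule indicator_L2) (simp_all add: emeasure_unit_cube del: emeasure_completion)
  then have "(\<lambda>x. wave k x * indicator unit_cube x) \<in> L2"
    by (rule L2_mult_bounded[OF _ wave_measurable, of _ _ 1]) simp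
  then show ?thesis by (simp add: cube_wave_def[abs_def] mult.commute)
qed

lemma cube_wave_orthonormal:
  assumes "k \<in> int_lattice" "l \<in> int_lattice"
  shows "L2_inner (cube_wave k) (cube_wave l) = (if k = l then 1 else 0)"
proof -
  have "cube_wave k x * cnj (cube_wave l x) = indicator unit_cube x * wave (k - l) x" for x
    using wave_add_left[of k "-l" x] by (simp add: cube_wave_def indicator_def wave_minus_left)
  then have "L2_inner (cube_wave k) (cube_wave l) = (LINT x|lebesgue. indicator unit_cube x * wave (k - l) x)"
    by (simp add: L2_inner_def)
  then show ?thesis
    using integral_unit_cube_wave[OF int_lattice_diff[OF assms]] by simp
qed

text \<open>The functions orthogonal to all \<open>cube_wave k\<close> form a closed space that is invariant under integer modulations,
  so its members may be multiplied by periodic indicator functions before they are tested against \<open>cube_wave 0\<close>.\<close>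

lemma cube_wave_complete:
  fixes u :: "real^'n \<Rightarrow> complex"
  assumes u: "u \<in> L2" "\<And>k. k \<in> int_lattice \<Longrightarrow> L2_inner u (cube_wave k) = 0"
  shows "AE x in lebesgue. x \<in> unit_cube \<longrightarrow> u x = 0"
proof (rule L2_zero_test[OF u(1)])
  define Y where "Y = {u::real^'n \<Rightarrow> complex. u \<in> L2 \<and> (\<forall>k\<in>int_lattice. L2_inner u (cube_wave k) = 0)}"
  have Y: "closed_L2_subspace Y"
    using closed_subspace_orthogonal[of int_lattice cube_wave] unfolding Y_def by (simp add: cube_wave_L2)
  have inv: "(\<lambda>x. wave l x * v x) \<in> Y" if l: "l \<in> int_lattice" and v: "v \<in> Y" for l v
  proof -
    have "(\<lambda>x. wave l x * v x) \<in> L2"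
      using v by (intro L2_mult_bounded[OF _ wave_measurable, of _ _ 1]) (simp_all add: Y_def)
    moreover have "L2_inner (\<lambda>x. wave l x * v x) (cube_wave k) = 0" if k: "k \<in> int_lattice" for k
    proof -
      have "cnj (wave l x) * cube_wave k x = cube_wave (k - l) x" for x
        using wave_add_left[of k "-l" x] by (simp add: cube_wave_def wave_minus_left)
      then show ?thesis
        using v int_lattice_diff[OF k l] by (simp add: L2_inner_move Y_def)
    qed
    ultimately show ?thesis by (simp add: Y_def)
  qed
  have uY: "u \<in> Y" using u by (simp add: Y_def)
  fix F :: "(real^'n) set" assume F: "F \<in> sets lebesgue" "F \<subseteq> unit_cube"
  have "(\<lambda>x. indicator (periodic_hull F) x * u x) \<in> Y"
    by (rule multiplierD[OF multiplier_periodic_hull[OF Y inv F(1)] uY])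
  then have "L2_inner (\<lambda>x. indicator (periodic_hull F) x * u x) (cube_wave 0) = 0"
    by (simp add: Y_def)
  \<comment> \<open>Inside the cube the hull of \<open>F\<close> is \<open>F\<close> itself, because
    lattice representatives are unique. So testing against \<open>cube_wave 0\<close> amounts to
    testing against the indicator of \<open>F\<close>.\<close>
  moreover have "cnj (indicator (periodic_hull F) x) * cube_wave 0 x = indicator F x" for x
  proof -
    have "x \<in> F" if "x \<in> unit_cube" "x \<in> periodic_hull F"
    proof -
      obtain k where k: "k \<in> int_lattice" "x - k \<in> F" using \<open>x \<in> periodic_hull F\<close> by (auto simp: periodic_hull_def)
      then have "k = 0" using unit_cube_unique[of k 0 x] F(2) \<open>x \<in> unit_cube\<close> by auto
      then show ?thesis using k by simp
    qed
    moreover have "x \<in> periodic_hull F" if "x \<in> F"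
      using that by (auto simp: periodic_hull_def intro: bexI[of _ 0])
    ultimately show ?thesis using F(2) by (auto simp: indicator_def cube_wave_def)
  qed
  ultimately show "L2_inner u (indicator F) = 0"
    by (simp add: L2_inner_move)
qed (simp_all add: emeasure_unit_cube del: emeasure_completion)

text \<open>By Bessel the partial Fourier sums are Cauchy. Their limit has the same coefficients as
  \<open>h\<close>, so \<open>cube_wave_complete\<close> identifies the two on the cube, and both
  vanish outside.\<close>

lemma parseval_unit_cube:
  fixes h :: "real^'n \<Rightarrow> complex"
  assumes h: "h \<in> L2" and supp: "\<And>x. x \<notin> unit_cube \<Longrightarrow> h x = 0"
  shows "(\<lambda>n. (cmod (fourier_L1 h (lattice_enum n)))\<^sup>2) sums (L2_norm h)\<^sup>2"
proof -
  define E :: "nat \<Rightarrow> real^'n \<Rightarrow> complex" where "E n = cube_wave (lattice_enum n)" for n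
  define c where "c n = L2_inner h (E n)" for n
  define S where "S N x = (\<Sum>n<N. c n * E n x)" for N x
  define a where "a N = (\<Sum>n<N. (cmod (c n))\<^sup>2)" for N
  have EL: "E n \<in> L2" for n by (simp add: E_def cube_wave_L2)
  have cf: "c n = fourier_L1 h (lattice_enum n)" for n
  proof -
    have "h x * cnj (E n x) = h x * cnj (wave (lattice_enum n) x)" for x
      using supp[of x] by (cases "x \<in> unit_cube") (simp_all add: E_def cube_wave_def)
    then have "(\<lambda>x. h x * cnj (E n x)) = (\<lambda>x. h x * cnj (wave (lattice_enum n) x))" by (rule ext)
    then show ?thesis by (simp only: c_def L2_inner_def fourier_L1_wave)
  qed
  have ortho: "L2_inner (E m) (E n) = (if m = n then 1 else 0)" for m n
    by (simp add: E_def cube_wave_orthonormal)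
  have SL: "S N \<in> L2" for N unfolding S_def[abs_def] by (intro L2_sum L2_cmult EL)
  have SE: "L2_inner (S N) (E m) = (if m < N then c m else 0)" for N m
  proof -
    have "L2_inner (S N) (E m) = (\<Sum>n<N. c n * L2_inner (E n) (E m))"
      unfolding S_def[abs_def] by (subst L2_inner_sum_left) (simp_all add: EL L2_cmult L2_inner_cmult_left)
    also have "\<dots> = (\<Sum>n<N. if n = m then c m else 0)" by (intro sum.cong) (auto simp: ortho)
    finally show ?thesis by simp
  qed
  have gS: "L2_inner g (S N) = (\<Sum>n<N. cnj (c n) * L2_inner g (E n))" if g: "g \<in> L2" for g N
  proof -
    have "L2_inner (S N) g = (\<Sum>n<N. c n * L2_inner (E n) g)"
      unfolding S_def[abs_def] by (subst L2_inner_sum_left) (simp_all add: EL g L2_cmult L2_inner_cmult_left)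
    then show ?thesis by (subst L2_inner_commute) (simp add: L2_inner_commute[of "E _" g])
  qed
  have cc: "cnj (c n) * c n = complex_of_real ((cmod (c n))\<^sup>2)" for n
    by (simp only: complex_norm_square mult.commute)
  have hS: "L2_inner h (S N) = complex_of_real (a N)" for N
    unfolding gS[OF h] c_def[symmetric] cc a_def by simp
  have SS: "L2_inner (S M) (S N) = complex_of_real (a (min M N))" for M N
  proof -
    have "L2_inner (S M) (S N) = (\<Sum>n<N. if n < M then complex_of_real ((cmod (c n))\<^sup>2) else 0)"
      unfolding gS[OF SL] SE cc[symmetric] by (intro sum.cong) auto
    also have "\<dots> = (\<Sum>n\<in>{..<N} \<inter> {n. n < M}. complex_of_real ((cmod (c n))\<^sup>2))"
      by (subst sum.inter_restrict) (simp_all only: finite_lessThan mem_Collect_eq)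
    also have "{..<N} \<inter> {n. n < M} = {..<min M N}" by auto
    finally show ?thesis by (simp add: a_def)
  qed
  have nS: "(L2_norm (S N))\<^sup>2 = a N" for N
    using L2_inner_self[of "S N"] unfolding SS of_real_eq_iff by simp
  have amono: "a M \<le> a N" if "M \<le> N" for M N
    unfolding a_def using that by (intro sum_mono2) auto
  have bessel: "a N \<le> (L2_norm h)\<^sup>2" for N
  proof -
    have "0 \<le> (L2_norm (\<lambda>x. h x - S N x))\<^sup>2" by simp
    also have "\<dots> = (L2_norm h)\<^sup>2 - a N"
      unfolding L2_norm_diff_sq[OF h SL] hS nS by simp
    finally show ?thesis by simp
  qed
  have diff: "(L2_norm (\<lambda>x. S M x - S N x))\<^sup>2 = \<bar>a M - a N\<bar>" for M N
    unfolding L2_norm_diff_sq[OF SL SL] SS nS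
    using amono[of M N] amono[of N M] by (cases "M \<le> N") (auto simp: min_def)
  have "0 \<le> a N" for N by (simp add: a_def sum_nonneg)
  then have "norm (a N) \<le> (L2_norm h)\<^sup>2" for N using bessel by simp
  then have "Bseq a" by (rule BseqI')
  then have "convergent a" by (rule Bseq_monoseq_convergent) (rule monoI1, simp add: amono)
  then have "Cauchy a" by (rule convergent_Cauchy)
  obtain p where p: "L2_tendsto S p"
  proof (rule L2_complete[OF SL])
    fix e :: real assume e: "0 < e"
    then obtain N where N: "\<forall>m\<ge>N. \<forall>n\<ge>N. norm (a m - a n) < e\<^sup>2"
      using CauchyD[OF \<open>Cauchy a\<close>, of "e\<^sup>2"] by auto
    have "L2_norm (\<lambda>x. S m x - S n x) < e" if "m \<ge> N" "n \<ge> N" for m n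
    proof (rule power2_less_imp_less)
      show "(L2_norm (\<lambda>x. S m x - S n x))\<^sup>2 < e\<^sup>2"
        using N that unfolding diff by simp
    qed (use e in simp)
    then show "\<exists>N. \<forall>m\<ge>N. \<forall>n\<ge>N. L2_norm (\<lambda>x. S m x - S n x) < e" by blast
  qed
  note pL = L2_tendstoD(1)[OF p]
  have pE: "L2_inner p (E m) = c m" for m
  proof -
    have "(\<lambda>N. L2_inner (S N) (E m)) \<longlonglongrightarrow> L2_inner p (E m)" by (rule L2_tendsto_inner[OF p EL])
    moreover have "(\<lambda>N. L2_inner (S N) (E m)) \<longlonglongrightarrow> c m"
      unfolding SE by (intro tendsto_eventually eventually_sequentiallyI[of "Suc m"]) simp
    ultimately show ?thesis by (rule LIMSEQ_unique)
  qed
  have in_cube: "AE x in lebesgue. x \<in> unit_cube \<longrightarrow> h x - p x = 0"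
  proof (rule cube_wave_complete[OF L2_diff[OF h pL]])
    fix k :: "real^'n" assume "k \<in> int_lattice"
    then obtain m where "k = lattice_enum m" by (rule lattice_enum_obtain)
    then have "cube_wave k = E m" by (simp add: E_def)
    then show "L2_inner (\<lambda>x. h x - p x) (cube_wave k) = 0"
      using h pL EL by (simp add: L2_inner_diff_left pE c_def)
  qed
  have off_cube: "AE x in lebesgue. x \<notin> unit_cube \<longrightarrow> p x = 0"
  proof -
    have "L2_tendsto (\<lambda>n x. indicator (- unit_cube) x * S n x) (\<lambda>x. indicator (- unit_cube) x * p x)"
      using sets.compl_sets[OF unit_cube_lebesgue[where 'a='n]]
      by (intro L2_tendsto_mult_bounded[OF p, of _ 1] borel_measurable_indicator AE_I2)
        (simp_all add: indicator_def Compl_eq_Diff_UNIV)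
    moreover have "(\<lambda>x. indicator (- unit_cube) x * S n x) = (\<lambda>x. 0)" for n
      by (auto simp: fun_eq_iff indicator_def S_def E_def cube_wave_def)
    ultimately have "L2_tendsto (\<lambda>n x. 0) (\<lambda>x. indicator (- unit_cube) x * p x)" by simp
    from L2_tendsto_unique[OF this L2_tendsto_const[OF L2_zero]]
    show ?thesis by eventually_elim (auto simp: indicator_def)
  qed
  have "AE x in lebesgue. p x = h x"
    using in_cube off_cube by eventually_elim (auto simp: supp)
  then have "L2_norm p = L2_norm h" by (rule L2_norm_cong[OF pL])
  then have "(\<lambda>N. (L2_norm (S N))\<^sup>2) \<longlonglongrightarrow> (L2_norm h)\<^sup>2"
    using tendsto_power[OF L2_tendsto_norm[OF p], of 2] by simp
  then show ?thesis unfolding nS sums_def a_def cf .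
qed

lemma fourier_L1_translate:
  assumes "f \<in> borel_measurable lebesgue"
  shows "fourier_L1 (\<lambda>x. f (x + \<theta>)) \<xi> = wave \<xi> \<theta> * fourier_L1 f \<xi>"
proof -
  have m: "(\<lambda>x. f x * cnj (wave \<xi> (x - \<theta>))) \<in> borel_measurable lebesgue"
  proof -
    have "(\<lambda>x. f x * (wave \<xi> \<theta> * cnj (wave \<xi> x))) \<in> borel_measurable lebesgue"
      by (intro borel_measurable_times borel_measurable_const assms wave_cnj_measurable)
    moreover have "cnj (wave \<xi> (x - \<theta>)) = wave \<xi> \<theta> * cnj (wave \<xi> x)" for x
      using wave_add_right[of \<xi> x "-\<theta>"] by (simp add: wave_minus_right)
    ultimately show ?thesis by simp
  qed
  have "fourier_L1 (\<lambda>x. f (x + \<theta>)) \<xi> = (LINT x|lebesgue. f x * cnj (wave \<xi> (x - \<theta>)))"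
    using rescales_integral[OF rescales_translation m, of \<theta>] by (simp add: fourier_L1_wave)
  also have "\<dots> = (LINT x|lebesgue. wave \<xi> \<theta> * (f x * cnj (wave \<xi> x)))"
    using wave_add_right[of \<xi> _ "-\<theta>"] by (simp add: wave_minus_right mult_ac)
  finally show ?thesis by (simp add: fourier_L1_wave)
qed

lemma fourier_L1_modulate: "fourier_L1 (\<lambda>x. cnj (wave \<xi> x) * f x) \<eta> = fourier_L1 f (\<xi> + \<eta>)"
  by (simp add: fourier_L1_wave wave_add_left mult_ac)

lemma wave_mult_L2: "f \<in> L2 \<Longrightarrow> (\<lambda>x. wave k x * f x) \<in> L2"
  by (rule L2_mult_bounded[OF _ wave_measurable, of _ _ 1]) simp_all

lemma L2_norm_wave_mult: "L2_norm (\<lambda>x. wave k x * f x) = L2_norm f"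
  by (simp add: L2_norm_def norm_mult)

text \<open>A modulation moves the frequency lattice by \<xi>, and the translation by \<theta> costs
  only a unimodular factor. The free offset \<xi> is the variable over which
  \<open>plancherel_cube\<close> integrates.\<close>

lemma parseval_cube:
  fixes h :: "real^'n \<Rightarrow> complex"
  assumes h: "h \<in> L2" and supp: "\<And>x. x - \<theta> \<notin> unit_cube \<Longrightarrow> h x = 0"
  shows "(\<lambda>n. (cmod (fourier_L1 h (\<xi> + lattice_enum n)))\<^sup>2) sums (L2_norm h)\<^sup>2"
proof -
  define f where "f x = wave (- \<xi>) x * h x" for x
  have f: "f \<in> L2" unfolding f_def by (rule wave_mult_L2[OF h])
  have "(\<lambda>n. (cmod (fourier_L1 (\<lambda>x. f (x + \<theta>)) (lattice_enum n)))\<^sup>2) sums (L2_norm (\<lambda>x. f (x + \<theta>)))\<^sup>2"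
  proof (rule parseval_unit_cube[OF rescales_L2(1)[OF rescales_translation f]])
    fix x :: "real^'n" assume "x \<notin> unit_cube"
    then show "f (x + \<theta>) = 0" using supp[of "x + \<theta>"] by (simp add: f_def)
  qed
  moreover have "fourier_L1 (\<lambda>x. f (x + \<theta>)) \<eta> = wave \<eta> \<theta> * fourier_L1 h (\<xi> + \<eta>)" for \<eta>
  proof -
    have "fourier_L1 f \<eta> = fourier_L1 h (\<xi> + \<eta>)"
      using fourier_L1_modulate[of \<xi> h \<eta>] by (simp add: f_def[abs_def] wave_minus_left)
    then show ?thesis using fourier_L1_translate[OF L2_measurable[OF f]] by simp
  qed
  moreover have "(L2_norm (\<lambda>x. f (x + \<theta>)))\<^sup>2 = (L2_norm h)\<^sup>2"
    using rescales_L2_norm[OF rescales_translation f, of \<theta>] L2_norm_wave_mult[of "-\<xi>" h]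
    by (simp add: f_def[abs_def])
  ultimately show ?thesis by (simp add: norm_mult)
qed

lemma integrable_wave:
  assumes "integrable lebesgue f"
  shows "integrable lebesgue (\<lambda>x. f x * cnj (wave \<xi> x))"
proof (rule Bochner_Integration.integrable_bound[OF assms])
  show "(\<lambda>x. f x * cnj (wave \<xi> x)) \<in> borel_measurable lebesgue"
    by (intro borel_measurable_times borel_measurable_integrable assms wave_cnj_measurable)
qed (simp add: norm_mult)

lemma continuous_fourier_L1:
  fixes f :: "real^'n \<Rightarrow> complex"
  assumes f: "integrable lebesgue f"
  shows "continuous_on UNIV (fourier_L1 f)"
  unfolding continuous_on_sequentially
proof (intro allI ballI impI)
  fix x :: "nat \<Rightarrow> real^'n" and a assume x: "(\<forall>n. x n \<in> UNIV) \<and> x \<longlonglongrightarrow> a"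
  have w: "(\<lambda>n. wave (x n) y) \<longlonglongrightarrow> wave a y" for y
  proof -
    have "isCont (wave y) a"
      using continuous_wave[of UNIV y] by (simp add: continuous_on_eq_continuous_at)
    moreover have "x \<longlonglongrightarrow> a" using x by (rule conjunct2)
    ultimately have "(\<lambda>n. wave y (x n)) \<longlonglongrightarrow> wave y a" by (rule isCont_tendsto_compose)
    then show ?thesis unfolding wave_commute[of y] .
  qed
  have "(\<lambda>n. LINT y|lebesgue. f y * cnj (wave (x n) y)) \<longlonglongrightarrow> (LINT y|lebesgue. f y * cnj (wave a y))"
  proof (rule integral_dominated_convergence)
    show "integrable lebesgue (\<lambda>y. norm (f y))" using f by (rule integrable_norm)
    show "(\<lambda>y. f y * cnj (wave a y)) \<in> borel_measurable lebesgue"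
      "(\<lambda>y. f y * cnj (wave (x n) y)) \<in> borel_measurable lebesgue" for n
      by (intro borel_measurable_integrable integrable_wave f)+
    show "AE y in lebesgue. (\<lambda>n. f y * cnj (wave (x n) y)) \<longlonglongrightarrow> f y * cnj (wave a y)"
      by (intro AE_I2 tendsto_intros w)
    show "AE y in lebesgue. norm (f y * cnj (wave (x n) y)) \<le> norm (f y)" for n
      by (simp add: norm_mult)
  qed
  then show "(fourier_L1 f \<circ> x) \<longlonglongrightarrow> fourier_L1 f a" by (simp add: fourier_L1_wave o_def)
qed

lemma fourier_L1_measurable:
  "integrable lebesgue f \<Longrightarrow> fourier_L1 f \<in> borel_measurable lebesgue"
  by (intro measurable_completion) (simp add: borel_measurable_continuous_onI continuous_fourier_L1)

lemma L2_integrable_finite_support: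
  assumes h: "h \<in> L2" and S: "S \<in> sets lebesgue" "emeasure lebesgue S < \<infinity>" and supp: "\<And>x. x \<notin> S \<Longrightarrow> h x = 0"
  shows "integrable lebesgue h"
proof -
  have "(\<lambda>x. h x * cnj (indicator S x)) = h" using supp by (auto simp: fun_eq_iff indicator_def)
  then show ?thesis using L2_inner_integrable[OF h indicator_L2[OF S]] by simp
qed

text \<open>For every offset the sum of the squared transform over the shifted lattice is the same
  constant. Integrating it over a cube of volume 1 and unfolding by
  \<open>nn_integral_tiling\<close> gives the integral over the whole space.\<close>

lemma plancherel_cube:
  fixes h :: "real^'n \<Rightarrow> complex"
  assumes h: "h \<in> L2" and supp: "\<And>x. x - \<theta> \<notin> unit_cube \<Longrightarrow> h x = 0"
  shows "fourier_L1 h \<in> L2" "L2_norm (fourier_L1 h) = L2_norm h"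
proof -
  have eq: "(\<lambda>x. x + \<theta>) ` unit_cube = {x. x - \<theta> \<in> unit_cube}"
    by (auto intro: image_eqI[of _ _ "_ - \<theta>"])
  have "integrable lebesgue h"
  proof (rule L2_integrable_finite_support[OF h])
    show "(\<lambda>x. x + \<theta>) ` unit_cube \<in> sets lebesgue" "emeasure lebesgue ((\<lambda>x. x + \<theta>) ` unit_cube) < \<infinity>"
      using translation_sets_lebesgue[OF unit_cube_lebesgue, of \<theta>] by (simp_all add: emeasure_unit_cube del: emeasure_completion)
  qed (simp add: eq supp)
  then have m: "fourier_L1 h \<in> borel_measurable lebesgue" by (rule fourier_L1_measurable)
  have sum: "(\<Sum>n. ennreal ((cmod (fourier_L1 h (\<xi> + lattice_enum n)))\<^sup>2)) = ennreal ((L2_norm h)\<^sup>2)" for \<xi>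
    using parseval_cube[OF h supp] by (intro suminf_ennreal_eq) auto
  have "(\<integral>\<^sup>+\<xi>. ennreal ((cmod (fourier_L1 h \<xi>))\<^sup>2) \<partial>lebesgue)
      = (\<integral>\<^sup>+\<xi>. indicator unit_cube \<xi> * (\<Sum>n. ennreal ((cmod (fourier_L1 h (\<xi> + lattice_enum n)))\<^sup>2)) \<partial>lebesgue)"
    using m by (intro nn_integral_tiling) measurable
  also have "\<dots> = (\<integral>\<^sup>+\<xi>. ennreal ((L2_norm h)\<^sup>2) * indicator (unit_cube :: (real^'n) set) \<xi> \<partial>lebesgue)"
    unfolding sum by (simp add: mult.commute)
  also have "\<dots> = ennreal ((L2_norm h)\<^sup>2)"
    by (subst nn_integral_cmult_indicator) (simp_all add: emeasure_unit_cube del: emeasure_completion)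
  finally have *: "(\<integral>\<^sup>+\<xi>. ennreal ((cmod (fourier_L1 h \<xi>))\<^sup>2) \<partial>lebesgue) = ennreal ((L2_norm h)\<^sup>2)" .
  then show L: "fourier_L1 h \<in> L2" using m by (simp add: L2_iff_nn_integral)
  show "L2_norm (fourier_L1 h) = L2_norm h"
    using * unfolding nn_integral_L2_norm[OF L] by (simp add: power2_eq_iff_nonneg)
qed

text \<open>Under the substitution by \<open>L\<close> the phase pairs \<open>M' \<xi>\<close> with
  \<open>L x\<close>; moving \<open>M'\<close> to the other side as \<open>M\<close> cancels
  \<open>L\<close>.\<close>

lemma fourier_L1_linear:
  assumes L: "rescales L d" "\<And>x. M (L x) = x" and adj: "\<And>\<xi> x. M' \<xi> \<bullet> x = \<xi> \<bullet> M x"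
    and f: "integrable lebesgue f"
  shows "fourier_L1 f (M' \<xi>) = complex_of_real d * fourier_L1 (\<lambda>x. f (L x)) \<xi>"
proof -
  have w: "wave (M' \<xi>) x = wave \<xi> (M x)" for x by (simp add: wave_def adj)
  have "fourier_L1 f (M' \<xi>) = d *\<^sub>R (LINT x|lebesgue. f (L x) * cnj (wave (M' \<xi>) (L x)))"
    unfolding fourier_L1_wave
    by (rule rescales_integral[OF L(1)]) (intro borel_measurable_integrable integrable_wave f)
  then show ?thesis by (simp add: w L(2) fourier_L1_wave scaleR_conv_of_real)
qed

text \<open>Contracting by \<open>2 * real (Suc N)\<close> makes this a translate of
  \<open>unit_cube\<close>; \<open>Suc\<close> keeps the factor nonzero for
  \<open>N = 0\<close>.\<close>

definition big_cube :: "nat \<Rightarrow> (real^'n) set" where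
  "big_cube N = {x. \<forall>i. - real (Suc N) \<le> x $ i \<and> x $ i < real (Suc N)}"

lemma big_cube_scaled:
  "x \<in> big_cube N \<longleftrightarrow> (1 / (2 * real (Suc N))) *\<^sub>R x - (\<chi> i. - 1/2) \<in> unit_cube"
proof -
  have c: "0 < 2 * real (Suc N)" by simp
  have "- real (Suc N) \<le> t \<longleftrightarrow> 0 \<le> 1 / (2 * real (Suc N)) * t - - 1/2"
    "t < real (Suc N) \<longleftrightarrow> 1 / (2 * real (Suc N)) * t - - 1/2 < 1" for t
    using c by (auto simp: field_simps)
  then show ?thesis by (simp add: big_cube_def unit_cube_def del: of_nat_Suc)
qed

lemma big_cube_sets [simp]: "(big_cube N :: (real^'n) set) \<in> sets lebesgue"
proof -
  have "(\<lambda>x::real^'n. (1 / (2 * real (Suc N))) *\<^sub>R x - (\<chi> i. - 1/2)) \<in> borel \<rightarrow>\<^sub>M borel"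
    by (intro borel_measurable_continuous_onI continuous_intros)
  from measurable_sets[OF this unit_cube_sets] have "(big_cube N :: (real^'n) set) \<in> sets borel"
    unfolding vimage_def big_cube_scaled[symmetric] by simp
  then show ?thesis by simp
qed

lemma bounded_big_cube: "bounded (big_cube N)"
proof -
  have "big_cube N \<subseteq> cbox (\<chi> i. - real (Suc N)) (\<chi> i. real (Suc N))"
    by (auto simp: big_cube_def mem_box_cart less_imp_le)
  then show ?thesis using bounded_cbox bounded_subset by blast
qed

lemma emeasure_bounded_lebesgue:
  fixes S :: "(real^'n) set"
  assumes "bounded S" "S \<in> sets lebesgue"
  shows "emeasure lebesgue S < \<infinity>"
  using bounded_set_imp_lmeasurable[OF assms] by (simp add: fmeasurable_def del: emeasure_completion)

lemma eventually_big_cube: "\<forall>\<^sub>F N in sequentially. x \<in> big_cube N"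
proof -
  obtain K :: nat where K: "norm x < real K" using reals_Archimedean2 by blast
  show ?thesis
  proof (rule eventually_sequentiallyI[of K])
    fix N assume "K \<le> N"
    then have "\<bar>x $ i\<bar> < real (Suc N)" for i
      using component_le_norm_cart[of x i] K by simp
    then have "- real (Suc N) \<le> x $ i \<and> x $ i < real (Suc N)" for i
      by (smt (verit) abs_less_iff)
    then show "x \<in> big_cube N" by (simp add: big_cube_def)
  qed
qed

text \<open>With \<open>g = f o S\<close> the transform of \<open>f\<close> is \<open>d\<close>
  times that of \<open>g\<close> composed with \<open>S\<close>. The factor \<open>d\<close> enters
  squared, composition with \<open>S\<close> divides it out once, and what remains is the factor
  between the squared norms of \<open>f\<close> and \<open>g\<close>.\<close>

lemma plancherel_big_cube:
  fixes f :: "real^'n \<Rightarrow> complex"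
  assumes f: "f \<in> L2" and supp: "\<And>x. x \<notin> big_cube N \<Longrightarrow> f x = 0"
  shows "fourier_L1 f \<in> L2" "L2_norm (fourier_L1 f) = L2_norm f"
proof -
  define c where "c = 2 * real (Suc N)"
  have c: "0 < c" by (simp add: c_def)
  define S T where "S x = c *\<^sub>R x" and "T x = (1 / c) *\<^sub>R x" for x :: "real^'n"
  have ST: "S (T x) = x" "T (S x) = x" for x using c by (simp_all add: S_def T_def)
  have lin: "linear S" "linear T" unfolding S_def T_def by (intro linear_scaleR linearI; simp add: algebra_simps)+
  obtain d where d: "rescales S d" using rescales_linear[OF lin ST] .
  have d0: "0 < d" by (rule rescales_pos[OF d])
  define g where "g x = f (S x)" for x
  have g: "g \<in> L2" and gn: "(L2_norm f)\<^sup>2 = d * (L2_norm g)\<^sup>2"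
    unfolding g_def using rescales_L2[OF d f] rescales_L2_norm[OF d f] by auto
  have "g x = 0" if "x - (\<chi> i. - 1/2) \<notin> unit_cube" for x
  proof -
    have "S x \<notin> big_cube N" using that ST(2)[of x] unfolding big_cube_scaled T_def c_def by simp
    then show ?thesis unfolding g_def by (rule supp)
  qed
  note P = plancherel_cube[OF g this]
  have int: "integrable lebesgue f"
    by (rule L2_integrable_finite_support[OF f big_cube_sets emeasure_bounded_lebesgue[OF bounded_big_cube big_cube_sets] supp])
  have F: "fourier_L1 f (T \<xi>) = complex_of_real d * fourier_L1 g \<xi>" for \<xi>
    unfolding g_def by (rule fourier_L1_linear[OF d ST(2) _ int]) (simp add: T_def)
  have eq: "fourier_L1 f = (\<lambda>\<xi>. complex_of_real d * fourier_L1 g (S \<xi>))"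
  proof
    fix \<xi> show "fourier_L1 f \<xi> = complex_of_real d * fourier_L1 g (S \<xi>)"
      using F[of "S \<xi>"] by (simp add: ST)
  qed
  show "fourier_L1 f \<in> L2" unfolding eq by (intro L2_cmult rescales_L2[OF d P(1)])
  have "d * (L2_norm (\<lambda>\<xi>. fourier_L1 g (S \<xi>)))\<^sup>2 = (L2_norm g)\<^sup>2"
    using rescales_L2_norm[OF d P(1)] P(2) by simp
  then have "(L2_norm (fourier_L1 f))\<^sup>2 = d * (L2_norm g)\<^sup>2"
    unfolding eq L2_norm_cmult using d0 by (simp add: power_mult_distrib power2_eq_square mult_ac)
  then have "(L2_norm (fourier_L1 f))\<^sup>2 = (L2_norm f)\<^sup>2" using gn by simp
  then show "L2_norm (fourier_L1 f) = L2_norm f" by (simp add: power2_eq_iff_nonneg)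
qed

lemma norm_indicator_le_1: "cmod (indicator F x) \<le> 1"
  by (simp add: indicator_def)

text \<open>Truncations are integrable as well as square integrable, so they supply the
  approximating sequences that the defining property of \<open>fourier\<close> asks for.\<close>

definition cut :: "nat \<Rightarrow> (real^'n \<Rightarrow> complex) \<Rightarrow> real^'n \<Rightarrow> complex" where
  "cut N f x = indicator (big_cube N) x * f x"

lemma cut_L2: "f \<in> L2 \<Longrightarrow> cut N f \<in> L2"
  unfolding cut_def[abs_def]
  by (rule L2_mult_bounded[of _ _ 1]) (simp_all add: norm_indicator_le_1 borel_measurable_indicator)

lemma cut_integrable:
  assumes "f \<in> L2"
  shows "integrable lebesgue (cut N f)"
  by (rule L2_integrable_finite_support[OF cut_L2[OF assms] big_cube_sets
      emeasure_bounded_lebesgue[OF bounded_big_cube big_cube_sets], of N]) (simp add: cut_def)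

lemma indicator_big_cube_lim: "(\<lambda>N. indicator (big_cube N) x :: complex) \<longlonglongrightarrow> 1"
proof (rule tendsto_eventually)
  show "\<forall>\<^sub>F N in sequentially. indicator (big_cube N) x = (1::complex)"
    using eventually_big_cube[of x] by (rule eventually_mono) simp
qed

lemma L2_tendsto_cut:
  assumes "f \<in> L2"
  shows "L2_tendsto (\<lambda>N. cut N f) f"
proof -
  have "L2_tendsto (\<lambda>N x. indicator (big_cube N) x * f x) (\<lambda>x. 1 * f x)"
    by (rule L2_dominated_convergence[OF assms, where C=1])
      (simp_all add: norm_indicator_le_1 indicator_big_cube_lim borel_measurable_indicator)
  then show ?thesis by (simp add: cut_def[abs_def])
qed

lemma fourier_L1_diff:
  assumes "integrable lebesgue f" "integrable lebesgue g"
  shows "fourier_L1 (\<lambda>x. f x - g x) = (\<lambda>\<xi>. fourier_L1 f \<xi> - fourier_L1 g \<xi>)"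
  using integrable_wave[OF assms(1)] integrable_wave[OF assms(2)]
  by (simp add: fun_eq_iff fourier_L1_wave left_diff_distrib)

lemma fourier_L1_add:
  assumes "integrable lebesgue f" "integrable lebesgue g"
  shows "fourier_L1 (\<lambda>x. f x + g x) = (\<lambda>\<xi>. fourier_L1 f \<xi> + fourier_L1 g \<xi>)"
  using integrable_wave[OF assms(1)] integrable_wave[OF assms(2)]
  by (simp add: fun_eq_iff fourier_L1_wave distrib_right)

lemma fourier_L1_cmult: "fourier_L1 (\<lambda>x. c * f x) = (\<lambda>\<xi>. c * fourier_L1 f \<xi>)"
  by (simp add: fun_eq_iff fourier_L1_wave mult.assoc)

text \<open>The transforms of the truncations converge pointwise by dominated convergence. Fatou
  then yields square integrability, but only an inequality of norms.\<close>

lemma plancherel_L1_le: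
  assumes f: "f \<in> L2" "integrable lebesgue f"
  shows "fourier_L1 f \<in> L2" "L2_norm (fourier_L1 f) \<le> L2_norm f"
proof -
  have P: "fourier_L1 (cut N f) \<in> L2" "L2_norm (fourier_L1 (cut N f)) = L2_norm (cut N f)" for N
    by (rule plancherel_big_cube[OF cut_L2[OF f(1)], where N=N]; simp add: cut_def)+
  have le: "L2_norm (cut N f) \<le> L2_norm f" for N
    unfolding L2_norm_def cut_def
    by (intro real_sqrt_le_mono integral_mono L2_integrable f(1) L2_integrable[OF cut_L2[OF f(1), unfolded cut_def[abs_def]]])
      (simp add: indicator_def)
  have lim: "AE \<xi> in lebesgue. (\<lambda>N. fourier_L1 (cut N f) \<xi>) \<longlonglongrightarrow> fourier_L1 f \<xi>"
  proof (rule AE_I2)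
    fix \<xi>
    have "(\<lambda>N. LINT x|lebesgue. cut N f x * cnj (wave \<xi> x)) \<longlonglongrightarrow> (LINT x|lebesgue. f x * cnj (wave \<xi> x))"
    proof (rule integral_dominated_convergence)
      show "integrable lebesgue (\<lambda>y. norm (f y))" using f(2) by (rule integrable_norm)
      show "(\<lambda>y. f y * cnj (wave \<xi> y)) \<in> borel_measurable lebesgue"
        "(\<lambda>y. cut N f y * cnj (wave \<xi> y)) \<in> borel_measurable lebesgue" for N
        by (intro borel_measurable_integrable integrable_wave f(2) cut_integrable[OF f(1)])+
      show "AE x in lebesgue. (\<lambda>N. cut N f x * cnj (wave \<xi> x)) \<longlonglongrightarrow> f x * cnj (wave \<xi> x)"
      proof (rule AE_I2)
        fix x
        have "(\<lambda>N. indicator (big_cube N) x * f x * cnj (wave \<xi> x)) \<longlonglongrightarrow> 1 * f x * cnj (wave \<xi> x)"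
          by (intro tendsto_intros indicator_big_cube_lim)
        then show "(\<lambda>N. cut N f x * cnj (wave \<xi> x)) \<longlonglongrightarrow> f x * cnj (wave \<xi> x)" by (simp add: cut_def)
      qed
      show "AE x in lebesgue. norm (cut N f x * cnj (wave \<xi> x)) \<le> norm (f x)" for N
        by (simp add: cut_def norm_mult indicator_def)
    qed
    then show "(\<lambda>N. fourier_L1 (cut N f) \<xi>) \<longlonglongrightarrow> fourier_L1 f \<xi>" by (simp add: fourier_L1_wave)
  qed
  have "\<forall>\<^sub>F N in sequentially. L2_norm (fourier_L1 (cut N f)) \<le> L2_norm f"
    by (intro always_eventually allI) (simp add: P le)
  from L2_Fatou[OF P(1) fourier_L1_measurable[OF f(2)] lim this]
  show "fourier_L1 f \<in> L2" "L2_norm (fourier_L1 f) \<le> L2_norm f" by simp_all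
qed

text \<open>Applied to the difference of a truncation and \<open>f\<close>, the inequality becomes
  convergence in norm, and the exact equality for truncations passes to the limit.\<close>

theorem plancherel_L1:
  assumes f: "f \<in> L2" "integrable lebesgue f"
  shows "L2_norm (fourier_L1 f) = L2_norm f"
proof -
  have P: "fourier_L1 (cut N f) \<in> L2" "L2_norm (fourier_L1 (cut N f)) = L2_norm (cut N f)" for N
    by (rule plancherel_big_cube[OF cut_L2[OF f(1)], where N=N]; simp add: cut_def)+
  have "L2_tendsto (\<lambda>N. fourier_L1 (cut N f)) (fourier_L1 f)"
  proof (rule L2_tendsto_bound[OF P(1) plancherel_L1_le(1)[OF f]])
    show "(\<lambda>N. L2_norm (\<lambda>x. cut N f x - f x)) \<longlonglongrightarrow> 0"
      by (rule L2_tendstoD(3)[OF L2_tendsto_cut[OF f(1)]])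
    fix N
    have "L2_norm (fourier_L1 (\<lambda>x. cut N f x - f x)) \<le> L2_norm (\<lambda>x. cut N f x - f x)"
      by (intro plancherel_L1_le L2_diff cut_L2 f Bochner_Integration.integrable_diff cut_integrable)
    then show "L2_norm (\<lambda>x. fourier_L1 (cut N f) x - fourier_L1 f x) \<le> L2_norm (\<lambda>x. cut N f x - f x)"
      by (simp add: fourier_L1_diff[OF cut_integrable[OF f(1)] f(2)])
  qed
  from L2_tendsto_norm[OF this] have "(\<lambda>N. L2_norm (cut N f)) \<longlonglongrightarrow> L2_norm (fourier_L1 f)"
    by (simp add: P)
  then show ?thesis
    using L2_tendsto_norm[OF L2_tendsto_cut[OF f(1)]] by (rule LIMSEQ_unique)
qed

text \<open>The limit of the transforms of the truncations is a witness for the choice in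
  \<open>fourier\<close>. Any other integrable approximating sequence differs from the truncations
  by a null sequence in norm, and so do the transforms.\<close>

lemma fourier_spec:
  fixes f :: "real^'n \<Rightarrow> complex"
  assumes f: "f \<in> L2"
  shows "fourier f \<in> L2 \<and> (\<forall>u. (\<forall>n. integrable lebesgue (u n)) \<and> L2_tendsto u f \<longrightarrow>
     L2_tendsto (\<lambda>n. fourier_L1 (u n)) (fourier f))"
proof -
  let ?F = "\<lambda>n. fourier_L1 (cut n f)"
  have iso: "(\<lambda>x. fourier_L1 v x - fourier_L1 w x) \<in> L2"
      "L2_norm (\<lambda>x. fourier_L1 v x - fourier_L1 w x) = L2_norm (\<lambda>x. v x - w x)"
    if "v \<in> L2" "w \<in> L2" "integrable lebesgue v" "integrable lebesgue w" for v w
  proof -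
    have d: "(\<lambda>x. v x - w x) \<in> L2" "integrable lebesgue (\<lambda>x. v x - w x)"
      by (intro L2_diff that Bochner_Integration.integrable_diff)+
    show "(\<lambda>x. fourier_L1 v x - fourier_L1 w x) \<in> L2"
      "L2_norm (\<lambda>x. fourier_L1 v x - fourier_L1 w x) = L2_norm (\<lambda>x. v x - w x)"
      using plancherel_L1_le(1)[OF d] plancherel_L1[OF d] by (simp_all add: fourier_L1_diff that)
  qed
  have FL: "?F n \<in> L2" for n
    by (rule plancherel_L1_le(1)[OF cut_L2[OF f] cut_integrable[OF f]])
  obtain g where g: "L2_tendsto ?F g"
  proof (rule L2_complete[OF FL])
    fix e :: real assume "0 < e"
    from L2_tendsto_Cauchy[OF L2_tendsto_cut[OF f] this]
    show "\<exists>N. \<forall>m\<ge>N. \<forall>n\<ge>N. L2_norm (\<lambda>x. ?F m x - ?F n x) < e"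
      by (simp add: iso cut_L2[OF f] cut_integrable[OF f])
  qed
  have "L2_tendsto (\<lambda>n. fourier_L1 (u n)) g"
    if int: "\<And>n. integrable lebesgue (u n)" and u: "L2_tendsto u f" for u
  proof -
    note uL = L2_tendstoD(2)[OF u]
    have "L2_tendsto (\<lambda>n x. u n x - cut n f x) (\<lambda>x. f x - f x)"
      by (rule L2_tendsto_diff[OF u L2_tendsto_cut[OF f]])
    from L2_tendstoD(3)[OF this] have lim: "(\<lambda>n. L2_norm (\<lambda>x. u n x - cut n f x)) \<longlonglongrightarrow> 0" by simp
    have "L2_tendsto (\<lambda>n x. fourier_L1 (u n) x - ?F n x) (\<lambda>x. 0)"
      by (rule L2_tendsto_bound[OF _ L2_zero _ lim])
        (simp_all add: iso uL int cut_L2[OF f] cut_integrable[OF f])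
    from L2_tendsto_add[OF this g] show ?thesis by simp
  qed
  then have ex: "\<exists>g. g \<in> L2 \<and> (\<forall>u. (\<forall>n. integrable lebesgue (u n)) \<and> L2_tendsto u f \<longrightarrow>
     L2_tendsto (\<lambda>n. fourier_L1 (u n)) g)"
    using L2_tendstoD(1)[OF g] by (intro exI[of _ g]) simp
  show ?thesis unfolding fourier_def by (rule someI_ex[OF ex])
qed

lemma fourier_L2: "f \<in> L2 \<Longrightarrow> fourier f \<in> L2"
  using fourier_spec[of f] by (rule conjunct1)

lemma fourier_limit:
  assumes "L2_tendsto u f" "\<And>n. integrable lebesgue (u n)"
  shows "L2_tendsto (\<lambda>n. fourier_L1 (u n)) (fourier f)"
  using conjunct2[OF fourier_spec[OF L2_tendstoD(1)[OF assms(1)]]] assms by simp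

lemma fourier_limit_cut: "f \<in> L2 \<Longrightarrow> L2_tendsto (\<lambda>n. fourier_L1 (cut n f)) (fourier f)"
  by (intro fourier_limit L2_tendsto_cut cut_integrable)

lemma fourier_eqI:
  assumes "L2_tendsto u f" "\<And>n. integrable lebesgue (u n)" "L2_tendsto (\<lambda>n. fourier_L1 (u n)) g"
  shows "AE \<xi> in lebesgue. fourier f \<xi> = g \<xi>"
  by (rule L2_tendsto_unique[OF fourier_limit[OF assms(1,2)] assms(3)])

lemma fourier_eq_L1:
  assumes "f \<in> L2" "integrable lebesgue f"
  shows "AE \<xi> in lebesgue. fourier f \<xi> = fourier_L1 f \<xi>"
  by (rule fourier_eqI[OF L2_tendsto_const[OF assms(1)] assms(2)])
    (rule L2_tendsto_const[OF plancherel_L1_le(1)[OF assms]])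

theorem fourier_norm:
  assumes "f \<in> L2"
  shows "L2_norm (fourier f) = L2_norm f"
proof -
  have "(\<lambda>n. L2_norm (cut n f)) \<longlonglongrightarrow> L2_norm (fourier f)"
    using L2_tendsto_norm[OF fourier_limit_cut[OF assms]]
    by (simp add: plancherel_L1[OF cut_L2[OF assms] cut_integrable[OF assms]])
  then show ?thesis
    using L2_tendsto_norm[OF L2_tendsto_cut[OF assms]] by (rule LIMSEQ_unique)
qed

section \<open>Rules for the transform on \<open>L2\<close>\<close>

lemma fourier_cong:
  assumes "f \<in> L2" "AE x in lebesgue. f x = g x"
  shows "AE \<xi> in lebesgue. fourier f \<xi> = fourier g \<xi>"
proof -
  have "L2_tendsto (\<lambda>n. cut n f) g"
    using L2_tendsto_cong[OF L2_tendsto_cut[OF assms(1)] _ assms(2)] by simp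
  then show ?thesis
    by (intro fourier_eqI[OF L2_tendsto_cut[OF assms(1)] cut_integrable[OF assms(1)]] fourier_limit
      cut_integrable[OF assms(1)])
qed

lemma fourier_add:
  assumes "f \<in> L2" "g \<in> L2"
  shows "AE \<xi> in lebesgue. fourier (\<lambda>x. f x + g x) \<xi> = fourier f \<xi> + fourier g \<xi>"
proof (rule fourier_eqI)
  show "L2_tendsto (\<lambda>n x. cut n f x + cut n g x) (\<lambda>x. f x + g x)"
    by (intro L2_tendsto_add L2_tendsto_cut assms)
  show "integrable lebesgue (\<lambda>x. cut n f x + cut n g x)" for n
    by (intro Bochner_Integration.integrable_add cut_integrable assms)
  show "L2_tendsto (\<lambda>n. fourier_L1 (\<lambda>x. cut n f x + cut n g x)) (\<lambda>\<xi>. fourier f \<xi> + fourier g \<xi>)"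
    unfolding fourier_L1_add[OF cut_integrable[OF assms(1)] cut_integrable[OF assms(2)]]
    by (intro L2_tendsto_add fourier_limit_cut assms)
qed

lemma fourier_diff:
  assumes "f \<in> L2" "g \<in> L2"
  shows "AE \<xi> in lebesgue. fourier (\<lambda>x. f x - g x) \<xi> = fourier f \<xi> - fourier g \<xi>"
proof (rule fourier_eqI)
  show "L2_tendsto (\<lambda>n x. cut n f x - cut n g x) (\<lambda>x. f x - g x)"
    by (intro L2_tendsto_diff L2_tendsto_cut assms)
  show "integrable lebesgue (\<lambda>x. cut n f x - cut n g x)" for n
    by (intro Bochner_Integration.integrable_diff cut_integrable assms)
  show "L2_tendsto (\<lambda>n. fourier_L1 (\<lambda>x. cut n f x - cut n g x)) (\<lambda>\<xi>. fourier f \<xi> - fourier g \<xi>)"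
    unfolding fourier_L1_diff[OF cut_integrable[OF assms(1)] cut_integrable[OF assms(2)]]
    by (intro L2_tendsto_diff fourier_limit_cut assms)
qed

lemma fourier_cmult:
  assumes "f \<in> L2"
  shows "AE \<xi> in lebesgue. fourier (\<lambda>x. c * f x) \<xi> = c * fourier f \<xi>"
proof (rule fourier_eqI)
  show "L2_tendsto (\<lambda>n x. c * cut n f x) (\<lambda>x. c * f x)"
    by (intro L2_tendsto_cmult L2_tendsto_cut assms)
  show "integrable lebesgue (\<lambda>x. c * cut n f x)" for n
    by (intro integrable_mult_right cut_integrable assms)
  show "L2_tendsto (\<lambda>n. fourier_L1 (\<lambda>x. c * cut n f x)) (\<lambda>\<xi>. c * fourier f \<xi>)"
    unfolding fourier_L1_cmult by (intro L2_tendsto_cmult fourier_limit_cut assms)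
qed

lemma fourier_dist:
  assumes "f \<in> L2" "g \<in> L2"
  shows "L2_norm (\<lambda>\<xi>. fourier f \<xi> - fourier g \<xi>) = L2_norm (\<lambda>x. f x - g x)"
  using L2_norm_cong[OF fourier_L2[OF L2_diff[OF assms]] fourier_diff[OF assms]]
    fourier_norm[OF L2_diff[OF assms]] by simp

lemma fourier_tendsto:
  assumes "L2_tendsto u f"
  shows "L2_tendsto (\<lambda>n. fourier (u n)) (fourier f)"
  using L2_tendstoD[OF assms] by (simp add: L2_tendsto_def fourier_L2 fourier_dist)

text \<open>Polarisation: preserved distances determine the real part of the inner product, and the
  same applied to \<open>\<i> * g\<close> gives the imaginary part.\<close>

lemma fourier_inner:
  assumes f: "f \<in> L2" and g: "g \<in> L2"
  shows "L2_inner (fourier f) (fourier g) = L2_inner f g"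
proof -
  have re: "Re (L2_inner (fourier f) (fourier h)) = Re (L2_inner f h)" if h: "h \<in> L2" for h
  proof -
    have "L2_norm (\<lambda>\<xi>. fourier f \<xi> - fourier h \<xi>) = L2_norm (\<lambda>x. f x - h x)"
      by (rule fourier_dist[OF f h])
    then have "(L2_norm (\<lambda>\<xi>. fourier f \<xi> - fourier h \<xi>))\<^sup>2 = (L2_norm (\<lambda>x. f x - h x))\<^sup>2" by simp
    then show ?thesis
      unfolding L2_norm_diff_sq[OF f h] L2_norm_diff_sq[OF fourier_L2[OF f] fourier_L2[OF h]]
        fourier_norm[OF f] fourier_norm[OF h] by simp
  qed
  have "L2_inner (fourier f) (fourier (\<lambda>x. \<i> * g x)) = L2_inner (fourier f) (\<lambda>\<xi>. \<i> * fourier g \<xi>)"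
    by (rule L2_inner_cong[OF fourier_L2[OF f] fourier_L2[OF L2_cmult[OF g]] _ fourier_cmult[OF g]]) simp
  then have "Im (L2_inner (fourier f) (fourier g)) = Im (L2_inner f g)"
    using re[OF L2_cmult[OF g, of \<i>]] by (simp add: L2_inner_cmult_right)
  then show ?thesis using re[OF g] by (simp add: complex_eq_iff)
qed

lemma shift_L2: "f \<in> L2 \<Longrightarrow> shift k f \<in> L2"
  using rescales_L2(1)[OF rescales_translation[of "-k"], of f] by (simp add: shift_def)

lemma L2_tendsto_rescale:
  assumes "rescales T d" "L2_tendsto u f"
  shows "L2_tendsto (\<lambda>n x. u n (T x)) (\<lambda>x. f (T x))"
proof -
  note L = L2_tendstoD[OF assms(2)] and d = rescales_pos[OF assms(1)]
  have eq: "L2_norm (\<lambda>x. u n (T x) - f (T x)) = sqrt (1 / d) * L2_norm (\<lambda>x. u n x - f x)" for n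
  proof -
    have "(L2_norm (\<lambda>x. u n (T x) - f (T x)))\<^sup>2 = (1 / d) * (L2_norm (\<lambda>x. u n x - f x))\<^sup>2"
      using rescales_L2_norm[OF assms(1) L2_diff[OF L(2)[of n] L(1)]] d by simp
    also have "\<dots> = (sqrt (1 / d) * L2_norm (\<lambda>x. u n x - f x))\<^sup>2"
      using d by (simp add: power_mult_distrib)
    finally show ?thesis using d by (simp add: power2_eq_iff_nonneg)
  qed
  show ?thesis
    unfolding L2_tendsto_def eq
    using rescales_L2(1)[OF assms(1)] L tendsto_mult_left[OF L(3), of "sqrt (1 / d)"] by simp
qed

lemma fourier_shift:
  assumes "f \<in> L2"
  shows "AE \<xi> in lebesgue. fourier (shift k f) \<xi> = cnj (wave k \<xi>) * fourier f \<xi>"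
proof (rule fourier_eqI)
  show "L2_tendsto (\<lambda>n x. cut n f (x + - k)) (shift k f)"
    using L2_tendsto_rescale[OF rescales_translation[of "-k"] L2_tendsto_cut[OF assms]]
    by (simp add: shift_def)
  show "integrable lebesgue (\<lambda>x. cut n f (x + - k))" for n
    using rescales_integrable[OF rescales_translation[of "-k"] borel_measurable_integrable[OF cut_integrable[OF assms, of n]]]
      cut_integrable[OF assms, of n] by simp
  have "fourier_L1 (\<lambda>x. cut n f (x + - k)) = (\<lambda>\<xi>. cnj (wave k \<xi>) * fourier_L1 (cut n f) \<xi>)" for n
    using fourier_L1_translate[OF borel_measurable_integrable[OF cut_integrable[OF assms, of n]], of "-k"]
    by (simp add: fun_eq_iff wave_minus_right wave_commute[of _ k])
  then show "L2_tendsto (\<lambda>n. fourier_L1 (\<lambda>x. cut n f (x + - k))) (\<lambda>\<xi>. cnj (wave k \<xi>) * fourier f \<xi>)"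
    using L2_tendsto_mult_bounded[OF fourier_limit_cut[OF assms] wave_cnj_measurable, of k 1] by simp
qed

lemma fourier_linear:
  assumes L: "rescales L d" "\<And>x. M (L x) = x" and adj: "\<And>\<xi> x. M' \<xi> \<bullet> x = \<xi> \<bullet> M x"
    and M': "rescales M' e" and f: "f \<in> L2"
  shows "AE \<xi> in lebesgue. fourier f (M' \<xi>) = complex_of_real d * fourier (\<lambda>x. f (L x)) \<xi>"
proof (rule L2_tendsto_unique)
  show "L2_tendsto (\<lambda>n \<xi>. fourier_L1 (cut n f) (M' \<xi>)) (\<lambda>\<xi>. fourier f (M' \<xi>))"
    by (rule L2_tendsto_rescale[OF M' fourier_limit_cut[OF f]])
  have "L2_tendsto (\<lambda>n. fourier_L1 (\<lambda>x. cut n f (L x))) (fourier (\<lambda>x. f (L x)))"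
    by (intro fourier_limit L2_tendsto_rescale[OF L(1)] L2_tendsto_cut[OF f])
      (simp add: rescales_integrable[OF L(1) borel_measurable_integrable[OF cut_integrable[OF f]]] cut_integrable[OF f])
  from L2_tendsto_cmult[OF this, of "complex_of_real d"]
  show "L2_tendsto (\<lambda>n \<xi>. fourier_L1 (cut n f) (M' \<xi>)) (\<lambda>\<xi>. complex_of_real d * fourier (\<lambda>x. f (L x)) \<xi>)"
    by (simp add: fourier_L1_linear[OF L adj cut_integrable[OF f]])
qed

section \<open>The image of a space under the Fourier transform\<close>

text \<open>Saturated under almost everywhere equality, since \<open>fourier f\<close> is one chosen
  representative and the pointwise image would not be a subspace.\<close>

definition hat :: "(real^'n \<Rightarrow> complex) set \<Rightarrow> (real^'n \<Rightarrow> complex) set" where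
  "hat S = {g \<in> L2. \<exists>f\<in>S. AE x in lebesgue. fourier f x = g x}"

lemma hatI: "f \<in> S \<Longrightarrow> f \<in> L2 \<Longrightarrow> AE x in lebesgue. fourier f x = g x \<Longrightarrow> g \<in> hat S"
  unfolding hat_def using L2_cong_AE[OF fourier_L2] by blast

lemma hatE:
  assumes "g \<in> hat S"
  obtains f where "g \<in> L2" "f \<in> S" "AE x in lebesgue. fourier f x = g x"
  using assms unfolding hat_def by blast

lemma fourier_in_hat: "f \<in> S \<Longrightarrow> f \<in> L2 \<Longrightarrow> fourier f \<in> hat S"
  by (erule hatI, assumption) (rule AE_I2, rule refl)

text \<open>By the isometry \<open>fourier_dist\<close> a convergent sequence of transforms comes
  from a Cauchy sequence of functions.\<close>

lemma hat_closure:
  assumes S: "S \<subseteq> L2"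
  shows "L2_closure (hat S) \<subseteq> hat (L2_closure S)"
proof
  fix g assume "g \<in> L2_closure (hat S)"
  then obtain w where w: "\<And>n. w n \<in> hat S" "L2_tendsto w g"
    unfolding L2_closure_def by auto
  have "\<exists>f\<in>S. AE x in lebesgue. fourier f x = w n x" for n
    using w(1)[of n] unfolding hat_def by blast
  then obtain f where f: "\<And>n. f n \<in> S" "\<And>n. AE x in lebesgue. fourier (f n) x = w n x" by metis
  have fL: "f n \<in> L2" for n using f(1) S by blast
  have F: "L2_tendsto (\<lambda>n. fourier (f n)) g"
  proof (rule L2_tendsto_cong[OF w(2)])
    show "AE x in lebesgue. w n x = fourier (f n) x" for n using f(2)[of n] by eventually_elim simp
  qed simp
  obtain h where h: "L2_tendsto f h"
  proof (rule L2_complete[OF fL])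
    fix e :: real assume "0 < e"
    from L2_tendsto_Cauchy[OF F this]
    show "\<exists>N. \<forall>m\<ge>N. \<forall>n\<ge>N. L2_norm (\<lambda>x. f m x - f n x) < e"
      by (simp add: fourier_dist fL)
  qed
  show "g \<in> hat (L2_closure S)"
  proof (rule hatI[of h])
    show "h \<in> L2_closure S" unfolding L2_closure_def using h f(1) by auto
    show "h \<in> L2" by (rule L2_tendstoD(1)[OF h])
    show "AE x in lebesgue. fourier h x = g x"
      by (rule L2_tendsto_unique[OF fourier_tendsto[OF h] F])
  qed
qed

lemma hat_closure_eq:
  assumes S: "S \<subseteq> L2"
  shows "L2_closure (hat S) = hat (L2_closure S)"
proof (rule antisym[OF hat_closure[OF S]], rule subsetI)
  fix g assume "g \<in> hat (L2_closure S)"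
  then obtain f where f: "g \<in> L2" "f \<in> L2_closure S" "AE x in lebesgue. fourier f x = g x" by (rule hatE)
  obtain u where u: "\<And>n. u n \<in> S" "L2_tendsto u f"
    using f(2) unfolding L2_closure_def by auto
  have "L2_tendsto (\<lambda>n. fourier (u n)) g"
    by (rule L2_tendsto_cong[OF fourier_tendsto[OF u(2)] _ f(3)]) simp
  moreover have "fourier (u n) \<in> hat S" for n
    using u(1) L2_tendstoD(2)[OF u(2)] by (rule fourier_in_hat)
  ultimately show "g \<in> L2_closure (hat S)"
    unfolding L2_closure_def by (intro CollectI exI[of _ "\<lambda>n. fourier (u n)"]) simp
qed

lemma hat_closed_subspace:
  assumes V: "closed_L2_subspace V"
  shows "closed_L2_subspace (hat V)"
  unfolding closed_L2_subspace_def
proof (intro conjI ballI allI)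
  show "hat V \<subseteq> L2" unfolding hat_def by blast
  have VL: "f \<in> V \<Longrightarrow> f \<in> L2" for f by (rule closed_subspace_L2[OF V])
  show "(\<lambda>x. 0) \<in> hat V"
  proof (rule hatI[of "\<lambda>x. 0"])
    show "AE x in lebesgue. fourier (\<lambda>x. 0) x = 0"
      using fourier_cmult[OF L2_zero, of 0] by simp
  qed (simp_all add: closed_subspace_zero[OF V])
  show "(\<lambda>x. f x + g x) \<in> hat V" if f: "f \<in> hat V" and g: "g \<in> hat V" for f g
  proof -
    obtain a where a: "a \<in> V" "AE x in lebesgue. fourier a x = f x" using f by (rule hatE)
    obtain b where b: "b \<in> V" "AE x in lebesgue. fourier b x = g x" using g by (rule hatE)
    show ?thesis
    proof (rule hatI[OF closed_subspace_add[OF V a(1) b(1)]])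
      show "(\<lambda>x. a x + b x) \<in> L2" by (intro L2_add VL a b)
      show "AE x in lebesgue. fourier (\<lambda>x. a x + b x) x = f x + g x"
        using fourier_add[OF VL[OF a(1)] VL[OF b(1)]] a(2) b(2) by eventually_elim simp
    qed
  qed
  show "(\<lambda>x. c * f x) \<in> hat V" if f: "f \<in> hat V" for c f
  proof -
    obtain a where a: "a \<in> V" "AE x in lebesgue. fourier a x = f x" using f by (rule hatE)
    show ?thesis
    proof (rule hatI[OF closed_subspace_cmult[OF V a(1)]])
      show "(\<lambda>x. c * a x) \<in> L2" by (intro L2_cmult VL a)
      show "AE x in lebesgue. fourier (\<lambda>x. c * a x) x = c * f x"
        using fourier_cmult[OF VL[OF a(1)], of c] a(2) by eventually_elim simp
    qed
  qed
  have "V \<subseteq> L2" "L2_closure V \<subseteq> V" using V unfolding closed_L2_subspace_def by simp_all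
  then have "L2_closure (hat V) \<subseteq> hat (L2_closure V)" "hat (L2_closure V) \<subseteq> hat V"
    using hat_closure[of V] by (auto simp: hat_def)
  then show "L2_closure (hat V) \<subseteq> hat V" by (rule order.trans)
qed

text \<open>The eigenvalue condition enters the analysis only through \<open>contract\<close>,
  uniform contraction on balls. Isolating it lets the same results serve for the adjoint of the
  dilation and for multiplication by 2 in the proof of \<open>hat_L2\<close>.\<close>

locale expanding =
  fixes B R :: "real^'n \<Rightarrow> real^'n"
  assumes linear_B: "linear B" and linear_R: "linear R"
    and B_R: "\<And>x. B (R x) = x" and R_B: "\<And>x. R (B x) = x"
    and contract: "\<And>e r. 0 < e \<Longrightarrow> \<exists>N. \<forall>j\<ge>N. \<forall>x. norm x \<le> r \<longrightarrow> norm ((R ^^ j) x) < e"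
begin

definition dB :: real where "dB = (SOME d. rescales B d)"
definition dR :: real where "dR = (SOME d. rescales R d)"

lemma rescales_B: "rescales B dB"
proof -
  obtain d where "rescales B d" using rescales_linear[OF linear_B linear_R B_R R_B] .
  then show ?thesis unfolding dB_def by (rule someI)
qed

lemma rescales_R: "rescales R dR"
proof -
  obtain d where "rescales R d" using rescales_linear[OF linear_R linear_B R_B B_R] .
  then show ?thesis unfolding dR_def by (rule someI)
qed

lemmas rescales_Bn = rescales_funpow[OF rescales_B] and rescales_Rn = rescales_funpow[OF rescales_R]

lemma Bn_Rn [simp]: "(B ^^ n) ((R ^^ n) x) = x"
proof (induction n arbitrary: x)
  case (Suc n)
  have "(B ^^ Suc n) ((R ^^ Suc n) x) = B ((B ^^ n) ((R ^^ n) (R x)))" by (simp add: funpow_swap1)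
  then show ?case by (simp add: Suc B_R)
qed simp

lemma Rn_Bn [simp]: "(R ^^ n) ((B ^^ n) x) = x"
proof (induction n arbitrary: x)
  case (Suc n)
  have "(R ^^ Suc n) ((B ^^ Suc n) x) = R ((R ^^ n) ((B ^^ n) (B x)))" by (simp add: funpow_swap1)
  then show ?case by (simp add: Suc R_B)
qed simp

lemma linear_Rn: "linear (R ^^ n)"
proof (induction n)
  case 0
  show ?case by (simp add: linear_id[unfolded id_def] id_def)
next
  case (Suc n)
  then show ?case using linear_compose[OF Suc linear_R] by (simp add: o_def)
qed

lemma Rn_image:
  assumes "S \<in> sets lebesgue"
  shows "(R ^^ n) ` S \<in> sets lebesgue" "emeasure lebesgue ((R ^^ n) ` S) = ennreal (dR ^ n) * emeasure lebesgue S"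
  using rescales_emeasure_image[OF rescales_Rn rescales_Bn, of n n S] assms by simp_all

end

text \<open>In the application \<open>B\<close> is the adjoint of the dilation and \<open>Y = hat V\<close>; then \<open>Yn n\<close> below is \<open>hat (\<D>\<^sub>A\<^sup>n V)\<close>.\<close>

locale refinable_space = expanding B R for B R :: "real^'n \<Rightarrow> real^'n" +
  fixes Y :: "(real^'n \<Rightarrow> complex) set"
  assumes Y: "closed_L2_subspace Y"
    and Y_wave: "\<And>k u. k \<in> int_lattice \<Longrightarrow> u \<in> Y \<Longrightarrow> (\<lambda>x. wave k x * u x) \<in> Y"
    and Y_refine: "\<And>u. u \<in> Y \<Longrightarrow> (\<lambda>x. u (B x)) \<in> Y"
begin

definition Yn :: "nat \<Rightarrow> (real^'n \<Rightarrow> complex) set" where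
  "Yn n = {u \<in> L2. (\<lambda>x. u ((B ^^ n) x)) \<in> Y}"

definition W :: "(real^'n \<Rightarrow> complex) set" where
  "W = L2_closure (\<Union>n. Yn n)"

lemma Yn_Suc: "Yn n \<subseteq> Yn (Suc n)"
proof
  fix u assume "u \<in> Yn n"
  then have "u \<in> L2" "(\<lambda>x. u ((B ^^ n) (B x))) \<in> Y"
    using Y_refine[of "\<lambda>x. u ((B ^^ n) x)"] by (simp_all add: Yn_def)
  then show "u \<in> Yn (Suc n)" by (simp add: Yn_def funpow_swap1)
qed

lemma Yn_mono: "m \<le> n \<Longrightarrow> Yn m \<subseteq> Yn n"
  by (rule lift_Suc_mono_le[of Yn]) (rule Yn_Suc)

lemma Y_subset: "Y \<subseteq> Yn 0"
  using closed_subspace_L2[OF Y] by (auto simp: Yn_def)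

lemma UN_Yn_L2: "(\<Union>n. Yn n) \<subseteq> L2"
  by (auto simp: Yn_def)

lemma Yn_W: "Yn n \<subseteq> W"
  unfolding W_def using L2_closure_incl[OF UN_Yn_L2] by blast

lemma W: "closed_L2_subspace W"
  unfolding W_def
proof (rule closed_subspace_closure[OF UN_Yn_L2])
  show "(\<lambda>x. 0) \<in> (\<Union>n. Yn n)" using closed_subspace_zero[OF Y] Y_subset by blast
next
  fix f g assume "f \<in> (\<Union>n. Yn n)" "g \<in> (\<Union>n. Yn n)"
  then obtain m n where "f \<in> Yn m" "g \<in> Yn n" by auto
  then have "f \<in> Yn (max m n)" "g \<in> Yn (max m n)"
    using Yn_mono[of m "max m n"] Yn_mono[of n "max m n"] by auto
  then have "(\<lambda>x. f x + g x) \<in> Yn (max m n)"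
    using closed_subspace_add[OF Y, of "\<lambda>x. f ((B ^^ max m n) x)" "\<lambda>x. g ((B ^^ max m n) x)"]
    by (simp add: Yn_def L2_add)
  then show "(\<lambda>x. f x + g x) \<in> (\<Union>n. Yn n)" by blast
next
  fix c f assume "f \<in> (\<Union>n. Yn n)"
  then obtain n where "f \<in> Yn n" by auto
  then have "(\<lambda>x. c * f x) \<in> Yn n"
    using closed_subspace_cmult[OF Y, of "\<lambda>x. f ((B ^^ n) x)" c] by (simp add: Yn_def L2_cmult)
  then show "(\<lambda>x. c * f x) \<in> (\<Union>n. Yn n)" by blast
qed

text \<open>The \<open>B\<^sup>j \<int>\<^sup>d\<close>-periodic hull of the bounded set \<open>F\<close> agrees with \<open>F\<close> on bounded sets once \<open>j\<close> is large.\<close>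

lemma W_indicator:
  assumes F: "F \<in> sets lebesgue" "bounded F" and u: "u \<in> W"
  shows "(\<lambda>x. indicator F x * u x) \<in> W"
proof -
  obtain r where r: "\<And>x. x \<in> F \<Longrightarrow> norm x \<le> r" using F(2) by (auto simp: bounded_iff)
  define m where "m j x = (indicator (periodic_hull ((R ^^ j) ` F)) ((R ^^ j) x) :: complex)" for j x
  have hull: "periodic_hull ((R ^^ j) ` F) \<in> sets lebesgue" for j
    by (intro periodic_hull_sets Rn_image F)
  have mm: "m j \<in> borel_measurable lebesgue" for j
    unfolding m_def by (rule rescales_compose[OF rescales_Rn]) (intro borel_measurable_indicator hull)
  have mb: "cmod (m j x) \<le> 1" for j x by (simp add: m_def norm_indicator_le_1)
  have m_lim: "(\<lambda>j. m j x) \<longlonglongrightarrow> indicator F x" for x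
  proof -
    \<comment> \<open>From \<open>N\<close> on, \<open>R^j\<close> maps every difference of
      \<open>x\<close> and a point of \<open>F\<close> to a vector of norm below 1, and the only
      lattice vector that short is 0.\<close>
    obtain N where N: "\<And>j y. j \<ge> N \<Longrightarrow> norm y \<le> norm x + r \<Longrightarrow> norm ((R ^^ j) y) < 1"
      using contract[of 1 "norm x + r"] by auto
    have "m j x = indicator F x" if "j \<ge> N" for j
    proof -
      have "(R ^^ j) x \<in> periodic_hull ((R ^^ j) ` F) \<longleftrightarrow> x \<in> F"
      proof
        assume "(R ^^ j) x \<in> periodic_hull ((R ^^ j) ` F)"
        then obtain k f where k: "k \<in> int_lattice" "f \<in> F" "(R ^^ j) x - k = (R ^^ j) f"
          by (auto simp: periodic_hull_def)
        have "norm (x - f) \<le> norm x + r" using norm_triangle_ineq4[of x f] r[OF k(2)] by linarith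
        then have "norm ((R ^^ j) (x - f)) < 1" by (rule N[OF that])
        moreover have "(R ^^ j) (x - f) = k" using k(3) linear_diff[OF linear_Rn, of j x f] by (simp add: algebra_simps)
        ultimately have "k = 0" using int_lattice_norm_ge_1[OF k(1)] by auto
        then have "(B ^^ j) ((R ^^ j) x) = (B ^^ j) ((R ^^ j) f)" using k(3) by simp
        then show "x \<in> F" using k(2) by simp
      next
        assume "x \<in> F"
        then show "(R ^^ j) x \<in> periodic_hull ((R ^^ j) ` F)"
          unfolding periodic_hull_def by (auto intro!: bexI[of _ 0])
      qed
      then show ?thesis by (simp add: m_def indicator_def)
    qed
    then show ?thesis by (intro tendsto_eventually eventually_sequentiallyI[of N])
  qed
  have step: "(\<lambda>x. indicator F x * v x) \<in> W" if v: "v \<in> Yn i" for v i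
  proof (rule closed_subspace_limit[OF W])
    have vL: "v \<in> L2" using v by (simp add: Yn_def)
    \<comment> \<open>The index starts at \<open>i\<close> because \<open>v\<close> is known to lie
      in \<open>Yn j\<close> for \<open>j\<close> at least \<open>i\<close>; there \<open>v\<close>
      composed with \<open>B^j\<close> is in \<open>Y\<close> and may be multiplied by periodic
      indicator functions.\<close>
    show "L2_tendsto (\<lambda>n x. m (n + i) x * v x) (\<lambda>x. indicator F x * v x)"
      by (rule L2_dominated_convergence[OF vL mm _ _ _, where C=1])
        (auto intro!: AE_I2 mb borel_measurable_indicator F LIMSEQ_ignore_initial_segment[OF m_lim])
    fix n
    have vn: "(\<lambda>x. v ((B ^^ (n + i)) x)) \<in> Y" using v Yn_mono[of i "n + i"] by (auto simp: Yn_def)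
    have "(\<lambda>x. indicator (periodic_hull ((R ^^ (n + i)) ` F)) x * v ((B ^^ (n + i)) x)) \<in> Y"
      by (rule multiplierD[OF multiplier_periodic_hull[OF Y Y_wave Rn_image(1)[OF F(1)]] vn])
    moreover have "(\<lambda>x. m (n + i) x * v x) \<in> L2"
      by (rule L2_mult_bounded[OF vL mm, of _ 1]) (intro AE_I2 mb)
    ultimately have "(\<lambda>x. m (n + i) x * v x) \<in> Yn (n + i)" by (simp add: Yn_def m_def)
    then show "(\<lambda>x. m (n + i) x * v x) \<in> W" using Yn_W by blast
  qed
  obtain w where w: "\<And>n. w n \<in> (\<Union>n. Yn n)" "L2_tendsto w u"
    using u unfolding W_def L2_closure_def by auto
  show ?thesis
  proof (rule closed_subspace_limit[OF W])
    show "L2_tendsto (\<lambda>n x. indicator F x * w n x) (\<lambda>x. indicator F x * u x)"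
      by (rule L2_tendsto_mult_bounded[OF w(2), where C=1])
        (auto intro!: AE_I2 borel_measurable_indicator F norm_indicator_le_1)
    show "(\<lambda>x. indicator F x * w n x) \<in> W" for n
    proof -
      obtain i where "w n \<in> Yn i" using w(1)[of n] by auto
      then show ?thesis by (rule step)
    qed
  qed
qed

end

text \<open>Projections give information only about sets that fit into a lattice cell. Separability
  glues such local statements: countably many balls of a fixed radius cover the space.\<close>

lemma AE_ball_cover:
  fixes P :: "real^'n \<Rightarrow> bool"
  assumes "0 < \<delta>" "\<And>\<theta>. AE x in lebesgue. x \<in> ball \<theta> \<delta> \<longrightarrow> P x"
  shows "AE x in lebesgue. P x"
proof -
  obtain D :: "(real^'n) set" where D: "countable D" "\<And>X. open X \<Longrightarrow> X \<noteq> {} \<Longrightarrow> \<exists>d\<in>D. d \<in> X"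
    using countable_dense_setE by metis
  have "AE x in lebesgue. \<forall>\<theta>\<in>D. x \<in> ball \<theta> \<delta> \<longrightarrow> P x"
    using assms(2) by (subst AE_ball_countable[OF D(1)]) simp
  then show ?thesis
  proof eventually_elim
    case (elim x)
    obtain \<theta> where "\<theta> \<in> D" "\<theta> \<in> ball x \<delta>"
      using D(2)[of "ball x \<delta>"] assms(1) by auto
    then show ?case using elim[rule_format, of \<theta>] by (simp add: dist_commute)
  qed
qed

section \<open>Surjectivity of the transform on \<open>L2\<close>\<close>

lemma hat_L2_wave:
  assumes "g \<in> hat L2"
  shows "(\<lambda>x. wave k x * g x) \<in> hat L2"
proof -
  obtain f where f: "f \<in> L2" "AE x in lebesgue. fourier f x = g x" using assms by (rule hatE)
  show ?thesis
  proof (rule hatI[OF shift_L2[OF f(1)] shift_L2[OF f(1)]])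
    show "AE x in lebesgue. fourier (shift (- k) f) x = wave k x * g x"
      using fourier_shift[OF f(1), of "-k"] f(2) by eventually_elim (simp add: wave_minus_left)
  qed
qed

lemma hat_L2_scale:
  fixes g :: "real^'n \<Rightarrow> complex"
  assumes "g \<in> hat L2" "c \<noteq> 0"
  shows "(\<lambda>x. g (c *\<^sub>R x)) \<in> hat L2"
proof -
  obtain f where f: "f \<in> L2" "AE x in lebesgue. fourier f x = g x" using assms(1) by (rule hatE)
  define S T where "S x = c *\<^sub>R x" and "T x = (1 / c) *\<^sub>R x" for x :: "real^'n"
  have ST: "S (T x) = x" "T (S x) = x" for x using assms(2) by (simp_all add: S_def T_def)
  have lin: "linear S" "linear T" unfolding S_def T_def by (intro linearI; simp add: algebra_simps)+
  obtain d where d: "rescales S d" using rescales_linear[OF lin ST] .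
  obtain e where e: "rescales T e" using rescales_linear[OF lin(2,1) ST(2,1)] .
  have fT: "(\<lambda>x. complex_of_real e * f (T x)) \<in> L2" by (intro L2_cmult rescales_L2(1)[OF e f(1)])
  show ?thesis
  proof (rule hatI[OF fT fT])
    have "AE \<xi> in lebesgue. fourier f (S \<xi>) = complex_of_real e * fourier (\<lambda>x. f (T x)) \<xi>"
      by (rule fourier_linear[OF e ST(1) _ d f(1)]) (simp add: S_def)
    moreover have "AE \<xi> in lebesgue. fourier f (S \<xi>) = g (S \<xi>)" by (rule rescales_AE[OF d f(2)])
    moreover note fourier_cmult[OF rescales_L2(1)[OF e f(1)], of "complex_of_real e"]
    ultimately show "AE x in lebesgue. fourier (\<lambda>x. complex_of_real e * f (T x)) x = g (c *\<^sub>R x)"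
      by eventually_elim (simp add: S_def)
  qed
qed

text \<open>The range is refinable for the dilation by \<open>2\<close>, hence invariant under multiplication by indicator functions.
  A function orthogonal to it is then orthogonal pointwise to a transform that vanishes nowhere near the origin.\<close>

theorem hat_L2: "hat L2 = (L2 :: (real^'n \<Rightarrow> complex) set)"
proof
  show "hat L2 \<subseteq> (L2 :: (real^'n \<Rightarrow> complex) set)" unfolding hat_def by blast
  have closed: "closed_L2_subspace (hat L2 :: (real^'n \<Rightarrow> complex) set)"
  proof (rule hat_closed_subspace)
    show "closed_L2_subspace (L2 :: (real^'n \<Rightarrow> complex) set)"
      unfolding closed_L2_subspace_def by (auto intro: L2_add L2_cmult L2_closure_L2)
  qed
  define B R where "B x = 2 *\<^sub>R x" and "R x = (1/2) *\<^sub>R x" for x :: "real^'n"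
  have Rn: "(R ^^ j) x = (1/2)^j *\<^sub>R x" for j x by (induction j) (simp_all add: R_def)
  have Bn: "(B ^^ j) x = 2^j *\<^sub>R x" for j x by (induction j) (simp_all add: B_def)
  have "expanding B R"
  proof (rule expanding.intro)
    fix e r :: real assume e: "0 < e"
    have "(\<lambda>j. (1/2)^j * \<bar>r\<bar>) \<longlonglongrightarrow> 0 * \<bar>r\<bar>" by (intro tendsto_intros LIMSEQ_realpow_zero) auto
    then obtain N where N: "\<And>j. j \<ge> N \<Longrightarrow> (1/2)^j * \<bar>r\<bar> < e"
      using order_tendstoD(2)[of "\<lambda>j. (1/2)^j * \<bar>r\<bar>" 0 sequentially e] e by (auto simp: eventually_sequentially)
    have "norm ((R ^^ j) x) < e" if "j \<ge> N" "norm x \<le> r" for j x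
    proof -
      have "norm ((R ^^ j) x) = (1/2)^j * norm x" by (simp add: Rn)
      also have "\<dots> \<le> (1/2)^j * \<bar>r\<bar>" using that(2) by (intro mult_left_mono) auto
      finally show ?thesis using N[OF that(1)] by simp
    qed
    then show "\<exists>N. \<forall>j\<ge>N. \<forall>x. norm x \<le> r \<longrightarrow> norm ((R ^^ j) x) < e" by blast
  next
    show "linear B" unfolding B_def by (intro linearI; simp add: algebra_simps)
    show "linear R" unfolding R_def by (intro linearI; simp add: algebra_simps)
  qed (simp_all add: B_def R_def)
  moreover have "refinable_space_axioms B (hat L2)"
  proof (rule refinable_space_axioms.intro[OF closed hat_L2_wave])
    show "(\<lambda>x. u (B x)) \<in> hat L2" if "u \<in> hat L2" for u
      unfolding B_def by (rule hat_L2_scale[OF that]) simp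
  qed
  ultimately interpret refinable_space B R "hat L2" by (rule refinable_space.intro)
  have "Yn n \<subseteq> hat L2" for n
  proof
    fix u assume "u \<in> Yn n"
    then have "(\<lambda>x. u ((B ^^ n) x)) \<in> hat L2" by (simp add: Yn_def)
    from hat_L2_scale[OF this, of "(1/2)^n"] show "u \<in> hat L2"
      by (simp add: Bn power_mult_distrib[symmetric])
  qed
  then have W_hat: "W \<subseteq> hat L2"
    using closed unfolding W_def closed_L2_subspace_def
    by (meson L2_closure_mono UN_least order.trans)
  \<comment> \<open>The transform of \<open>h\<close> is continuous and equals the volume 1 of the
    cube at the origin, hence it is nonzero on a small ball.\<close>
  define h :: "real^'n \<Rightarrow> complex" where "h = indicator unit_cube"
  have hL: "h \<in> L2" unfolding h_def
    by (rule indicator_L2) (simp_all add: emeasure_unit_cube del: emeasure_completion)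
  have int: "integrable lebesgue h"
    by (rule L2_integrable_finite_support[OF hL unit_cube_lebesgue])
      (simp_all add: emeasure_unit_cube h_def del: emeasure_completion)
  have h0: "fourier_L1 h 0 = 1"
    using integral_unit_cube_wave[OF int_lattice_zero, where 'a='n] by (simp add: fourier_L1_wave h_def)
  have "isCont (fourier_L1 h) 0"
    using continuous_fourier_L1[OF int] by (simp add: continuous_on_eq_continuous_at)
  then have "\<exists>\<delta>>0. \<forall>\<xi>. dist \<xi> 0 < \<delta> \<longrightarrow> dist (fourier_L1 h \<xi>) (fourier_L1 h 0) < 1"
    unfolding continuous_at_eps_delta by (meson zero_less_one)
  then obtain \<delta> where \<delta>: "0 < \<delta>" "\<And>\<xi>. norm \<xi> < \<delta> \<Longrightarrow> dist (fourier_L1 h \<xi>) 1 < 1"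
    using h0 by auto
  have nz: "fourier_L1 h \<xi> \<noteq> 0" if "norm \<xi> < \<delta>" for \<xi> using \<delta>(2)[OF that] by auto
  show "(L2 :: (real^'n \<Rightarrow> complex) set) \<subseteq> hat L2"
  proof
    fix g :: "real^'n \<Rightarrow> complex" assume g: "g \<in> L2"
    from L2_projection[OF closed g]
    obtain p where p: "p \<in> hat L2" "\<forall>y\<in>hat L2. L2_inner (\<lambda>x. g x - p x) y = 0" by (rule bexE)
    define u where "u x = g x - p x" for x
    have uL: "u \<in> L2" unfolding u_def using p(1) g by (intro L2_diff) (auto simp: hat_def)
    have "AE x in lebesgue. u x = 0"
    proof (rule AE_ball_cover[OF \<delta>(1)])
      fix \<theta> :: "real^'n"
      \<comment> \<open>Modulating \<open>h\<close> translates its transform, so \<phi> is nonzero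
        on the ball around \<theta>. Orthogonality of \<open>u\<close> to all
        \<open>indicator F * \<phi>\<close> then annihilates \<open>u\<close> there.\<close>
      define \<phi> where "\<phi> = fourier_L1 (\<lambda>x. cnj (wave (- \<theta>) x) * h x)"
      have \<phi>: "\<phi> \<xi> = fourier_L1 h (\<xi> - \<theta>)" for \<xi>
        unfolding \<phi>_def fourier_L1_modulate by simp
      have wh: "(\<lambda>x. cnj (wave (- \<theta>) x) * h x) \<in> L2"
        using wave_mult_L2[OF hL, of \<theta>] by (simp add: wave_minus_left)
      have wint: "integrable lebesgue (\<lambda>x. cnj (wave (- \<theta>) x) * h x)"
        using integrable_wave[OF int, of "-\<theta>"] by (simp add: mult.commute)
      have \<phi>_hat: "\<phi> \<in> hat L2" unfolding \<phi>_def by (rule hatI[OF wh wh fourier_eq_L1[OF wh wint]])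
      have \<phi>m: "(\<lambda>x. cnj (\<phi> x)) \<in> borel_measurable lebesgue"
        using L2_measurable[OF L2_cnj[OF plancherel_L1_le(1)[OF wh wint]]] by (simp add: \<phi>_def)
      have \<phi>b: "cmod (cnj (\<phi> x)) \<le> (LINT y|lebesgue. cmod (cnj (wave (- \<theta>) y) * h y))" for x
      proof -
        have "cmod (\<phi> x) \<le> (LINT y|lebesgue. cmod (cnj (wave (- \<theta>) y) * h y * cnj (wave x y)))"
          unfolding \<phi>_def fourier_L1_wave by (rule integral_norm_bound)
        then show ?thesis by (simp add: norm_mult)
      qed
      have "AE x in lebesgue. x \<in> ball \<theta> \<delta> \<longrightarrow> cnj (\<phi> x) * u x = 0"
      proof (rule L2_zero_test)
        show "(\<lambda>x. cnj (\<phi> x) * u x) \<in> L2" by (rule L2_mult_bounded[OF uL \<phi>m AE_I2[OF \<phi>b]])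
        show "ball \<theta> \<delta> \<in> sets lebesgue" by simp
        then show "emeasure lebesgue (ball \<theta> \<delta>) < \<infinity>" by (intro emeasure_bounded_lebesgue bounded_ball)
        fix F assume F: "F \<in> sets lebesgue" "F \<subseteq> ball \<theta> \<delta>"
        have "\<phi> \<in> W" using \<phi>_hat Y_subset Yn_W by blast
        then have "(\<lambda>x. indicator F x * \<phi> x) \<in> hat L2"
          using W_indicator[OF F(1) bounded_subset[OF bounded_ball F(2)]] W_hat by blast
        then have "L2_inner u (\<lambda>x. indicator F x * \<phi> x) = 0" unfolding u_def by (rule bspec[OF p(2)])
        then show "L2_inner (\<lambda>x. cnj (\<phi> x) * u x) (indicator F) = 0"
          using L2_inner_move[of "\<lambda>x. cnj (\<phi> x)" u "indicator F"] by (simp add: mult.commute[of "\<phi> _"])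
      qed
      then show "AE x in lebesgue. x \<in> ball \<theta> \<delta> \<longrightarrow> u x = 0"
      proof eventually_elim
        case (elim x)
        have "\<phi> x \<noteq> 0" if "x \<in> ball \<theta> \<delta>"
          unfolding \<phi> by (rule nz) (use that in \<open>simp add: dist_norm norm_minus_commute\<close>)
        then show ?case using elim by auto
      qed
    qed
    then have "AE x in lebesgue. p x = g x" by eventually_elim (simp add: u_def)
    then show "g \<in> hat L2" by (rule closed_subspace_cong[OF closed p(1)])
  qed
qed

section \<open>The spectral function along the inverse dilations\<close>

text \<open>\<open>p\<close> and \<open>q\<close> are projections of \<open>g\<close> to a smaller
  and a larger space. Only orthogonality to \<open>p\<close> enters: it makes the inner product of
  \<open>q\<close> and \<open>p\<close> equal to the squared norm of \<open>p\<close>, and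
  Cauchy--Schwarz finishes. With \<open>q = g\<close> this says that projections do not increase
  norms.\<close>

lemma projection_norm_mono:
  assumes g: "g \<in> L2" and p: "p \<in> L2" "q \<in> L2"
    and "L2_inner (\<lambda>x. g x - p x) p = 0" "L2_inner (\<lambda>x. g x - q x) p = 0"
  shows "L2_norm p \<le> L2_norm q"
proof -
  have "L2_inner g p - L2_inner p p = 0" "L2_inner g p - L2_inner q p = 0"
    using assms by (simp_all add: L2_inner_diff_left)
  then have "L2_inner q p = complex_of_real ((L2_norm p)\<^sup>2)"
    by (simp add: L2_inner_self)
  then have "cmod (complex_of_real ((L2_norm p)\<^sup>2)) \<le> L2_norm q * L2_norm p"
    using L2_Cauchy_Schwarz[OF p(2,1)] by simp
  then have "L2_norm p * L2_norm p \<le> L2_norm q * L2_norm p"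
    unfolding norm_of_real by (simp add: power2_eq_square)
  then show ?thesis
    by (cases "L2_norm p = 0") (simp_all add: mult_le_cancel_right order_less_le)
qed

lemma L2_inner_AE_zero:
  assumes "f \<in> L2" "g \<in> L2" "AE x in lebesgue. f x * cnj (g x) = 0"
  shows "L2_inner f g = 0"
proof -
  have "L2_inner f g = (LINT x|lebesgue. 0 * f x)"
    unfolding L2_inner_def
    using borel_measurable_integrable[OF L2_inner_integrable[OF assms(1,2)]] assms(3)
    by (intro integral_cong_AE) auto
  then show ?thesis by simp
qed

lemma integrable_indicator_bounded:
  fixes f :: "real^'n \<Rightarrow> real"
  assumes "E \<in> sets lebesgue" "emeasure lebesgue E < \<infinity>" "f \<in> borel_measurable lebesgue"
    and "AE x in lebesgue. \<bar>f x\<bar> \<le> C"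
  shows "integrable lebesgue (\<lambda>x. indicator E x * f x)"
proof (rule Bochner_Integration.integrable_bound)
  show "integrable lebesgue (\<lambda>x. C * indicator E x :: real)"
    using assms(1,2) by (intro integrable_mult_right integrable_real_indicator)
  show "(\<lambda>x. indicator E x * f x) \<in> borel_measurable lebesgue"
    using assms by (intro borel_measurable_times borel_measurable_indicator)
  show "AE x in lebesgue. norm (indicator E x * f x) \<le> norm (C * indicator E x)"
    using assms(4) by eventually_elim (auto simp: indicator_def)
qed

lemma measure_tendsto_AE:
  fixes X :: "nat \<Rightarrow> (real^'n) set"
  assumes S: "S \<in> sets lebesgue" "emeasure lebesgue S < \<infinity>"
    and X: "\<And>n. X n \<in> sets lebesgue" "\<And>n. X n \<subseteq> S" "Z \<in> sets lebesgue"
    and lim: "AE x in lebesgue. \<forall>\<^sub>F n in sequentially. x \<in> X n \<longleftrightarrow> x \<in> Z"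
  shows "(\<lambda>n. measure lebesgue (X n)) \<longlonglongrightarrow> measure lebesgue Z"
proof -
  have "(\<lambda>n. LINT x|lebesgue. indicator (X n) x) \<longlonglongrightarrow> (LINT x|lebesgue. indicator Z x :: real)"
  proof (rule integral_dominated_convergence)
    show "integrable lebesgue (indicator S :: _ \<Rightarrow> real)"
      using S by (intro integrable_real_indicator)
    show "AE x in lebesgue. (\<lambda>n. indicator (X n) x) \<longlonglongrightarrow> (indicator Z x :: real)"
      using lim
    proof eventually_elim
      case (elim x)
      then show ?case by (intro tendsto_eventually) (auto elim!: eventually_mono simp: indicator_def)
    qed
    show "AE x in lebesgue. norm (indicator (X n) x :: real) \<le> indicator S x" for n
      using X(2)[of n] by (auto simp: indicator_def)
  qed (use X in \<open>auto intro!: borel_measurable_indicator\<close>)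
  then show ?thesis using X by simp
qed

lemma AE_false_measure:
  fixes S :: "(real^'n) set"
  assumes "S \<in> sets lebesgue"
  shows "(AE x in lebesgue. x \<notin> S) \<longleftrightarrow> emeasure lebesgue S = 0"
  using AE_iff_measurable[OF assms, of "\<lambda>x. x \<notin> S"] by simp

section \<open>A radius for which all inverse dilates fit into a lattice cell\<close>

context expanding
begin

lemma contract_point:
  assumes "0 < e"
  shows "\<forall>\<^sub>F j in sequentially. norm ((R ^^ j) x) < e"
  using contract[OF assms, of "norm x"] by (auto simp: eventually_sequentially)

text \<open>One radius has to serve for all \<open>j\<close>. From \<open>N\<close> on
  \<open>contract\<close> controls the unit ball; the finitely many remaining powers have norm at
  most \<open>C\<close>, and the summand 1 in \<open>C\<close> keeps the radius
  \<open>1 / (2 * C)\<close> inside the unit ball.\<close>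

lemma small_radius:
  obtains r where "0 < r" "\<And>j x. norm x < r \<Longrightarrow> norm ((R ^^ j) x) < 1 / 2"
proof -
  obtain N where N: "\<And>j x. j \<ge> N \<Longrightarrow> norm x \<le> 1 \<Longrightarrow> norm ((R ^^ j) x) < 1/2"
    using contract[of "1/2" 1] by auto
  have "\<exists>K>0. \<forall>x. norm ((R ^^ j) x) \<le> K * norm x" for j
    using linear_bounded_pos[OF linear_Rn[of j]] by metis
  then obtain K where K: "\<And>j. 0 < K j" "\<And>j x. norm ((R ^^ j) x) \<le> K j * norm x" by metis
  define C where "C = 1 + (\<Sum>j<N. K j)"
  have C1: "1 \<le> C" unfolding C_def using K(1) by (simp add: sum_nonneg less_imp_le)
  show thesis
  proof (rule that[of "1 / (2 * C)"])
    show "0 < 1 / (2 * C)" using C1 by simp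
    fix j x assume x: "norm (x::real^'n) < 1 / (2 * C)"
    show "norm ((R ^^ j) x) < 1 / 2"
    proof (cases "j \<ge> N")
      case True
      have "1 / (2 * C) \<le> 1" using C1 by simp
      then show ?thesis using N[OF True] x by simp
    next
      case False
      then have "K j \<le> (\<Sum>j<N. K j)" using K(1) by (intro member_le_sum) (auto intro: less_imp_le)
      then have "K j \<le> C" by (simp add: C_def)
      have "norm ((R ^^ j) x) \<le> K j * norm x" by (rule K(2))
      also have "\<dots> < K j * (1 / (2 * C))" using x K(1)[of j] by (rule mult_strict_left_mono)
      also have "\<dots> \<le> C * (1 / (2 * C))" using \<open>K j \<le> C\<close> C1 by (intro mult_right_mono) auto
      also have "\<dots> = 1/2" using C1 by simp
      finally show ?thesis .
    qed
  qed
qed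

definition r0 :: real where
  "r0 = (SOME r. 0 < r \<and> (\<forall>j x. norm x < r \<longrightarrow> norm ((R ^^ j) x) < 1 / 2))"

lemma r0: "0 < r0" "norm x < r0 \<Longrightarrow> norm ((R ^^ j) x) < 1 / 2"
proof -
  obtain r where "0 < r \<and> (\<forall>j x. norm x < r \<longrightarrow> norm ((R ^^ j) x) < 1 / 2)"
    using small_radius by metis
  then have "0 < r0 \<and> (\<forall>j x. norm x < r0 \<longrightarrow> norm ((R ^^ j) x) < 1 / 2)"
    unfolding r0_def by (rule someI)
  then show "0 < r0" "norm x < r0 \<Longrightarrow> norm ((R ^^ j) x) < 1 / 2" by simp_all
qed

text \<open>Every coordinate stays within 1/2 of that of the image of \<open>c\<close>, so the unit
  cube centred at this point contains the image.\<close>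

lemma Rn_small:
  assumes "E \<subseteq> ball c r0"
  shows "\<exists>\<theta>. (R ^^ j) ` E \<subseteq> {x. x - \<theta> \<in> unit_cube}"
proof (intro exI subsetI)
  fix y assume "y \<in> (R ^^ j) ` E"
  then obtain x where x: "x \<in> E" "y = (R ^^ j) x" by blast
  then have "norm (x - c) < r0" using assms by (auto simp: dist_norm norm_minus_commute)
  then have n: "norm ((R ^^ j) (x - c)) < 1 / 2" by (rule r0(2))
  have "y - ((R ^^ j) c - (\<chi> i. 1/2)) = (R ^^ j) (x - c) + (\<chi> i. 1/2)"
    using linear_diff[OF linear_Rn, of j x c] by (simp add: x)
  moreover have "0 \<le> (R ^^ j) (x - c) $ i + 1/2 \<and> (R ^^ j) (x - c) $ i + 1/2 < 1" for i
    using component_le_norm_cart[of "(R ^^ j) (x - c)" i] n by (auto simp: abs_le_iff)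
  ultimately have "y - ((R ^^ j) c - (\<chi> i. 1/2)) \<in> unit_cube"
    unfolding unit_cube_def by (simp only: mem_Collect_eq vector_add_component vec_lambda_beta) simp
  then show "y \<in> {x. x - ((R ^^ j) c - (\<chi> i. 1/2)) \<in> unit_cube}" by (rule CollectI)
qed

lemma emeasure_ball_finite: "emeasure lebesgue E < \<infinity>" if "E \<in> sets lebesgue" "E \<subseteq> ball c r" for E :: "(real^'n) set"
  using that by (intro emeasure_bounded_lebesgue) (auto intro: bounded_subset[OF bounded_ball])

lemma indicator_Bn: "indicator E ((B ^^ j) x) = indicator ((R ^^ j) ` E) x"
proof -
  have "(B ^^ j) x \<in> E \<longleftrightarrow> x \<in> (R ^^ j) ` E"
  proof
    assume "(B ^^ j) x \<in> E"
    then show "x \<in> (R ^^ j) ` E" by (intro image_eqI[of _ _ "(B ^^ j) x"]) simp_all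
  qed auto
  then show ?thesis by (simp add: indicator_def)
qed

end

text \<open>The last assumption determines \<open>\<sigma>\<close> up to a null set and makes no reference to a tight frame generator.\<close>

locale spectral = refinable_space B R Y for B R :: "real^'n \<Rightarrow> real^'n" and Y +
  fixes \<sigma> :: "real^'n \<Rightarrow> real"
  assumes \<sigma>m: "\<sigma> \<in> borel_measurable lebesgue"
    and \<sigma>01: "AE x in lebesgue. 0 \<le> \<sigma> x \<and> \<sigma> x \<le> 1"
    and \<sigma>_proj: "\<And>E \<theta>. E \<in> sets lebesgue \<Longrightarrow> E \<subseteq> {x. x - \<theta> \<in> unit_cube} \<Longrightarrow>
      \<exists>p\<in>Y. (\<forall>y\<in>Y. L2_inner (\<lambda>x. indicator E x - p x) y = 0) \<and>
        (LINT x|lebesgue. indicator E x * \<sigma> x) = (L2_norm p)\<^sup>2"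
begin

abbreviation \<sigma>n :: "nat \<Rightarrow> real^'n \<Rightarrow> real" where
  "\<sigma>n j x \<equiv> \<sigma> ((R ^^ j) x)"

lemma \<sigma>n_m: "\<sigma>n j \<in> borel_measurable lebesgue"
  by (rule rescales_compose[OF rescales_Rn \<sigma>m])

lemma \<sigma>n_01: "AE x in lebesgue. \<forall>j. 0 \<le> \<sigma>n j x \<and> \<sigma>n j x \<le> 1"
  unfolding AE_all_countable using rescales_AE[OF rescales_Rn \<sigma>01] by blast

lemma \<sigma>n_bound: "AE x in lebesgue. \<bar>\<sigma>n j x\<bar> \<le> 1"
  using \<sigma>n_01 by eventually_elim (simp add: abs_le_iff order.trans[of _ 0])

text \<open>Composition with \<open>B^j\<close> carries \<open>Yn j\<close> into \<open>Y\<close>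
  and the indicator of \<open>E\<close> to that of \<open>R^j E\<close>, which still fits into a
  lattice cell. The integral and the squared norm pick up the same factor
  \<open>dB ^ j\<close>.\<close>

lemma \<sigma>n_proj:
  assumes E: "E \<in> sets lebesgue" "E \<subseteq> ball c r0"
  shows "\<exists>p\<in>Yn j. (\<forall>y\<in>Yn j. L2_inner (\<lambda>x. indicator E x - p x) y = 0) \<and>
    (LINT x|lebesgue. indicator E x * \<sigma>n j x) = (L2_norm p)\<^sup>2"
proof -
  obtain \<theta> where \<theta>: "(R ^^ j) ` E \<subseteq> {x. x - \<theta> \<in> unit_cube}" using Rn_small[OF E(2)] by blast
  obtain q where q: "q \<in> Y" "\<forall>y\<in>Y. L2_inner (\<lambda>x. indicator ((R ^^ j) ` E) x - q x) y = 0"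
    "(LINT x|lebesgue. indicator ((R ^^ j) ` E) x * \<sigma> x) = (L2_norm q)\<^sup>2"
    using \<sigma>_proj[OF Rn_image(1)[OF E(1)] \<theta>] by blast
  define p where "p x = q ((R ^^ j) x)" for x
  have qL: "q \<in> L2" by (rule closed_subspace_L2[OF Y q(1)])
  have pL: "p \<in> L2" unfolding p_def by (rule rescales_L2(1)[OF rescales_Rn qL])
  have pB: "p ((B ^^ j) x) = q x" for x by (simp add: p_def)
  have pY: "p \<in> Yn j" using q(1) pL by (simp add: Yn_def pB)
  have EL: "(indicator E :: _ \<Rightarrow> complex) \<in> L2"
    by (rule indicator_L2[OF E(1) emeasure_ball_finite[OF E]])
  show ?thesis
  proof (intro bexI[OF _ pY] conjI ballI)
    fix y assume y: "y \<in> Yn j"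
    then have "L2_inner (\<lambda>x. indicator ((R ^^ j) ` E) x - q x) (\<lambda>x. y ((B ^^ j) x)) = 0"
      using q(2) by (simp add: Yn_def)
    then have "L2_inner (\<lambda>x. indicator E ((B ^^ j) x) - p ((B ^^ j) x)) (\<lambda>x. y ((B ^^ j) x)) = 0"
      by (simp only: indicator_Bn pB)
    moreover have "y \<in> L2" using y by (simp add: Yn_def)
    ultimately show "L2_inner (\<lambda>x. indicator E x - p x) y = 0"
      using rescales_L2_inner[OF rescales_Bn[of j] L2_diff[OF EL pL] \<open>y \<in> L2\<close>] by simp
  next
    have "(LINT x|lebesgue. indicator E x * \<sigma>n j x)
        = (dB ^ j) *\<^sub>R (LINT x|lebesgue. indicator E ((B ^^ j) x) * \<sigma>n j ((B ^^ j) x))"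
      by (rule rescales_integral[OF rescales_Bn])
        (intro borel_measurable_times borel_measurable_indicator E \<sigma>n_m)
    also have "\<dots> = dB ^ j * (LINT x|lebesgue. indicator ((R ^^ j) ` E) x * \<sigma> x)"
      by (simp add: indicator_Bn)
    also have "\<dots> = dB ^ j * (L2_norm q)\<^sup>2" by (simp only: q(3))
    also have "\<dots> = (L2_norm p)\<^sup>2"
      using rescales_L2_norm[OF rescales_Bn[of j] pL] by (simp add: pB)
    finally show "(LINT x|lebesgue. indicator E x * \<sigma>n j x) = (L2_norm p)\<^sup>2" .
  qed
qed

lemma \<sigma>n_integrable:
  assumes "E \<in> sets lebesgue" "emeasure lebesgue E < \<infinity>"
  shows "integrable lebesgue (\<lambda>x. indicator E x * \<sigma>n j x)"
  by (rule integrable_indicator_bounded[OF assms \<sigma>n_m \<sigma>n_bound])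

text \<open>Tested on the set where the inequality fails: the projection to the larger space
  \<open>Yn (Suc j)\<close> has the larger norm, so the positive difference has integral at most
  0.\<close>

lemma \<sigma>n_Suc: "AE x in lebesgue. \<sigma>n j x \<le> \<sigma>n (Suc j) x"
proof (rule AE_ball_cover[OF r0(1)])
  fix \<theta> :: "real^'n"
  define E where "E = {x \<in> space lebesgue. \<sigma>n (Suc j) x < \<sigma>n j x} \<inter> ball \<theta> r0"
  have E: "E \<in> sets lebesgue" "E \<subseteq> ball \<theta> r0"
  proof -
    show "E \<in> sets lebesgue"
      unfolding E_def by (intro sets.Int borel_measurable_less \<sigma>n_m) simp
  qed (simp add: E_def)
  obtain p where p: "p \<in> Yn j" "\<forall>y\<in>Yn j. L2_inner (\<lambda>x. indicator E x - p x) y = 0"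
    "(LINT x|lebesgue. indicator E x * \<sigma>n j x) = (L2_norm p)\<^sup>2" using \<sigma>n_proj[OF E] by blast
  obtain q where q: "q \<in> Yn (Suc j)" "\<forall>y\<in>Yn (Suc j). L2_inner (\<lambda>x. indicator E x - q x) y = 0"
    "(LINT x|lebesgue. indicator E x * \<sigma>n (Suc j) x) = (L2_norm q)\<^sup>2" using \<sigma>n_proj[OF E] by blast
  have "L2_norm p \<le> L2_norm q"
  proof (rule projection_norm_mono[OF indicator_L2[OF E(1) emeasure_ball_finite[OF E]]])
    show "L2_inner (\<lambda>x. indicator E x - q x) p = 0" using p(1) q(2) Yn_Suc[of j] by blast
  qed (use p q in \<open>simp_all add: Yn_def\<close>)
  then have le: "(LINT x|lebesgue. indicator E x * \<sigma>n j x) \<le> (LINT x|lebesgue. indicator E x * \<sigma>n (Suc j) x)"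
    unfolding p(3) q(3) by (rule power_mono) simp
  note int = \<sigma>n_integrable[OF E(1) emeasure_ball_finite[OF E]]
  have int': "integrable lebesgue (\<lambda>x. indicator E x * \<sigma>n j x - indicator E x * \<sigma>n (Suc j) x)"
    by (intro Bochner_Integration.integrable_diff int)
  have nn: "0 \<le> indicator E x * \<sigma>n j x - indicator E x * \<sigma>n (Suc j) x" for x
    by (simp add: indicator_def E_def)
  then have "0 \<le> (LINT x|lebesgue. indicator E x * \<sigma>n j x - indicator E x * \<sigma>n (Suc j) x)"
    by (rule Bochner_Integration.integral_nonneg)
  then have "(LINT x|lebesgue. indicator E x * \<sigma>n j x - indicator E x * \<sigma>n (Suc j) x) = 0"
    using le unfolding Bochner_Integration.integral_diff[OF int int] by linarith
  then have "AE x in lebesgue. indicator E x * \<sigma>n j x - indicator E x * \<sigma>n (Suc j) x = 0"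
    using integral_nonneg_eq_0_iff_AE[OF int'] nn by simp
  then show "AE x in lebesgue. x \<in> ball \<theta> r0 \<longrightarrow> \<sigma>n j x \<le> \<sigma>n (Suc j) x"
    by eventually_elim (auto simp: E_def indicator_def split: if_splits)
qed

lemma \<sigma>n_mono: "AE x in lebesgue. incseq (\<lambda>j. \<sigma>n j x)"
proof -
  have "AE x in lebesgue. \<forall>j. \<sigma>n j x \<le> \<sigma>n (Suc j) x"
    unfolding AE_all_countable using \<sigma>n_Suc by blast
  then show ?thesis by eventually_elim (rule incseq_SucI, simp)
qed

definition s :: "real^'n \<Rightarrow> real" where
  "s x = lim (\<lambda>j. \<sigma>n j x)"

lemma s_m: "s \<in> borel_measurable lebesgue"
  unfolding s_def by (rule borel_measurable_lim_metric[OF \<sigma>n_m])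

lemma s_lim: "AE x in lebesgue. (\<lambda>j. \<sigma>n j x) \<longlonglongrightarrow> s x"
  using \<sigma>n_mono \<sigma>n_01
proof eventually_elim
  case (elim x)
  obtain L where "(\<lambda>j. \<sigma>n j x) \<longlonglongrightarrow> L"
    using incseq_convergent[OF elim(1), of 1] elim(2) by blast
  then show ?case unfolding s_def by (simp add: limI)
qed

lemma s_01: "AE x in lebesgue. 0 \<le> s x \<and> s x \<le> 1"
  using s_lim \<sigma>n_01
proof eventually_elim
  case (elim x)
  have "0 \<le> s x" using elim(1) by (rule LIMSEQ_le_const) (use elim(2) in auto)
  moreover have "s x \<le> 1" using elim(1) by (rule LIMSEQ_le_const2) (use elim(2) in auto)
  ultimately show ?case by simp
qed

lemma s_bound: "AE x in lebesgue. \<bar>s x\<bar> \<le> 1"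
  using s_01 by eventually_elim simp

lemma s_integrable:
  assumes "E \<in> sets lebesgue" "emeasure lebesgue E < \<infinity>"
  shows "integrable lebesgue (\<lambda>x. indicator E x * s x)"
  by (rule integrable_indicator_bounded[OF assms s_m s_bound])

lemma integral_\<sigma>n_lim:
  assumes E: "E \<in> sets lebesgue" "emeasure lebesgue E < \<infinity>"
  shows "(\<lambda>j. LINT x|lebesgue. indicator E x * \<sigma>n j x) \<longlonglongrightarrow> (LINT x|lebesgue. indicator E x * s x)"
proof (rule integral_dominated_convergence)
  show "integrable lebesgue (indicator E :: _ \<Rightarrow> real)" using E by (intro integrable_real_indicator)
  show "AE x in lebesgue. (\<lambda>j. indicator E x * \<sigma>n j x) \<longlonglongrightarrow> indicator E x * s x"
    using s_lim by eventually_elim (intro tendsto_intros)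
  show "AE x in lebesgue. norm (indicator E x * \<sigma>n j x) \<le> indicator E x" for j
    using \<sigma>n_bound[of j] by eventually_elim (auto simp: indicator_def)
qed (use E \<sigma>n_m s_m in \<open>auto intro!: borel_measurable_times borel_measurable_indicator\<close>)

text \<open>The projections to the increasing spaces \<open>Yn j\<close> converge to the projection
  \<open>p\<close> to the closure of their union: each is the best approximation of \<open>p\<close>
  in its space, and \<open>p\<close> can be approximated from the union.\<close>

lemma s_proj:
  assumes E: "E \<in> sets lebesgue" "E \<subseteq> ball c r0"
    and p: "p \<in> W" "\<And>w. w \<in> W \<Longrightarrow> L2_inner (\<lambda>x. indicator E x - p x) w = 0"
  shows "(LINT x|lebesgue. indicator E x * s x) = (L2_norm p)\<^sup>2"
proof -
  have EL: "(indicator E :: _ \<Rightarrow> complex) \<in> L2"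
    by (rule indicator_L2[OF E(1) emeasure_ball_finite[OF E]])
  have pL: "p \<in> L2" by (rule closed_subspace_L2[OF W p(1)])
  have "\<exists>q\<in>Yn j. (\<forall>y\<in>Yn j. L2_inner (\<lambda>x. indicator E x - q x) y = 0) \<and>
    (LINT x|lebesgue. indicator E x * \<sigma>n j x) = (L2_norm q)\<^sup>2" for j
    by (rule \<sigma>n_proj[OF E])
  then obtain q where q: "\<And>j. q j \<in> Yn j"
    "\<And>j y. y \<in> Yn j \<Longrightarrow> L2_inner (\<lambda>x. indicator E x - q j x) y = 0"
    "\<And>j. (LINT x|lebesgue. indicator E x * \<sigma>n j x) = (L2_norm (q j))\<^sup>2"
    by metis
  have qL: "q j \<in> L2" for j using q(1)[of j] by (simp add: Yn_def)
  have orth: "L2_inner (\<lambda>x. p x - q j x) y = 0" if y: "y \<in> Yn j" for j y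
  proof -
    have yL: "y \<in> L2" using y by (simp add: Yn_def)
    have "L2_inner (\<lambda>x. indicator E x - p x) y = 0" using y Yn_W by (intro p(2)) blast
    moreover have "L2_inner (\<lambda>x. indicator E x - q j x) y = 0" by (rule q(2)[OF y])
    ultimately show ?thesis using EL pL qL yL by (simp add: L2_inner_diff_left)
  qed
  have best: "L2_norm (\<lambda>x. q j x - p x) \<le> L2_norm (\<lambda>x. y x - p x)" if y: "y \<in> Yn j" for j y
  proof -
    have yL: "y \<in> L2" using y by (simp add: Yn_def)
    have d: "(\<lambda>x. p x - q j x) \<in> L2" "(\<lambda>x. q j x - y x) \<in> L2" by (intro L2_diff pL qL yL)+
    have "L2_inner (\<lambda>x. p x - q j x) (\<lambda>x. q j x - y x) = 0"
      using orth[OF y] orth[OF q(1)] by (simp add: L2_inner_diff_right[OF qL yL d(1)])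
    then have "(L2_norm (\<lambda>x. p x - y x))\<^sup>2 = (L2_norm (\<lambda>x. p x - q j x))\<^sup>2 + (L2_norm (\<lambda>x. q j x - y x))\<^sup>2"
      using L2_norm_add_sq[OF d] by simp
    then have "(L2_norm (\<lambda>x. p x - q j x))\<^sup>2 \<le> (L2_norm (\<lambda>x. p x - y x))\<^sup>2" by simp
    then have "L2_norm (\<lambda>x. p x - q j x) \<le> L2_norm (\<lambda>x. p x - y x)" by (rule power2_le_imp_le) simp
    then show ?thesis by (simp only: L2_norm_minus_commute[of p])
  qed
  have "L2_tendsto q p"
    unfolding L2_tendsto_def
  proof (intro conjI allI qL pL LIMSEQ_I)
    fix e :: real assume "0 < e"
    then obtain y where y: "y \<in> (\<Union>n. Yn n)" "L2_norm (\<lambda>x. y x - p x) < e"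
      using L2_closure_approx[of p "\<Union>n. Yn n" e] p(1) unfolding W_def by blast
    then obtain i where i: "y \<in> Yn i" by auto
    have "norm (L2_norm (\<lambda>x. q j x - p x) - 0) < e" if "j \<ge> i" for j
      using best[of y j] i Yn_mono[OF that] y(2) by auto
    then show "\<exists>no. \<forall>n\<ge>no. norm (L2_norm (\<lambda>x. q n x - p x) - 0) < e" by blast
  qed
  from tendsto_power[OF L2_tendsto_norm[OF this], of 2]
  have "(\<lambda>j. LINT x|lebesgue. indicator E x * \<sigma>n j x) \<longlonglongrightarrow> (L2_norm p)\<^sup>2"
    by (simp only: q(3))
  with integral_\<sigma>n_lim[OF E(1) emeasure_ball_finite[OF E]] show ?thesis by (rule LIMSEQ_unique)
qed

lemma W_projection:
  assumes "E \<in> sets lebesgue" "E \<subseteq> ball c r0"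
  shows "\<exists>p\<in>W. \<forall>w\<in>W. L2_inner (\<lambda>x. indicator E x - p x) w = 0"
  by (rule L2_projection[OF W indicator_L2[OF assms(1) emeasure_ball_finite[OF assms]]])

lemma s_dichotomy: "AE x in lebesgue. s x = 0 \<or> s x = 1"
proof (rule AE_ball_cover[OF r0(1)])
  fix \<theta> :: "real^'n"
  define E where "E = ball \<theta> r0"
  have E: "E \<in> sets lebesgue" "E \<subseteq> ball \<theta> r0" by (simp_all add: E_def)
  note Efin = emeasure_ball_finite[OF E]
  have EL: "(indicator E :: _ \<Rightarrow> complex) \<in> L2" by (rule indicator_L2[OF E(1) Efin])
  obtain p where p: "p \<in> W" "\<And>w. w \<in> W \<Longrightarrow> L2_inner (\<lambda>x. indicator E x - p x) w = 0"
    using W_projection[OF E] by blast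
  have pL: "p \<in> L2" by (rule closed_subspace_L2[OF W p(1)])
  define q where "q x = indicator E x - p x" for x
  have qL: "q \<in> L2" unfolding q_def by (rule L2_diff[OF EL pL])
  \<comment> \<open>\<open>q\<close> is orthogonal to \<open>W\<close>, and \<open>W\<close>
    contains \<open>indicator F * p\<close> for every bounded \<open>F\<close>.\<close>
  have pq: "AE x in lebesgue. p x * cnj (q x) = 0"
  proof (rule AE_ball_cover[OF zero_less_one])
    fix \<eta> :: "real^'n"
    show "AE x in lebesgue. x \<in> ball \<eta> 1 \<longrightarrow> p x * cnj (q x) = 0"
    proof (rule integral_zero_test[OF L2_inner_integrable[OF pL qL]])
      show "ball \<eta> 1 \<in> sets lebesgue" by simp
      fix F assume F: "F \<in> sets lebesgue" "F \<subseteq> ball \<eta> 1"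
      have "(\<lambda>x. indicator F x * p x) \<in> W"
        by (rule W_indicator[OF F(1) bounded_subset[OF bounded_ball F(2)] p(1)])
      then have "L2_inner q (\<lambda>x. indicator F x * p x) = 0" unfolding q_def by (rule p(2))
      then have "L2_inner (\<lambda>x. indicator F x * p x) q = 0" by (subst L2_inner_commute) simp
      then show "(LINT x|lebesgue. indicator F x * (p x * cnj (q x))) = 0"
        by (simp add: L2_inner_def mult.assoc)
    qed
  qed
  \<comment> \<open>Multiplication by \<open>indicator F\<close> preserves \<open>W\<close> and its
    orthogonal complement, so \<open>indicator F * p\<close> is the projection of
    \<open>indicator F\<close>. Hence \<open>s\<close> and the squared modulus of \<open>p\<close>
    have equal integrals over all subsets of \<open>E\<close>.\<close>
  have int: "(LINT x|lebesgue. indicator F x * s x) = (LINT x|lebesgue. indicator F x * (cmod (p x))\<^sup>2)"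
    if F: "F \<in> sets lebesgue" "F \<subseteq> E" for F
  proof -
    have Fb: "bounded F" using F(2) by (auto simp: E_def intro: bounded_subset[OF bounded_ball])
    have Fs: "F \<subseteq> ball \<theta> r0" using F(2) by (simp add: E_def)
    have "(LINT x|lebesgue. indicator F x * s x) = (L2_norm (\<lambda>x. indicator F x * p x))\<^sup>2"
    proof (rule s_proj[OF F(1) Fs W_indicator[OF F(1) Fb p(1)]])
      fix w assume w: "w \<in> W"
      have "(\<lambda>x. indicator F x - indicator F x * p x) = (\<lambda>x. indicator F x * q x)"
        using F(2) by (auto simp: fun_eq_iff q_def indicator_def)
      then have "L2_inner (\<lambda>x. indicator F x - indicator F x * p x) w
          = L2_inner q (\<lambda>x. cnj (indicator F x) * w x)" by (simp only: L2_inner_move)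
      also have "(\<lambda>x. cnj (indicator F x) * w x) = (\<lambda>x. indicator F x * w x)"
        by (simp add: fun_eq_iff indicator_def)
      also have "L2_inner q (\<lambda>x. indicator F x * w x) = 0"
        unfolding q_def by (rule p(2)[OF W_indicator[OF F(1) Fb w]])
      finally show "L2_inner (\<lambda>x. indicator F x - indicator F x * p x) w = 0" .
    qed
    also have "\<dots> = (LINT x|lebesgue. indicator F x * (cmod (p x))\<^sup>2)"
      unfolding L2_norm_sq by (rule Bochner_Integration.integral_cong) (auto simp: indicator_def)
    finally show ?thesis .
  qed
  have ip: "integrable lebesgue (\<lambda>x. indicator F x * (cmod (p x))\<^sup>2)" if "F \<in> sets lebesgue" for F
    using integrable_mult_indicator[OF that L2_integrable[OF pL]] by (simp add: mult.commute)
  have "AE x in lebesgue. x \<in> E \<longrightarrow> complex_of_real (indicator E x * s x - indicator E x * (cmod (p x))\<^sup>2) = 0"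
  proof (rule integral_zero_test[OF _ E(1)])
    show "integrable lebesgue (\<lambda>x. complex_of_real (indicator E x * s x - indicator E x * (cmod (p x))\<^sup>2))"
      by (intro integrable_of_real Bochner_Integration.integrable_diff s_integrable[OF E(1) Efin] ip E)
    fix F assume F: "F \<in> sets lebesgue" "F \<subseteq> E"
    have Ffin: "emeasure lebesgue F < \<infinity>" using F(2) by (intro emeasure_ball_finite[OF F(1), of \<theta> r0]) (simp add: E_def)
    have "(\<lambda>x. indicator F x * complex_of_real (indicator E x * s x - indicator E x * (cmod (p x))\<^sup>2))
       = (\<lambda>x. complex_of_real (indicator F x * s x - indicator F x * (cmod (p x))\<^sup>2))"
      using F(2) by (auto simp: fun_eq_iff indicator_def)
    then have "(LINT x|lebesgue. indicator F x * complex_of_real (indicator E x * s x - indicator E x * (cmod (p x))\<^sup>2))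
       = complex_of_real (LINT x|lebesgue. indicator F x * s x - indicator F x * (cmod (p x))\<^sup>2)"
      by (simp only: integral_complex_of_real)
    also have "(LINT x|lebesgue. indicator F x * s x - indicator F x * (cmod (p x))\<^sup>2) = 0"
      by (simp add: Bochner_Integration.integral_diff[OF s_integrable[OF F(1) Ffin] ip[OF F(1)]] int[OF F])
    finally show "(LINT x|lebesgue. indicator F x * complex_of_real (indicator E x * s x - indicator E x * (cmod (p x))\<^sup>2)) = 0"
      by simp
  qed
  with pq show "AE x in lebesgue. x \<in> ball \<theta> r0 \<longrightarrow> s x = 0 \<or> s x = 1"
  proof eventually_elim
    case (elim x)
    show ?case
    proof
      assume x: "x \<in> ball \<theta> r0"
      then have "x \<in> E" by (simp add: E_def)
      then have "complex_of_real (s x - (cmod (p x))\<^sup>2) = 0" using elim(2) by simp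
      then have "s x = (cmod (p x))\<^sup>2" unfolding of_real_eq_0_iff by simp
      \<comment> \<open>On \<open>E\<close> the function \<open>q\<close> is \<open>1 - p\<close>,
        so a vanishing product leaves only these two values.\<close>
      moreover have "p x = 0 \<or> p x = 1" using elim(1) \<open>x \<in> E\<close> by (auto simp: q_def)
      ultimately show "s x = 0 \<or> s x = 1" by auto
    qed
  qed
qed

end

section \<open>Pointwise and averaged conditions at the origin\<close>

context expanding
begin

lemma inv_B: "inv B = R"
  by (rule inv_equality) (simp_all add: B_R R_B)

lemma int_funpow_neg [simp]: "int_funpow B (- int j) = R ^^ j"
  by (cases "j = 0") (simp_all add: int_funpow_def inv_B)

lemma int_funpow_nonneg: "int_funpow B (int j) = B ^^ j"
  by (simp add: int_funpow_def)

lemma int_funpow_cases: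
  obtains n where "int_funpow B j = B ^^ n" | n where "int_funpow B j = R ^^ n"
  using that by (cases "0 \<le> j") (auto simp: int_funpow_def inv_B)

lemma Bn_image_iff: "x \<in> (B ^^ n) ` S \<longleftrightarrow> (R ^^ n) x \<in> S"
proof
  assume "(R ^^ n) x \<in> S"
  then show "x \<in> (B ^^ n) ` S" by (intro image_eqI[of _ _ "(R ^^ n) x"]) simp_all
qed auto

lemma Rn_image_iff: "x \<in> (R ^^ n) ` S \<longleftrightarrow> (B ^^ n) x \<in> S"
proof
  assume "(B ^^ n) x \<in> S"
  then show "x \<in> (R ^^ n) ` S" by (intro image_eqI[of _ _ "(B ^^ n) x"]) simp_all
qed auto

lemma dR_pos: "0 < dR ^ j"
  by (rule rescales_pos[OF rescales_Rn])

lemma dR_nonzero: "dR \<noteq> 0"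
  using dR_pos[of 1] by simp

lemma measure_Rn_image:
  assumes "S \<in> sets lebesgue"
  shows "measure lebesgue ((R ^^ j) ` S) = dR ^ j * measure lebesgue S"
  using Rn_image(2)[OF assms, of j] less_imp_le[OF dR_pos[of j]]
  by (simp add: measure_def enn2real_mult del: emeasure_completion)

end

locale spectral_set = spectral B R Y \<sigma> for B R :: "real^'n \<Rightarrow> real^'n" and Y \<sigma> +
  fixes G :: "(real^'n) set"
  assumes G: "G \<in> sets lebesgue" and G_pos: "emeasure lebesgue G > 0"
    and B_G: "B ` G = G" and supp_G: "ae_subset (Supp \<sigma>) G"
begin

lemma R_G: "R x \<in> G \<longleftrightarrow> x \<in> G"
  using B_G B_R R_B by (metis imageE imageI)

lemma Rn_G [simp]: "(R ^^ j) x \<in> G \<longleftrightarrow> x \<in> G"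
  by (induction j) (simp_all add: R_G)

lemma Bn_G [simp]: "(B ^^ j) x \<in> G \<longleftrightarrow> x \<in> G"
  using Rn_G[of j "(B ^^ j) x"] by simp

definition full :: bool where
  "full \<longleftrightarrow> (AE x in lebesgue. x \<in> G \<longrightarrow> s x = 1)"

lemma s_ge: "AE x in lebesgue. \<forall>j. \<sigma>n j x \<le> s x"
  using \<sigma>n_mono s_lim
proof eventually_elim
  case (elim x)
  show ?case using incseq_le[OF elim] by simp
qed

text \<open>By monotonicity a single nonzero value makes the limit positive, and a positive limit is
  1 by \<open>s_dichotomy\<close>.\<close>

lemma s_pos_iff: "AE x in lebesgue. (\<exists>j. \<sigma>n j x \<noteq> 0) \<longleftrightarrow> s x = 1"
  using s_ge \<sigma>n_01 s_lim s_dichotomy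
proof eventually_elim
  case (elim x)
  show ?case
  proof
    assume "\<exists>j. \<sigma>n j x \<noteq> 0"
    then obtain j where "\<sigma>n j x \<noteq> 0" by blast
    then have "0 < \<sigma>n j x" using elim(2) by (simp add: order_less_le)
    then have "0 < s x" using elim(1)[rule_format, of j] by linarith
    then show "s x = 1" using elim(4) by auto
  next
    assume "s x = 1"
    show "\<exists>j. \<sigma>n j x \<noteq> 0"
    proof (rule ccontr)
      assume "\<nexists>j. \<sigma>n j x \<noteq> 0"
      then have "(\<lambda>j. \<sigma>n j x) \<longlonglongrightarrow> 0" by simp
      with elim(3) have "s x = 0" by (rule LIMSEQ_unique)
      then show False using \<open>s x = 1\<close> by simp
    qed
  qed
qed

lemma limit_one_iff: "AE x in lebesgue. (\<lambda>j. \<sigma>n j x) \<longlonglongrightarrow> 1 \<longleftrightarrow> s x = 1"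
  using s_lim by eventually_elim (auto dest: LIMSEQ_unique)

lemma limit_pos_iff: "AE x in lebesgue. (\<exists>l>0. (\<lambda>j. \<sigma>n j x) \<longlonglongrightarrow> l) \<longleftrightarrow> s x = 1"
  using s_lim s_dichotomy
proof eventually_elim
  case (elim x)
  show ?case
  proof
    assume "\<exists>l>0. (\<lambda>j. \<sigma>n j x) \<longlonglongrightarrow> l"
    then obtain l where "0 < l" "(\<lambda>j. \<sigma>n j x) \<longlonglongrightarrow> l" by blast
    then have "0 < s x" using LIMSEQ_unique[OF elim(1)] by blast
    then show "s x = 1" using elim(2) by auto
  qed (use elim(1) in \<open>auto intro: exI[of _ 1]\<close>)
qed

lemma eventually_nonzero_iff: "AE x in lebesgue. (\<exists>j0::nat>0. \<forall>j\<ge>j0. \<sigma>n j x \<noteq> 0) \<longleftrightarrow> s x = 1"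
  using s_pos_iff \<sigma>n_mono \<sigma>n_01
proof eventually_elim
  case (elim x)
  have "\<exists>j0::nat>0. \<forall>j\<ge>j0. \<sigma>n j x \<noteq> 0" if "\<sigma>n i x \<noteq> 0" for i
  \<comment> \<open>\<open>Suc i\<close> instead of \<open>i\<close>, because the definition of
    absorption asks for a positive index.\<close>
  proof (intro exI[of _ "Suc i"] conjI allI impI)
    fix j assume "Suc i \<le> j"
    then have "\<sigma>n i x \<le> \<sigma>n j x" using incseqD[OF elim(2), of i j] by simp
    moreover have "0 < \<sigma>n i x" using that elim(3) by (simp add: order_less_le)
    ultimately show "\<sigma>n j x \<noteq> 0" by simp
  qed simp
  then show ?case using elim(1) by blast
qed

lemma AE_implies_full:
  assumes "AE x in lebesgue. P x \<longleftrightarrow> s x = 1"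
  shows "(AE x in lebesgue. x \<in> G \<longrightarrow> P x) \<longleftrightarrow> full"
  unfolding full_def by (rule eventually_subst) (use assms in \<open>eventually_elim, simp\<close>)

theorem absorbing_iff_full: "inv_absorbing B G (Supp \<sigma>) \<longleftrightarrow> full"
  using AE_implies_full[OF eventually_nonzero_iff] by (simp add: inv_absorbing_def Supp_def)

theorem limit_one_iff_full: "(AE x in lebesgue. x \<in> G \<longrightarrow> (\<lambda>j. \<sigma>n j x) \<longlonglongrightarrow> 1) \<longleftrightarrow> full"
  by (rule AE_implies_full[OF limit_one_iff])

theorem limit_pos_iff_full: "(AE x in lebesgue. x \<in> G \<longrightarrow> (\<exists>l>0. (\<lambda>j. \<sigma>n j x) \<longlonglongrightarrow> l)) \<longleftrightarrow> full"
  by (rule AE_implies_full[OF limit_pos_iff])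

text \<open>The values of \<sigma> along the orbit of \<open>R^j x\<close> are a tail of those along
  the orbit of \<open>x\<close>.\<close>

lemma s_inv: "AE x in lebesgue. \<forall>j. s ((R ^^ j) x) = s x"
proof -
  have "AE x in lebesgue. s ((R ^^ j) x) = s x" for j
    using rescales_AE[OF rescales_Rn s_lim, of j] s_lim
  proof eventually_elim
    case (elim x)
    have "(\<lambda>i. \<sigma>n (i + j) x) \<longlonglongrightarrow> s x" using elim(2) by (rule LIMSEQ_ignore_initial_segment)
    moreover have "\<sigma>n i ((R ^^ j) x) = \<sigma>n (i + j) x" for i by (simp add: funpow_add)
    ultimately show ?case using LIMSEQ_unique[OF elim(1)] by simp
  qed
  then show ?thesis by (simp add: AE_all_countable)
qed

text \<open>Almost every orbit keeps the value of \<open>s\<close>, and every orbit enters the ball,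
  so it suffices to look near the origin.\<close>

lemma full_of_ball:
  assumes "0 < r" "AE x in lebesgue. x \<in> G \<and> x \<in> ball 0 r \<longrightarrow> s x = 1"
  shows full
proof -
  have "AE x in lebesgue. \<forall>j. (R ^^ j) x \<in> G \<and> (R ^^ j) x \<in> ball 0 r \<longrightarrow> s ((R ^^ j) x) = 1"
    unfolding AE_all_countable using rescales_AE[OF rescales_Rn assms(2)] by blast
  then show ?thesis
    unfolding full_def using s_inv
  proof eventually_elim
    case (elim x)
    obtain j where "norm ((R ^^ j) x) < r"
      using eventually_happens'[OF sequentially_bot contract_point[OF assms(1)]] by blast
    then show ?case using elim(1)[rule_format, of j] elim(2) by simp
  qed
qed

text \<open>\<open>s\<close> is at most 1, so its integral can reach the measure of \<open>E\<close>
  only if \<open>s\<close> is 1 almost everywhere on \<open>E\<close>.\<close>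

lemma measure_one_full:
  assumes E: "E \<in> sets lebesgue" "emeasure lebesgue E < \<infinity>"
    and int: "(LINT x|lebesgue. indicator E x * s x) = measure lebesgue E"
  shows "AE x in lebesgue. x \<in> E \<longrightarrow> s x = 1"
proof -
  have i1: "integrable lebesgue (indicator E :: _ \<Rightarrow> real)"
    using E by (intro integrable_real_indicator)
  have i: "integrable lebesgue (\<lambda>x. indicator E x - indicator E x * s x)"
    by (intro Bochner_Integration.integrable_diff i1 s_integrable E)
  have "(LINT x|lebesgue. indicator E x - indicator E x * s x) = 0"
    unfolding Bochner_Integration.integral_diff[OF i1 s_integrable[OF E]] int using E(1) by simp
  moreover have "AE x in lebesgue. 0 \<le> indicator E x - indicator E x * s x"
    using s_01 by eventually_elim (auto simp: indicator_def)
  ultimately have "AE x in lebesgue. indicator E x - indicator E x * s x = 0"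
    using integral_nonneg_eq_0_iff_AE[OF i] by blast
  then show ?thesis by eventually_elim (auto simp: indicator_def)
qed

lemma integral_full:
  assumes "full" and E: "E \<in> sets lebesgue" "E \<subseteq> G"
  shows "(LINT x|lebesgue. indicator E x * s x) = measure lebesgue E"
proof -
  have "(LINT x|lebesgue. indicator E x * s x) = (LINT x|lebesgue. indicator E x)"
  proof (rule integral_cong_AE)
    show "AE x in lebesgue. indicator E x * s x = indicator E x"
      using assms(1) unfolding full_def
    proof eventually_elim
      case (elim x)
      then show ?case using E(2) by (auto simp: indicator_def)
    qed
  qed (use E s_m in \<open>auto intro!: borel_measurable_times borel_measurable_indicator\<close>)
  then show ?thesis using E by simp
qed

text \<open>Pulled back by \<open>R^j\<close>, the average of \<sigma> over \<open>R^j E\<close>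
  becomes the average of \<open>\<sigma>n j\<close> over the fixed set \<open>E\<close>, so it
  always converges, namely to the average of \<open>s\<close> over \<open>E\<close>. For the
  implication to \<open>full\<close> the set \<open>G \<inter> ball 0 1\<close> is enough by
  \<open>full_of_ball\<close>.\<close>

theorem average_iff_full:
  "(\<forall>E. E \<in> sets lebesgue \<and> bounded E \<and> E \<subseteq> G \<and> emeasure lebesgue E > 0 \<longrightarrow>
     (\<lambda>j. 1 / measure lebesgue ((R ^^ j) ` E) * (LINT \<xi>:(R ^^ j) ` E|lebesgue. \<sigma> \<xi>)) \<longlonglongrightarrow> 1) \<longleftrightarrow> full"
proof -
  have lim: "(\<lambda>j. 1 / measure lebesgue ((R ^^ j) ` E) * (LINT \<xi>:(R ^^ j) ` E|lebesgue. \<sigma> \<xi>))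
      \<longlonglongrightarrow> (LINT x|lebesgue. indicator E x * s x) / measure lebesgue E"
    if E: "E \<in> sets lebesgue" "bounded E" "emeasure lebesgue E > 0" for E
  proof -
    have fin: "emeasure lebesgue E < \<infinity>" by (rule emeasure_bounded_lebesgue[OF E(2,1)])
    have m: "0 < measure lebesgue E"
      using E(3) fin by (simp add: measure_def enn2real_positive_iff del: emeasure_completion)
    have "1 / measure lebesgue ((R ^^ j) ` E) * (LINT \<xi>:(R ^^ j) ` E|lebesgue. \<sigma> \<xi>)
        = (LINT x|lebesgue. indicator E x * \<sigma>n j x) / measure lebesgue E" for j
    proof -
      have "(LINT \<xi>:(R ^^ j) ` E|lebesgue. \<sigma> \<xi>) = (LINT x|lebesgue. indicator ((R ^^ j) ` E) x * \<sigma> x)"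
        by (simp add: set_lebesgue_integral_def)
      also have "\<dots> = (dR ^ j) *\<^sub>R (LINT x|lebesgue. indicator ((R ^^ j) ` E) ((R ^^ j) x) * \<sigma>n j x)"
        by (rule rescales_integral[OF rescales_Rn])
          (intro borel_measurable_times borel_measurable_indicator Rn_image E \<sigma>m)
      also have "(\<lambda>x. indicator ((R ^^ j) ` E) ((R ^^ j) x) * \<sigma>n j x) = (\<lambda>x. indicator E x * \<sigma>n j x)"
        by (simp add: fun_eq_iff indicator_def Rn_image_iff)
      finally show ?thesis
        unfolding measure_Rn_image[OF E(1)] by (simp add: dR_nonzero)
    qed
    then show ?thesis
      using tendsto_divide[OF integral_\<sigma>n_lim[OF E(1) fin] tendsto_const, of "measure lebesgue E"] m by simp
  qed
  show ?thesis
  proof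
    assume H: "\<forall>E. E \<in> sets lebesgue \<and> bounded E \<and> E \<subseteq> G \<and> emeasure lebesgue E > 0 \<longrightarrow>
     (\<lambda>j. 1 / measure lebesgue ((R ^^ j) ` E) * (LINT \<xi>:(R ^^ j) ` E|lebesgue. \<sigma> \<xi>)) \<longlonglongrightarrow> 1"
    define E where "E = G \<inter> ball 0 1"
    have E: "E \<in> sets lebesgue" "bounded E" "E \<subseteq> G" unfolding E_def using G by auto
    have fin: "emeasure lebesgue E < \<infinity>" by (rule emeasure_bounded_lebesgue[OF E(2,1)])
    have "AE x in lebesgue. x \<in> E \<longrightarrow> s x = 1"
    proof (cases "emeasure lebesgue E = 0")
      case True
      then have "AE x in lebesgue. x \<notin> E" using AE_false_measure[OF E(1)] by blast
      then show ?thesis by eventually_elim simp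
    next
      case False
      then have pos: "emeasure lebesgue E > 0" by (simp add: order_less_le del: emeasure_completion)
      have "(LINT x|lebesgue. indicator E x * s x) / measure lebesgue E = 1"
        using LIMSEQ_unique[OF lim[OF E(1,2) pos]] H E pos by blast
      then have "(LINT x|lebesgue. indicator E x * s x) = measure lebesgue E"
        by (cases "measure lebesgue E = 0") (simp_all add: field_simps)
      then show ?thesis by (rule measure_one_full[OF E(1) fin])
    qed
    then have "AE x in lebesgue. x \<in> G \<and> x \<in> ball 0 1 \<longrightarrow> s x = 1"
      by eventually_elim (simp add: E_def)
    then show full by (rule full_of_ball[OF zero_less_one])
  next
    assume full
    show "\<forall>E. E \<in> sets lebesgue \<and> bounded E \<and> E \<subseteq> G \<and> emeasure lebesgue E > 0 \<longrightarrow>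
     (\<lambda>j. 1 / measure lebesgue ((R ^^ j) ` E) * (LINT \<xi>:(R ^^ j) ` E|lebesgue. \<sigma> \<xi>)) \<longlonglongrightarrow> 1"
    proof (intro allI impI, elim conjE)
      fix E assume E: "E \<in> sets lebesgue" "bounded E" "E \<subseteq> G" "emeasure lebesgue E > 0"
      have "measure lebesgue E \<noteq> 0"
        using E(4) emeasure_bounded_lebesgue[OF E(2,1)]
        by (auto simp: measure_def enn2real_eq_0_iff simp del: emeasure_completion)
      then have "(LINT x|lebesgue. indicator E x * s x) / measure lebesgue E = 1"
        unfolding integral_full[OF \<open>full\<close> E(1,3)] by simp
      then show "(\<lambda>j. 1 / measure lebesgue ((R ^^ j) ` E) * (LINT \<xi>:(R ^^ j) ` E|lebesgue. \<sigma> \<xi>)) \<longlonglongrightarrow> 1"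
        using lim[OF E(1,2,4)] by simp
    qed
  qed
qed

section \<open>Proportions inside \<open>G\<close> near the origin\<close>

lemma G_ball: "G \<inter> ball 0 r \<in> sets lebesgue" "emeasure lebesgue (G \<inter> ball 0 r) < \<infinity>"
proof -
  show m: "G \<inter> ball 0 r \<in> sets lebesgue" using G by (intro sets.Int) auto
  show "emeasure lebesgue (G \<inter> ball 0 r) < \<infinity>"
    by (rule emeasure_ball_finite[OF m, of 0 r]) simp
qed

text \<open>If \<open>G\<close> were null near the origin, it would be null everywhere, since it is
  invariant and every orbit under \<open>R\<close> enters the ball. Hence the quotients in
  conditions (7) and (8) have positive denominators and no division by zero hides in them.\<close>

lemma measure_G_ball:
  assumes "0 < r"
  shows "0 < measure lebesgue (G \<inter> ball 0 r)"
proof (rule ccontr)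
  assume "\<not> 0 < measure lebesgue (G \<inter> ball 0 r)"
  then have "measure lebesgue (G \<inter> ball 0 r) = 0" by (simp add: order_less_le)
  then have "emeasure lebesgue (G \<inter> ball 0 r) = 0"
    using G_ball(2)[of r] by (auto simp: measure_def enn2real_eq_0_iff simp del: emeasure_completion)
  then have "AE x in lebesgue. x \<notin> G \<inter> ball 0 r" using AE_false_measure[OF G_ball(1)] by blast
  then have "AE x in lebesgue. \<forall>j. (R ^^ j) x \<notin> G \<inter> ball 0 r"
    unfolding AE_all_countable using rescales_AE[OF rescales_Rn] by blast
  then have "AE x in lebesgue. x \<notin> G"
  proof eventually_elim
    case (elim x)
    obtain j where "norm ((R ^^ j) x) < r"
      using eventually_happens'[OF sequentially_bot contract_point[OF assms]] by blast
    then show ?case using elim[rule_format, of j] by simp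
  qed
  then show False using AE_false_measure[OF G] G_pos by simp
qed

lemma Rn_ball_eq: "G \<inter> (R ^^ j) ` ball 0 r \<inter> Z = (R ^^ j) ` (G \<inter> ball 0 r \<inter> {x. (R ^^ j) x \<in> Z})"
  by (auto simp: Rn_image_iff)

lemma vimage_Rn_sets: "Z \<in> sets lebesgue \<Longrightarrow> {x. (R ^^ j) x \<in> Z} \<in> sets lebesgue"
  using measurable_sets[OF rescales_measurable[OF rescales_Rn], of Z j] by (simp add: vimage_def)

text \<open>As \<open>G\<close> is invariant, numerator and denominator both scale by
  \<open>dR ^ j\<close>. The shrinking domain is traded for the fixed set
  \<open>G \<inter> ball 0 r\<close>, on which dominated convergence applies.\<close>

lemma ratio:
  assumes Z: "Z \<in> sets lebesgue"
  shows "measure lebesgue (G \<inter> (R ^^ j) ` ball 0 r \<inter> Z) / measure lebesgue (G \<inter> (R ^^ j) ` ball 0 r)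
    = measure lebesgue (G \<inter> ball 0 r \<inter> {x. (R ^^ j) x \<in> Z}) / measure lebesgue (G \<inter> ball 0 r)"
proof -
  have "measure lebesgue (G \<inter> (R ^^ j) ` ball 0 r \<inter> Z) = dR ^ j * measure lebesgue (G \<inter> ball 0 r \<inter> {x. (R ^^ j) x \<in> Z})"
    unfolding Rn_ball_eq by (intro measure_Rn_image sets.Int[OF G_ball(1)] vimage_Rn_sets Z)
  moreover have "measure lebesgue (G \<inter> (R ^^ j) ` ball 0 r) = dR ^ j * measure lebesgue (G \<inter> ball 0 r)"
    using Rn_ball_eq[of j r UNIV] measure_Rn_image[OF G_ball(1), of j r] by simp
  ultimately show ?thesis by (simp add: dR_nonzero)
qed

lemma ratio_lim:
  assumes Z: "Z \<in> sets lebesgue" "Z' \<in> sets lebesgue" and r: "0 < r"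
    and lim: "AE x in lebesgue. x \<in> G \<longrightarrow> (\<forall>\<^sub>F j in sequentially. (R ^^ j) x \<in> Z \<longleftrightarrow> x \<in> Z')"
  shows "(\<lambda>j. measure lebesgue (G \<inter> (R ^^ j) ` ball 0 r \<inter> Z) / measure lebesgue (G \<inter> (R ^^ j) ` ball 0 r))
    \<longlonglongrightarrow> measure lebesgue (G \<inter> ball 0 r \<inter> Z') / measure lebesgue (G \<inter> ball 0 r)"
  unfolding ratio[OF Z(1)]
proof (intro tendsto_divide tendsto_const measure_tendsto_AE[OF G_ball])
  show "G \<inter> ball 0 r \<inter> {x. (R ^^ j) x \<in> Z} \<in> sets lebesgue" for j
    by (intro sets.Int[OF G_ball(1)] vimage_Rn_sets Z)
  show "G \<inter> ball 0 r \<inter> Z' \<in> sets lebesgue" by (intro sets.Int[OF G_ball(1)] Z)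
  show "AE x in lebesgue. \<forall>\<^sub>F j in sequentially. (x \<in> G \<inter> ball 0 r \<inter> {x. (R ^^ j) x \<in> Z}) \<longleftrightarrow> x \<in> G \<inter> ball 0 r \<inter> Z'"
    using lim
  proof eventually_elim
    case (elim x)
    show ?case
    proof (cases "x \<in> G")
      case True
      then have "\<forall>\<^sub>F j in sequentially. (R ^^ j) x \<in> Z \<longleftrightarrow> x \<in> Z'" using elim by blast
      then show ?thesis by (rule eventually_mono) auto
    qed simp
  qed
qed (use measure_G_ball[OF r] in auto)

lemma zero_set: "{x. \<sigma> x = 0} \<in> sets lebesgue" "{x. s x = 0} \<in> sets lebesgue"
proof -
  have "{x \<in> space lebesgue. \<sigma> x = 0} \<in> sets lebesgue" "{x \<in> space lebesgue. s x = 0} \<in> sets lebesgue"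
    by (intro borel_measurable_eq borel_measurable_const \<sigma>m s_m)+
  then show "{x. \<sigma> x = 0} \<in> sets lebesgue" "{x. s x = 0} \<in> sets lebesgue" by simp_all
qed

text \<open>Along almost every orbit \<sigma> is eventually nonzero if \<open>s\<close> is 1 and
  identically zero if \<open>s\<close> is 0. So the proportions of zeros always converge, and the
  limit is the proportion of \<open>s = 0\<close> in \<open>G \<inter> ball 0 1\<close>.\<close>

theorem locally_nonzero_iff_full: "locally_nonzero_at_0 G B \<sigma> \<longleftrightarrow> full"
proof -
  have eq: "{x \<in> G \<inter> (R ^^ j) ` ball 0 1. \<sigma> x = 0} = G \<inter> (R ^^ j) ` ball 0 1 \<inter> {x. \<sigma> x = 0}" for j
    by blast
  have lim: "(\<lambda>j. measure lebesgue (G \<inter> (R ^^ j) ` ball 0 1 \<inter> {x. \<sigma> x = 0}) / measure lebesgue (G \<inter> (R ^^ j) ` ball 0 1))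
    \<longlonglongrightarrow> measure lebesgue (G \<inter> ball 0 1 \<inter> {x. s x = 0}) / measure lebesgue (G \<inter> ball 0 1)"
  proof (rule ratio_lim[OF zero_set zero_less_one])
    show "AE x in lebesgue. x \<in> G \<longrightarrow> (\<forall>\<^sub>F j in sequentially. ((R ^^ j) x \<in> {x. \<sigma> x = 0}) \<longleftrightarrow> x \<in> {x. s x = 0})"
      using s_pos_iff eventually_nonzero_iff s_dichotomy
    proof eventually_elim
      case (elim x)
      show ?case
      proof (cases "s x = 1")
        case True
        then obtain j0 where "\<forall>j\<ge>j0. \<sigma>n j x \<noteq> 0" using elim(2) by blast
        then show ?thesis using True by (auto simp: eventually_sequentially)
      next
        case False
        then have "\<sigma>n j x = 0" for j using elim(1) by blast
        moreover have "s x = 0" using False elim(3) by blast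
        ultimately show ?thesis by simp
      qed
    qed
  qed
  have m: "G \<inter> ball 0 1 \<inter> {x. s x = 0} \<in> sets lebesgue" by (intro sets.Int[OF G_ball(1)] zero_set)
  have fin: "emeasure lebesgue (G \<inter> ball 0 1 \<inter> {x. s x = 0}) < \<infinity>"
    by (rule emeasure_ball_finite[OF m, of 0 1]) auto
  have "locally_nonzero_at_0 G B \<sigma> \<longleftrightarrow>
      measure lebesgue (G \<inter> ball 0 1 \<inter> {x. s x = 0}) / measure lebesgue (G \<inter> ball 0 1) = 0"
    unfolding locally_nonzero_at_0_def int_funpow_neg eq
  proof
    assume "(\<lambda>j. measure lebesgue (G \<inter> (R ^^ j) ` ball 0 1 \<inter> {x. \<sigma> x = 0}) / measure lebesgue (G \<inter> (R ^^ j) ` ball 0 1)) \<longlonglongrightarrow> 0"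
    with lim show "measure lebesgue (G \<inter> ball 0 1 \<inter> {x. s x = 0}) / measure lebesgue (G \<inter> ball 0 1) = 0"
      by (rule LIMSEQ_unique)
  next
    assume z: "measure lebesgue (G \<inter> ball 0 1 \<inter> {x. s x = 0}) / measure lebesgue (G \<inter> ball 0 1) = 0"
    show "(\<lambda>j. measure lebesgue (G \<inter> (R ^^ j) ` ball 0 1 \<inter> {x. \<sigma> x = 0}) / measure lebesgue (G \<inter> (R ^^ j) ` ball 0 1)) \<longlonglongrightarrow> 0"
      using lim unfolding z .
  qed
  also have "\<dots> \<longleftrightarrow> measure lebesgue (G \<inter> ball 0 1 \<inter> {x. s x = 0}) = 0"
    using measure_G_ball[OF zero_less_one] by simp
  also have "\<dots> \<longleftrightarrow> emeasure lebesgue (G \<inter> ball 0 1 \<inter> {x. s x = 0}) = 0"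
    using fin by (auto simp: measure_def enn2real_eq_0_iff simp del: emeasure_completion)
  also have "\<dots> \<longleftrightarrow> (AE x in lebesgue. x \<notin> G \<inter> ball 0 1 \<inter> {x. s x = 0})"
    by (rule AE_false_measure[OF m, symmetric])
  also have "\<dots> \<longleftrightarrow> full"
  proof
    assume "AE x in lebesgue. x \<notin> G \<inter> ball 0 1 \<inter> {x. s x = 0}"
    with s_dichotomy have "AE x in lebesgue. x \<in> G \<and> x \<in> ball 0 1 \<longrightarrow> s x = 1"
      by eventually_elim auto
    then show full by (rule full_of_ball[OF zero_less_one])
  next
    assume full
    then show "AE x in lebesgue. x \<notin> G \<inter> ball 0 1 \<inter> {x. s x = 0}"
      unfolding full_def by eventually_elim auto
  qed
  finally show ?thesis .
qed

end

section \<open>Approximate continuity at the origin\<close>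

context spectral_set
begin

text \<open>Used in contraposition: a point of norm at least \<open>e\<close> needs more than
  \<open>n\<close> applications of \<open>R\<close> to enter the ball of radius \<delta>.\<close>

lemma Bn_small_near_0:
  assumes "0 < e"
  shows "\<exists>\<delta>>0. \<delta> \<le> e \<and> (\<forall>i\<le>n. \<forall>x. norm x < \<delta> \<longrightarrow> norm ((B ^^ i) x) < e)"
proof -
  have lin: "linear (B ^^ i)" for i
  proof (induction i)
    case 0
    show ?case by (simp add: linear_id[unfolded id_def] id_def)
  next
    case (Suc i)
    then show ?case using linear_compose[OF Suc linear_B] by (simp add: o_def)
  qed
  have "\<exists>K>0. \<forall>x. norm ((B ^^ i) x) \<le> K * norm x" for i
    using linear_bounded_pos[OF lin[of i]] by metis
  then obtain K where K: "\<And>i. 0 < K i" "\<And>i x. norm ((B ^^ i) x) \<le> K i * norm x" by metis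
  define C where "C = 1 + (\<Sum>i\<le>n. K i)"
  have C1: "1 \<le> C" unfolding C_def using K(1) by (simp add: sum_nonneg less_imp_le)
  show ?thesis
  proof (intro exI[of _ "e / C"] conjI allI impI)
    show "0 < e / C" using C1 assms by simp
    show "e / C \<le> e" using C1 assms by (simp add: divide_le_eq)
    fix i and x :: "real^'n" assume i: "i \<le> n" and x: "norm x < e / C"
    have "K i \<le> (\<Sum>i\<le>n. K i)" using K(1) i by (intro member_le_sum) (auto intro: less_imp_le)
    then have "K i \<le> C" by (simp add: C_def)
    have "norm ((B ^^ i) x) \<le> K i * norm x" by (rule K(2))
    also have "\<dots> \<le> C * norm x" using \<open>K i \<le> C\<close> by (intro mult_right_mono) auto
    also have "\<dots> < C * (e / C)" using x C1 by (intro mult_strict_left_mono) auto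
    also have "\<dots> = e" using C1 by simp
    finally show "norm ((B ^^ i) x) < e" .
  qed
qed

text \<open>The set is cut out near the origin by the conditions \<open>\<sigma> > 1 - 1 / (n + 1)\<close> on balls of radius \<open>\<epsilon> n\<close>.
  By Borel--Cantelli almost every point of \<open>G\<close> satisfies \<open>\<sigma> (R\<^sup>j x) > 1 - 1 / (n + 1)\<close> for all \<open>j \<ge> k n\<close> once
  \<open>n\<close> is large, and \<open>\<epsilon> n\<close> is so small that \<open>R\<^sup>j x\<close> enters the ball only for \<open>j > k n\<close>.\<close>

lemma full_imp_approx_continuous:
  assumes full
  shows "approx_continuous_at_0 G B (\<sigma>(0 := 1))"
proof -
  have lim1: "AE x in lebesgue. x \<in> G \<longrightarrow> (\<lambda>j. \<sigma>n j x) \<longlonglongrightarrow> 1"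
    using assms limit_one_iff_full by blast
  define t where "t n = 1 - 1 / real (Suc n)" for n
  define X where "X n j = G \<inter> ball 0 1 \<inter> {x \<in> space lebesgue. \<sigma>n j x \<le> t n}" for n j
  have t1: "t n < 1" for n by (simp add: t_def)
  have t_mono: "t m \<le> t n" if "m \<le> n" for m n using that by (simp add: t_def frac_le)
  have Xm: "X n j \<in> sets lebesgue" for n j
    unfolding X_def by (intro sets.Int[OF G_ball(1)] borel_measurable_le \<sigma>n_m borel_measurable_const)
  have Xlim: "(\<lambda>j. measure lebesgue (X n j)) \<longlonglongrightarrow> measure lebesgue ({} :: (real^'n) set)" for n
  proof (rule measure_tendsto_AE[OF G_ball Xm])
    show "X n j \<subseteq> G \<inter> ball 0 1" for j by (auto simp: X_def)
    show "AE x in lebesgue. \<forall>\<^sub>F j in sequentially. (x \<in> X n j) \<longleftrightarrow> x \<in> {}"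
      using lim1
    proof eventually_elim
      case (elim x)
      show ?case
      proof (cases "x \<in> G")
        case True
        then have "\<forall>\<^sub>F j in sequentially. t n < \<sigma>n j x"
          using order_tendstoD(1)[OF _ t1] elim by blast
        then show ?thesis by (rule eventually_mono) (auto simp: X_def)
      qed (simp add: X_def)
    qed
  qed simp
  have "\<exists>j. measure lebesgue (X n j) < (1/2)^n" for n
    using order_tendstoD(2)[OF Xlim, of "(1/2)^n" n] by (auto simp: eventually_sequentially)
  then obtain k where k: "\<And>n. measure lebesgue (X n (k n)) < (1/2)^n" by metis
  have "AE x in lebesgue. \<forall>\<^sub>F n in sequentially. x \<in> space lebesgue - X n (k n)"
  proof (rule borel_cantelli_AE1)
    show "X n (k n) \<in> sets lebesgue" for n by (rule Xm)
    show "emeasure lebesgue (X n (k n)) < \<infinity>" for n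
      by (rule emeasure_ball_finite[OF Xm, of _ _ 0 1]) (auto simp: X_def)
    show "summable (\<lambda>n. measure lebesgue (X n (k n)))"
    proof (rule summable_comparison_test'[of "\<lambda>n. (1/2::real)^n" 0])
      show "summable (\<lambda>n. (1/2::real)^n)" by (rule summable_geometric) simp
      show "norm (measure lebesgue (X n (k n))) \<le> (1/2)^n" for n using k[of n] by simp
    qed
  qed
  \<comment> \<open>Borel--Cantelli controls only the scale \<open>k n\<close>; monotonicity of
    \<open>\<sigma>n\<close> extends the bound to all later ones.\<close>
  then have BC: "AE x in lebesgue. x \<in> G \<inter> ball 0 1 \<longrightarrow> (\<exists>m. \<forall>n\<ge>m. \<forall>j\<ge>k n. t n < \<sigma>n j x)"
    using \<sigma>n_mono
  proof eventually_elim
    case (elim x)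
    obtain m where m: "\<And>n. n \<ge> m \<Longrightarrow> x \<notin> X n (k n)" using elim(1) by (auto simp: eventually_sequentially)
    show ?case
    proof (intro impI exI[of _ m] allI)
      fix n j assume x: "x \<in> G \<inter> ball 0 1" and n: "m \<le> n" and j: "k n \<le> j"
      have "t n < \<sigma>n (k n) x" using m[OF n] x by (auto simp: X_def)
      also have "\<dots> \<le> \<sigma>n j x" by (rule incseqD[OF elim(2) j])
      finally show "t n < \<sigma>n j x" .
    qed
  qed
  have "\<exists>\<delta>>0. \<delta> \<le> 1 / real (Suc n) \<and> (\<forall>i\<le>k n. \<forall>x. norm x < \<delta> \<longrightarrow> norm ((B ^^ i) x) < 1 / real (Suc n))" for n
    by (rule Bn_small_near_0) simp
  then obtain \<epsilon> where \<epsilon>: "\<And>n. 0 < \<epsilon> n"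
    "\<And>n i x. i \<le> k n \<Longrightarrow> norm x < \<epsilon> n \<Longrightarrow> norm ((B ^^ i) x) < 1 / real (Suc n)" by metis
  \<comment> \<open>The points of norm at least 1 secure positive measure. The condition
    \<open>\<sigma> x \<le> 1\<close> makes \<open>t n < \<sigma> x\<close> a bound for the distance
    of \<open>\<sigma> x\<close> from 1.\<close>
  define E where "E = {x. 1 \<le> norm x \<or> (\<sigma> x \<le> 1 \<and> (\<forall>n. norm x < \<epsilon> n \<longrightarrow> t n < \<sigma> x))}"
  have Em: "E \<in> sets lebesgue"
  proof -
    have "E = - ball 0 1 \<union> ({x \<in> space lebesgue. \<sigma> x \<le> 1} \<inter> (\<Inter>n. - ball 0 (\<epsilon> n) \<union> {x \<in> space lebesgue. t n < \<sigma> x}))"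
      by (auto simp: E_def)
    also have "\<dots> \<in> sets lebesgue"
      by (intro sets.Un sets.Int sets.countable_INT'' borel_measurable_le borel_measurable_less \<sigma>m borel_measurable_const)
        auto
    finally show ?thesis .
  qed
  have "emeasure lebesgue E > 0"
  proof (rule ccontr)
    assume "\<not> emeasure lebesgue E > 0"
    then have "emeasure lebesgue E = 0" by (simp add: order_less_le del: emeasure_completion)
    moreover have "emeasure lebesgue (UNIV :: (real^'n) set) \<le> emeasure lebesgue E + emeasure lebesgue (ball (0::real^'n) 1)"
      using Em by (intro order.trans[OF emeasure_mono[of UNIV "E \<union> ball 0 1"] emeasure_subadditive]) (auto simp: E_def)
    moreover have "emeasure lebesgue (ball (0::real^'n) 1) < \<infinity>"
      by (intro emeasure_bounded_lebesgue) auto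
    ultimately show False by simp
  qed
  moreover have "density_at_0 G B E"
    unfolding density_at_0_def int_funpow_neg
  proof (intro allI impI)
    fix r :: real assume r: "0 < r"
    have in_E: "AE x in lebesgue. x \<in> G \<inter> ball 0 1 \<longrightarrow> (\<forall>\<^sub>F j in sequentially. (R ^^ j) x \<in> E)"
      using BC \<sigma>n_01 lim1 AE_false_measure[of "{0::real^'n}"]
    proof -
      have "AE x in lebesgue. x \<notin> {0::real^'n}" using AE_false_measure[of "{0::real^'n}"] by simp
      with BC \<sigma>n_01 lim1 show ?thesis
      proof eventually_elim
        case (elim x)
        show ?case
        proof
          assume x: "x \<in> G \<inter> ball 0 1"
          then obtain m where m: "\<And>n j. n \<ge> m \<Longrightarrow> j \<ge> k n \<Longrightarrow> t n < \<sigma>n j x" using elim(1) by blast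
          have "0 < norm x" using elim(4) by simp
          \<comment> \<open>Once \<open>n\<close> is at least \<open>m'\<close>, a point of norm
            above \<open>1 / real (Suc m')\<close> enters the ball of radius
            \<open>\<epsilon> n\<close> only after step \<open>k n\<close>, where the
            Borel--Cantelli bound holds. Indices below \<open>M\<close> are covered by the eventual
            bound \<open>t M\<close>, as \<open>t\<close> is increasing; this is why
            \<open>x = 0\<close> had to be removed.\<close>
          then obtain m' where m': "1 / real (Suc m') < norm x"
            using reals_Archimedean[of "norm x"] by (auto simp: inverse_eq_divide)
          define M where "M = max m m'"
          have "\<forall>\<^sub>F j in sequentially. t M < \<sigma>n j x"
            using order_tendstoD(1)[OF _ t1] elim(3) x by blast
          then show "\<forall>\<^sub>F j in sequentially. (R ^^ j) x \<in> E"
          proof (rule eventually_mono)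
            fix j assume j: "t M < \<sigma>n j x"
            have "t n < \<sigma>n j x" if n: "norm ((R ^^ j) x) < \<epsilon> n" for n
            proof (cases "n \<ge> M")
              case True
              have "\<not> j \<le> k n"
              proof
                assume "j \<le> k n"
                from \<epsilon>(2)[OF this n] have "norm x < 1 / real (Suc n)" by simp
                also have "\<dots> \<le> 1 / real (Suc m')" using True by (simp add: M_def frac_le)
                finally show False using m' by simp
              qed
              then show ?thesis using m[of n j] True by (simp add: M_def)
            next
              case False
              then have "t n \<le> t M" by (intro t_mono) simp
              then show ?thesis using j by simp
            qed
            then show "(R ^^ j) x \<in> E" using elim(2) by (simp add: E_def)
          qed
        qed
      qed
    qed
    \<comment> \<open>So far only points of the unit ball are treated. Every orbit in
      \<open>G\<close> is there after some \<open>i\<close> steps, and eventual membership is not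
      changed by dropping the first \<open>i\<close> terms.\<close>
    have "AE x in lebesgue. \<forall>i. (R ^^ i) x \<in> G \<inter> ball 0 1 \<longrightarrow> (\<forall>\<^sub>F j in sequentially. (R ^^ j) ((R ^^ i) x) \<in> E)"
      unfolding AE_all_countable using rescales_AE[OF rescales_Rn in_E] by blast
    then have "AE x in lebesgue. x \<in> G \<longrightarrow> (\<forall>\<^sub>F j in sequentially. ((R ^^ j) x \<in> E) \<longleftrightarrow> x \<in> UNIV)"
    proof eventually_elim
      case (elim x)
      show ?case
      proof
        assume x: "x \<in> G"
        obtain i where "norm ((R ^^ i) x) < 1"
          using eventually_happens'[OF sequentially_bot contract_point[OF zero_less_one]] by blast
        then have "\<forall>\<^sub>F j in sequentially. (R ^^ j) ((R ^^ i) x) \<in> E" using elim x by simp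
        then have "\<forall>\<^sub>F j in sequentially. (R ^^ (j + i)) x \<in> E" by (simp add: funpow_add)
        then have "\<forall>\<^sub>F j in sequentially. (R ^^ j) x \<in> E"
          by (rule iffD1[OF eventually_sequentially_seg[of "\<lambda>j. (R ^^ j) x \<in> E" i]])
        then show "\<forall>\<^sub>F j in sequentially. ((R ^^ j) x \<in> E) \<longleftrightarrow> x \<in> UNIV" by simp
      qed
    qed
    from ratio_lim[OF Em _ r this]
    show "(\<lambda>j. measure lebesgue (E \<inter> G \<inter> (R ^^ j) ` ball 0 r) / measure lebesgue (G \<inter> (R ^^ j) ` ball 0 r)) \<longlonglongrightarrow> 1"
      using measure_G_ball[OF r] by (simp add: Int_ac)
  qed
  moreover have "((\<sigma>(0 := 1)) \<longlongrightarrow> (\<sigma>(0 := 1)) 0) (at 0 within E)"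
    unfolding tendsto_iff
  proof (intro allI impI)
    fix e :: real assume "0 < e"
    then obtain n where n: "1 / real (Suc n) < e" using reals_Archimedean[of e] by (auto simp: inverse_eq_divide)
    show "\<forall>\<^sub>F x in at 0 within E. dist ((\<sigma>(0 := 1)) x) ((\<sigma>(0 := 1)) 0) < e"
      unfolding eventually_at
    proof (intro exI[of _ "min 1 (\<epsilon> n)"] conjI ballI impI)
      show "0 < min 1 (\<epsilon> n)" using \<epsilon>(1) by simp
      fix x assume "x \<in> E" and x: "x \<noteq> 0 \<and> dist x 0 < min 1 (\<epsilon> n)"
      then have "\<sigma> x \<le> 1" "t n < \<sigma> x" by (auto simp: E_def)
      then have "dist (\<sigma> x) 1 < 1 / real (Suc n)" by (simp add: dist_real_def t_def)
      then show "dist ((\<sigma>(0 := 1)) x) ((\<sigma>(0 := 1)) 0) < e" using x n by simp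
    qed
  qed
  ultimately show ?thesis
    unfolding approx_continuous_at_0_def using Em by blast
qed

text \<open>Reduction to condition (7): close to the origin \<sigma> is positive on \<open>E\<close>
  away from 0, so its zeros lie in the complement of \<open>E\<close>, whose proportion tends to
  0.\<close>

lemma approx_continuous_imp_full:
  assumes "approx_continuous_at_0 G B (\<sigma>(0 := 1))"
  shows full
proof -
  obtain E where E: "E \<in> sets lebesgue" "density_at_0 G B E" "((\<sigma>(0 := 1)) \<longlongrightarrow> (\<sigma>(0 := 1)) 0) (at 0 within E)"
    using assms unfolding approx_continuous_at_0_def by blast
  have "\<forall>\<^sub>F x in at 0 within E. 0 < (\<sigma>(0 := 1)) x"
    using order_tendstoD(1)[OF E(3), of 0] by simp
  then obtain \<delta> where \<delta>: "0 < \<delta>" "\<And>x. x \<in> E \<Longrightarrow> x \<noteq> 0 \<Longrightarrow> norm x < \<delta> \<Longrightarrow> 0 < \<sigma> x"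
    by (auto simp: eventually_at)
  obtain N where N: "\<And>j x. j \<ge> N \<Longrightarrow> norm x \<le> 1 \<Longrightarrow> norm ((R ^^ j) x) < \<delta>"
    using contract[OF \<delta>(1), of 1] by auto
  let ?D = "\<lambda>j. G \<inter> (R ^^ j) ` ball 0 1"
  have Dm: "?D j \<in> sets lebesgue" for j
    by (intro sets.Int[OF G] Rn_image) simp
  have Dfin: "emeasure lebesgue (?D j) < \<infinity>" for j
  proof -
    have "emeasure lebesgue (?D j) \<le> emeasure lebesgue ((R ^^ j) ` ball (0::real^'n) 1)"
      by (intro emeasure_mono Rn_image) auto
    also have "\<dots> < \<infinity>"
      using emeasure_bounded_lebesgue[of "ball (0::real^'n) 1"] Rn_image(2)[of "ball 0 1" j]
      by (simp add: ennreal_mult_less_top)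
    finally show ?thesis .
  qed
  have Dpos: "0 < measure lebesgue (?D j)" for j
    using Rn_ball_eq[of j 1 UNIV] measure_Rn_image[OF G_ball(1), of j 1] dR_pos[of j] measure_G_ball[of 1]
    by simp
  have dens: "(\<lambda>j. measure lebesgue (E \<inter> G \<inter> (R ^^ j) ` ball 0 1) / measure lebesgue (?D j)) \<longlonglongrightarrow> 1"
    using E(2) unfolding density_at_0_def int_funpow_neg by simp
  have "locally_nonzero_at_0 G B \<sigma>"
    unfolding locally_nonzero_at_0_def int_funpow_neg
  proof (rule tendsto_sandwich[OF _ _ tendsto_const])
    show "\<forall>\<^sub>F j in sequentially. 0 \<le> measure lebesgue {x \<in> ?D j. \<sigma> x = 0} / measure lebesgue (?D j)"
      by simp
    show "(\<lambda>j. 1 - measure lebesgue (E \<inter> G \<inter> (R ^^ j) ` ball 0 1) / measure lebesgue (?D j)) \<longlonglongrightarrow> 0"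
      using tendsto_diff[OF tendsto_const dens, of 1] by simp
    show "\<forall>\<^sub>F j in sequentially. measure lebesgue {x \<in> ?D j. \<sigma> x = 0} / measure lebesgue (?D j)
        \<le> 1 - measure lebesgue (E \<inter> G \<inter> (R ^^ j) ` ball 0 1) / measure lebesgue (?D j)"
    proof (rule eventually_sequentiallyI[of N])
      fix j assume j: "N \<le> j"
      have fm: "?D j \<in> fmeasurable lebesgue" using Dm Dfin by (intro fmeasurableI)
      have EDm: "E \<inter> G \<inter> (R ^^ j) ` ball 0 1 \<in> sets lebesgue" using sets.Int[OF E(1) Dm[of j]] by (simp add: Int_assoc)
      \<comment> \<open>The origin is listed separately because a limit taken at 0 within
        \<open>E\<close> says nothing about the value of \<sigma> there.\<close>
      have sub: "{x \<in> ?D j. \<sigma> x = 0} \<subseteq> (?D j - (E \<inter> G \<inter> (R ^^ j) ` ball 0 1)) \<union> {0}"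
      proof
        fix x assume x: "x \<in> {x \<in> ?D j. \<sigma> x = 0}"
        then obtain y where y: "norm y < 1" "x = (R ^^ j) y" by auto
        then have "norm x < \<delta>" using N[OF j, of y] by simp
        then have "x \<notin> E \<or> x = 0" using \<delta>(2)[of x] x by auto
        then show "x \<in> (?D j - (E \<inter> G \<inter> (R ^^ j) ` ball 0 1)) \<union> {0}" using x by auto
      qed
      have fm2: "?D j - (E \<inter> G \<inter> (R ^^ j) ` ball 0 1) \<in> fmeasurable lebesgue"
        by (rule fmeasurable_Diff[OF fm EDm])
      have fm0: "{0::real^'n} \<in> fmeasurable lebesgue"
        by (rule negligible_imp_measurable[OF negligible_sing])
      have zs: "{x \<in> ?D j. \<sigma> x = 0} \<in> sets lebesgue"
        using sets.Int[OF Dm[of j] zero_set(1)] by (simp add: Int_def)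
      have "measure lebesgue {x \<in> ?D j. \<sigma> x = 0} \<le> measure lebesgue ((?D j - (E \<inter> G \<inter> (R ^^ j) ` ball 0 1)) \<union> {0})"
        by (rule measure_mono_fmeasurable[OF sub zs fmeasurable.Un[OF fm2 fm0]])
      also have "\<dots> \<le> measure lebesgue (?D j - (E \<inter> G \<inter> (R ^^ j) ` ball 0 1)) + measure lebesgue {0::real^'n}"
        by (rule measure_Un_le) (use fm2 in auto)
      also have "\<dots> = measure lebesgue (?D j) - measure lebesgue (E \<inter> G \<inter> (R ^^ j) ` ball 0 1)"
        using measurable_measure_Diff[OF fm EDm] by auto
      finally have le: "measure lebesgue {x \<in> ?D j. \<sigma> x = 0}
        \<le> measure lebesgue (?D j) - measure lebesgue (E \<inter> G \<inter> (R ^^ j) ` ball 0 1)" .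
      have "measure lebesgue {x \<in> ?D j. \<sigma> x = 0} / measure lebesgue (?D j)
        \<le> (measure lebesgue (?D j) - measure lebesgue (E \<inter> G \<inter> (R ^^ j) ` ball 0 1)) / measure lebesgue (?D j)"
        by (rule divide_right_mono[OF le]) simp
      also have "\<dots> = 1 - measure lebesgue (E \<inter> G \<inter> (R ^^ j) ` ball 0 1) / measure lebesgue (?D j)"
        unfolding diff_divide_distrib using Dpos[of j] by simp
      finally show "measure lebesgue {x \<in> ?D j. \<sigma> x = 0} / measure lebesgue (?D j)
        \<le> 1 - measure lebesgue (E \<inter> G \<inter> (R ^^ j) ` ball 0 1) / measure lebesgue (?D j)" .
    qed
  qed
  then show full using locally_nonzero_iff_full by simp
qed

theorem approx_continuous_iff_full: "approx_continuous_at_0 G B (\<sigma>(0 := 1)) \<longleftrightarrow> full"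
  using approx_continuous_imp_full full_imp_approx_continuous by blast

section \<open>Supports, and conditions (1) and (2) in terms of \<open>full\<close>\<close>

lemma Y_supp:
  assumes u: "u \<in> Y"
  shows "AE x in lebesgue. u x \<noteq> 0 \<longrightarrow> \<sigma> x \<noteq> 0"
proof (rule AE_ball_cover[OF r0(1)])
  fix \<theta> :: "real^'n"
  have uL: "u \<in> L2" by (rule closed_subspace_L2[OF Y u])
  define S where "S = {x. \<sigma> x = 0} \<inter> ball \<theta> r0"
  have S: "S \<in> sets lebesgue" "S \<subseteq> ball \<theta> r0" unfolding S_def using zero_set by auto
  have "AE x in lebesgue. x \<in> S \<longrightarrow> u x = 0"
  proof (rule L2_zero_test[OF uL S(1) emeasure_ball_finite[OF S]])
    fix F assume F: "F \<in> sets lebesgue" "F \<subseteq> S"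
    have Fb: "F \<subseteq> ball \<theta> r0" using F(2) S(2) by blast
    have FL: "(indicator F :: _ \<Rightarrow> complex) \<in> L2" by (rule indicator_L2[OF F(1) emeasure_ball_finite[OF F(1) Fb]])
    obtain \<theta>' where \<theta>': "F \<subseteq> {x. x - \<theta>' \<in> unit_cube}" using Rn_small[OF Fb, of 0] by auto
    obtain p where p: "p \<in> Y" "\<forall>y\<in>Y. L2_inner (\<lambda>x. indicator F x - p x) y = 0"
      "(LINT x|lebesgue. indicator F x * \<sigma> x) = (L2_norm p)\<^sup>2" using \<sigma>_proj[OF F(1) \<theta>'] by blast
    have pL: "p \<in> L2" by (rule closed_subspace_L2[OF Y p(1)])
    \<comment> \<open>Where \<sigma> vanishes, the projection of \<open>indicator F\<close> to
      \<open>Y\<close> has norm 0, so the indicator is orthogonal to every \<open>u\<close> in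
      \<open>Y\<close>.\<close>
    have "(\<lambda>x. indicator F x * \<sigma> x) = (\<lambda>x. 0)" using F(2) by (auto simp: fun_eq_iff S_def indicator_def)
    then have "L2_norm p = 0" using p(3) by simp
    then have "L2_inner p u = 0" using L2_Cauchy_Schwarz[OF pL uL] by simp
    then have "L2_inner (indicator F) u = 0" using bspec[OF p(2) u] FL pL uL by (simp add: L2_inner_diff_left)
    then show "L2_inner u (indicator F) = 0" by (subst L2_inner_commute) simp
  qed
  then show "AE x in lebesgue. x \<in> ball \<theta> r0 \<longrightarrow> u x \<noteq> 0 \<longrightarrow> \<sigma> x \<noteq> 0"
    by eventually_elim (auto simp: S_def)
qed

text \<open>Converse to \<open>Y_supp\<close>: an indicator function living outside \<open>U\<close>
  is orthogonal to \<open>Y\<close>, so its projection and with it the integral of \<sigma> vanish.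
  Together they make \<open>Supp \<sigma>\<close> the essential union of the supports of members of
  \<open>Y\<close>.\<close>

lemma \<sigma>_supp:
  assumes U: "U \<in> sets lebesgue" and H: "\<And>u. u \<in> Y \<Longrightarrow> AE x in lebesgue. u x \<noteq> 0 \<longrightarrow> x \<in> U"
  shows "AE x in lebesgue. \<sigma> x \<noteq> 0 \<longrightarrow> x \<in> U"
proof (rule AE_ball_cover[OF r0(1)])
  fix \<theta> :: "real^'n"
  define F where "F = (- U) \<inter> ball \<theta> r0"
  have F: "F \<in> sets lebesgue" "F \<subseteq> ball \<theta> r0"
    unfolding F_def using sets.compl_sets[OF U] by (auto simp: Compl_eq_Diff_UNIV)
  note fin = emeasure_ball_finite[OF F]
  have FL: "(indicator F :: _ \<Rightarrow> complex) \<in> L2" by (rule indicator_L2[OF F(1) fin])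
  obtain \<theta>' where \<theta>': "F \<subseteq> {x. x - \<theta>' \<in> unit_cube}" using Rn_small[OF F(2), of 0] by auto
  obtain p where p: "p \<in> Y" "\<forall>y\<in>Y. L2_inner (\<lambda>x. indicator F x - p x) y = 0"
    "(LINT x|lebesgue. indicator F x * \<sigma> x) = (L2_norm p)\<^sup>2" using \<sigma>_proj[OF F(1) \<theta>'] by blast
  have pL: "p \<in> L2" by (rule closed_subspace_L2[OF Y p(1)])
  have "L2_inner (indicator F) p = 0"
    by (rule L2_inner_AE_zero[OF FL pL]) (use H[OF p(1)] in \<open>eventually_elim, auto simp: F_def indicator_def\<close>)
  then have "L2_inner p p = 0" using bspec[OF p(2) p(1)] FL pL by (simp add: L2_inner_diff_left)
  then have "(LINT x|lebesgue. indicator F x * \<sigma> x) = 0" unfolding p(3) L2_inner_self by simp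
  moreover have "integrable lebesgue (\<lambda>x. indicator F x * \<sigma> x)" using \<sigma>n_integrable[OF F(1) fin, of 0] by simp
  moreover have "AE x in lebesgue. 0 \<le> indicator F x * \<sigma> x" using \<sigma>01 by eventually_elim simp
  ultimately have "AE x in lebesgue. indicator F x * \<sigma> x = 0"
    using integral_nonneg_eq_0_iff_AE by blast
  then show "AE x in lebesgue. x \<in> ball \<theta> r0 \<longrightarrow> \<sigma> x \<noteq> 0 \<longrightarrow> x \<in> U"
    by eventually_elim (auto simp: F_def indicator_def)
qed

definition L2_on :: "(real^'n \<Rightarrow> complex) set" where
  "L2_on = {g \<in> L2. AE x in lebesgue. g x \<noteq> 0 \<longrightarrow> x \<in> G}"

lemma supp_G': "AE x in lebesgue. \<sigma> x \<noteq> 0 \<longrightarrow> x \<in> G"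
  using supp_G by (simp add: ae_subset_def Supp_def)

lemma Yn_L2_on: "Yn n \<subseteq> L2_on"
proof
  fix u assume u: "u \<in> Yn n"
  then have "(\<lambda>x. u ((B ^^ n) x)) \<in> Y" by (simp add: Yn_def)
  from Y_supp[OF this] supp_G' have "AE x in lebesgue. u ((B ^^ n) x) \<noteq> 0 \<longrightarrow> x \<in> G"
    by eventually_elim auto
  from rescales_AE[OF rescales_Rn this, of n] have "AE x in lebesgue. u x \<noteq> 0 \<longrightarrow> x \<in> G" by simp
  then show "u \<in> L2_on" using u by (simp add: L2_on_def Yn_def)
qed

lemma L2_closure_supp:
  assumes U: "U \<in> sets lebesgue" and f: "f \<in> L2_closure S" and S: "\<And>g. g \<in> S \<Longrightarrow> AE x in lebesgue. g x \<noteq> 0 \<longrightarrow> x \<in> U"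
  shows "AE x in lebesgue. f x \<noteq> 0 \<longrightarrow> x \<in> U"
proof -
  obtain u where u: "\<And>n. u n \<in> S" "L2_tendsto u f" using f unfolding L2_closure_def by auto
  have "L2_tendsto (\<lambda>n x. indicator U x * u n x) (\<lambda>x. indicator U x * f x)"
    by (rule L2_tendsto_mult_bounded[OF u(2), where C=1])
      (auto intro!: AE_I2 borel_measurable_indicator U norm_indicator_le_1)
  moreover have "L2_tendsto (\<lambda>n x. indicator U x * u n x) f"
  proof (rule L2_tendsto_cong[OF u(2)])
    show "AE x in lebesgue. u n x = indicator U x * u n x" for n
      using S[OF u(1)[of n]] by eventually_elim (auto simp: indicator_def)
  qed simp
  ultimately have "AE x in lebesgue. indicator U x * f x = f x" by (rule L2_tendsto_unique)
  then show ?thesis by eventually_elim (auto simp: indicator_def)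
qed

lemma W_L2_on: "W \<subseteq> L2_on"
proof
  fix f assume f: "f \<in> W"
  have "AE x in lebesgue. f x \<noteq> 0 \<longrightarrow> x \<in> G"
    by (rule L2_closure_supp[OF G f[unfolded W_def]]) (use Yn_L2_on in \<open>auto simp: L2_on_def\<close>)
  then show "f \<in> L2_on" using closed_subspace_L2[OF W f] by (simp add: L2_on_def)
qed

text \<open>If \<open>W\<close> is everything over \<open>G\<close>, then \<open>indicator E\<close>
  is its own projection and \<open>s_proj\<close> gives the integral of \<open>s\<close> its maximal
  value. Conversely, if \<open>s = 1\<close> on \<open>G\<close>, the projection of
  \<open>indicator E\<close> has the same norm as \<open>indicator E\<close> and thus equals it; a
  function over \<open>G\<close> orthogonal to all these indicators is zero.\<close>

theorem W_iff_full: "W = L2_on \<longleftrightarrow> full"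
proof
  assume eq: "W = L2_on"
  have "AE x in lebesgue. x \<in> G \<longrightarrow> s x = 1"
  proof (rule AE_ball_cover[OF r0(1)])
    fix \<theta> :: "real^'n"
    define E where "E = G \<inter> ball \<theta> r0"
    have E: "E \<in> sets lebesgue" "E \<subseteq> ball \<theta> r0" unfolding E_def using G by auto
    note fin = emeasure_ball_finite[OF E]
    have "(indicator E :: _ \<Rightarrow> complex) \<in> W"
      unfolding eq L2_on_def using indicator_L2[OF E(1) fin] by (auto simp: E_def indicator_def)
    then have "(LINT x|lebesgue. indicator E x * s x) = (L2_norm (indicator E))\<^sup>2"
      by (rule s_proj[OF E]) (simp add: L2_inner_def)
    then have "AE x in lebesgue. x \<in> E \<longrightarrow> s x = 1"
      unfolding L2_norm_indicator[OF E(1)] by (rule measure_one_full[OF E(1) fin])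
    then show "AE x in lebesgue. x \<in> ball \<theta> r0 \<longrightarrow> x \<in> G \<longrightarrow> s x = 1"
      by eventually_elim (simp add: E_def)
  qed
  then show full unfolding full_def .
next
  assume full: full
  have ind: "(indicator E :: _ \<Rightarrow> complex) \<in> W" if E: "E \<in> sets lebesgue" "E \<subseteq> ball \<theta> r0" "E \<subseteq> G" for E \<theta>
  proof -
    note fin = emeasure_ball_finite[OF E(1,2)]
    have EL: "(indicator E :: _ \<Rightarrow> complex) \<in> L2" by (rule indicator_L2[OF E(1) fin])
    obtain p where p: "p \<in> W" "\<And>w. w \<in> W \<Longrightarrow> L2_inner (\<lambda>x. indicator E x - p x) w = 0"
      using W_projection[OF E(1,2)] by blast
    have pL: "p \<in> L2" by (rule closed_subspace_L2[OF W p(1)])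
    have n: "(L2_norm p)\<^sup>2 = (L2_norm (indicator E))\<^sup>2"
      using s_proj[OF E(1,2) p] integral_full[OF full E(1,3)] L2_norm_indicator[OF E(1)] by simp
    have "L2_inner (indicator E) p = L2_inner p p"
      using p(2)[OF p(1)] EL pL by (simp add: L2_inner_diff_left)
    then have "(L2_norm (\<lambda>x. indicator E x - p x))\<^sup>2 = 0"
      unfolding L2_norm_diff_sq[OF EL pL] n[symmetric] by (simp add: L2_inner_self del: of_real_power)
    then have "AE x in lebesgue. indicator E x - p x = 0"
      using L2_norm_eq_0_iff[OF L2_diff[OF EL pL]] by simp
    then have "AE x in lebesgue. p x = indicator E x" by eventually_elim simp
    then show ?thesis by (rule closed_subspace_cong[OF W p(1)])
  qed
  have "L2_on \<subseteq> W"
  proof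
    fix g assume g: "g \<in> L2_on"
    then have gL: "g \<in> L2" by (simp add: L2_on_def)
    obtain p where p: "p \<in> W" "\<forall>w\<in>W. L2_inner (\<lambda>x. g x - p x) w = 0"
      using L2_projection[OF W gL] by blast
    have pL: "p \<in> L2" by (rule closed_subspace_L2[OF W p(1)])
    have uL: "(\<lambda>x. g x - p x) \<in> L2" by (rule L2_diff[OF gL pL])
    have "AE x in lebesgue. g x \<noteq> 0 \<longrightarrow> x \<in> G" "AE x in lebesgue. p x \<noteq> 0 \<longrightarrow> x \<in> G"
      using g p(1) W_L2_on by (auto simp: L2_on_def)
    then have off: "AE x in lebesgue. x \<notin> G \<longrightarrow> g x - p x = 0" by eventually_elim auto
    have "AE x in lebesgue. g x - p x = 0"
    proof (rule AE_ball_cover[OF r0(1)])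
      fix \<theta> :: "real^'n"
      have E: "G \<inter> ball \<theta> r0 \<in> sets lebesgue" "G \<inter> ball \<theta> r0 \<subseteq> ball \<theta> r0" using G by auto
      have "AE x in lebesgue. x \<in> G \<inter> ball \<theta> r0 \<longrightarrow> g x - p x = 0"
      proof (rule L2_zero_test[OF uL E(1) emeasure_ball_finite[OF E]])
        fix F assume F: "F \<in> sets lebesgue" "F \<subseteq> G \<inter> ball \<theta> r0"
        have "(indicator F :: _ \<Rightarrow> complex) \<in> W" by (rule ind[OF F(1), of \<theta>]) (use F(2) in auto)
        then show "L2_inner (\<lambda>x. g x - p x) (indicator F) = 0" by (rule bspec[OF p(2)])
      qed
      with off show "AE x in lebesgue. x \<in> ball \<theta> r0 \<longrightarrow> g x - p x = 0" by eventually_elim auto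
    qed
    then have "AE x in lebesgue. p x = g x" by eventually_elim simp
    then show "g \<in> W" by (rule closed_subspace_cong[OF W p(1)])
  qed
  then show "W = L2_on" using W_L2_on by blast
qed

lemma ae_subset_image:
  assumes "ae_subset S T"
  shows "ae_subset (int_funpow B j ` S) (int_funpow B j ` T)"
proof (cases rule: int_funpow_cases[of j])
  case (1 n)
  show ?thesis unfolding 1 ae_subset_def Bn_image_iff
    by (rule rescales_AE[OF rescales_Rn assms[unfolded ae_subset_def]])
next
  case (2 n)
  show ?thesis unfolding 2 ae_subset_def Rn_image_iff
    by (rule rescales_AE[OF rescales_Bn assms[unfolded ae_subset_def]])
qed

lemma int_funpow_image_sets:
  assumes "S \<in> sets lebesgue"
  shows "int_funpow B j ` S \<in> sets lebesgue"
proof (cases rule: int_funpow_cases[of j])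
  case (1 n)
  have "(B ^^ n) ` S = {x. (R ^^ n) x \<in> S}" by (auto simp: Bn_image_iff)
  then show ?thesis unfolding 1 using vimage_Rn_sets[OF assms] by simp
next
  case (2 n)
  show ?thesis unfolding 2 by (rule Rn_image(1)[OF assms])
qed

lemma int_funpow_G: "int_funpow B j ` G = G"
proof (cases rule: int_funpow_cases[of j])
  case (1 n)
  show ?thesis unfolding 1 by (auto simp: Bn_image_iff)
next
  case (2 n)
  show ?thesis unfolding 2 by (auto simp: Rn_image_iff)
qed

lemma Supp_\<sigma>_sets: "Supp \<sigma> \<in> sets lebesgue"
proof -
  have "Supp \<sigma> = - {x. \<sigma> x = 0}" by (auto simp: Supp_def)
  then show ?thesis using sets.compl_sets[OF zero_set(1)] by (simp add: Compl_eq_Diff_UNIV)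
qed

text \<open>Generation is needed only in the form of \<open>gen\<close>: a measurable set that
  carries all members of \<open>F\<close> carries all of \<open>Y\<close>.\<close>

lemma full_imp_ess_Union:
  assumes full and sub: "F \<subseteq> Y"
    and gen: "\<And>U u. U \<in> sets lebesgue \<Longrightarrow> (\<And>g. g \<in> F \<Longrightarrow> AE x in lebesgue. g x \<noteq> 0 \<longrightarrow> x \<in> U) \<Longrightarrow>
      u \<in> Y \<Longrightarrow> AE x in lebesgue. u x \<noteq> 0 \<longrightarrow> x \<in> U"
  shows "is_ess_Union {int_funpow B j ` Supp g | g j. g \<in> F} G"
  unfolding is_ess_Union_def
proof (intro conjI ballI impI G)
  fix S assume "S \<in> {int_funpow B j ` Supp g | g j. g \<in> F}"
  then obtain g j where g: "g \<in> F" "S = int_funpow B j ` Supp g" by blast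
  have "ae_subset (Supp g) G"
    using Yn_L2_on[of 0] Y_subset sub g(1) by (auto simp: L2_on_def ae_subset_def Supp_def)
  from ae_subset_image[OF this, of j] show "ae_subset S G" unfolding g(2) int_funpow_G .
next
  fix U assume U: "U \<in> sets lebesgue" and H: "\<forall>S\<in>{int_funpow B j ` Supp g | g j. g \<in> F}. ae_subset S U"
  \<comment> \<open>The points whose forward orbit under \<open>B\<close> stays in \<open>U\<close>.
    The dilates of the supports by nonnegative powers lie in \<open>U\<close>, so \<open>V\<close>
    carries all of \<open>F\<close> and therefore \<sigma>; and \<open>R^j x\<close> in
    \<open>V\<close> gives back \<open>x\<close> in \<open>U\<close>.\<close>
  define V where "V = (\<Inter>j. {x. (B ^^ j) x \<in> U})"
  have Vm: "V \<in> sets lebesgue"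
  proof -
    have "{x. (B ^^ j) x \<in> U} = (R ^^ j) ` U" for j by (auto simp: Rn_image_iff)
    then show ?thesis unfolding V_def using Rn_image(1)[OF U] by (intro sets.countable_INT'') auto
  qed
  have "AE x in lebesgue. u x \<noteq> 0 \<longrightarrow> x \<in> V" if "u \<in> Y" for u
  proof (rule gen[OF Vm _ that])
    fix g assume g: "g \<in> F"
    have "AE x in lebesgue. g x \<noteq> 0 \<longrightarrow> (B ^^ j) x \<in> U" for j
    proof -
      have "ae_subset (int_funpow B (int j) ` Supp g) U" using H g by blast
      then have "AE x in lebesgue. (R ^^ j) x \<in> Supp g \<longrightarrow> x \<in> U"
        unfolding int_funpow_nonneg ae_subset_def Bn_image_iff .
      from rescales_AE[OF rescales_Bn this, of j] show ?thesis by (simp add: Supp_def)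
    qed
    then have "AE x in lebesgue. \<forall>j. g x \<noteq> 0 \<longrightarrow> (B ^^ j) x \<in> U" unfolding AE_all_countable by blast
    then show "AE x in lebesgue. g x \<noteq> 0 \<longrightarrow> x \<in> V" by eventually_elim (auto simp: V_def)
  qed
  then have "AE x in lebesgue. \<sigma> x \<noteq> 0 \<longrightarrow> x \<in> V" by (rule \<sigma>_supp[OF Vm])
  then have "AE x in lebesgue. \<forall>j. \<sigma>n j x \<noteq> 0 \<longrightarrow> (R ^^ j) x \<in> V"
    unfolding AE_all_countable using rescales_AE[OF rescales_Rn] by blast
  then show "ae_subset G U"
    using \<open>full\<close> s_pos_iff unfolding ae_subset_def full_def
  proof eventually_elim
    case (elim x)
    show ?case
    proof
      assume "x \<in> G"
      then obtain j where "\<sigma>n j x \<noteq> 0" using elim by blast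
      then have "(R ^^ j) x \<in> V" using elim(1) by blast
      then have "(B ^^ j) ((R ^^ j) x) \<in> U" unfolding V_def by blast
      then show "x \<in> U" by simp
    qed
  qed
qed

text \<open>By \<open>Y_supp\<close> the union of the dilates of \<open>Supp \<sigma>\<close>
  contains every set of the family, so the minimality in the essential union puts \<open>G\<close>
  inside it.\<close>

lemma ess_Union_imp_full:
  assumes sub: "F \<subseteq> Y" and ess: "is_ess_Union {int_funpow B j ` Supp g | g j. g \<in> F} G"
  shows full
proof -
  define U where "U = (\<Union>j. int_funpow B j ` Supp \<sigma>)"
  have Um: "U \<in> sets lebesgue" unfolding U_def
    by (intro sets.countable_UN'' int_funpow_image_sets Supp_\<sigma>_sets) auto
  have "ae_subset G U"
  proof -
    have "ae_subset S U" if "S \<in> {int_funpow B j ` Supp g | g j. g \<in> F}" for S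
    proof -
      obtain g j where g: "g \<in> F" "S = int_funpow B j ` Supp g" using \<open>S \<in> _\<close> by blast
      have "ae_subset (Supp g) (Supp \<sigma>)"
        using Y_supp[of g] sub g(1) by (auto simp: ae_subset_def Supp_def)
      from ae_subset_image[OF this, of j] have "ae_subset S (int_funpow B j ` Supp \<sigma>)" unfolding g(2) .
      then show ?thesis unfolding ae_subset_def U_def by eventually_elim blast
    qed
    then show ?thesis using ess Um unfolding is_ess_Union_def by blast
  qed
  moreover have "AE x in lebesgue. \<forall>n. incseq (\<lambda>j. \<sigma>n j ((B ^^ n) x))"
    unfolding AE_all_countable using rescales_AE[OF rescales_Bn \<sigma>n_mono] by blast
  moreover have "AE x in lebesgue. \<forall>n. 0 \<le> \<sigma> ((B ^^ n) x)"
  proof -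
    have "AE x in lebesgue. 0 \<le> \<sigma> x" using \<sigma>01 by eventually_elim simp
    then show ?thesis unfolding AE_all_countable using rescales_AE[OF rescales_Bn] by blast
  qed
  ultimately show full
    unfolding full_def ae_subset_def using s_pos_iff
  proof eventually_elim
    case (elim x)
    show ?case
    proof
      assume "x \<in> G"
      then obtain j where j: "x \<in> int_funpow B j ` Supp \<sigma>" using elim(1) by (auto simp: U_def)
      show "s x = 1"
      proof (cases rule: int_funpow_cases[of j])
        case (1 n)
        then have "\<sigma>n n x \<noteq> 0" using j unfolding 1 Bn_image_iff by (simp add: Supp_def)
        then show ?thesis using elim(4) by blast
      next
        case (2 n)
        then have "\<sigma> ((B ^^ n) x) \<noteq> 0" using j unfolding 2 Rn_image_iff by (simp add: Supp_def)
        then have "0 < \<sigma> ((B ^^ n) x)" using elim(3) by (simp add: order_less_le)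
        \<comment> \<open>The orbit of \<open>B^n x\<close> under \<open>R\<close> reaches
          \<open>x\<close> after \<open>n\<close> steps, and \<sigma> increases along it.\<close>
        also have "\<sigma> ((B ^^ n) x) \<le> \<sigma> x" using incseqD[OF elim(2)[rule_format, of n], of 0 n] by simp
        finally have "\<sigma>n 0 x \<noteq> 0" by simp
        then show ?thesis using elim(4) by blast
      qed
    qed
  qed
qed

end

section \<open>Powers of matrices with small eigenvalues\<close>

text \<open>\<open>e / 2\<close> is the fixed point of the map that sends a to
  \<open>r a + (1 - r) e / 2\<close>. Once the perturbation is below \<open>(1 - r) e / 2\<close>,
  the excess over \<open>e / 2\<close> contracts by \<open>r\<close> in each step.\<close>

lemma contraction_recurrence:
  fixes a b :: "nat \<Rightarrow> real"
  assumes rec: "\<And>j. a (Suc j) \<le> r * a j + b j" and a: "\<And>j. 0 \<le> a j" and r: "0 \<le> r" "r < 1"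
    and b: "b \<longlonglongrightarrow> 0"
  shows "a \<longlonglongrightarrow> 0"
proof (rule LIMSEQ_I)
  fix e :: real assume e: "0 < e"
  have "0 < (1 - r) * (e / 2)" using r e by simp
  then obtain N where N: "\<And>j. j \<ge> N \<Longrightarrow> b j < (1 - r) * (e / 2)"
    using order_tendstoD(2)[OF b] unfolding eventually_sequentially by blast
  have bound: "a (N + k) \<le> e / 2 + r ^ k * a N" for k
  proof (induction k)
    case 0
    then show ?case using e by simp
  next
    case (Suc k)
    have "a (N + Suc k) \<le> r * a (N + k) + b (N + k)" using rec[of "N + k"] by simp
    also have "\<dots> \<le> r * (e / 2 + r ^ k * a N) + (1 - r) * (e / 2)"
      using Suc r N[of "N + k"] by (intro add_mono mult_left_mono) auto
    also have "\<dots> = e / 2 + r ^ Suc k * a N" by (simp add: field_simps)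
    finally show ?case .
  qed
  have "(\<lambda>k. r ^ k * a N) \<longlonglongrightarrow> 0 * a N" by (intro tendsto_intros LIMSEQ_realpow_zero r)
  then obtain K where K: "\<And>k. k \<ge> K \<Longrightarrow> r ^ k * a N < e / 2"
    using order_tendstoD(2)[of "\<lambda>k. r ^ k * a N" 0 sequentially "e / 2"] e by (auto simp: eventually_sequentially)
  have "norm (a n - 0) < e" if "n \<ge> N + K" for n
  proof -
    have "K \<le> n - N" "N + (n - N) = n" using that by simp_all
    then have "a n < e" using bound[of "n - N"] K[of "n - N"] by simp
    then show ?thesis using a[of n] by simp
  qed
  then show "\<exists>no. \<forall>n\<ge>no. norm (a n - 0) < e" by blast
qed

text \<open>This is \<open>p(N) v\<close>, written through the iterates of \<open>v\<close> so that
  no powers of matrices occur.\<close>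

definition poly_apply :: "complex^'n^'n \<Rightarrow> complex poly \<Rightarrow> complex^'n \<Rightarrow> complex^'n" where
  "poly_apply N p v = (\<Sum>i\<le>degree p. coeff p i *s (((*v) N ^^ i) v))"

lemma poly_apply_bound:
  assumes "degree p \<le> n"
  shows "poly_apply N p v = (\<Sum>i\<le>n. coeff p i *s (((*v) N ^^ i) v))"
  unfolding poly_apply_def
  using assms by (intro sum.mono_neutral_left) (auto simp: coeff_eq_0)

lemma matrix_power_linear:
  fixes N :: "complex^'n^'n"
  shows "((*v) N ^^ i) (x - c *s y) = ((*v) N ^^ i) x - c *s ((*v) N ^^ i) (y :: complex^'n)"
  by (induction i) (simp_all add: matrix_vector_mult_diff_distrib vector_scalar_commute)

lemma poly_apply_linear: "poly_apply N p (x - c *s y) = poly_apply N p x - c *s poly_apply N p y"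
  unfolding poly_apply_def matrix_power_linear
  by (simp add: vec.scale_sum_right sum_subtractf vec.scale_right_diff_distrib mult.commute)

lemma poly_apply_factor:
  "poly_apply N ([:- \<mu>, 1:] * q) v = poly_apply N q (N *v v - \<mu> *s v)"
proof -
  define n where "n = degree q"
  have deg: "degree ([:- \<mu>, 1:] * q) \<le> Suc n"
    using degree_mult_le[of "[:- \<mu>, 1:]" q] by (simp add: n_def)
  have c: "coeff ([:- \<mu>, 1:] * q) i = coeff (pCons 0 q) i - \<mu> * coeff q i" for i
    by simp
  have "poly_apply N ([:- \<mu>, 1:] * q) v
      = (\<Sum>i\<le>Suc n. coeff (pCons 0 q) i *s (((*v) N ^^ i) v)) - (\<Sum>i\<le>Suc n. (\<mu> * coeff q i) *s (((*v) N ^^ i) v))"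
    unfolding poly_apply_bound[OF deg] c by (simp only: vec.scale_left_diff_distrib sum_subtractf)
  also have "(\<Sum>i\<le>Suc n. coeff (pCons 0 q) i *s (((*v) N ^^ i) v)) = (\<Sum>i\<le>n. coeff q i *s (((*v) N ^^ Suc i) v))"
    by (subst sum.atMost_Suc_shift) simp
  also have "\<dots> = poly_apply N q (N *v v)"
    unfolding poly_apply_def n_def[symmetric] by (simp add: funpow_swap1)
  also have "(\<Sum>i\<le>Suc n. (\<mu> * coeff q i) *s (((*v) N ^^ i) v)) = \<mu> *s poly_apply N q v"
    unfolding poly_apply_bound[of q "Suc n", OF le_SucI[OF eq_refl[OF n_def[symmetric]]]] vec.scale_sum_right
    by simp
  also have "poly_apply N q (N *v v) - \<mu> *s poly_apply N q v = poly_apply N q (N *v v - \<mu> *s v)"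
    by (rule poly_apply_linear[symmetric])
  finally show ?thesis .
qed

lemma poly_apply_commute: "N *v poly_apply N q v = poly_apply N q (N *v v)"
proof -
  have "N *v poly_apply N q v = (\<Sum>i\<le>degree q. N *v (coeff q i *s (((*v) N ^^ i) v)))"
    unfolding poly_apply_def by (rule vec.sum)
  also have "\<dots> = poly_apply N q (N *v v)"
    unfolding poly_apply_def by (simp add: vector_scalar_commute funpow_swap1)
  finally show ?thesis .
qed

text \<open>There is one more iterate than the dimension. Since linear dependence is a property of
  the set of iterates, a coincidence of two of them is a separate case, settled by a difference of
  two monomials.\<close>

lemma annihilating_polynomial:
  fixes v :: "complex^'n"
  obtains p where "p \<noteq> 0" "poly_apply N p v = 0"
proof -
  define f where "f i = ((*v) N ^^ i) v" for i
  define n where "n = CARD('n)"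
  show thesis
  proof (cases "inj_on f {..n}")
    case True
    have "vec.dependent (f ` {..n})"
    proof (rule vec.dependent_biggerset_general)
      show "vec.dim (f ` {..n}) < card (f ` {..n})"
        using dim_subset_UNIV_cart_gen[of "f ` {..n}"] True by (simp add: card_image n_def)
    qed
    then obtain u where u: "\<exists>x\<in>f ` {..n}. u x \<noteq> 0" "(\<Sum>x\<in>f ` {..n}. u x *s x) = 0"
      by (subst (asm) vec.dependent_finite) auto
    define p where "p = (\<Sum>i\<le>n. monom (u (f i)) i)"
    have cp: "coeff p i = (if i \<le> n then u (f i) else 0)" for i
      by (simp add: p_def coeff_sum)
    have "degree p \<le> n" by (rule degree_le) (simp add: cp)
    then have "poly_apply N p v = (\<Sum>i\<le>n. coeff p i *s f i)" unfolding f_def by (rule poly_apply_bound)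
    also have "\<dots> = (\<Sum>x\<in>f ` {..n}. u x *s x)"
      unfolding sum.reindex[OF True] by (intro sum.cong) (auto simp: cp)
    finally have z: "poly_apply N p v = 0" using u(2) by simp
    obtain i where "i \<le> n" "u (f i) \<noteq> 0" using u(1) by auto
    then have "coeff p i \<noteq> 0" by (simp add: cp)
    then have "p \<noteq> 0" by auto
    then show thesis using z by (rule that)
  next
    case False
    then obtain i j where ij: "i < j" "f i = f j"
      unfolding inj_on_def by (metis linorder_neqE_nat)
    define p where "p = monom (1::complex) j - monom 1 i"
    have cp: "coeff p k = (if k = j then 1 else 0) - (if k = i then 1 else 0)" for k
      by (simp add: p_def eq_commute)
    have "degree p \<le> j" by (rule degree_le) (use ij in \<open>simp add: cp\<close>)
    then have "poly_apply N p v = (\<Sum>k\<le>j. coeff p k *s f k)" unfolding f_def by (rule poly_apply_bound)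
    also have "\<dots> = (\<Sum>k\<le>j. (if k = j then f k else 0)) - (\<Sum>k\<le>j. (if k = i then f k else 0))"
      unfolding sum_subtractf[symmetric] by (intro sum.cong) (auto simp: cp)
    also have "\<dots> = 0" using ij by simp
    finally have z: "poly_apply N p v = 0" .
    have "coeff p j = 1" using ij by (simp add: cp)
    then have "p \<noteq> 0" by auto
    then show thesis using z by (rule that)
  qed
qed

text \<open>Let \<open>\<mu>\<close> be a root of \<open>p\<close> with cofactor \<open>q\<close>, which annihilates \<open>w = N v - \<mu> v\<close>. If \<open>\<bar>\<mu>\<bar> < 1\<close>, then \<open>N\<^sup>j v\<close> satisfies
  a contracting recurrence with perturbation \<open>N\<^sup>j w\<close>. Otherwise \<open>\<mu>\<close> is no eigenvalue and \<open>q\<close> annihilates \<open>v\<close> already.\<close>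

lemma annihilated_powers_tendsto_0:
  fixes N :: "complex^'n^'n"
  assumes eig: "\<And>\<mu> v. v \<noteq> 0 \<Longrightarrow> N *v v = \<mu> *s v \<Longrightarrow> cmod \<mu> < 1"
  shows "p \<noteq> 0 \<Longrightarrow> poly_apply N p v = 0 \<Longrightarrow> (\<lambda>j. ((*v) N ^^ j) v) \<longlonglongrightarrow> 0"
proof (induction "degree p" arbitrary: p v)
  case 0
  then obtain c where "p = [:c:]" "c \<noteq> 0" by (metis degree_eq_zeroE pCons_eq_0_iff)
  then have "v = 0" using 0(3) by (simp add: poly_apply_def vec.scale_eq_0_iff)
  moreover have "((*v) N ^^ j) 0 = 0" for j by (induction j) simp_all
  ultimately show ?case by simp
next
  case (Suc n)
  have "\<not> constant (poly p)" using Suc(2) by (simp add: constant_degree)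
  then obtain \<mu> where "poly p \<mu> = 0" using fundamental_theorem_of_algebra by blast
  then obtain q where q: "p = [:- \<mu>, 1:] * q" using poly_eq_0_iff_dvd by (metis dvdE)
  have q0: "q \<noteq> 0" using q Suc(3) by auto
  have "degree p = Suc (degree q)" unfolding q by (subst degree_mult_eq) (use q0 in auto)
  then have dq: "n = degree q" using Suc(2) by simp
  define w where "w = N *v v - \<mu> *s v"
  have qw: "poly_apply N q w = 0" using Suc(4) unfolding q poly_apply_factor w_def .
  have wlim: "(\<lambda>j. ((*v) N ^^ j) w) \<longlonglongrightarrow> 0" by (rule Suc(1)[OF dq q0 qw])
  show ?case
  proof (cases "cmod \<mu> < 1")
    case True
    have "(\<lambda>j. norm (((*v) N ^^ j) v)) \<longlonglongrightarrow> 0"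
    proof (rule contraction_recurrence[where r="cmod \<mu>"])
      show "(\<lambda>j. norm (((*v) N ^^ j) w)) \<longlonglongrightarrow> 0" using tendsto_norm[OF wlim] by simp
      fix j
      have "((*v) N ^^ j) w = ((*v) N ^^ Suc j) v - \<mu> *s ((*v) N ^^ j) v"
        unfolding w_def matrix_power_linear by (simp add: funpow_swap1)
      then have "((*v) N ^^ Suc j) v = \<mu> *s ((*v) N ^^ j) v + ((*v) N ^^ j) w" by simp
      moreover have "norm (\<mu> *s x) = cmod \<mu> * norm x" for x :: "complex^'n"
        by (simp add: norm_vec_def norm_mult L2_set_right_distrib)
      ultimately show "norm (((*v) N ^^ Suc j) v) \<le> cmod \<mu> * norm (((*v) N ^^ j) v) + norm (((*v) N ^^ j) w)"
        by (metis norm_triangle_ineq)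
    qed (use True in auto)
    then show ?thesis by (simp add: tendsto_norm_zero_iff)
  next
    case False
    \<comment> \<open>As \<open>q\<close> annihilates \<open>w\<close>, the vector \<open>z\<close>
      satisfies the eigenvalue equation for \<mu>; the modulus of \<mu> is too large for an
      eigenvalue, hence \<open>z\<close> is 0.\<close>
    define z where "z = poly_apply N q v"
    have "N *v z - \<mu> *s z = poly_apply N q w"
      unfolding z_def w_def poly_apply_commute poly_apply_linear ..
    then have "N *v z = \<mu> *s z" using qw by simp
    then have "z = 0" using eig False by blast
    then show ?thesis using Suc(1)[OF dq q0] unfolding z_def by blast
  qed
qed

theorem matrix_powers_tendsto_0:
  fixes N :: "complex^'n^'n"
  assumes "\<And>\<mu> v. v \<noteq> 0 \<Longrightarrow> N *v v = \<mu> *s v \<Longrightarrow> cmod \<mu> < 1"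
  shows "(\<lambda>j. ((*v) N ^^ j) v) \<longlonglongrightarrow> 0"
proof -
  obtain p where "p \<noteq> 0" "poly_apply N p v = 0" by (rule annihilating_polynomial)
  then show ?thesis by (rule annihilated_powers_tendsto_0[rotated]) (rule assms)
qed

section \<open>Complexification, and the inverse of the adjoint dilation\<close>

definition cvec :: "real^'n \<Rightarrow> complex^'n" where
  "cvec x = (\<chi> i. complex_of_real (x $ i))"

definition cmat :: "(real^'n \<Rightarrow> real^'n) \<Rightarrow> complex^'n^'n" where
  "cmat A = (\<chi> i j. complex_of_real (matrix A $ i $ j))"

lemma cvec_eq_0_iff: "cvec x = 0 \<longleftrightarrow> x = 0"
  by (simp add: cvec_def vec_eq_iff)

lemma norm_cvec: "norm (cvec x) = norm x"
  by (simp add: cvec_def norm_vec_def)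

lemma cmat_cvec:
  assumes "linear A"
  shows "cmat A *v cvec x = cvec (A x)"
proof -
  have "A x = matrix A *v x" using assms by simp
  then show ?thesis by (simp add: cmat_def cvec_def matrix_vector_mult_def vec_eq_iff)
qed

lemma cmat_compose:
  assumes "linear A" "linear C" "\<And>x. A (C x) = x"
  shows "cmat A *v (cmat C *v v) = v"
proof -
  have "A \<circ> C = id" using assms(3) by auto
  then have "matrix A ** matrix C = mat 1"
    using matrix_compose[OF assms(2,1)] by (metis matrix_id_mat_1)
  then have "(\<Sum>k\<in>UNIV. matrix A $ i $ k * matrix C $ k $ j) = (if i = j then 1 else 0)" for i j
    by (simp add: matrix_matrix_mult_def mat_def vec_eq_iff)
  then have "complex_of_real (\<Sum>k\<in>UNIV. matrix A $ i $ k * matrix C $ k $ j) = (if i = j then 1 else 0)" for i j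
    by simp
  then have "cmat A ** cmat C = mat 1"
    by (simp add: cmat_def matrix_matrix_mult_def mat_def vec_eq_iff)
  then show ?thesis by (simp add: matrix_vector_mul_assoc)
qed

text \<open>If \<mu> is an eigenvalue of the complexified inverse, its reciprocal is one of the
  dilation, so \<mu> has modulus below 1 and \<open>matrix_powers_tendsto_0\<close> applies.
  Injectivity holds because 0 is no eigenvalue.\<close>

lemma expansive_inverse:
  fixes A :: "real^'n \<Rightarrow> real^'n"
  assumes "expansive_dilation A"
  obtains C where "linear C" "\<And>x. C (A x) = x" "\<And>x. A (C x) = x" "\<And>x. (\<lambda>j. (C ^^ j) x) \<longlonglongrightarrow> 0"
proof -
  have lin: "linear A" and ev: "\<And>z v. v \<noteq> 0 \<Longrightarrow> cmat A *v v = z *s v \<Longrightarrow> 1 < cmod z"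
    using assms by (auto simp: expansive_dilation_def cmat_def)
  have "inj A"
    unfolding linear_injective_0[OF lin]
  proof (intro allI impI, rule ccontr)
    fix x assume "A x = 0" "x \<noteq> 0"
    then have "cvec x \<noteq> 0" "cmat A *v cvec x = 0 *s cvec x"
      by (simp_all add: cvec_eq_0_iff cmat_cvec[OF lin])
    from ev[OF this] show False by simp
  qed
  then obtain C where C: "linear C" "\<And>x. C (A x) = x" "\<And>x. A (C x) = x"
    using linear_injective_isomorphism[OF lin] by blast
  have "(\<lambda>j. (C ^^ j) x) \<longlonglongrightarrow> 0" for x
  proof -
    have "(\<lambda>j. ((*v) (cmat C) ^^ j) (cvec x)) \<longlonglongrightarrow> 0"
    proof (rule matrix_powers_tendsto_0)
      fix \<mu> and v :: "complex^'n" assume v: "v \<noteq> 0" "cmat C *v v = \<mu> *s v"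
      have eq: "v = \<mu> *s (cmat A *v v)"
        using cmat_compose[OF lin C(1,3), of v] unfolding v(2) by (simp add: vector_scalar_commute)
      then have "\<mu> \<noteq> 0" using v(1) by auto
      have "(1 / \<mu>) *s v = (1 / \<mu>) *s (\<mu> *s (cmat A *v v))" using eq by simp
      then have "cmat A *v v = (1 / \<mu>) *s v" using \<open>\<mu> \<noteq> 0\<close> by simp
      from ev[OF v(1) this] show "cmod \<mu> < 1"
        using \<open>\<mu> \<noteq> 0\<close> by (simp add: norm_divide)
    qed
    moreover have "((*v) (cmat C) ^^ j) (cvec x) = cvec ((C ^^ j) x)" for j
      by (induction j) (simp_all add: cmat_cvec[OF C(1)])
    ultimately have "(\<lambda>j. norm (cvec ((C ^^ j) x))) \<longlonglongrightarrow> 0" by (simp add: tendsto_norm_zero_iff)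
    then show ?thesis by (simp add: norm_cvec tendsto_norm_zero_iff)
  qed
  then show thesis using C by (intro that)
qed

text \<open>The coordinates of the image of \<open>x\<close> under the j-th power of
  \<open>adjoint C\<close> are the inner products of \<open>x\<close> with the images of the unit
  vectors under \<open>C^j\<close>. Convergence at these finitely many vectors is therefore uniform
  contraction of the adjoint on balls.\<close>

lemma expanding_adjoint:
  fixes A C :: "real^'n \<Rightarrow> real^'n"
  assumes A: "linear A" and C: "linear C" "\<And>x. C (A x) = x" "\<And>x. A (C x) = x"
    and lim: "\<And>x. (\<lambda>j. (C ^^ j) x) \<longlonglongrightarrow> 0"
  shows "expanding (adjoint A) (adjoint C)"
proof (rule expanding.intro)
  show "linear (adjoint A)" "linear (adjoint C)" by (intro adjoint_linear A C)+
  show "adjoint A (adjoint C x) = x" for x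
  proof (rule vector_eq_ldot[THEN iffD1], rule allI)
    show "y \<bullet> adjoint A (adjoint C x) = y \<bullet> x" for y by (simp add: adjoint_works A C)
  qed
  show "adjoint C (adjoint A x) = x" for x
  proof (rule vector_eq_ldot[THEN iffD1], rule allI)
    show "y \<bullet> adjoint C (adjoint A x) = y \<bullet> x" for y by (simp add: adjoint_works A C)
  qed
  have pow: "y \<bullet> (adjoint C ^^ j) x = (C ^^ j) y \<bullet> x" for j x y
  proof (induction j arbitrary: y)
    case (Suc j)
    have "y \<bullet> (adjoint C ^^ Suc j) x = C y \<bullet> (adjoint C ^^ j) x" by (simp add: adjoint_works C)
    also have "\<dots> = (C ^^ j) (C y) \<bullet> x" by (rule Suc)
    finally show ?case by (simp add: funpow_swap1)
  qed simp
  fix e r :: real assume e: "0 < e"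
  have "(\<lambda>j. (\<Sum>i\<in>UNIV. norm ((C ^^ j) (axis i 1))) * \<bar>r\<bar>) \<longlonglongrightarrow> (\<Sum>i\<in>(UNIV::'n set). norm (0::real^'n)) * \<bar>r\<bar>"
    by (intro tendsto_intros lim)
  then obtain N where N: "\<And>j. j \<ge> N \<Longrightarrow> (\<Sum>i\<in>(UNIV::'n set). norm ((C ^^ j) (axis i 1))) * \<bar>r\<bar> < e"
    using order_tendstoD(2)[of _ 0 sequentially e] e by (auto simp: eventually_sequentially)
  have "norm ((adjoint C ^^ j) x) < e" if "j \<ge> N" "norm x \<le> r" for j x
  proof -
    have "norm ((adjoint C ^^ j) x) \<le> (\<Sum>i\<in>UNIV. \<bar>(adjoint C ^^ j) x $ i\<bar>)" by (rule norm_le_l1_cart)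
    also have "\<dots> \<le> (\<Sum>i\<in>UNIV. norm ((C ^^ j) (axis i 1)) * \<bar>r\<bar>)"
    proof (rule sum_mono)
      fix i
      have "(adjoint C ^^ j) x $ i = (C ^^ j) (axis i 1) \<bullet> x"
        using pow[of "axis i 1" j x] by (simp add: inner_axis')
      then have "\<bar>(adjoint C ^^ j) x $ i\<bar> \<le> norm ((C ^^ j) (axis i 1)) * norm x"
        using Cauchy_Schwarz_ineq2[of "(C ^^ j) (axis i 1)" x] by simp
      also have "\<dots> \<le> norm ((C ^^ j) (axis i 1)) * \<bar>r\<bar>" using that(2) by (intro mult_left_mono) auto
      finally show "\<bar>(adjoint C ^^ j) x $ i\<bar> \<le> norm ((C ^^ j) (axis i 1)) * \<bar>r\<bar>" .
    qed
    also have "\<dots> = (\<Sum>i\<in>UNIV. norm ((C ^^ j) (axis i 1))) * \<bar>r\<bar>" by (simp add: sum_distrib_right)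
    also have "\<dots> < e" by (rule N[OF that(1)])
    finally show ?thesis .
  qed
  then show "\<exists>N. \<forall>j\<ge>N. \<forall>x. norm x \<le> r \<longrightarrow> norm ((adjoint C ^^ j) x) < e" by blast
qed

section \<open>Tight frame generators\<close>

lemma infsum_ennreal_nat:
  fixes f :: "nat \<Rightarrow> ennreal"
  shows "infsum f I = (\<Sum>n. if n \<in> I then f n else 0)"
proof -
  have "infsum f I = infsum (\<lambda>n. if n \<in> I then f n else 0) UNIV"
    by (rule infsum_cong_neutral) auto
  moreover have "(\<lambda>n. if n \<in> I then f n else 0) summable_on UNIV"
    by (rule nonneg_summable_on_complete) simp
  then have "(\<lambda>n. if n \<in> I then f n else 0) sums infsum (\<lambda>n. if n \<in> I then f n else 0) UNIV"
    by (intro has_sum_imp_sums has_sum_infsum)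
  ultimately show ?thesis by (simp add: sums_iff)
qed

lemma infsum_int_lattice:
  fixes F :: "real^'n \<Rightarrow> ennreal"
  shows "infsum F int_lattice = (\<Sum>n. F (lattice_enum n))"
  using infsum_reindex_bij_betw[OF bij_lattice_enum, of F] infsum_ennreal_nat[of "\<lambda>n. F (lattice_enum n)" UNIV]
  by simp

lemma infsum_int_lattice_minus:
  fixes F :: "real^'n \<Rightarrow> ennreal"
  shows "infsum (\<lambda>k. F (- k)) int_lattice = infsum F int_lattice"
proof (rule infsum_reindex_bij_betw)
  show "bij_betw uminus int_lattice (int_lattice :: (real^'n) set)"
    by (rule bij_betwI[where g=uminus]) (simp_all add: int_lattice_minus)
qed

text \<open>The series of the spectral function in \<open>ennreal\<close>, where it makes sense
  before any convergence is known and can be integrated term by term.\<close>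

definition frame_sum :: "nat set \<Rightarrow> (nat \<Rightarrow> real^'n \<Rightarrow> complex) \<Rightarrow> real^'n \<Rightarrow> ennreal" where
  "frame_sum I \<phi> \<xi> = (\<Sum>n. if n \<in> I then ennreal ((cmod (fourier (\<phi> n) \<xi>))\<^sup>2) else 0)"

lemma hat_wave:
  assumes "shift_invariant V" "k \<in> int_lattice" "u \<in> hat V"
  shows "(\<lambda>x. wave k x * u x) \<in> hat V"
proof -
  obtain f where f: "f \<in> V" "AE x in lebesgue. fourier f x = u x" using assms(3) by (rule hatE)
  have V: "closed_L2_subspace V" and sh: "shift (- k) f \<in> V"
    using assms f(1) int_lattice_minus[of k] by (auto simp: shift_invariant_def)
  have fL: "f \<in> L2" by (rule closed_subspace_L2[OF V f(1)])
  show ?thesis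
  proof (rule hatI[OF sh shift_L2[OF fL]])
    show "AE x in lebesgue. fourier (shift (- k) f) x = wave k x * u x"
      using fourier_shift[OF fL, of "-k"] f(2) by eventually_elim (simp add: wave_minus_left)
  qed
qed

text \<open>The frame identity is applied to the \<open>f\<close> in \<open>V\<close> whose
  transform is the projection \<open>p\<close> of \<open>indicator E\<close>. Against modulations of
  transforms of members of \<open>V\<close>, \<open>p\<close> may be replaced by
  \<open>indicator E\<close>; the inner products thus become the Fourier coefficients of
  \<open>h\<close>, which is supported in one cube, and Parseval sums them.\<close>

lemma frame_sum_projection:
  fixes V :: "(real^'n \<Rightarrow> complex) set"
  assumes V: "shift_invariant V" and frame: "tight_frame_generator V I \<phi>"
    and E: "E \<in> sets lebesgue" "E \<subseteq> {x. x - \<theta> \<in> unit_cube}"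
  shows "\<exists>p\<in>hat V. (\<forall>y\<in>hat V. L2_inner (\<lambda>x. indicator E x - p x) y = 0) \<and>
    (\<integral>\<^sup>+x. indicator E x * frame_sum I \<phi> x \<partial>lebesgue) = ennreal ((L2_norm p)\<^sup>2)"
proof -
  have Vc: "closed_L2_subspace V" using V by (simp add: shift_invariant_def)
  have VL: "f \<in> V \<Longrightarrow> f \<in> L2" for f by (rule closed_subspace_L2[OF Vc])
  note Y = hat_closed_subspace[OF Vc]
  have cube: "{x. x - \<theta> \<in> unit_cube} \<in> sets lebesgue" "emeasure lebesgue {x. x - \<theta> \<in> unit_cube} = 1"
  proof -
    have "(\<lambda>x. x + \<theta>) ` unit_cube = {x. x - \<theta> \<in> unit_cube}"
      by (auto intro: image_eqI[of _ _ "_ - \<theta>"])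
    then show "{x. x - \<theta> \<in> unit_cube} \<in> sets lebesgue" "emeasure lebesgue {x. x - \<theta> \<in> unit_cube} = 1"
      using translation_sets_lebesgue[OF unit_cube_lebesgue, of \<theta>] emeasure_unit_cube[where 'n='n] by simp_all
  qed
  have fin: "emeasure lebesgue E < \<infinity>"
    using emeasure_mono[OF E(2) cube(1)] cube(2) by (auto intro: order_le_less_trans)
  have EL: "(indicator E :: _ \<Rightarrow> complex) \<in> L2" by (rule indicator_L2[OF E(1) fin])
  obtain p where p: "p \<in> hat V" "\<forall>y\<in>hat V. L2_inner (\<lambda>x. indicator E x - p x) y = 0"
    using L2_projection[OF Y EL] by blast
  have pL: "p \<in> L2" by (rule closed_subspace_L2[OF Y p(1)])
  obtain f where f: "f \<in> V" "AE x in lebesgue. fourier f x = p x" using p(1) by (rule hatE)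
  have inner_sum: "(\<Sum>\<^sub>\<infinity>k\<in>int_lattice. ennreal ((cmod (L2_inner f (shift k (\<phi> \<alpha>))))\<^sup>2))
      = (\<integral>\<^sup>+x. indicator E x * ennreal ((cmod (fourier (\<phi> \<alpha>) x))\<^sup>2) \<partial>lebesgue)" if \<alpha>: "\<alpha> \<in> I" for \<alpha>
  proof -
    have \<phi>V: "\<phi> \<alpha> \<in> V" using frame \<alpha> by (simp add: tight_frame_generator_def)
    note \<phi>L = VL[OF \<phi>V] and \<psi>L = fourier_L2[OF VL[OF \<phi>V]]
    define h where "h x = indicator E x * cnj (fourier (\<phi> \<alpha>) x)" for x
    have hL: "h \<in> L2" unfolding h_def
      by (rule L2_mult_bounded[OF L2_cnj[OF \<psi>L], where C=1])
        (use E in \<open>auto intro!: AE_I2 borel_measurable_indicator norm_indicator_le_1\<close>)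
    have coeff: "L2_inner f (shift k (\<phi> \<alpha>)) = fourier_L1 h (- k)" if k: "k \<in> int_lattice" for k
    proof -
      have sV: "shift k (\<phi> \<alpha>) \<in> V" using V \<phi>V k by (simp add: shift_invariant_def)
      have mem: "(\<lambda>x. wave (- k) x * fourier (\<phi> \<alpha>) x) \<in> hat V"
        using k by (intro hat_wave[OF V] fourier_in_hat \<phi>V \<phi>L) (simp add: int_lattice_minus)
      have memL: "(\<lambda>x. wave (- k) x * fourier (\<phi> \<alpha>) x) \<in> L2" by (rule closed_subspace_L2[OF Y mem])
      have "L2_inner f (shift k (\<phi> \<alpha>)) = L2_inner (fourier f) (fourier (shift k (\<phi> \<alpha>)))"
        by (rule fourier_inner[symmetric, OF VL[OF f(1)] VL[OF sV]])
      also have "\<dots> = L2_inner p (\<lambda>x. wave (- k) x * fourier (\<phi> \<alpha>) x)"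
        using fourier_shift[OF \<phi>L, of k]
        by (intro L2_inner_cong fourier_L2 VL f sV) (simp_all add: wave_minus_left)
      also have "\<dots> = L2_inner (indicator E) (\<lambda>x. wave (- k) x * fourier (\<phi> \<alpha>) x)"
        using bspec[OF p(2) mem] EL pL memL by (simp add: L2_inner_diff_left)
      also have "\<dots> = fourier_L1 h (- k)"
        by (simp add: L2_inner_def fourier_L1_wave h_def mult_ac)
      finally show ?thesis .
    qed
    have "(\<Sum>\<^sub>\<infinity>k\<in>int_lattice. ennreal ((cmod (L2_inner f (shift k (\<phi> \<alpha>))))\<^sup>2))
        = (\<Sum>\<^sub>\<infinity>k\<in>int_lattice. ennreal ((cmod (fourier_L1 h (- k)))\<^sup>2))"
      by (rule infsum_cong) (simp add: coeff)
    also have "\<dots> = (\<Sum>n. ennreal ((cmod (fourier_L1 h (lattice_enum n)))\<^sup>2))"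
      unfolding infsum_int_lattice_minus[of "\<lambda>k. ennreal ((cmod (fourier_L1 h k))\<^sup>2)"] by (rule infsum_int_lattice)
    also have "\<dots> = ennreal ((L2_norm h)\<^sup>2)"
    proof (rule suminf_ennreal_eq)
      have "h x = 0" if "x - \<theta> \<notin> unit_cube" for x
        using E(2) that by (auto simp: h_def indicator_def)
      from parseval_cube[OF hL this, of \<theta> 0]
      show "(\<lambda>n. (cmod (fourier_L1 h (lattice_enum n)))\<^sup>2) sums (L2_norm h)\<^sup>2" by simp
    qed simp
    also have "\<dots> = (\<integral>\<^sup>+x. indicator E x * ennreal ((cmod (fourier (\<phi> \<alpha>) x))\<^sup>2) \<partial>lebesgue)"
      unfolding nn_integral_L2_norm[OF hL, symmetric]
      by (rule nn_integral_cong) (simp add: h_def indicator_def)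
    finally show ?thesis .
  qed
  have m: "(\<lambda>x. indicator E x * (if n \<in> I then ennreal ((cmod (fourier (\<phi> n) x))\<^sup>2) else 0)) \<in> borel_measurable lebesgue" for n
  proof (cases "n \<in> I")
    case True
    then have "fourier (\<phi> n) \<in> borel_measurable lebesgue"
      using frame by (intro L2_measurable fourier_L2 VL) (simp add: tight_frame_generator_def)
    then have "(\<lambda>x. ennreal ((cmod (fourier (\<phi> n) x))\<^sup>2)) \<in> borel_measurable lebesgue" by measurable
    then show ?thesis using True E(1) by (simp add: borel_measurable_times_ennreal borel_measurable_indicator)
  qed simp
  have "(\<integral>\<^sup>+x. indicator E x * frame_sum I \<phi> x \<partial>lebesgue)
      = (\<integral>\<^sup>+x. (\<Sum>n. indicator E x * (if n \<in> I then ennreal ((cmod (fourier (\<phi> n) x))\<^sup>2) else 0)) \<partial>lebesgue)"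
    unfolding frame_sum_def ennreal_suminf_cmult ..
  also have "\<dots> = (\<Sum>n. \<integral>\<^sup>+x. indicator E x * (if n \<in> I then ennreal ((cmod (fourier (\<phi> n) x))\<^sup>2) else 0) \<partial>lebesgue)"
    by (rule nn_integral_suminf) (rule m)
  also have "\<dots> = (\<Sum>n. if n \<in> I then (\<Sum>\<^sub>\<infinity>k\<in>int_lattice. ennreal ((cmod (L2_inner f (shift k (\<phi> n))))\<^sup>2)) else 0)"
    by (rule suminf_cong) (simp add: inner_sum)
  also have "\<dots> = (\<Sum>\<^sub>\<infinity>\<alpha>\<in>I. \<Sum>\<^sub>\<infinity>k\<in>int_lattice. ennreal ((cmod (L2_inner f (shift k (\<phi> \<alpha>))))\<^sup>2))"
    by (rule infsum_ennreal_nat[symmetric])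
  also have "\<dots> = ennreal ((L2_norm f)\<^sup>2)"
    using frame f(1) by (simp add: tight_frame_generator_def)
  also have "L2_norm f = L2_norm p"
    using fourier_norm[OF VL[OF f(1)]] L2_norm_cong[OF fourier_L2[OF VL[OF f(1)]] f(2)] by simp
  finally show ?thesis using p by blast
qed

lemma frame_sum_measurable:
  assumes "closed_L2_subspace V" "tight_frame_generator V I \<phi>"
  shows "frame_sum I \<phi> \<in> borel_measurable lebesgue"
  unfolding frame_sum_def
proof (rule borel_measurable_suminf_order)
  fix n
  show "(\<lambda>x. if n \<in> I then ennreal ((cmod (fourier (\<phi> n) x))\<^sup>2) else 0) \<in> borel_measurable lebesgue"
  proof (cases "n \<in> I")
    case True
    then have "fourier (\<phi> n) \<in> borel_measurable lebesgue"
      using assms(2) by (intro L2_measurable fourier_L2 closed_subspace_L2[OF assms(1)]) (simp add: tight_frame_generator_def)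
    then have "(\<lambda>x. ennreal ((cmod (fourier (\<phi> n) x))\<^sup>2)) \<in> borel_measurable lebesgue" by measurable
    then show ?thesis using True by simp
  qed simp
qed

text \<open>Projections do not increase norms, so the integral over a small set is at most its
  measure; the test set is where the bound fails.\<close>

lemma frame_sum_le_1:
  fixes V :: "(real^'n \<Rightarrow> complex) set"
  assumes V: "shift_invariant V" and frame: "tight_frame_generator V I \<phi>"
  shows "AE x in lebesgue. frame_sum I \<phi> x \<le> 1"
proof (rule AE_ball_cover[of "1/2"])
  fix c :: "real^'n"
  have Vc: "closed_L2_subspace V" using V by (simp add: shift_invariant_def)
  have Y: "closed_L2_subspace (hat V)" by (rule hat_closed_subspace[OF Vc])
  \<comment> \<open>Truncation at 2 gives a bounded real function that still exceeds 1 exactly where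
    \<open>frame_sum\<close> does.\<close>
  define \<tau> where "\<tau> x = enn2real (min (frame_sum I \<phi> x) 2)" for x
  have fm: "(\<lambda>x. min (frame_sum I \<phi> x) 2) \<in> borel_measurable lebesgue"
    using frame_sum_measurable[OF Vc frame] by measurable
  then have \<tau>m: "\<tau> \<in> borel_measurable lebesgue" unfolding \<tau>_def by measurable
  have \<tau>_eq: "ennreal (\<tau> x) = min (frame_sum I \<phi> x) 2" for x
    unfolding \<tau>_def by (rule ennreal_enn2real) (auto simp: min_less_iff_disj)
  have \<tau>_le: "0 \<le> \<tau> x" "\<tau> x \<le> 2" for x
  proof -
    show "0 \<le> \<tau> x" by (simp add: \<tau>_def)
    have "ennreal (\<tau> x) \<le> ennreal 2" unfolding \<tau>_eq by simp
    then show "\<tau> x \<le> 2" by (simp only: ennreal_le_iff zero_le_numeral)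
  qed
  define E where "E = {x \<in> space lebesgue. 1 < \<tau> x} \<inter> ball c (1/2)"
  have Em: "E \<in> sets lebesgue" unfolding E_def
    by (intro sets.Int borel_measurable_less borel_measurable_const \<tau>m) simp
  have fin: "emeasure lebesgue E < \<infinity>"
    by (intro emeasure_bounded_lebesgue Em) (auto simp: E_def intro: bounded_subset[OF bounded_ball])
  have EL: "(indicator E :: _ \<Rightarrow> complex) \<in> L2" by (rule indicator_L2[OF Em fin])
  have sub: "E \<subseteq> {x. x - (c - (\<chi> i. 1/2)) \<in> unit_cube}"
  proof
    fix x assume "x \<in> E"
    then have "norm (x - c) < 1/2" by (simp add: E_def dist_norm norm_minus_commute)
    then have *: "\<bar>x $ i - c $ i\<bar> < 1/2" for i
      using component_le_norm_cart[of "x - c" i] by simp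
    have "0 \<le> x $ i - (c $ i - 1/2) \<and> x $ i - (c $ i - 1/2) < 1" for i
      using *[of i] unfolding abs_less_iff by linarith
    then show "x \<in> {x. x - (c - (\<chi> i. 1/2)) \<in> unit_cube}" by (simp add: unit_cube_def)
  qed
  obtain p where p: "p \<in> hat V" "\<forall>y\<in>hat V. L2_inner (\<lambda>x. indicator E x - p x) y = 0"
    "(\<integral>\<^sup>+x. indicator E x * frame_sum I \<phi> x \<partial>lebesgue) = ennreal ((L2_norm p)\<^sup>2)"
    using frame_sum_projection[OF V frame Em sub] by blast
  have "L2_norm p \<le> L2_norm (indicator E)"
    by (rule projection_norm_mono[OF EL closed_subspace_L2[OF Y p(1)] EL bspec[OF p(2) p(1)]])
      (simp add: L2_inner_def)
  then have "(L2_norm p)\<^sup>2 \<le> measure lebesgue E"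
    unfolding L2_norm_indicator[OF Em, symmetric] by (rule power_mono) simp
  then have le: "(\<integral>\<^sup>+x. indicator E x * frame_sum I \<phi> x \<partial>lebesgue) \<le> ennreal (measure lebesgue E)"
    unfolding p(3) by (rule ennreal_leI)
  have int: "integrable lebesgue (\<lambda>x. indicator E x * \<tau> x)"
    by (rule integrable_indicator_bounded[OF Em fin \<tau>m, of 2]) (use \<tau>_le in \<open>auto simp: abs_le_iff intro: order.trans[of _ 0]\<close>)
  have i1: "integrable lebesgue (indicator E :: _ \<Rightarrow> real)" using Em fin by (intro integrable_real_indicator)
  have "ennreal (LINT x|lebesgue. indicator E x * \<tau> x) = (\<integral>\<^sup>+x. ennreal (indicator E x * \<tau> x) \<partial>lebesgue)"
    using \<tau>_le(1) by (intro nn_integral_eq_integral[symmetric] int) simp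
  also have "\<dots> \<le> (\<integral>\<^sup>+x. indicator E x * frame_sum I \<phi> x \<partial>lebesgue)"
    by (rule nn_integral_mono) (simp add: ennreal_mult' ennreal_indicator \<tau>_eq indicator_def)
  also note le
  finally have "(LINT x|lebesgue. indicator E x * \<tau> x) \<le> measure lebesgue E" by simp
  then have "(LINT x|lebesgue. indicator E x * \<tau> x - indicator E x) \<le> 0"
    unfolding Bochner_Integration.integral_diff[OF int i1] using Em by simp
  moreover have nn: "0 \<le> indicator E x * \<tau> x - indicator E x" for x by (simp add: indicator_def E_def)
  then have "0 \<le> (LINT x|lebesgue. indicator E x * \<tau> x - indicator E x)"
    by (rule Bochner_Integration.integral_nonneg)
  ultimately have "(LINT x|lebesgue. indicator E x * \<tau> x - indicator E x) = 0" by linarith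
  then have "AE x in lebesgue. indicator E x * \<tau> x - indicator E x = 0"
    using integral_nonneg_eq_0_iff_AE[OF Bochner_Integration.integrable_diff[OF int i1]] nn by simp
  then show "AE x in lebesgue. x \<in> ball c (1/2) \<longrightarrow> frame_sum I \<phi> x \<le> 1"
  proof eventually_elim
    case (elim x)
    show ?case
    proof
      assume x: "x \<in> ball c (1/2)"
      have "\<tau> x \<le> 1"
      proof (rule ccontr)
        assume "\<not> \<tau> x \<le> 1"
        then have "x \<in> E" using x by (simp add: E_def)
        then show False using elim \<open>\<not> \<tau> x \<le> 1\<close> by simp
      qed
      then have "ennreal (\<tau> x) \<le> 1" by simp
      then show "frame_sum I \<phi> x \<le> 1" unfolding \<tau>_eq by (auto simp: min_le_iff_disj)
    qed
  qed
qed simp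

text \<open>The bound guarantees convergence of the real series, so the default value 0 of a
  divergent \<open>infsum\<close> does not interfere.\<close>

lemma frame_sum_spectral:
  assumes "frame_sum I \<phi> \<xi> \<le> 1"
  shows "ennreal (\<Sum>\<^sub>\<infinity>\<alpha>\<in>I. (cmod (fourier (\<phi> \<alpha>) \<xi>))\<^sup>2) = frame_sum I \<phi> \<xi>"
proof -
  define a where "a n = (if n \<in> I then (cmod (fourier (\<phi> n) \<xi>))\<^sup>2 else 0)" for n
  have a: "0 \<le> a n" for n by (simp add: a_def)
  have eq: "frame_sum I \<phi> \<xi> = (\<Sum>n. ennreal (a n))"
    unfolding frame_sum_def a_def by (rule suminf_cong) simp
  then have "(\<Sum>n. ennreal (a n)) \<noteq> top" using assms by (auto simp: top_unique)
  then have sum: "summable a" using a by (intro summable_suminf_not_top)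
  have "(\<Sum>\<^sub>\<infinity>\<alpha>\<in>I. (cmod (fourier (\<phi> \<alpha>) \<xi>))\<^sup>2) = infsum a UNIV"
    by (rule infsum_cong_neutral) (auto simp: a_def)
  also have "\<dots> = suminf a"
    using sums_nonneg_imp_has_sum[OF summable_sums[OF sum]] a by (intro infsumI) simp
  finally show ?thesis unfolding eq using suminf_ennreal2[OF a sum] by simp
qed

text \<open>Composed with the n-th power of \<open>adjoint A\<close>, the transform of a dilated
  function is a nonzero constant times the transform of the original one, and \<open>V\<close>
  absorbs the constant.\<close>

lemma dilation_power_hat:
  fixes A C :: "real^'n \<Rightarrow> real^'n"
  assumes A: "linear A" and C: "linear C" "\<And>x. C (A x) = x" "\<And>x. A (C x) = x"
    and exp: "expanding (adjoint A) (adjoint C)" and det: "det (matrix A) \<noteq> 0"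
    and V: "closed_L2_subspace V" and u: "u \<in> L2"
  shows "u \<in> hat ((dilation A ^^ n) ` V) \<longleftrightarrow> (\<lambda>x. u ((adjoint A ^^ n) x)) \<in> hat V"
proof -
  interpret expanding "adjoint A" "adjoint C" by (rule exp)
  define c where "c = complex_of_real (sqrt \<bar>det (matrix A)\<bar>) ^ n"
  have c0: "c \<noteq> 0" using det by (simp add: c_def)
  obtain d1 where d1: "rescales A d1" using rescales_linear[OF A C(1) C(3) C(2)] .
  define d where "d = d1 ^ n"
  have dA: "rescales (A ^^ n) d" unfolding d_def by (rule rescales_funpow[OF d1])
  have d0: "complex_of_real d \<noteq> 0" using rescales_pos[OF dA] by simp
  have CA: "(C ^^ n) ((A ^^ n) x) = x" for x
  proof (induction n arbitrary: x)
    case (Suc n)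
    have "(C ^^ Suc n) ((A ^^ Suc n) x) = C ((C ^^ n) ((A ^^ n) (A x)))" by (simp add: funpow_swap1)
    then show ?case by (simp add: Suc C)
  qed simp
  have adj: "(adjoint C ^^ n) \<xi> \<bullet> x = \<xi> \<bullet> (C ^^ n) x" for \<xi> x
  proof (induction n arbitrary: x)
    case (Suc n)
    have "(adjoint C ^^ Suc n) \<xi> \<bullet> x = (adjoint C ^^ n) \<xi> \<bullet> C x"
      using adjoint_works[OF C(1), of x "(adjoint C ^^ n) \<xi>"] by (simp add: inner_commute)
    then show ?case by (simp add: Suc funpow_swap1)
  qed simp
  have Dn: "(dilation A ^^ n) g = (\<lambda>x. c * g ((A ^^ n) x))" for g
    unfolding c_def
  proof (induction n)
    case (Suc n)
    have "(dilation A ^^ Suc n) g = dilation A (\<lambda>x. complex_of_real (sqrt \<bar>det (matrix A)\<bar>) ^ n * g ((A ^^ n) x))"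
      by (simp add: Suc)
    also have "\<dots> = (\<lambda>x. complex_of_real (sqrt \<bar>det (matrix A)\<bar>) ^ Suc n * g ((A ^^ Suc n) x))"
      by (simp add: dilation_def fun_eq_iff mult.assoc funpow_swap1)
    finally show ?case .
  qed simp
  have key: "AE \<xi> in lebesgue. fourier ((dilation A ^^ n) g) ((adjoint A ^^ n) \<xi>) = (c / complex_of_real d) * fourier g \<xi>"
    if g: "g \<in> L2" for g
  proof -
    note gA = rescales_L2(1)[OF dA g]
    have "AE \<xi> in lebesgue. fourier g ((adjoint C ^^ n) \<xi>) = complex_of_real d * fourier (\<lambda>x. g ((A ^^ n) x)) \<xi>"
      by (rule fourier_linear[OF dA CA adj rescales_Rn g])
    from rescales_AE[OF rescales_Bn this, of n]
    have "AE \<xi> in lebesgue. fourier g \<xi> = complex_of_real d * fourier (\<lambda>x. g ((A ^^ n) x)) ((adjoint A ^^ n) \<xi>)"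
      by simp
    moreover have "AE \<xi> in lebesgue. fourier (\<lambda>x. c * g ((A ^^ n) x)) ((adjoint A ^^ n) \<xi>) = c * fourier (\<lambda>x. g ((A ^^ n) x)) ((adjoint A ^^ n) \<xi>)"
      by (rule rescales_AE[OF rescales_Bn fourier_cmult[OF gA]])
    ultimately show ?thesis unfolding Dn by eventually_elim (use d0 in simp)
  qed
  have DL: "(dilation A ^^ n) g \<in> L2" if "g \<in> L2" for g
    unfolding Dn by (intro L2_cmult rescales_L2(1)[OF dA] that)
  have VL: "g \<in> V \<Longrightarrow> g \<in> L2" for g by (rule closed_subspace_L2[OF V])
  show ?thesis
  proof
    assume "u \<in> hat ((dilation A ^^ n) ` V)"
    then obtain g where g: "g \<in> V" "AE x in lebesgue. fourier ((dilation A ^^ n) g) x = u x"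
      by (auto elim: hatE)
    show "(\<lambda>x. u ((adjoint A ^^ n) x)) \<in> hat V"
    proof (rule hatI[OF closed_subspace_cmult[OF V g(1), of "c / complex_of_real d"] L2_cmult[OF VL[OF g(1)]]])
      show "AE x in lebesgue. fourier (\<lambda>x. c / complex_of_real d * g x) x = u ((adjoint A ^^ n) x)"
        using rescales_AE[OF rescales_Bn g(2), of n] key[OF VL[OF g(1)]] fourier_cmult[OF VL[OF g(1)], of "c / complex_of_real d"]
        by eventually_elim simp
    qed
  next
    assume "(\<lambda>x. u ((adjoint A ^^ n) x)) \<in> hat V"
    then obtain g where g: "g \<in> V" "AE x in lebesgue. fourier g x = u ((adjoint A ^^ n) x)" by (rule hatE)
    define h where "h x = (complex_of_real d / c) * g x" for x
    have hV: "h \<in> V" unfolding h_def by (rule closed_subspace_cmult[OF V g(1)])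
    have "AE x in lebesgue. fourier ((dilation A ^^ n) h) ((adjoint A ^^ n) x) = u ((adjoint A ^^ n) x)"
      using key[OF VL[OF hV]] g(2) fourier_cmult[OF VL[OF g(1)], of "complex_of_real d / c"]
      by eventually_elim (use d0 c0 in \<open>simp add: h_def[abs_def]\<close>)
    from rescales_AE[OF rescales_Rn this, of n]
    have "AE x in lebesgue. fourier ((dilation A ^^ n) h) x = u x" by simp
    then show "u \<in> hat ((dilation A ^^ n) ` V)"
      by (intro hatI[of "(dilation A ^^ n) h"] imageI hV DL[OF VL[OF hV]])
  qed
qed

section \<open>Supports of transforms and generating sets\<close>

lemma closed_subspace_fourier_supp:
  assumes U: "U \<in> sets lebesgue"
  shows "closed_L2_subspace {f \<in> L2. AE x in lebesgue. fourier f x \<noteq> 0 \<longrightarrow> x \<in> U}" (is "closed_L2_subspace ?Z")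
  unfolding closed_L2_subspace_def
proof (intro conjI ballI allI)
  have Z: "f \<in> ?Z \<longleftrightarrow> f \<in> L2 \<and> (AE x in lebesgue. fourier f x \<noteq> 0 \<longrightarrow> x \<in> U)" for f by simp
  show "?Z \<subseteq> L2" by blast
  show "(\<lambda>x. 0) \<in> ?Z"
  proof -
    have "AE x in lebesgue. fourier (\<lambda>x. 0) x = 0" using fourier_cmult[OF L2_zero, of 0] by simp
    then have "AE x in lebesgue. fourier (\<lambda>x. 0) x \<noteq> 0 \<longrightarrow> x \<in> U" by eventually_elim simp
    then show ?thesis by simp
  qed
  show "(\<lambda>x. f x + g x) \<in> ?Z" if f: "f \<in> ?Z" and g: "g \<in> ?Z" for f g
  proof -
    have L: "f \<in> L2" "g \<in> L2" using f g by simp_all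
    have "AE x in lebesgue. fourier f x \<noteq> 0 \<longrightarrow> x \<in> U" "AE x in lebesgue. fourier g x \<noteq> 0 \<longrightarrow> x \<in> U"
      using f g by simp_all
    then have "AE x in lebesgue. fourier (\<lambda>x. f x + g x) x \<noteq> 0 \<longrightarrow> x \<in> U"
      using fourier_add[OF L] by eventually_elim auto
    then show ?thesis using L2_add[OF L] by simp
  qed
  show "(\<lambda>x. c * f x) \<in> ?Z" if f: "f \<in> ?Z" for c f
  proof -
    have L: "f \<in> L2" using f by simp
    have "AE x in lebesgue. fourier f x \<noteq> 0 \<longrightarrow> x \<in> U" using f by simp
    then have "AE x in lebesgue. fourier (\<lambda>x. c * f x) x \<noteq> 0 \<longrightarrow> x \<in> U"
      using fourier_cmult[OF L, of c] by eventually_elim auto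
    then show ?thesis using L2_cmult[OF L] by simp
  qed
  show "L2_closure ?Z \<subseteq> ?Z"
  proof
    fix f assume f: "f \<in> L2_closure ?Z"
    then obtain u where u: "\<And>n. u n \<in> ?Z" "L2_tendsto u f" unfolding L2_closure_def by auto
    have "L2_tendsto (\<lambda>n x. indicator U x * fourier (u n) x) (\<lambda>x. indicator U x * fourier f x)"
      by (rule L2_tendsto_mult_bounded[OF fourier_tendsto[OF u(2)], where C=1])
        (auto intro!: AE_I2 borel_measurable_indicator U norm_indicator_le_1)
    moreover have "L2_tendsto (\<lambda>n x. indicator U x * fourier (u n) x) (fourier f)"
    proof (rule L2_tendsto_cong[OF fourier_tendsto[OF u(2)]])
      fix n
      have "AE x in lebesgue. fourier (u n) x \<noteq> 0 \<longrightarrow> x \<in> U" using u(1)[of n] by simp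
      then show "AE x in lebesgue. fourier (u n) x = indicator U x * fourier (u n) x"
        by eventually_elim (auto simp: indicator_def)
    qed simp
    ultimately have "AE x in lebesgue. indicator U x * fourier f x = fourier f x" by (rule L2_tendsto_unique)
    then have "AE x in lebesgue. fourier f x \<noteq> 0 \<longrightarrow> x \<in> U" by eventually_elim (auto simp: indicator_def)
    then show "f \<in> ?Z" using L2_closure_L2[OF f] by simp
  qed
qed

text \<open>A shift multiplies the transform by a unimodular function and keeps its support, and the
  functions with spectrum in \<open>U\<close> form a closed subspace.\<close>

lemma shift_generates_supp:
  assumes gen: "shift_generates \<G> V" and \<G>: "\<G> \<subseteq> L2" and U: "U \<in> sets lebesgue"
    and supp: "\<And>\<phi>. \<phi> \<in> \<G> \<Longrightarrow> AE x in lebesgue. fourier \<phi> x \<noteq> 0 \<longrightarrow> x \<in> U"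
    and f: "f \<in> V"
  shows "AE x in lebesgue. fourier f x \<noteq> 0 \<longrightarrow> x \<in> U"
proof -
  let ?Z = "{f \<in> L2. AE x in lebesgue. fourier f x \<noteq> 0 \<longrightarrow> x \<in> U}"
  note Z = closed_subspace_fourier_supp[OF U]
  have sh: "shift k \<phi> \<in> ?Z" if \<phi>: "\<phi> \<in> \<G>" for k \<phi>
  proof -
    have L: "\<phi> \<in> L2" using \<phi> \<G> by blast
    have "AE x in lebesgue. fourier (shift k \<phi>) x \<noteq> 0 \<longrightarrow> x \<in> U"
      using fourier_shift[OF L, of k] supp[OF \<phi>] by eventually_elim auto
    then show ?thesis using shift_L2[OF L] by simp
  qed
  have "lin_span {shift k \<phi> | k \<phi>. k \<in> int_lattice \<and> \<phi> \<in> \<G>} \<subseteq> ?Z"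
  proof
    fix g assume "g \<in> lin_span {shift k \<phi> | k \<phi>. k \<in> int_lattice \<and> \<phi> \<in> \<G>}"
    then obtain T c where T: "g = (\<lambda>x. \<Sum>h\<in>T. c h * h x)" "T \<subseteq> {shift k \<phi> | k \<phi>. k \<in> int_lattice \<and> \<phi> \<in> \<G>}"
      unfolding lin_span_def by blast
    show "g \<in> ?Z" unfolding T(1)
    proof (rule closed_subspace_sum[OF Z])
      fix h assume "h \<in> T"
      then obtain k \<phi> where "h = shift k \<phi>" "\<phi> \<in> \<G>" using T(2) by blast
      then have "h \<in> ?Z" using sh by simp
      then show "(\<lambda>x. c h * h x) \<in> ?Z" by (rule closed_subspace_cmult[OF Z])
    qed
  qed
  then have "L2_closure (lin_span {shift k \<phi> | k \<phi>. k \<in> int_lattice \<and> \<phi> \<in> \<G>}) \<subseteq> L2_closure ?Z"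
    by (rule L2_closure_mono)
  also have "\<dots> \<subseteq> ?Z" using Z unfolding closed_L2_subspace_def by blast
  finally have "f \<in> ?Z" using gen f unfolding shift_generates_def by blast
  then show ?thesis by simp
qed

lemma shift_generates_self:
  assumes V: "closed_L2_subspace V"
  shows "shift_generates V V"
  unfolding shift_generates_def
proof
  fix f assume f: "f \<in> V"
  let ?S = "lin_span {shift k \<phi> | k \<phi>. k \<in> int_lattice \<and> \<phi> \<in> V}"
  have "shift 0 f = f" by (simp add: shift_def)
  then have "f = shift 0 f" by simp
  then have "f \<in> {shift k \<phi> | k \<phi>. k \<in> int_lattice \<and> \<phi> \<in> V}"
    using f int_lattice_zero by (intro CollectI exI conjI)
  then have "f \<in> ?S"
    unfolding lin_span_def by (intro CollectI exI[of _ "{f}"] exI[of _ "\<lambda>_. 1"]) simp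
  then show "f \<in> L2_closure ?S"
    unfolding L2_closure_def using L2_tendsto_const[OF closed_subspace_L2[OF V f]]
    by (intro CollectI exI[of _ "\<lambda>n. f"]) simp
qed

section \<open>The equivalence\<close>

text \<open>Supplies the assumptions of the locale \<open>spectral\<close>; beyond this point no
  tight frame generator occurs.\<close>

lemma spectral_function_axioms:
  fixes V :: "(real^'n \<Rightarrow> complex) set"
  assumes V: "shift_invariant V" and spec: "is_spectral_function V \<sigma>"
  shows "\<sigma> \<in> borel_measurable lebesgue" "AE x in lebesgue. 0 \<le> \<sigma> x \<and> \<sigma> x \<le> 1"
    and "\<And>E \<theta>. E \<in> sets lebesgue \<Longrightarrow> E \<subseteq> {x. x - \<theta> \<in> unit_cube} \<Longrightarrow>
      \<exists>p\<in>hat V. (\<forall>y\<in>hat V. L2_inner (\<lambda>x. indicator E x - p x) y = 0) \<and>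
        (LINT x|lebesgue. indicator E x * \<sigma> x) = (L2_norm p)\<^sup>2"
proof -
  have Vc: "closed_L2_subspace V" using V by (simp add: shift_invariant_def)
  obtain I \<phi> where frame: "tight_frame_generator V I \<phi>"
    and \<sigma>: "AE \<xi> in lebesgue. \<sigma> \<xi> = (\<Sum>\<^sub>\<infinity>\<alpha>\<in>I. (cmod (fourier (\<phi> \<alpha>) \<xi>))\<^sup>2)"
    using spec unfolding is_spectral_function_def by blast
  have eq: "AE \<xi> in lebesgue. 0 \<le> \<sigma> \<xi> \<and> \<sigma> \<xi> \<le> 1 \<and> ennreal (\<sigma> \<xi>) = frame_sum I \<phi> \<xi>"
    using \<sigma> frame_sum_le_1[OF V frame]
  proof eventually_elim
    case (elim \<xi>)
    have nn: "0 \<le> \<sigma> \<xi>" unfolding elim(1) by (rule infsum_nonneg) simp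
    have "ennreal (\<sigma> \<xi>) = frame_sum I \<phi> \<xi>"
      using frame_sum_spectral[OF elim(2)] elim(1) by simp
    moreover from this have "ennreal (\<sigma> \<xi>) \<le> 1" using elim(2) by (simp only:)
    then have "\<sigma> \<xi> \<le> 1" by simp
    ultimately show ?case using nn by simp
  qed
  show "AE x in lebesgue. 0 \<le> \<sigma> x \<and> \<sigma> x \<le> 1" using eq by eventually_elim simp
  have fm: "(\<lambda>\<xi>. enn2real (frame_sum I \<phi> \<xi>)) \<in> borel_measurable lebesgue"
    using frame_sum_measurable[OF Vc frame] by measurable
  have "AE \<xi> in lebesgue. enn2real (frame_sum I \<phi> \<xi>) = \<sigma> \<xi>"
    using eq by eventually_elim (metis enn2real_ennreal)
  then show \<sigma>m: "\<sigma> \<in> borel_measurable lebesgue" by (rule measurable_lebesgue_AE[OF fm])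
  show "\<exists>p\<in>hat V. (\<forall>y\<in>hat V. L2_inner (\<lambda>x. indicator E x - p x) y = 0) \<and>
        (LINT x|lebesgue. indicator E x * \<sigma> x) = (L2_norm p)\<^sup>2"
    if E: "E \<in> sets lebesgue" "E \<subseteq> {x. x - \<theta> \<in> unit_cube}" for E \<theta>
  proof -
    obtain p where p: "p \<in> hat V" "\<forall>y\<in>hat V. L2_inner (\<lambda>x. indicator E x - p x) y = 0"
      "(\<integral>\<^sup>+x. indicator E x * frame_sum I \<phi> x \<partial>lebesgue) = ennreal ((L2_norm p)\<^sup>2)"
      using frame_sum_projection[OF V frame E] by blast
    have "(LINT x|lebesgue. indicator E x * \<sigma> x) = enn2real (\<integral>\<^sup>+x. ennreal (indicator E x * \<sigma> x) \<partial>lebesgue)"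
    proof (rule integral_eq_nn_integral)
      show "(\<lambda>x. indicator E x * \<sigma> x) \<in> borel_measurable lebesgue"
        using E(1) \<sigma>m by (intro borel_measurable_times borel_measurable_indicator)
      show "AE x in lebesgue. 0 \<le> indicator E x * \<sigma> x" using eq by eventually_elim simp
    qed
    also have "(\<integral>\<^sup>+x. ennreal (indicator E x * \<sigma> x) \<partial>lebesgue) = (\<integral>\<^sup>+x. indicator E x * frame_sum I \<phi> x \<partial>lebesgue)"
      by (rule nn_integral_cong_AE, use eq in eventually_elim) (auto simp: indicator_def)
    finally show ?thesis using p by auto
  qed
qed

lemma hat_mono: "S \<subseteq> T \<Longrightarrow> hat S \<subseteq> hat T"
  unfolding hat_def by blast

text \<open>The inclusion from right to left rests on the surjectivity
  \<open>hat_L2\<close>.\<close>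

lemma hat_H2:
  fixes G :: "(real^'n) set"
  shows "hat (H2 G) = {g \<in> L2. AE x in lebesgue. g x \<noteq> 0 \<longrightarrow> x \<in> G}"
proof (intro equalityI subsetI)
  fix g :: "real^'n \<Rightarrow> complex" assume "g \<in> hat (H2 G)"
  then obtain f where f: "g \<in> L2" "f \<in> H2 G" "AE x in lebesgue. fourier f x = g x" by (rule hatE)
  have "AE x in lebesgue. fourier f x \<noteq> 0 \<longrightarrow> x \<in> G"
    using f(2) by (simp add: H2_def ae_subset_def Supp_def)
  with f(3) have "AE x in lebesgue. g x \<noteq> 0 \<longrightarrow> x \<in> G" by eventually_elim simp
  with f(1) show "g \<in> {g \<in> L2. AE x in lebesgue. g x \<noteq> 0 \<longrightarrow> x \<in> G}" by simp
next
  fix g :: "real^'n \<Rightarrow> complex" assume g: "g \<in> {g \<in> L2. AE x in lebesgue. g x \<noteq> 0 \<longrightarrow> x \<in> G}"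
  then have "g \<in> hat L2" by (simp add: hat_L2)
  then obtain f where f: "f \<in> L2" "AE x in lebesgue. fourier f x = g x" by (rule hatE)
  have "AE x in lebesgue. g x \<noteq> 0 \<longrightarrow> x \<in> G" using g by simp
  with f(2) have "AE x in lebesgue. fourier f x \<noteq> 0 \<longrightarrow> x \<in> G" by eventually_elim simp
  then have "f \<in> H2 G" using f(1) by (simp add: H2_def ae_subset_def Supp_def)
  then show "g \<in> hat (H2 G)" using f by (intro hatI[of f])
qed

text \<open>Transforms that agree almost everywhere come from functions that agree almost
  everywhere, so \<open>S\<close> has to be saturated under this relation, as \<open>sat\<close>
  demands.\<close>

lemma hat_inject_AE:
  assumes S: "S \<subseteq> L2" and sat: "\<And>f g. f \<in> S \<Longrightarrow> AE x in lebesgue. f x = g x \<Longrightarrow> g \<in> S"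
    and T: "T \<subseteq> L2" and sub: "hat T \<subseteq> hat S"
  shows "T \<subseteq> S"
proof
  fix f assume f: "f \<in> T"
  then have fL: "f \<in> L2" using T by blast
  have "fourier f \<in> hat S" using fourier_in_hat[OF f fL] sub by blast
  then obtain g where g: "g \<in> S" "AE x in lebesgue. fourier g x = fourier f x" by (rule hatE)
  have gL: "g \<in> L2" using g(1) S by blast
  have "L2_norm (\<lambda>x. fourier g x - fourier f x) = 0"
    unfolding L2_norm_eq_0_iff[OF L2_diff[OF fourier_L2[OF gL] fourier_L2[OF fL]]] using g(2) by simp
  then have "L2_norm (\<lambda>x. g x - f x) = 0" unfolding fourier_dist[OF gL fL] .
  then have "AE x in lebesgue. g x - f x = 0" unfolding L2_norm_eq_0_iff[OF L2_diff[OF gL fL]] .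
  then show "f \<in> S" by (intro sat[OF g(1)]) simp
qed

lemma L2_closure_AE:
  assumes "f \<in> L2_closure S" "AE x in lebesgue. f x = g x"
  shows "g \<in> L2_closure S"
proof -
  obtain u where u: "\<And>n. u n \<in> S" "L2_tendsto u f" using assms(1) unfolding L2_closure_def by auto
  have "L2_tendsto u g" by (rule L2_tendsto_cong[OF u(2) _ assms(2)]) simp
  then show ?thesis unfolding L2_closure_def using u(1) by blast
qed

lemma H2_AE:
  assumes "f \<in> H2 G" "AE x in lebesgue. f x = g x"
  shows "g \<in> H2 G"
proof -
  have f: "f \<in> L2" "AE x in lebesgue. fourier f x \<noteq> 0 \<longrightarrow> x \<in> G"
    using assms(1) by (auto simp: H2_def ae_subset_def Supp_def)
  have "AE x in lebesgue. fourier g x \<noteq> 0 \<longrightarrow> x \<in> G"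
    using f(2) fourier_cong[OF f(1) assms(2)] by eventually_elim simp
  then show ?thesis using L2_cong_AE[OF f(1) assms(2)] by (simp add: H2_def ae_subset_def Supp_def)
qed

text \<open>By refinability the inverse of \<open>D\<close> maps \<open>V\<close> into itself, so
  negative powers contribute nothing beyond \<open>V\<close>.\<close>

lemma UN_dilation_powers:
  assumes inj: "inj D" and sub: "V \<subseteq> D ` V"
  shows "(\<Union>j::int. int_funpow D j ` V) = (\<Union>n. (D ^^ n) ` V)"
proof -
  have inv: "(inv D ^^ n) ` V \<subseteq> V" for n
  proof (induction n)
    case (Suc n)
    have "inv D x \<in> V" if "x \<in> V" for x
    proof -
      obtain y where "y \<in> V" "x = D y" using sub \<open>x \<in> V\<close> by blast
      then show ?thesis by (simp add: inv_f_f[OF inj])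
    qed
    then show ?case using Suc by fastforce
  qed simp
  have "int_funpow D j ` V \<subseteq> (\<Union>n. (D ^^ n) ` V)" for j
  proof (cases "j \<ge> 0")
    case True
    then show ?thesis by (auto simp: int_funpow_def)
  next
    case False
    have "V \<subseteq> (\<Union>n. (D ^^ n) ` V)" by (rule subset_trans[OF _ UN_upper[of 0]]) auto
    then show ?thesis using False inv[of "nat (- j)"] by (auto simp: int_funpow_def)
  qed
  moreover have "(D ^^ n) ` V \<subseteq> (\<Union>j::int. int_funpow D j ` V)" for n
    by (rule subset_trans[OF _ UN_upper[of "int n"]]) (auto simp: int_funpow_def)
  ultimately show ?thesis by (intro equalityI UN_least)
qed

lemma hat_UN: "hat (\<Union>n. S n) = (\<Union>n. hat (S n))"
  unfolding hat_def by blast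

theorem theorem5p1:
  fixes A :: "real^'n \<Rightarrow> real^'n"
    and V :: "(real^'n \<Rightarrow> complex) set"
    and G :: "(real^'n) set"
    and \<sigma> :: "real^'n \<Rightarrow> real"
  assumes "expansive_dilation A"
    and "shift_invariant V"
    and "\<exists>f\<in>V. \<not> (AE x in lebesgue. f x = 0)"
    and "refinable A V"
    and "is_spectral_function V \<sigma>"
    and "G \<in> sets lebesgue" and "emeasure lebesgue G > 0"
    and "adjoint A ` G = G"
    and "ae_subset (Supp \<sigma>) G"
  shows "all_equivalent
    [L2_closure (\<Union>j::int. int_funpow (dilation A) j ` V) = H2 G,
     \<forall>\<G>. \<G> \<subseteq> V \<and> shift_generates \<G> V \<longrightarrow>
       is_ess_Union {int_funpow (adjoint A) j ` Supp (fourier \<phi>) | \<phi> j. \<phi> \<in> \<G>} G,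
     \<forall>E. E \<in> sets lebesgue \<and> bounded E \<and> E \<subseteq> G \<and> emeasure lebesgue E > 0 \<longrightarrow>
       (\<lambda>j::nat. 1 / measure lebesgue (int_funpow (adjoint A) (- int j) ` E)
          * (LINT \<xi>:int_funpow (adjoint A) (- int j) ` E|lebesgue. \<sigma> \<xi>)) \<longlonglongrightarrow> 1,
     inv_absorbing (adjoint A) G (Supp \<sigma>),
     AE \<xi> in lebesgue. \<xi> \<in> G \<longrightarrow>
       (\<exists>l>0. (\<lambda>j::nat. \<sigma> (int_funpow (adjoint A) (- int j) \<xi>)) \<longlonglongrightarrow> l),
     AE \<xi> in lebesgue. \<xi> \<in> G \<longrightarrow>
       (\<lambda>j::nat. \<sigma> (int_funpow (adjoint A) (- int j) \<xi>)) \<longlonglongrightarrow> 1,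
     locally_nonzero_at_0 G (adjoint A) \<sigma>,
     approx_continuous_at_0 G (adjoint A) (\<sigma>(0 := 1))]"
proof -
  have A: "linear A" using assms(1) by (simp add: expansive_dilation_def)
  have Vc: "closed_L2_subspace V" using assms(2) by (simp add: shift_invariant_def)
  have VL: "f \<in> V \<Longrightarrow> f \<in> L2" for f by (rule closed_subspace_L2[OF Vc])
  obtain C where C: "linear C" "\<And>x. C (A x) = x" "\<And>x. A (C x) = x" "\<And>x. (\<lambda>j. (C ^^ j) x) \<longlonglongrightarrow> 0"
    using expansive_inverse[OF assms(1)] by metis
  have exp: "expanding (adjoint A) (adjoint C)" by (rule expanding_adjoint[OF A C])
  have injA: "inj A" by (rule inj_on_inverseI[of _ C]) (rule C)
  then have det: "det (matrix A) \<noteq> 0" by (simp add: det_nz_iff_inj[OF A])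
  note dilation_hat = dilation_power_hat[OF A C(1-3) exp det Vc]
  have injD: "inj (dilation A)"
  proof (rule injI)
    fix f g assume eq: "dilation A f = dilation A g"
    show "f = g"
    proof
      fix x
      show "f x = g x" using fun_cong[OF eq, of "C x"] det by (simp add: dilation_def C(3))
    qed
  qed
  note spec = spectral_function_axioms[OF assms(2,5)]
  interpret spectral_set "adjoint A" "adjoint C" "hat V" \<sigma> G
  proof (intro spectral_set.intro spectral.intro refinable_space.intro exp
      refinable_space_axioms.intro spectral_axioms.intro spectral_set_axioms.intro spec assms)
    show "closed_L2_subspace (hat V)" by (rule hat_closed_subspace[OF Vc])
    show "(\<lambda>x. wave k x * u x) \<in> hat V" if "k \<in> int_lattice" "u \<in> hat V" for k u
      by (rule hat_wave[OF assms(2) that])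
    \<comment> \<open>Refinability seen on the Fourier side, by \<open>dilation_power_hat\<close>
      for the first power.\<close>
    show "(\<lambda>x. u (adjoint A x)) \<in> hat V" if u: "u \<in> hat V" for u
    proof -
      have "u \<in> hat (dilation A ` V)" using u hat_mono assms(4) unfolding refinable_def by blast
      moreover have "u \<in> L2" using u by (auto elim: hatE)
      ultimately show ?thesis using dilation_hat[of u 1] by simp
    qed
  qed
  define S where "S = (\<Union>n. (dilation A ^^ n) ` V)"
  have S: "(\<Union>j::int. int_funpow (dilation A) j ` V) = S"
    unfolding S_def by (rule UN_dilation_powers[OF injD]) (use assms(4) in \<open>simp add: refinable_def\<close>)
  have SL: "S \<subseteq> L2"
  proof -
    have "(dilation A ^^ n) f \<in> L2" if "f \<in> V" for n f
    proof (induction n)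
      case (Suc n)
      obtain d where "rescales A d" using rescales_linear[OF A C(1) C(3) C(2)] .
      from rescales_L2(1)[OF this Suc] show ?case by (simp add: dilation_def L2_cmult)
    qed (simp add: VL that)
    then show ?thesis unfolding S_def by blast
  qed
  have "hat ((dilation A ^^ n) ` V) = Yn n" for n
  proof -
    have "u \<in> hat ((dilation A ^^ n) ` V) \<longleftrightarrow> u \<in> Yn n" for u
    proof (cases "u \<in> L2")
      case True
      then show ?thesis using dilation_hat[OF True] by (simp add: Yn_def)
    next
      case False
      then show ?thesis by (auto simp: Yn_def elim: hatE)
    qed
    then show ?thesis by blast
  qed
  then have hat_S: "hat (L2_closure S) = W"
    unfolding hat_closure_eq[OF SL, symmetric] W_def unfolding S_def hat_UN by simp
  have H: "hat (H2 G) = L2_on" unfolding L2_on_def by (rule hat_H2)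
  have clL: "L2_closure S \<subseteq> L2" using L2_closure_L2 by blast
  have HL: "H2 G \<subseteq> L2" by (auto simp: H2_def)
  have 1: "L2_closure (\<Union>j::int. int_funpow (dilation A) j ` V) = H2 G \<longleftrightarrow> full"
    unfolding W_iff_full[symmetric] hat_S[symmetric] H[symmetric] S
  proof
    assume eq: "hat (L2_closure S) = hat (H2 G)"
    show "L2_closure S = H2 G"
    proof
      show "L2_closure S \<subseteq> H2 G"
        by (rule hat_inject_AE[OF HL H2_AE clL]) (simp_all add: eq)
      show "H2 G \<subseteq> L2_closure S"
        by (rule hat_inject_AE[OF clL L2_closure_AE HL]) (simp_all add: eq)
    qed
  qed simp
  have image: "{int_funpow (adjoint A) j ` Supp (fourier \<phi>) | \<phi> j. \<phi> \<in> \<G>}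
      = {int_funpow (adjoint A) j ` Supp g | g j. g \<in> fourier ` \<G>}" for \<G> :: "(real^'n \<Rightarrow> complex) set"
    by blast
  have fV: "fourier ` \<G> \<subseteq> hat V" if "\<G> \<subseteq> V" for \<G>
    using that fourier_in_hat VL by blast
  have 2: "(\<forall>\<G>. \<G> \<subseteq> V \<and> shift_generates \<G> V \<longrightarrow>
       is_ess_Union {int_funpow (adjoint A) j ` Supp (fourier \<phi>) | \<phi> j. \<phi> \<in> \<G>} G) \<longleftrightarrow> full"
    unfolding image
  proof (intro iffI allI impI)
    assume "\<forall>\<G>. \<G> \<subseteq> V \<and> shift_generates \<G> V \<longrightarrow>
       is_ess_Union {int_funpow (adjoint A) j ` Supp g | g j. g \<in> fourier ` \<G>} G"
    \<comment> \<open>The single instance in which \<open>V\<close> generates itself suffices for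
      this direction.\<close>
    then have "is_ess_Union {int_funpow (adjoint A) j ` Supp g | g j. g \<in> fourier ` V} G"
      using shift_generates_self[OF Vc] by blast
    then show full by (rule ess_Union_imp_full[OF fV[OF order_refl]])
  next
    fix \<G> assume full: full and gen: "\<G> \<subseteq> V \<and> shift_generates \<G> V"
    then have GL: "\<G> \<subseteq> L2" using VL by blast
    show "is_ess_Union {int_funpow (adjoint A) j ` Supp g | g j. g \<in> fourier ` \<G>} G"
    proof (rule full_imp_ess_Union[OF full fV])
      show "\<G> \<subseteq> V" using gen by simp
      fix U and u :: "real^'n \<Rightarrow> complex"
      assume U: "U \<in> sets lebesgue" and supp: "\<And>g. g \<in> fourier ` \<G> \<Longrightarrow> AE x in lebesgue. g x \<noteq> 0 \<longrightarrow> x \<in> U"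
        and u: "u \<in> hat V"
      obtain f where f: "f \<in> V" "AE x in lebesgue. fourier f x = u x" using u by (rule hatE)
      have "AE x in lebesgue. fourier f x \<noteq> 0 \<longrightarrow> x \<in> U"
        by (rule shift_generates_supp[OF conjunct2[OF gen] GL U _ f(1)]) (rule supp, rule imageI)
      with f(2) show "AE x in lebesgue. u x \<noteq> 0 \<longrightarrow> x \<in> U" by eventually_elim simp
    qed
  qed
  show ?thesis
    unfolding int_funpow_neg 1 2 average_iff_full absorbing_iff_full limit_pos_iff_full limit_one_iff_full
      locally_nonzero_iff_full approx_continuous_iff_full
    by (simp add: all_equivalent_def)
qed

end
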